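(* Let $X$ be a scheme, let $\mathscr{O}_Y$ be a quadratic $\mathscr{O}_X$-algebra, and let $\mathscr{I}$ be an $\mathscr{O}_Y$-module that is locally free of rank $2$ as an $\mathscr{O}_X$-module. If $\mathscr{I}$ is pseudoregular, then the norm map $N_{\mathscr{I}}\colon\mathscr{I}\to\mathscr{N}(\mathscr{I})$ satisfies $$N_{\mathscr{I}}(\gamma x)=\operatorname{Nm}(\gamma)N_{\mathscr{I}}(x)$$ for all open $U\subseteq X$, all $x\in\mathscr{I}(U)$ and all $\gamma\in\mathscr{O}_Y(U)$.
   Context: A quadratic $\mathscr{O}_X$-algebra is an $\mathscr{O}_X$-algebra that is locally free of rank $2$ as an $\mathscr{O}_X$-module; $\operatorname{Nm}\colon\mathscr{O}_Y\to\mathscr{O}_X$ is its norm (determinant of multiplication on $\mathscr{O}_Y$). $\mathscr{I}$ is pseudoregular if for every affine open $U\subseteq X$ and $\alpha\in\mathscr{O}_Y(U)$, the characteristic polynomials over $\mathscr{O}_X(U)$ of multiplication by $\alpha$ on $\mathscr{O}_Y(U)$ and on $\mathscr{I}(U)$ are equal. $\mathscr{N}(\mathscr{I})=\bigwedge^2_{\mathscr{O}_X}\mathscr{I}\otimes(\mathscr{O}_Y/\mathscr{O}_X)^\vee$. The canonical exterior form is the unique quadratic map $E_{\mathscr{I}}\colon\mathscr{I}\otimes\mathscr{O}_Y/\mathscr{O}_X\to\bigwedge^2\mathscr{I}\otimes\mathscr{O}_Y/\mathscr{O}_X$ with $E_{\mathscr{I}}(x\otimes\gamma)=(\gamma x\wedge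 x)\otimes\gamma$ (independent of the lift of $\gamma$ to $\mathscr{O}_Y$). The norm map $N_{\mathscr{I}}$ is its twist by $(\mathscr{O}_Y/\mathscr{O}_X)^\vee$; explicitly, locally where $\mathscr{O}_Y=\mathscr{O}_X\oplus\mathscr{O}_X\alpha$, $N_{\mathscr{I}}(x)=(\alpha x\wedge x)\otimes\overline{\alpha}^\vee$, with $\overline{\alpha}^\vee$ dual to the class of $\alpha$ in $\mathscr{O}_Y/\mathscr{O}_X$. *)

theory Defs
  imports
    "HOL-Algebra.Module"
    "HOL-Algebra.QuotRing"
    "HOL-Algebra.UnivPoly"
    "HOL-Analysis.Abstract_Topology"
    "HOL-Combinatorics.Permutations"
begin

section \<open>Sheaves of rings, modules and algebras\<close>

text \<open>
  All sections of a presheaf live in one ambient type; only values at open sets are meaningful.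
\<close>

record ('p, 'm, 'z) presheaf =
  sect :: "'p set \<Rightarrow> ('m, 'z) ring_scheme"
  restr :: "'p set \<Rightarrow> 'p set \<Rightarrow> 'm \<Rightarrow> 'm"

type_synonym ('p, 'r) ring_presheaf = "('p, 'r, unit) presheaf"
type_synonym ('p, 'r, 'm) module_presheaf = "('p, 'm, ('r, 'm, unit) module_ext) presheaf"

definition is_presheaf :: "'p topology \<Rightarrow> ('p, 'm, 'z) presheaf \<Rightarrow> bool" where
  "is_presheaf X F \<longleftrightarrow>
     (\<forall>U. openin X U \<longrightarrow> (\<forall>s\<in>carrier (sect F U). restr F U U s = s)) \<and>
     (\<forall>U V. openin X U \<and> openin X V \<and> V \<subseteq> U \<longrightarrow>
        restr F U V \<in> carrier (sect F U) \<rightarrow> carrier (sect F V)) \<and>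
     (\<forall>U V W. openin X U \<and> openin X V \<and> openin X W \<and> W \<subseteq> V \<and> V \<subseteq> U \<longrightarrow>
        (\<forall>s\<in>carrier (sect F U). restr F V W (restr F U V s) = restr F U W s))"

definition is_sheaf :: "'p topology \<Rightarrow> ('p, 'm, 'z) presheaf \<Rightarrow> bool" where
  "is_sheaf X F \<longleftrightarrow> is_presheaf X F \<and>
     (\<forall>\<V>. (\<forall>V\<in>\<V>. openin X V) \<longrightarrow>
        (\<forall>s\<in>carrier (sect F (\<Union>\<V>)). \<forall>t\<in>carrier (sect F (\<Union>\<V>)).
           (\<forall>V\<in>\<V>. restr F (\<Union>\<V>) V s = restr F (\<Union>\<V>) V t) \<longrightarrow> s = t)) \<and>
     (\<forall>\<V> \<sigma>. (\<forall>V\<in>\<V>. openin X V \<and> \<sigma> V \<in> carrier (sect F V)) \<and>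
        (\<forall>V\<in>\<V>. \<forall>W\<in>\<V>. restr F V (V \<inter> W) (\<sigma> V) = restr F W (V \<inter> W) (\<sigma> W)) \<longrightarrow>
        (\<exists>s\<in>carrier (sect F (\<Union>\<V>)). \<forall>V\<in>\<V>. restr F (\<Union>\<V>) V s = \<sigma> V))"

definition ringed_space :: "'p topology \<Rightarrow> ('p, 'r, 'z) presheaf \<Rightarrow> bool" where
  "ringed_space X OX \<longleftrightarrow> is_sheaf X OX \<and>
     (\<forall>U. openin X U \<longrightarrow> cring (sect OX U)) \<and>
     (\<forall>U V. openin X U \<and> openin X V \<and> V \<subseteq> U \<longrightarrow>
        restr OX U V \<in> ring_hom (sect OX U) (sect OX V))"

definition module_sheaf ::
    "'p topology \<Rightarrow> ('p, 'r, 'z) presheaf \<Rightarrow> ('p, 'r, 'm) module_presheaf \<Rightarrow> bool" where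
  "module_sheaf X OX M \<longleftrightarrow> is_sheaf X M \<and>
     (\<forall>U. openin X U \<longrightarrow> Module.module (sect OX U) (sect M U)) \<and>
     (\<forall>U V. openin X U \<and> openin X V \<and> V \<subseteq> U \<longrightarrow>
        (\<forall>x\<in>carrier (sect M U). \<forall>y\<in>carrier (sect M U).
           restr M U V (x \<oplus>\<^bsub>sect M U\<^esub> y) = restr M U V x \<oplus>\<^bsub>sect M V\<^esub> restr M U V y) \<and>
        (\<forall>r\<in>carrier (sect OX U). \<forall>x\<in>carrier (sect M U).
           restr M U V (r \<odot>\<^bsub>sect M U\<^esub> x) = restr OX U V r \<odot>\<^bsub>sect M V\<^esub> restr M U V x))"

definition algebra_sheaf ::
    "'p topology \<Rightarrow> ('p, 'r, 'z) presheaf \<Rightarrow> ('p, 'r, 'a) module_presheaf \<Rightarrow> bool" where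
  "algebra_sheaf X OX A \<longleftrightarrow> module_sheaf X OX A \<and>
     (\<forall>U. openin X U \<longrightarrow> Module.algebra (sect OX U) (sect A U)) \<and>
     (\<forall>U V. openin X U \<and> openin X V \<and> V \<subseteq> U \<longrightarrow>
        restr A U V \<in> ring_hom (sect A U) (sect A V))"

text \<open>A module over an algebra \<open>A\<close>, regarded as a module over the base ring via \<open>r \<mapsto> r \<cdot> 1\<close>.\<close>

definition restrict_scalars ::
    "('p, 'r, 'a) module_presheaf \<Rightarrow> ('p, 'a, 'm) module_presheaf \<Rightarrow> ('p, 'r, 'm) module_presheaf" where
  "restrict_scalars A M = \<lparr>
     sect = (\<lambda>U. \<lparr> carrier = carrier (sect M U),
                   monoid.mult = monoid.mult (sect M U), one = one (sect M U),
                   zero = zero (sect M U), add = add (sect M U),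
                   smult = (\<lambda>r x. (r \<odot>\<^bsub>sect A U\<^esub> \<one>\<^bsub>sect A U\<^esub>) \<odot>\<^bsub>sect M U\<^esub> x) \<rparr>),
     restr = restr M \<rparr>"


section \<open>Schemes\<close>

definition spec_topology :: "('r, 'z) ring_scheme \<Rightarrow> 'r set topology" where
  "spec_topology R =
     topology_generated_by ((\<lambda>f. {P. primeideal P R \<and> f \<notin> P}) ` carrier R)"

text \<open>The fraction \<open>a / s\<close> in the localization of \<open>R\<close> at the prime \<open>P\<close>, as an equivalence class.\<close>

definition local_frac :: "('r, 'z) ring_scheme \<Rightarrow> 'r set \<Rightarrow> 'r \<Rightarrow> 'r \<Rightarrow> ('r \<times> 'r) set" where
  "local_frac R P a s = {(b, t). b \<in> carrier R \<and> t \<in> carrier R - P \<and>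
     (\<exists>u\<in>carrier R - P. u \<otimes>\<^bsub>R\<^esub> ((a \<otimes>\<^bsub>R\<^esub> t) \<ominus>\<^bsub>R\<^esub> (b \<otimes>\<^bsub>R\<^esub> s)) = \<zero>\<^bsub>R\<^esub>)}"

definition localization :: "('r, 'z) ring_scheme \<Rightarrow> 'r set \<Rightarrow> ('r \<times> 'r) set ring" where
  "localization R P = \<lparr>
     carrier = {local_frac R P a s | a s. a \<in> carrier R \<and> s \<in> carrier R - P},
     monoid.mult = (\<lambda>A B. \<Union>(a, s)\<in>A. \<Union>(b, t)\<in>B. local_frac R P (a \<otimes>\<^bsub>R\<^esub> b) (s \<otimes>\<^bsub>R\<^esub> t)),
     one = local_frac R P \<one>\<^bsub>R\<^esub> \<one>\<^bsub>R\<^esub>,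
     zero = local_frac R P \<zero>\<^bsub>R\<^esub> \<one>\<^bsub>R\<^esub>,
     add = (\<lambda>A B. \<Union>(a, s)\<in>A. \<Union>(b, t)\<in>B.
              local_frac R P ((a \<otimes>\<^bsub>R\<^esub> t) \<oplus>\<^bsub>R\<^esub> (b \<otimes>\<^bsub>R\<^esub> s)) (s \<otimes>\<^bsub>R\<^esub> t)) \<rparr>"

definition spec_sheaf ::
    "('r, 'z) ring_scheme \<Rightarrow> ('r set, 'r set \<Rightarrow> ('r \<times> 'r) set) ring_presheaf" where
  "spec_sheaf R = \<lparr>
     sect = (\<lambda>U. \<lparr>
       carrier = {f \<in> (\<Pi>\<^sub>E P\<in>U. carrier (localization R P)).
         \<forall>P\<in>U. \<exists>V. \<exists>a\<in>carrier R. \<exists>s\<in>carrier R.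
           openin (spec_topology R) V \<and> P \<in> V \<and> V \<subseteq> U \<and>
           (\<forall>Q\<in>V. s \<notin> Q \<and> f Q = local_frac R Q a s)},
       monoid.mult = (\<lambda>f g. \<lambda>P\<in>U. f P \<otimes>\<^bsub>localization R P\<^esub> g P),
       one = (\<lambda>P\<in>U. \<one>\<^bsub>localization R P\<^esub>),
       zero = (\<lambda>P\<in>U. \<zero>\<^bsub>localization R P\<^esub>),
       add = (\<lambda>f g. \<lambda>P\<in>U. f P \<oplus>\<^bsub>localization R P\<^esub> g P) \<rparr>),
     restr = (\<lambda>U V f. restrict f V) \<rparr>"

text \<open>
  The ringed space \<open>(U, OX|U)\<close> is isomorphic to the spectrum of some ring \<open>A\<close>. Such an \<open>A\<close> is
  necessarily isomorphic to \<open>OX(U)\<close>, so that nothing is lost by taking \<open>A\<close> over the type \<open>'r\<close>;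
  an isomorphism of ringed spaces is automatically one of locally ringed spaces.
\<close>

definition affine_open :: "'p topology \<Rightarrow> ('p, 'r) ring_presheaf \<Rightarrow> 'p set \<Rightarrow> bool" where
  "affine_open X OX U \<longleftrightarrow> openin X U \<and>
     (\<exists>(A :: 'r ring) h \<phi>. cring A \<and>
        homeomorphic_map (subtopology X U) (spec_topology A) h \<and>
        (\<forall>V. openin X V \<and> V \<subseteq> U \<longrightarrow>
           \<phi> V \<in> ring_iso (sect OX V) (sect (spec_sheaf A) (h ` V))) \<and>
        (\<forall>V W. openin X V \<and> openin X W \<and> W \<subseteq> V \<and> V \<subseteq> U \<longrightarrow>
           (\<forall>s\<in>carrier (sect OX V).
              \<phi> W (restr OX V W s) = restr (spec_sheaf A) (h ` V) (h ` W) (\<phi> V s))))"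

definition scheme :: "'p topology \<Rightarrow> ('p, 'r) ring_presheaf \<Rightarrow> bool" where
  "scheme X OX \<longleftrightarrow> ringed_space X OX \<and>
     (\<forall>p\<in>topspace X. \<exists>U. affine_open X OX U \<and> p \<in> U)"


section \<open>Locally free modules, determinants and characteristic polynomials\<close>

text \<open>\<open>e 0, \<dots>, e (n - 1)\<close> define an isomorphism from the \<open>n\<close>-th power of \<open>OX|U\<close> to \<open>M|U\<close>.\<close>

definition frame_on ::
    "'p topology \<Rightarrow> ('p, 'r, 'z) presheaf \<Rightarrow> ('p, 'r, 'm) module_presheaf \<Rightarrow>
     nat \<Rightarrow> 'p set \<Rightarrow> (nat \<Rightarrow> 'm) \<Rightarrow> bool" where
  "frame_on X OX M n U e \<longleftrightarrow> openin X U \<and> (\<forall>i<n. e i \<in> carrier (sect M U)) \<and>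
     (\<forall>V. openin X V \<and> V \<subseteq> U \<longrightarrow>
        (\<forall>x\<in>carrier (sect M V). \<exists>!c. c \<in> {..<n} \<rightarrow>\<^sub>E carrier (sect OX V) \<and>
           x = (\<Oplus>\<^bsub>sect M V\<^esub>i\<in>{..<n}. c i \<odot>\<^bsub>sect M V\<^esub> restr M U V (e i))))"

definition locally_free ::
    "'p topology \<Rightarrow> ('p, 'r, 'z) presheaf \<Rightarrow> ('p, 'r, 'm) module_presheaf \<Rightarrow> nat \<Rightarrow> bool" where
  "locally_free X OX M n \<longleftrightarrow> module_sheaf X OX M \<and>
     (\<forall>p\<in>topspace X. \<exists>U e. p \<in> U \<and> frame_on X OX M n U e)"

text \<open>
  The locale \<open>algebra\<close> includes commutativity, which is automatic for an algebra of rank 2.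
\<close>

definition quadratic_algebra ::
    "'p topology \<Rightarrow> ('p, 'r, 'z) presheaf \<Rightarrow> ('p, 'r, 'a) module_presheaf \<Rightarrow> bool" where
  "quadratic_algebra X OX A \<longleftrightarrow> algebra_sheaf X OX A \<and> locally_free X OX A 2"

definition mat_det :: "('r, 'z) ring_scheme \<Rightarrow> nat \<Rightarrow> (nat \<Rightarrow> nat \<Rightarrow> 'r) \<Rightarrow> 'r" where
  "mat_det R n a = (\<Oplus>\<^bsub>R\<^esub>\<sigma>\<in>{\<sigma>. \<sigma> permutes {..<n}}.
     (if evenperm \<sigma> then \<one>\<^bsub>R\<^esub> else \<ominus>\<^bsub>R\<^esub> \<one>\<^bsub>R\<^esub>) \<otimes>\<^bsub>R\<^esub> (\<Otimes>\<^bsub>R\<^esub>i\<in>{..<n}. a i (\<sigma> i)))"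

definition mat_charpoly :: "('r, 'z) ring_scheme \<Rightarrow> nat \<Rightarrow> (nat \<Rightarrow> nat \<Rightarrow> 'r) \<Rightarrow> nat \<Rightarrow> 'r" where
  "mat_charpoly R n a = mat_det (UP R) n
     (\<lambda>i j. (if i = j then monom (UP R) \<one>\<^bsub>R\<^esub> 1 else \<zero>\<^bsub>UP R\<^esub>) \<ominus>\<^bsub>UP R\<^esub> monom (UP R) (a i j) 0)"

definition is_matrix_of ::
    "('r, 'z) ring_scheme \<Rightarrow> ('r, 'm) module \<Rightarrow> nat \<Rightarrow> (nat \<Rightarrow> 'm) \<Rightarrow> ('m \<Rightarrow> 'm) \<Rightarrow>
     (nat \<Rightarrow> nat \<Rightarrow> 'r) \<Rightarrow> bool" where
  "is_matrix_of R M n e f a \<longleftrightarrow> (\<forall>i<n. \<forall>j<n. a i j \<in> carrier R) \<and>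
     (\<forall>j<n. f (e j) = (\<Oplus>\<^bsub>M\<^esub>i\<in>{..<n}. a i j \<odot>\<^bsub>M\<^esub> e i))"

text \<open>
  For a locally free module \<open>M\<close> of rank \<open>n\<close>, the determinant and the characteristic polynomial of
  an endomorphism \<open>f\<close> of \<open>M|U\<close> (a family of maps indexed by the open subsets of \<open>U\<close>) are glued
  from those of the matrices of \<open>f\<close> on the open subsets of \<open>U\<close> where \<open>M\<close> is free. For affine \<open>U\<close>
  this is the determinant, respectively the characteristic polynomial, of the endomorphism \<open>f U\<close>
  of the finitely generated projective \<open>OX(U)\<close>-module \<open>M(U)\<close>. The carrier of \<open>UP R\<close> consists
  of coefficient functions, whence the coefficientwise restriction.
\<close>

definition endo_det ::
    "'p topology \<Rightarrow> ('p, 'r, 'z) presheaf \<Rightarrow> ('p, 'r, 'm) module_presheaf \<Rightarrow> nat \<Rightarrow> 'p set \<Rightarrow>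
     ('p set \<Rightarrow> 'm \<Rightarrow> 'm) \<Rightarrow> 'r" where
  "endo_det X OX M n U f = (THE d. d \<in> carrier (sect OX U) \<and>
     (\<forall>V e a. V \<subseteq> U \<and> frame_on X OX M n V e \<and>
        is_matrix_of (sect OX V) (sect M V) n e (f V) a \<longrightarrow>
        restr OX U V d = mat_det (sect OX V) n a))"

definition endo_charpoly ::
    "'p topology \<Rightarrow> ('p, 'r, 'z) presheaf \<Rightarrow> ('p, 'r, 'm) module_presheaf \<Rightarrow> nat \<Rightarrow> 'p set \<Rightarrow>
     ('p set \<Rightarrow> 'm \<Rightarrow> 'm) \<Rightarrow> nat \<Rightarrow> 'r" where
  "endo_charpoly X OX M n U f = (THE q. q \<in> carrier (UP (sect OX U)) \<and>
     (\<forall>V e a. V \<subseteq> U \<and> frame_on X OX M n V e \<and>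
        is_matrix_of (sect OX V) (sect M V) n e (f V) a \<longrightarrow>
        (\<lambda>k. restr OX U V (q k)) = mat_charpoly (sect OX V) n a))"

text \<open>The norm of a quadratic algebra.\<close>

definition Nm ::
    "'p topology \<Rightarrow> ('p, 'r, 'z) presheaf \<Rightarrow> ('p, 'r, 'a) module_presheaf \<Rightarrow> 'p set \<Rightarrow> 'a \<Rightarrow> 'r" where
  "Nm X OX A U \<gamma> = endo_det X OX A 2 U (\<lambda>V y. restr A U V \<gamma> \<otimes>\<^bsub>sect A V\<^esub> y)"

definition pseudoregular ::
    "'p topology \<Rightarrow> ('p, 'r) ring_presheaf \<Rightarrow> ('p, 'r, 'a) module_presheaf \<Rightarrow>
     ('p, 'a, 'm) module_presheaf \<Rightarrow> bool" where
  "pseudoregular X OX A I \<longleftrightarrow>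
     (\<forall>U \<alpha>. affine_open X OX U \<and> \<alpha> \<in> carrier (sect A U) \<longrightarrow>
        endo_charpoly X OX A 2 U (\<lambda>V y. restr A U V \<alpha> \<otimes>\<^bsub>sect A V\<^esub> y) =
        endo_charpoly X OX (restrict_scalars A I) 2 U (\<lambda>V x. restr A U V \<alpha> \<odot>\<^bsub>sect I V\<^esub> x))"


section \<open>Quotients, tensor products and exterior squares of modules\<close>

text \<open>The fields \<open>mult\<close> and \<open>one\<close> of a module record are irrelevant.\<close>

definition quotient_module :: "('r, 'm) module \<Rightarrow> 'm set \<Rightarrow> ('r, 'm set) module" where
  "quotient_module M N = \<lparr>
     carrier = a_rcosets\<^bsub>M\<^esub> N, monoid.mult = undefined, one = undefined,
     zero = N, add = set_add M,
     smult = (\<lambda>r C. \<Union>x\<in>C. N +>\<^bsub>M\<^esub> (r \<odot>\<^bsub>M\<^esub> x)) \<rparr>"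

definition submodule_span :: "('r, 'z) ring_scheme \<Rightarrow> ('r, 'm) module \<Rightarrow> 'm set \<Rightarrow> 'm set" where
  "submodule_span R M S = \<Inter>{N. submodule N R M \<and> S \<subseteq> N}"

definition free_module :: "('r, 'z) ring_scheme \<Rightarrow> 'k set \<Rightarrow> ('r, 'k \<Rightarrow> 'r) module" where
  "free_module R S = \<lparr>
     carrier = {f. (\<forall>k. f k \<in> carrier R) \<and> (\<forall>k. k \<notin> S \<longrightarrow> f k = \<zero>\<^bsub>R\<^esub>) \<and> finite {k. f k \<noteq> \<zero>\<^bsub>R\<^esub>}},
     monoid.mult = undefined, one = undefined,
     zero = (\<lambda>k. \<zero>\<^bsub>R\<^esub>), add = (\<lambda>f g k. f k \<oplus>\<^bsub>R\<^esub> g k),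
     smult = (\<lambda>r f k. r \<otimes>\<^bsub>R\<^esub> f k) \<rparr>"

definition free_gen :: "('r, 'z) ring_scheme \<Rightarrow> 'k \<Rightarrow> 'k \<Rightarrow> 'r" where
  "free_gen R k = (\<lambda>j. if j = k then \<one>\<^bsub>R\<^esub> else \<zero>\<^bsub>R\<^esub>)"

abbreviation tensor_free ::
    "('r, 'z) ring_scheme \<Rightarrow> ('r, 'm) module \<Rightarrow> ('r, 'n) module \<Rightarrow> ('r, 'm \<times> 'n \<Rightarrow> 'r) module" where
  "tensor_free R M N \<equiv> free_module R (carrier M \<times> carrier N)"

definition tensor_relations ::
    "('r, 'z) ring_scheme \<Rightarrow> ('r, 'm) module \<Rightarrow> ('r, 'n) module \<Rightarrow> ('m \<times> 'n \<Rightarrow> 'r) set" where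
  "tensor_relations R M N = submodule_span R (tensor_free R M N)
     ({free_gen R (x \<oplus>\<^bsub>M\<^esub> x', y) \<ominus>\<^bsub>tensor_free R M N\<^esub>
         (free_gen R (x, y) \<oplus>\<^bsub>tensor_free R M N\<^esub> free_gen R (x', y)) | x x' y.
         x \<in> carrier M \<and> x' \<in> carrier M \<and> y \<in> carrier N} \<union>
      {free_gen R (x, y \<oplus>\<^bsub>N\<^esub> y') \<ominus>\<^bsub>tensor_free R M N\<^esub>
         (free_gen R (x, y) \<oplus>\<^bsub>tensor_free R M N\<^esub> free_gen R (x, y')) | x y y'.
         x \<in> carrier M \<and> y \<in> carrier N \<and> y' \<in> carrier N} \<union>
      {free_gen R (r \<odot>\<^bsub>M\<^esub> x, y) \<ominus>\<^bsub>tensor_free R M N\<^esub>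
         (r \<odot>\<^bsub>tensor_free R M N\<^esub> free_gen R (x, y)) | r x y.
         r \<in> carrier R \<and> x \<in> carrier M \<and> y \<in> carrier N} \<union>
      {free_gen R (x, r \<odot>\<^bsub>N\<^esub> y) \<ominus>\<^bsub>tensor_free R M N\<^esub>
         (r \<odot>\<^bsub>tensor_free R M N\<^esub> free_gen R (x, y)) | r x y.
         r \<in> carrier R \<and> x \<in> carrier M \<and> y \<in> carrier N})"

definition tensor_module ::
    "('r, 'z) ring_scheme \<Rightarrow> ('r, 'm) module \<Rightarrow> ('r, 'n) module \<Rightarrow>
     ('r, ('m \<times> 'n \<Rightarrow> 'r) set) module" where
  "tensor_module R M N = quotient_module (tensor_free R M N) (tensor_relations R M N)"

definition pure_tensor ::
    "('r, 'z) ring_scheme \<Rightarrow> ('r, 'm) module \<Rightarrow> ('r, 'n) module \<Rightarrow>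
     'm \<Rightarrow> 'n \<Rightarrow> ('m \<times> 'n \<Rightarrow> 'r) set" where
  "pure_tensor R M N x y = tensor_relations R M N +>\<^bsub>tensor_free R M N\<^esub> free_gen R (x, y)"

definition square_tensors ::
    "('r, 'z) ring_scheme \<Rightarrow> ('r, 'm) module \<Rightarrow> ('m \<times> 'm \<Rightarrow> 'r) set set" where
  "square_tensors R M =
     submodule_span R (tensor_module R M M) ((\<lambda>x. pure_tensor R M M x x) ` carrier M)"


section \<open>Sheafification\<close>

definition germ ::
    "'p topology \<Rightarrow> ('p, 'm, 'z) presheaf \<Rightarrow> 'p \<Rightarrow> 'p set \<Rightarrow> 'm \<Rightarrow> ('p set \<times> 'm) set" where
  "germ X F p U x = {(V, y). openin X V \<and> p \<in> V \<and> y \<in> carrier (sect F V) \<and>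
     (\<exists>W. openin X W \<and> p \<in> W \<and> W \<subseteq> U \<inter> V \<and> restr F U W x = restr F V W y)}"

text \<open>
  The sections over \<open>U\<close> of the sheaf associated with a presheaf \<open>F\<close> of \<open>OX\<close>-modules are the
  families of germs that are locally induced by sections of \<open>F\<close>.
\<close>

definition sheafify ::
    "'p topology \<Rightarrow> ('p, 'r, 'z) presheaf \<Rightarrow> ('p, 'r, 'm) module_presheaf \<Rightarrow>
     ('p, 'r, 'p \<Rightarrow> ('p set \<times> 'm) set) module_presheaf" where
  "sheafify X OX F = \<lparr>
     sect = (\<lambda>U. \<lparr>
       carrier = {s \<in> extensional U.
         \<forall>p\<in>U. \<exists>V. openin X V \<and> p \<in> V \<and> V \<subseteq> U \<and>
           (\<exists>x\<in>carrier (sect F V). \<forall>q\<in>V. s q = germ X F q V x)},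
       monoid.mult = undefined, one = undefined,
       zero = (\<lambda>p\<in>U. germ X F p U \<zero>\<^bsub>sect F U\<^esub>),
       add = (\<lambda>s t. \<lambda>p\<in>U. \<Union>(V, x)\<in>s p. \<Union>(W, y)\<in>t p.
         germ X F p (V \<inter> W)
           (restr F V (V \<inter> W) x \<oplus>\<^bsub>sect F (V \<inter> W)\<^esub> restr F W (V \<inter> W) y)),
       smult = (\<lambda>r s. \<lambda>p\<in>U. \<Union>(V, x)\<in>s p.
         germ X F p (U \<inter> V)
           (restr OX U (U \<inter> V) r \<odot>\<^bsub>sect F (U \<inter> V)\<^esub> restr F V (U \<inter> V) x)) \<rparr>),
     restr = (\<lambda>U V s. restrict s V) \<rparr>"

definition to_sheafify ::
    "'p topology \<Rightarrow> ('p, 'm, 'z) presheaf \<Rightarrow> 'p set \<Rightarrow> 'm \<Rightarrow> 'p \<Rightarrow> ('p set \<times> 'm) set" where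
  "to_sheafify X F U x = (\<lambda>p\<in>U. germ X F p U x)"


section \<open>Quotient, dual, tensor product and exterior square of sheaves of modules\<close>

definition quotient_presheaf ::
    "('p, 'r, 'm) module_presheaf \<Rightarrow> ('p set \<Rightarrow> 'm set) \<Rightarrow> ('p, 'r, 'm set) module_presheaf" where
  "quotient_presheaf M N = \<lparr>
     sect = (\<lambda>U. quotient_module (sect M U) (N U)),
     restr = (\<lambda>U V C. \<Union>x\<in>C. N V +>\<^bsub>sect M V\<^esub> restr M U V x) \<rparr>"

definition tensor_presheaf ::
    "('p, 'r, 'z) presheaf \<Rightarrow> ('p, 'r, 'm) module_presheaf \<Rightarrow> ('p, 'r, 'n) module_presheaf \<Rightarrow>
     ('p, 'r, ('m \<times> 'n \<Rightarrow> 'r) set) module_presheaf" where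
  "tensor_presheaf OX M N = \<lparr>
     sect = (\<lambda>U. tensor_module (sect OX U) (sect M U) (sect N U)),
     restr = (\<lambda>U V C. \<Union>f\<in>C.
       tensor_relations (sect OX V) (sect M V) (sect N V)
         +>\<^bsub>tensor_free (sect OX V) (sect M V) (sect N V)\<^esub>
       (\<Oplus>\<^bsub>tensor_free (sect OX V) (sect M V) (sect N V)\<^esub>k\<in>{k. f k \<noteq> \<zero>\<^bsub>sect OX U\<^esub>}.
          restr OX U V (f k) \<odot>\<^bsub>tensor_free (sect OX V) (sect M V) (sect N V)\<^esub>
          free_gen (sect OX V) (restr M U V (fst k), restr N U V (snd k)))) \<rparr>"

definition tensor_sheaf ::
    "'p topology \<Rightarrow> ('p, 'r, 'z) presheaf \<Rightarrow> ('p, 'r, 'm) module_presheaf \<Rightarrow>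
     ('p, 'r, 'n) module_presheaf \<Rightarrow>
     ('p, 'r, 'p \<Rightarrow> ('p set \<times> ('m \<times> 'n \<Rightarrow> 'r) set) set) module_presheaf" where
  "tensor_sheaf X OX M N = sheafify X OX (tensor_presheaf OX M N)"

definition tensor_sect ::
    "'p topology \<Rightarrow> ('p, 'r, 'z) presheaf \<Rightarrow> ('p, 'r, 'm) module_presheaf \<Rightarrow>
     ('p, 'r, 'n) module_presheaf \<Rightarrow> 'p set \<Rightarrow> 'm \<Rightarrow> 'n \<Rightarrow>
     'p \<Rightarrow> ('p set \<times> ('m \<times> 'n \<Rightarrow> 'r) set) set" where
  "tensor_sect X OX M N U x y = to_sheafify X (tensor_presheaf OX M N) U
     (pure_tensor (sect OX U) (sect M U) (sect N U) x y)"

definition ext2_presheaf ::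
    "('p, 'r, 'z) presheaf \<Rightarrow> ('p, 'r, 'm) module_presheaf \<Rightarrow>
     ('p, 'r, ('m \<times> 'm \<Rightarrow> 'r) set set) module_presheaf" where
  "ext2_presheaf OX M = quotient_presheaf (tensor_presheaf OX M M)
     (\<lambda>U. square_tensors (sect OX U) (sect M U))"

definition ext2_sheaf ::
    "'p topology \<Rightarrow> ('p, 'r, 'z) presheaf \<Rightarrow> ('p, 'r, 'm) module_presheaf \<Rightarrow>
     ('p, 'r, 'p \<Rightarrow> ('p set \<times> ('m \<times> 'm \<Rightarrow> 'r) set set) set) module_presheaf" where
  "ext2_sheaf X OX M = sheafify X OX (ext2_presheaf OX M)"

definition wedge_sect ::
    "'p topology \<Rightarrow> ('p, 'r, 'z) presheaf \<Rightarrow> ('p, 'r, 'm) module_presheaf \<Rightarrow> 'p set \<Rightarrow> 'm \<Rightarrow> 'm \<Rightarrow>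
     'p \<Rightarrow> ('p set \<times> ('m \<times> 'm \<Rightarrow> 'r) set set) set" where
  "wedge_sect X OX M U x y = to_sheafify X (ext2_presheaf OX M) U
     (square_tensors (sect OX U) (sect M U)
        +>\<^bsub>tensor_module (sect OX U) (sect M U) (sect M U)\<^esub>
      pure_tensor (sect OX U) (sect M U) (sect M U) x y)"

text \<open>
  The sections over \<open>U\<close> of the dual sheaf are the homomorphisms \<open>M|U \<rightarrow> OX|U\<close> of sheaves of
  modules, made extensional so that equal homomorphisms are equal as HOL functions.
\<close>

definition dual_sheaf ::
    "'p topology \<Rightarrow> ('p, 'r, 'z) presheaf \<Rightarrow> ('p, 'r, 'm) module_presheaf \<Rightarrow>
     ('p, 'r, 'p set \<Rightarrow> 'm \<Rightarrow> 'r) module_presheaf" where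
  "dual_sheaf X OX M = \<lparr>
     sect = (\<lambda>U. \<lparr>
       carrier = {l \<in> (\<Pi>\<^sub>E V\<in>{V. openin X V \<and> V \<subseteq> U}. carrier (sect M V) \<rightarrow>\<^sub>E carrier (sect OX V)).
         (\<forall>V. openin X V \<and> V \<subseteq> U \<longrightarrow>
            (\<forall>x\<in>carrier (sect M V). \<forall>y\<in>carrier (sect M V).
               l V (x \<oplus>\<^bsub>sect M V\<^esub> y) = l V x \<oplus>\<^bsub>sect OX V\<^esub> l V y) \<and>
            (\<forall>r\<in>carrier (sect OX V). \<forall>x\<in>carrier (sect M V).
               l V (r \<odot>\<^bsub>sect M V\<^esub> x) = r \<otimes>\<^bsub>sect OX V\<^esub> l V x)) \<and>
         (\<forall>V W. openin X V \<and> openin X W \<and> W \<subseteq> V \<and> V \<subseteq> U \<longrightarrow>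
            (\<forall>x\<in>carrier (sect M V). l W (restr M V W x) = restr OX V W (l V x)))},
       monoid.mult = undefined, one = undefined,
       zero = (\<lambda>V\<in>{V. openin X V \<and> V \<subseteq> U}. \<lambda>x\<in>carrier (sect M V). \<zero>\<^bsub>sect OX V\<^esub>),
       add = (\<lambda>l l'. \<lambda>V\<in>{V. openin X V \<and> V \<subseteq> U}. \<lambda>x\<in>carrier (sect M V).
         l V x \<oplus>\<^bsub>sect OX V\<^esub> l' V x),
       smult = (\<lambda>r l. \<lambda>V\<in>{V. openin X V \<and> V \<subseteq> U}. \<lambda>x\<in>carrier (sect M V).
         restr OX U V r \<otimes>\<^bsub>sect OX V\<^esub> l V x) \<rparr>),
     restr = (\<lambda>U W l. restrict l {V. openin X V \<and> V \<subseteq> W}) \<rparr>"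


section \<open>The norm map\<close>

text \<open>The sheaf \<open>A / OX\<close> for an \<open>OX\<close>-algebra \<open>A\<close>, and the class in it of a section of \<open>A\<close>.\<close>

definition base_image ::
    "('p, 'r, 'z) presheaf \<Rightarrow> ('p, 'r, 'a) module_presheaf \<Rightarrow> 'p set \<Rightarrow> 'a set" where
  "base_image OX A U = (\<lambda>r. r \<odot>\<^bsub>sect A U\<^esub> \<one>\<^bsub>sect A U\<^esub>) ` carrier (sect OX U)"

definition alg_quotient ::
    "'p topology \<Rightarrow> ('p, 'r, 'z) presheaf \<Rightarrow> ('p, 'r, 'a) module_presheaf \<Rightarrow>
     ('p, 'r, 'p \<Rightarrow> ('p set \<times> 'a set) set) module_presheaf" where
  "alg_quotient X OX A = sheafify X OX (quotient_presheaf A (base_image OX A))"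

definition alg_class ::
    "'p topology \<Rightarrow> ('p, 'r, 'z) presheaf \<Rightarrow> ('p, 'r, 'a) module_presheaf \<Rightarrow> 'p set \<Rightarrow> 'a \<Rightarrow>
     'p \<Rightarrow> ('p set \<times> 'a set) set" where
  "alg_class X OX A U \<alpha> = to_sheafify X (quotient_presheaf A (base_image OX A)) U
     (base_image OX A U +>\<^bsub>sect A U\<^esub> \<alpha>)"

abbreviation alg_dual ::
    "'p topology \<Rightarrow> ('p, 'r, 'z) presheaf \<Rightarrow> ('p, 'r, 'a) module_presheaf \<Rightarrow>
     ('p, 'r, 'p set \<Rightarrow> ('p \<Rightarrow> ('p set \<times> 'a set) set) \<Rightarrow> 'r) module_presheaf" where
  "alg_dual X OX A \<equiv> dual_sheaf X OX (alg_quotient X OX A)"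

text \<open>The section of the dual of \<open>A / OX\<close> taking the value 1 on the generator given by \<open>\<alpha>\<close>.\<close>

definition dual_class ::
    "'p topology \<Rightarrow> ('p, 'r, 'z) presheaf \<Rightarrow> ('p, 'r, 'a) module_presheaf \<Rightarrow> 'p set \<Rightarrow> 'a \<Rightarrow>
     'p set \<Rightarrow> ('p \<Rightarrow> ('p set \<times> 'a set) set) \<Rightarrow> 'r" where
  "dual_class X OX A U \<alpha> = (THE l. l \<in> carrier (sect (alg_dual X OX A) U) \<and>
     l U (alg_class X OX A U \<alpha>) = \<one>\<^bsub>sect OX U\<^esub>)"

definition norm_sheaf ::
    "'p topology \<Rightarrow> ('p, 'r, 'z) presheaf \<Rightarrow> ('p, 'r, 'a) module_presheaf \<Rightarrow>
     ('p, 'a, 'm) module_presheaf \<Rightarrow>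
     ('p, 'r, 'p \<Rightarrow> ('p set \<times> (('p \<Rightarrow> ('p set \<times> ('m \<times> 'm \<Rightarrow> 'r) set set) set) \<times>
       ('p set \<Rightarrow> ('p \<Rightarrow> ('p set \<times> 'a set) set) \<Rightarrow> 'r) \<Rightarrow> 'r) set) set) module_presheaf" where
  "norm_sheaf X OX A I =
     tensor_sheaf X OX (ext2_sheaf X OX (restrict_scalars A I)) (alg_dual X OX A)"

text \<open>
  The norm map is the twist by the dual of \<open>A / OX\<close> of the canonical exterior form
  \<open>x \<otimes> \<gamma> \<mapsto> (\<gamma> x \<and> x) \<otimes> \<gamma>\<close> on \<open>I \<otimes> A / OX\<close>. Explicitly, it is glued from the local
  expressions \<open>(\<alpha> x \<and> x) \<otimes> \<alpha>\<^sup>\<or>\<close>, one for each open subset \<open>V\<close> and each \<open>\<alpha>\<close> such that \<open>A|V\<close>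
  is free with basis \<open>1, \<alpha>\<close>; that these agree on overlaps and do not depend on \<open>\<alpha>\<close> is not part of
  the definition.
\<close>

definition norm_map ::
    "'p topology \<Rightarrow> ('p, 'r, 'z) presheaf \<Rightarrow> ('p, 'r, 'a) module_presheaf \<Rightarrow>
     ('p, 'a, 'm) module_presheaf \<Rightarrow> 'p set \<Rightarrow> 'm \<Rightarrow>
     'p \<Rightarrow> ('p set \<times> (('p \<Rightarrow> ('p set \<times> ('m \<times> 'm \<Rightarrow> 'r) set set) set) \<times>
       ('p set \<Rightarrow> ('p \<Rightarrow> ('p set \<times> 'a set) set) \<Rightarrow> 'r) \<Rightarrow> 'r) set) set" where
  "norm_map X OX A I U x = (THE z. z \<in> carrier (sect (norm_sheaf X OX A I) U) \<and>
     (\<forall>V \<alpha>. V \<subseteq> U \<and> frame_on X OX A 2 V (\<lambda>i. if i = 0 then \<one>\<^bsub>sect A V\<^esub> else \<alpha>) \<longrightarrow>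
        restr (norm_sheaf X OX A I) U V z =
          tensor_sect X OX (ext2_sheaf X OX (restrict_scalars A I)) (alg_dual X OX A) V
            (wedge_sect X OX (restrict_scalars A I) V
               (\<alpha> \<odot>\<^bsub>sect I V\<^esub> restr I U V x) (restr I U V x))
            (dual_class X OX A V \<alpha>)))"

end

theory Submission
  imports Defs
begin

text \<open>
  Near a point, \<open>\<O>\<^sub>Y = \<O>\<^sub>X \<oplus> \<O>\<^sub>X \<alpha>\<close> and the norm map is \<open>x \<mapsto> (\<alpha> x \<and> x) \<otimes> \<alpha>\<^sup>\<or>\<close>. Since \<open>\<gamma>\<close> commutes with
  \<open>\<alpha>\<close>, we have \<open>\<alpha> \<gamma> x \<and> \<gamma> x = \<gamma> (\<alpha> x) \<and> \<gamma> x = det(\<gamma> | \<I>) (\<alpha> x \<and> x)\<close>, and it remains to identify this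
  determinant with \<open>Nm \<gamma>\<close>. Pseudoregularity does so only for sections over affine open sets.
  For a section \<open>\<gamma>\<close> over an arbitrary open set, restrict it to a distinguished open subset \<open>D f\<close>
  of an affine open set \<open>W\<close>: some \<open>f\<^sup>n \<gamma>\<close> extends to \<open>W\<close>, so the determinants of \<open>f\<^sup>n \<gamma>\<close> on \<open>\<O>\<^sub>Y\<close>
  and \<open>\<I>\<close> agree, and the factor \<open>f\<^sup>2\<^sup>n\<close> is invertible on \<open>D f\<close>.
\<close>

section \<open>Quotients, spans and free modules\<close>

text \<open>\<open>pseudoregular\<close> is not applied on \<open>D f\<close> itself. That
  \<open>D f\<close> is affine is a theorem, which would require an isomorphism with the spectrum of
  a localization; extending a multiple of \<gamma> replaces it by a statement about sections, and
  only the given affine set \<open>W\<close> enters. The exponent \<open>2 n\<close> is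
  \<open>n\<close> times the degree of a determinant in rank two.

  The finite subcovers of the usual extension argument are replaced by ideals: the elements
  \<open>r\<close> of the coordinate ring with a given property over \<open>D r\<close> form an
  ideal, and an ideal whose loci cover \<open>D g\<close> contains a power of \<open>g\<close>,
  because there are prime ideals avoiding the powers of \<open>g\<close>.

  The other obstacle is that the norm, the characteristic polynomial, the dual class and the norm
  map are definite descriptions. Nothing can be computed from them before existence and uniqueness
  are known, so each rests on independence of the chosen basis or generator and on gluing. The final
  identity is read off from the same uniqueness: both sides have the same local expressions.\<close>

text \<open>The quotients and spans of \<open>Defs\<close> take module records without extension fields.\<close>

locale plain_module = Module.module R M
  for R :: "('r, 'z) ring_scheme" (structure) and M :: "('r, 'm) module"

lemma (in plain_module) submodule_abelian_subgroup:
  assumes "submodule N R M"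
  shows "abelian_subgroup N M"
  using assms
  by (intro abelian_subgroupI3 additive_subgroup.intro)
     (auto simp: submodule_def M.abelian_group_axioms)

lemma (in plain_module) coset_eq_iff:
  assumes N: "submodule N R M" and x: "x \<in> carrier M" and y: "y \<in> carrier M"
  shows "N +>\<^bsub>M\<^esub> x = N +>\<^bsub>M\<^esub> y \<longleftrightarrow> x \<ominus>\<^bsub>M\<^esub> y \<in> N"
proof -
  interpret N: abelian_subgroup N M by (rule submodule_abelian_subgroup[OF N])
  show ?thesis
    using N.a_rcos_self[OF x] N.a_repr_independence'[OF _ y, of x] N.a_rcos_module[OF y x] y
    by (auto simp: a_minus_def)
qed

lemma quotient_module_zero:
  "zero (quotient_module M N) = N"
  by (simp add: quotient_module_def)

lemma quotient_module_carrier: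
  "carrier (quotient_module M N) = (\<lambda>x. N +>\<^bsub>M\<^esub> x) ` carrier M"
  by (auto simp: quotient_module_def A_RCOSETS_def' a_r_coset_def')

lemma (in plain_module) quotient_add:
  assumes N: "submodule N R M" and "x \<in> carrier M" "y \<in> carrier M"
  shows "(N +>\<^bsub>M\<^esub> x) \<oplus>\<^bsub>quotient_module M N\<^esub> (N +>\<^bsub>M\<^esub> y) = N +>\<^bsub>M\<^esub> (x \<oplus>\<^bsub>M\<^esub> y)"
  unfolding quotient_module_def ring.select_convs
  by (rule abelian_subgroup.a_rcos_sum[OF submodule_abelian_subgroup[OF N] assms(2,3)])

text \<open>Maps out of a quotient are defined as unions over a coset. Such a union collapses to its
  value at one representative once the body is constant on the coset; scalar multiplication and
  restriction on quotients both reduce to this.\<close>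

lemma (in plain_module) coset_map:
  assumes N: "submodule N R M" and x: "x \<in> carrier M"
    and c: "\<And>y. y \<in> carrier M \<Longrightarrow> y \<ominus>\<^bsub>M\<^esub> x \<in> N \<Longrightarrow> g y = g x"
  shows "(\<Union>y\<in>N +>\<^bsub>M\<^esub> x. g y) = g x"
proof -
  interpret N: abelian_subgroup N M by (rule submodule_abelian_subgroup[OF N])
  have "g y = g x" if "y \<in> N +>\<^bsub>M\<^esub> x" for y
    using c[of y] that N.a_rcos_module_imp[OF x that] N.a_elemrcos_carrier[OF x that]
    by (simp add: a_minus_def)
  then have "(\<Union>y\<in>N +>\<^bsub>M\<^esub> x. g y) = (\<Union>y\<in>N +>\<^bsub>M\<^esub> x. g x)"
    by (intro SUP_cong refl)
  then show ?thesis using N.a_rcos_self[OF x] by auto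
qed

lemma (in plain_module) smult_minus_distr:
  assumes "r \<in> carrier R" "x \<in> carrier M" "y \<in> carrier M"
  shows "r \<odot>\<^bsub>M\<^esub> (x \<ominus>\<^bsub>M\<^esub> y) = r \<odot>\<^bsub>M\<^esub> x \<ominus>\<^bsub>M\<^esub> r \<odot>\<^bsub>M\<^esub> y"
  using assms by (simp add: a_minus_def smult_r_distr smult_r_minus)

lemma (in plain_module) quotient_smult:
  assumes N: "submodule N R M" and r: "r \<in> carrier R" and x: "x \<in> carrier M"
  shows "r \<odot>\<^bsub>quotient_module M N\<^esub> (N +>\<^bsub>M\<^esub> x) = N +>\<^bsub>M\<^esub> (r \<odot>\<^bsub>M\<^esub> x)"
  unfolding quotient_module_def module.select_convs
proof (rule coset_map[OF N x])
  fix y assume "y \<in> carrier M" "y \<ominus>\<^bsub>M\<^esub> x \<in> N"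
  then show "N +>\<^bsub>M\<^esub> (r \<odot>\<^bsub>M\<^esub> y) = N +>\<^bsub>M\<^esub> (r \<odot>\<^bsub>M\<^esub> x)"
    using submoduleE(4)[OF N r] r x by (simp add: coset_eq_iff[OF N] smult_minus_distr[symmetric])
qed

lemma (in plain_module) quotient_is_module:
  assumes N: "submodule N R M"
  shows "Module.module R (quotient_module M N)"
proof -
  interpret N: abelian_subgroup N M by (rule submodule_abelian_subgroup[OF N])
  \<comment> \<open>The zero of the quotient is the set \<open>N\<close> itself; written as a coset
    it fits the addition rule.\<close>
  have N0: "N = N +>\<^bsub>M\<^esub> \<zero>\<^bsub>M\<^esub>" using N.a_subset by simp
  note q = quotient_add[OF N] quotient_smult[OF N]
  show ?thesis
  proof (rule moduleI)
    show "abelian_group (quotient_module M N)"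
    proof (rule abelian_groupI)
      fix C assume "C \<in> carrier (quotient_module M N)"
      then obtain x where x: "x \<in> carrier M" "C = N +>\<^bsub>M\<^esub> x"
        unfolding quotient_module_carrier by blast
      have "(N +>\<^bsub>M\<^esub> \<ominus>\<^bsub>M\<^esub> x) \<oplus>\<^bsub>quotient_module M N\<^esub> C = \<zero>\<^bsub>quotient_module M N\<^esub>"
        using x N0 by (simp add: q M.l_neg quotient_module_zero)
      then show "\<exists>D\<in>carrier (quotient_module M N). D \<oplus>\<^bsub>quotient_module M N\<^esub> C = \<zero>\<^bsub>quotient_module M N\<^esub>"
        using x(1) unfolding quotient_module_carrier by blast
      show "\<zero>\<^bsub>quotient_module M N\<^esub> \<oplus>\<^bsub>quotient_module M N\<^esub> C = C"
        using q(1)[OF M.zero_closed x(1)] x N0 by (simp add: quotient_module_zero)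
    next
      show "\<zero>\<^bsub>quotient_module M N\<^esub> \<in> carrier (quotient_module M N)"
        using N0 unfolding quotient_module_carrier by (auto simp: quotient_module_zero)
    qed (auto simp: quotient_module_carrier q M.a_ac)
  qed (auto simp: quotient_module_carrier q smult_l_distr smult_r_distr smult_assoc1 R.cring_axioms)
qed

lemma (in plain_module) span_submodule:
  assumes S: "S \<subseteq> carrier M"
  shows "submodule (submodule_span R M S) R M"
proof (rule submoduleI)
  show "submodule_span R M S \<subseteq> carrier M"
    using S carrier_is_submodule unfolding submodule_span_def by blast
  show "\<zero>\<^bsub>M\<^esub> \<in> submodule_span R M S"
    using subgroup.one_closed[OF submodule.axioms(1)] by (fastforce simp: submodule_span_def)
next
  fix x assume x: "x \<in> submodule_span R M S"
  then show "\<ominus>\<^bsub>M\<^esub> x \<in> submodule_span R M S"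
    by (auto simp: submodule_span_def intro: submoduleE(3))
  fix y assume "y \<in> submodule_span R M S"
  with x show "x \<oplus>\<^bsub>M\<^esub> y \<in> submodule_span R M S"
    by (auto simp: submodule_span_def intro: submoduleE(5))
next
  fix a x assume "a \<in> carrier R" "x \<in> submodule_span R M S"
  then show "a \<odot>\<^bsub>M\<^esub> x \<in> submodule_span R M S"
    by (auto simp: submodule_span_def intro: submoduleE(4))
qed

lemma span_superset: "S \<subseteq> submodule_span R M S"
  by (auto simp: submodule_span_def)

lemma span_minimal: "submodule N R M \<Longrightarrow> S \<subseteq> N \<Longrightarrow> submodule_span R M S \<subseteq> N"
  by (auto simp: submodule_span_def)

text \<open>Restriction maps change the ring of scalars together with the module, and \<rho> records
  what happens to the scalars. With \<rho> the identity this is ordinary linearity, the form used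
  for endomorphisms.\<close>

definition semilinear ::
    "('r, 'y) ring_scheme \<Rightarrow> ('r \<Rightarrow> 's) \<Rightarrow> ('r, 'm, 'z) module_scheme \<Rightarrow>
     ('s, 'n, 'w) module_scheme \<Rightarrow> ('m \<Rightarrow> 'n) \<Rightarrow> bool" where
  "semilinear R \<rho> M M' h \<longleftrightarrow> h \<in> carrier M \<rightarrow> carrier M' \<and>
     (\<forall>x\<in>carrier M. \<forall>y\<in>carrier M. h (x \<oplus>\<^bsub>M\<^esub> y) = h x \<oplus>\<^bsub>M'\<^esub> h y) \<and>
     (\<forall>r\<in>carrier R. \<forall>x\<in>carrier M. h (r \<odot>\<^bsub>M\<^esub> x) = \<rho> r \<odot>\<^bsub>M'\<^esub> h x)"

lemma semilinear_group_hom: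
  assumes "Module.module R M" "Module.module R' M'" "semilinear R \<rho> M M' h"
  shows "abelian_group_hom M M' h"
proof (rule abelian_group_homI)
  show M: "abelian_group M" "abelian_group M'"
    using assms unfolding Module.module_def by auto
  then show "group_hom (add_monoid M) (add_monoid M') h"
    using assms(3) unfolding semilinear_def group_hom_def group_hom_axioms_def hom_def
    by (auto intro: abelian_group.a_group)
qed

text \<open>The preimage of \<open>N'\<close> is a submodule containing \<open>S\<close>, hence it
  contains the span. This reduces the compatibility of restriction with spans to a check on
  generators.\<close>

lemma semilinear_span:
  assumes M: "plain_module R M" and M': "Module.module R' M'" and h: "semilinear R \<rho> M M' h"
    and \<rho>: "\<rho> \<in> carrier R \<rightarrow> carrier R'"
    and N': "submodule N' R' M'" and S: "S \<subseteq> carrier M" "h ` S \<subseteq> N'"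
  shows "h ` submodule_span R M S \<subseteq> N'"
proof -
  interpret h: abelian_group_hom M M' h by (rule semilinear_group_hom[OF plain_module.axioms[OF M] M' h])
  interpret M: plain_module R M by fact
  interpret M': Module.module R' M' by fact
  have "submodule {x \<in> carrier M. h x \<in> N'} R M"
    using M'.submoduleE[OF N'] subgroup.one_closed[OF submodule.axioms(1)[OF N']] h \<rho>
    by (intro M.submoduleI) (auto simp: semilinear_def intro!: M'.submoduleE(4)[OF N'])
  from span_minimal[OF this, of S] S show ?thesis by auto
qed

section \<open>Free modules and the maps induced between them\<close>

lemma free_module_ops:
  "zero (free_module R S) = (\<lambda>k. \<zero>\<^bsub>R\<^esub>)"
  "add (free_module R S) = (\<lambda>f g k. f k \<oplus>\<^bsub>R\<^esub> g k)"
  "smult (free_module R S) = (\<lambda>r f k. r \<otimes>\<^bsub>R\<^esub> f k)"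
  by (simp_all add: free_module_def)

lemma free_module_carrier:
  "f \<in> carrier (free_module R S) \<longleftrightarrow>
     (\<forall>k. f k \<in> carrier R) \<and> (\<forall>k. k \<notin> S \<longrightarrow> f k = \<zero>\<^bsub>R\<^esub>) \<and> finite {k. f k \<noteq> \<zero>\<^bsub>R\<^esub>}"
  by (simp add: free_module_def)

lemma (in cring) free_module_is_module: "Module.module R (free_module R S)"
proof -
  have fin: "finite {k. f k \<oplus> g k \<noteq> \<zero>}"
    if "finite {k. f k \<noteq> \<zero>}" "finite {k. g k \<noteq> \<zero>}" for f g :: "'c \<Rightarrow> 'a"
    by (rule finite_subset[OF _ finite_UnI[OF that]]) auto
  have fin2: "finite {k. r \<otimes> f k \<noteq> \<zero>}"
    if "finite {k. f k \<noteq> \<zero>}" "r \<in> carrier R" for f :: "'c \<Rightarrow> 'a" and r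
    by (rule finite_subset[OF _ that(1)]) (use that in auto)
  show ?thesis
  proof (rule moduleI)
    show "abelian_group (free_module R S)"
    proof (rule abelian_groupI)
      fix f assume "f \<in> carrier (free_module R S)"
      \<comment> \<open>The inverse is taken as the multiple by minus one, so that
        \<open>fin2\<close> yields the finiteness of its support.\<close>
      then show "\<exists>g\<in>carrier (free_module R S). g \<oplus>\<^bsub>free_module R S\<^esub> f = \<zero>\<^bsub>free_module R S\<^esub>"
        by (intro bexI[of _ "\<lambda>k. \<ominus> \<one> \<otimes> f k"])
           (auto simp: free_module_carrier free_module_ops fin2 l_minus l_neg)
    qed (auto simp: free_module_carrier free_module_ops fin a_ac)
  qed (auto simp: free_module_carrier free_module_ops fin fin2 l_distr r_distr m_assoc is_cring)
qed

lemma (in cring) free_gen_closed [simp]: "k \<in> S \<Longrightarrow> free_gen R k \<in> carrier (free_module R S)"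
  by (auto simp: free_module_carrier free_gen_def)

text \<open>Every element is a finite sum of multiples of generators; the induction is on a finite
  set containing the support.\<close>

lemma (in cring) free_module_induct:
  assumes f: "f \<in> carrier (free_module R S)"
    and zero: "P \<zero>\<^bsub>free_module R S\<^esub>"
    and add: "\<And>f g. f \<in> carrier (free_module R S) \<Longrightarrow> g \<in> carrier (free_module R S) \<Longrightarrow>
       P f \<Longrightarrow> P g \<Longrightarrow> P (f \<oplus>\<^bsub>free_module R S\<^esub> g)"
    and gen: "\<And>r k. r \<in> carrier R \<Longrightarrow> k \<in> S \<Longrightarrow> P (r \<odot>\<^bsub>free_module R S\<^esub> free_gen R k)"
  shows "P f"
proof -
  have "P f" if "finite T" "f \<in> carrier (free_module R S)" "{k. f k \<noteq> \<zero>} \<subseteq> T" for T f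
    using that
  proof (induction T arbitrary: f)
    case empty
    then have "f = \<zero>\<^bsub>free_module R S\<^esub>" by (auto simp: free_module_ops)
    then show ?case using zero by simp
  next
    case (insert k T)
    \<comment> \<open>\<open>g\<close> is \<open>f\<close> with the coefficient at \<open>k\<close>
      erased. If \<open>k\<close> lies outside \<open>S\<close>, that coefficient is zero already
      and \<open>g\<close> is \<open>f\<close>.\<close>
    define g where "g = (\<lambda>j. if j = k then \<zero> else f j)"
    have "{j. g j \<noteq> \<zero>} \<subseteq> {j. f j \<noteq> \<zero>}" by (auto simp: g_def)
    from finite_subset[OF this] have g: "g \<in> carrier (free_module R S)"
      using insert.prems by (auto simp: free_module_carrier g_def)
    then have "P g" using insert.prems insert.hyps by (intro insert.IH) (auto simp: g_def)
    note g = g this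
    have f: "f k \<in> carrier R" "\<And>j. f j \<in> carrier R" using insert.prems by (auto simp: free_module_carrier)
    show ?case
    proof (cases "k \<in> S")
      case True
      have "f = (f k \<odot>\<^bsub>free_module R S\<^esub> free_gen R k) \<oplus>\<^bsub>free_module R S\<^esub> g"
        using f by (auto simp: g_def free_gen_def free_module_ops)
      then show ?thesis
        using add[OF _ g(1) gen[OF f(1) True] g(2)]
          Module.module.smult_closed[OF free_module_is_module f(1) free_gen_closed[OF True]] by simp
    next
      case False
      then have "f = g" using insert.prems by (auto simp: g_def free_module_carrier)
      then show ?thesis using g by simp
    qed
  qed
  then show ?thesis using f by (auto simp: free_module_carrier)
qed

text \<open>The map given by \<rho> on coefficients and \<kappa> on generators. Summing over the
  support of \<open>f\<close> reproduces literally the sum in the restriction of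
  \<open>tensor_presheaf\<close>, so that \<open>tensor_presheaf_eq\<close> holds by
  unfolding.\<close>

definition free_map ::
    "('r, 'y) ring_scheme \<Rightarrow> ('s, 'z) ring_scheme \<Rightarrow> 'l set \<Rightarrow> ('r \<Rightarrow> 's) \<Rightarrow> ('k \<Rightarrow> 'l) \<Rightarrow>
     ('k \<Rightarrow> 'r) \<Rightarrow> 'l \<Rightarrow> 's" where
  "free_map R R' S' \<rho> \<kappa> f = (\<Oplus>\<^bsub>free_module R' S'\<^esub>k\<in>{k. f k \<noteq> \<zero>\<^bsub>R\<^esub>}.
     \<rho> (f k) \<odot>\<^bsub>free_module R' S'\<^esub> free_gen R' (\<kappa> k))"

lemma free_map:
  assumes R: "cring R" and R': "cring R'" and \<rho>: "\<rho> \<in> ring_hom R R'" and \<kappa>: "\<kappa> \<in> S \<rightarrow> S'"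
  shows free_map_semilinear: "semilinear R \<rho> (free_module R S) (free_module R' S') (free_map R R' S' \<rho> \<kappa>)"
    and free_map_gen: "\<And>k. k \<in> S \<Longrightarrow> free_map R R' S' \<rho> \<kappa> (free_gen R k) = free_gen R' (\<kappa> k)"
proof -
  interpret R: cring R by fact
  interpret R': cring R' by fact
  interpret \<rho>: ring_hom_cring R R' \<rho> using R R' \<rho> by (simp add: ring_hom_cring_def ring_hom_cring_axioms_def)
  interpret F: Module.module R "free_module R S" by (rule R.free_module_is_module)
  interpret F': Module.module R' "free_module R' S'" by (rule R'.free_module_is_module)
  let ?t = "\<lambda>f k. \<rho> (f k) \<odot>\<^bsub>free_module R' S'\<^esub> free_gen R' (\<kappa> k)"
  let ?h = "free_map R R' S' \<rho> \<kappa>"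
  have tc: "?t f k \<in> carrier (free_module R' S')" if "f \<in> carrier (free_module R S)" "k \<in> S" for f k
    using that \<kappa> by (intro F'.smult_closed R'.free_gen_closed) (auto simp: free_module_carrier)
  \<comment> \<open>The index set may be enlarged beyond the support, so that the sums for
    \<open>f\<close>, \<open>g\<close> and their sum can be compared term by term over a common
    set.\<close>
  have sup: "?h f = (\<Oplus>\<^bsub>free_module R' S'\<^esub>k\<in>T. ?t f k)"
    if f: "f \<in> carrier (free_module R S)" and T: "finite T" "{k. f k \<noteq> \<zero>\<^bsub>R\<^esub>} \<subseteq> T" "T \<subseteq> S" for f T
    unfolding free_map_def
  proof (rule F'.add.finprod_mono_neutral_cong_left[OF T(1,2)])
    fix k assume k: "k \<in> T - {k. f k \<noteq> \<zero>\<^bsub>R\<^esub>}"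
    then have "free_gen R' (\<kappa> k) \<in> carrier (free_module R' S')"
      using \<kappa> T(3) by (intro R'.free_gen_closed) auto
    then show "?t f k = \<zero>\<^bsub>free_module R' S'\<^esub>"
      using k F'.smult_l_null by simp
  next
    show "?t f \<in> T \<rightarrow> carrier (free_module R' S')" using tc[OF f] T(3) by auto
  qed auto
  have supp: "finite {k. f k \<noteq> \<zero>\<^bsub>R\<^esub>}" "{k. f k \<noteq> \<zero>\<^bsub>R\<^esub>} \<subseteq> S" if "f \<in> carrier (free_module R S)" for f
    using that by (auto simp: free_module_carrier)
  show "semilinear R \<rho> (free_module R S) (free_module R' S') ?h"
    unfolding semilinear_def
  proof (intro conjI ballI funcsetI)
    fix f assume f: "f \<in> carrier (free_module R S)"
    show "?h f \<in> carrier (free_module R' S')"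
      unfolding free_map_def using tc[OF f] supp[OF f] by (intro F'.finsum_closed) auto
  next
    fix f g assume f: "f \<in> carrier (free_module R S)" and g: "g \<in> carrier (free_module R S)"
    let ?T = "{k. f k \<noteq> \<zero>\<^bsub>R\<^esub>} \<union> {k. g k \<noteq> \<zero>\<^bsub>R\<^esub>}"
    have T: "finite ?T" "?T \<subseteq> S" using supp f g by auto
    have fg: "f \<oplus>\<^bsub>free_module R S\<^esub> g \<in> carrier (free_module R S)" using f g by simp
    have "?h (f \<oplus>\<^bsub>free_module R S\<^esub> g) = (\<Oplus>\<^bsub>free_module R' S'\<^esub>k\<in>?T. ?t (f \<oplus>\<^bsub>free_module R S\<^esub> g) k)"
      by (rule sup[OF fg T(1) _ T(2)]) (auto simp: free_module_ops)
    also have "\<dots> = (\<Oplus>\<^bsub>free_module R' S'\<^esub>k\<in>?T. ?t f k \<oplus>\<^bsub>free_module R' S'\<^esub> ?t g k)"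
    proof (rule F'.add.finprod_cong'[OF refl])
      fix k assume "k \<in> ?T"
      then have "k \<in> S" using T by auto
      then have "free_gen R' (\<kappa> k) \<in> carrier (free_module R' S')"
        using \<kappa> by (intro R'.free_gen_closed) auto
      moreover have "f k \<in> carrier R" "g k \<in> carrier R" using f g by (auto simp: free_module_carrier)
      ultimately show "?t (f \<oplus>\<^bsub>free_module R S\<^esub> g) k = ?t f k \<oplus>\<^bsub>free_module R' S'\<^esub> ?t g k"
        using F'.smult_l_distr[of "\<rho> (f k)" "\<rho> (g k)"] by (simp add: free_module_ops(2)[of R])
    qed (use tc f g T in \<open>auto intro!: F'.a_closed[OF tc tc]\<close>)
    also have "\<dots> = (\<Oplus>\<^bsub>free_module R' S'\<^esub>k\<in>?T. ?t f k) \<oplus>\<^bsub>free_module R' S'\<^esub> (\<Oplus>\<^bsub>free_module R' S'\<^esub>k\<in>?T. ?t g k)"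
      using tc f g T by (intro F'.finsum_addf) (auto intro!: tc[OF f] tc[OF g])
    also have "\<dots> = ?h f \<oplus>\<^bsub>free_module R' S'\<^esub> ?h g"
      using sup[OF f T(1) _ T(2)] sup[OF g T(1) _ T(2)] by simp
    finally show "?h (f \<oplus>\<^bsub>free_module R S\<^esub> g) = ?h f \<oplus>\<^bsub>free_module R' S'\<^esub> ?h g" .
  next
    fix r f assume r: "r \<in> carrier R" and f: "f \<in> carrier (free_module R S)"
    let ?T = "{k. f k \<noteq> \<zero>\<^bsub>R\<^esub>}"
    have T: "finite ?T" "?T \<subseteq> S" using supp f by auto
    have rf: "r \<odot>\<^bsub>free_module R S\<^esub> f \<in> carrier (free_module R S)" using r f by simp
    have "?h (r \<odot>\<^bsub>free_module R S\<^esub> f) = (\<Oplus>\<^bsub>free_module R' S'\<^esub>k\<in>?T. ?t (r \<odot>\<^bsub>free_module R S\<^esub> f) k)"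
      by (rule sup[OF rf T(1) _ T(2)]) (use r in \<open>auto simp: free_module_ops\<close>)
    also have "\<dots> = (\<Oplus>\<^bsub>free_module R' S'\<^esub>k\<in>?T. \<rho> r \<odot>\<^bsub>free_module R' S'\<^esub> ?t f k)"
    proof (rule F'.add.finprod_cong'[OF refl])
      fix k assume "k \<in> ?T"
      then have "k \<in> S" using T by auto
      then have "free_gen R' (\<kappa> k) \<in> carrier (free_module R' S')"
        using \<kappa> by (intro R'.free_gen_closed) auto
      moreover have "f k \<in> carrier R" using f by (auto simp: free_module_carrier)
      ultimately show "?t (r \<odot>\<^bsub>free_module R S\<^esub> f) k = \<rho> r \<odot>\<^bsub>free_module R' S'\<^esub> ?t f k"
        using F'.smult_assoc1[of "\<rho> r" "\<rho> (f k)"] r by (simp add: free_module_ops(3)[of R])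
    qed (use tc f r T in \<open>auto intro!: F'.smult_closed[OF _ tc]\<close>)
    also have "\<dots> = \<rho> r \<odot>\<^bsub>free_module R' S'\<^esub> ?h f"
      unfolding free_map_def using tc f r T
      by (subst F'.finsum_smult_ldistr) (auto intro!: tc[OF f])
    finally show "?h (r \<odot>\<^bsub>free_module R S\<^esub> f) = \<rho> r \<odot>\<^bsub>free_module R' S'\<^esub> ?h f" .
  qed
  fix k assume k: "k \<in> S"
  have g: "free_gen R' (\<kappa> k) \<in> carrier (free_module R' S')"
    using k \<kappa> by (intro R'.free_gen_closed) auto
  have "?h (free_gen R k) = (\<Oplus>\<^bsub>free_module R' S'\<^esub>j\<in>{k}. ?t (free_gen R k) j)"
    using k by (intro sup R.free_gen_closed) (auto simp: free_gen_def)
  also have "\<dots> = ?t (free_gen R k) k"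
    using tc[of "free_gen R k" k] k F'.finsum_insert[of "{}" k] by (simp add: Pi_def)
  also have "\<dots> = free_gen R' (\<kappa> k)"
    using F'.smult_one[OF g] by (simp add: free_gen_def)
  finally show "?h (free_gen R k) = free_gen R' (\<kappa> k)" .
qed

section \<open>Presheaves of modules\<close>

lemma semilinearD:
  assumes "semilinear R \<rho> M M' h"
  shows "x \<in> carrier M \<Longrightarrow> h x \<in> carrier M'"
    and "x \<in> carrier M \<Longrightarrow> y \<in> carrier M \<Longrightarrow> h (x \<oplus>\<^bsub>M\<^esub> y) = h x \<oplus>\<^bsub>M'\<^esub> h y"
    and "r \<in> carrier R \<Longrightarrow> x \<in> carrier M \<Longrightarrow> h (r \<odot>\<^bsub>M\<^esub> x) = \<rho> r \<odot>\<^bsub>M'\<^esub> h x"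
  using assms by (auto simp: semilinear_def)

lemma semilinear_minus:
  assumes "Module.module R M" "Module.module R' M'" "semilinear R \<rho> M M' h"
    and "x \<in> carrier M" "y \<in> carrier M"
  shows "h (x \<ominus>\<^bsub>M\<^esub> y) = h x \<ominus>\<^bsub>M'\<^esub> h y"
proof -
  interpret h: abelian_group_hom M M' h by (rule semilinear_group_hom[OF assms(1-3)])
  show ?thesis using assms(4,5) by (simp add: a_minus_def)
qed

text \<open>Serves to deduce the presheaf laws of \<open>free_presheaf\<close> from those on
  generators. The two coefficient maps are compared on the carrier only, because a composite of
  restrictions equals the direct restriction only there.\<close>

lemma semilinear_free_eq:
  assumes R: "cring R" and M: "Module.module R' M"
    and h: "semilinear R \<rho> (free_module R S) M h" and h': "semilinear R \<rho>' (free_module R S) M h'"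
    and \<rho>: "\<And>r. r \<in> carrier R \<Longrightarrow> \<rho> r = \<rho>' r"
    and eq: "\<And>k. k \<in> S \<Longrightarrow> h (free_gen R k) = h' (free_gen R k)"
    and f: "f \<in> carrier (free_module R S)"
  shows "h f = h' f"
proof -
  interpret R: cring R by fact
  interpret F: Module.module R "free_module R S" by (rule R.free_module_is_module)
  interpret h: abelian_group_hom "free_module R S" M h
    by (rule semilinear_group_hom[OF F.module_axioms M h])
  interpret h': abelian_group_hom "free_module R S" M h'
    by (rule semilinear_group_hom[OF F.module_axioms M h'])
  show ?thesis
    using f
  proof (rule R.free_module_induct)
    show "h \<zero>\<^bsub>free_module R S\<^esub> = h' \<zero>\<^bsub>free_module R S\<^esub>" by simp
  next
    fix r k assume "r \<in> carrier R" "k \<in> S"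
    then show "h (r \<odot>\<^bsub>free_module R S\<^esub> free_gen R k) = h' (r \<odot>\<^bsub>free_module R S\<^esub> free_gen R k)"
      by (simp add: semilinearD(3)[OF h] semilinearD(3)[OF h'] \<rho> eq)
  qed simp
qed

definition op_closed :: "('r, 'z) ring_scheme \<Rightarrow> ('r, 'm, 'w) module_scheme \<Rightarrow> bool" where
  "op_closed R M \<longleftrightarrow> (\<forall>x\<in>carrier M. \<forall>y\<in>carrier M. x \<oplus>\<^bsub>M\<^esub> y \<in> carrier M) \<and>
     (\<forall>r\<in>carrier R. \<forall>x\<in>carrier M. r \<odot>\<^bsub>M\<^esub> x \<in> carrier M)"

lemma module_op_closed:
  assumes "Module.module R M" shows "op_closed R M"
proof -
  interpret Module.module R M by fact
  show ?thesis by (simp add: op_closed_def)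
qed

lemma sheaf_separated:
  assumes "is_sheaf X F" and "\<And>V. V \<in> \<V> \<Longrightarrow> openin X V"
    and "s \<in> carrier (sect F (\<Union>\<V>))" "t \<in> carrier (sect F (\<Union>\<V>))"
    and "\<And>V. V \<in> \<V> \<Longrightarrow> restr F (\<Union>\<V>) V s = restr F (\<Union>\<V>) V t"
  shows "s = t"
  by (rule assms(1)[unfolded is_sheaf_def, THEN conjunct2, THEN conjunct1, rule_format, of \<V>])
     (use assms(2-5) in auto)

lemma sheaf_glue:
  assumes "is_sheaf X F" and "\<And>V. V \<in> \<V> \<Longrightarrow> openin X V \<and> \<sigma> V \<in> carrier (sect F V)"
    and "\<And>V W. V \<in> \<V> \<Longrightarrow> W \<in> \<V> \<Longrightarrow> restr F V (V \<inter> W) (\<sigma> V) = restr F W (V \<inter> W) (\<sigma> W)"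
  shows "\<exists>s\<in>carrier (sect F (\<Union>\<V>)). \<forall>V\<in>\<V>. restr F (\<Union>\<V>) V s = \<sigma> V"
  by (rule assms(1)[unfolded is_sheaf_def, THEN conjunct2, THEN conjunct2, THEN spec, THEN spec, THEN mp])
     (use assms(2-3) in auto)

section \<open>Sections of the structure sheaf: restriction, separatedness and gluing\<close>

locale ringed_base =
  fixes X :: "'p topology" and OX :: "('p, 'r, 'z) presheaf"
  assumes ringed: "ringed_space X OX"
begin

lemma base_cring: "openin X U \<Longrightarrow> cring (sect OX U)"
  using ringed by (simp add: ringed_space_def)

lemma base_hom:
  "openin X U \<Longrightarrow> openin X V \<Longrightarrow> V \<subseteq> U \<Longrightarrow> restr OX U V \<in> ring_hom (sect OX U) (sect OX V)"
  using ringed by (simp add: ringed_space_def)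

lemma base_closed [simp]:
  "openin X U \<Longrightarrow> openin X V \<Longrightarrow> V \<subseteq> U \<Longrightarrow> r \<in> carrier (sect OX U) \<Longrightarrow>
   restr OX U V r \<in> carrier (sect OX V)"
  by (rule ring_hom_closed[OF base_hom])

lemma base_id [simp]: "openin X U \<Longrightarrow> r \<in> carrier (sect OX U) \<Longrightarrow> restr OX U U r = r"
  using ringed by (simp add: ringed_space_def is_sheaf_def is_presheaf_def)

lemma base_restr [simp]:
  "openin X U \<Longrightarrow> openin X V \<Longrightarrow> openin X W \<Longrightarrow> W \<subseteq> V \<Longrightarrow> V \<subseteq> U \<Longrightarrow> r \<in> carrier (sect OX U) \<Longrightarrow>
   restr OX V W (restr OX U V r) = restr OX U W r"
  using ringed by (simp add: ringed_space_def is_sheaf_def is_presheaf_def)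

lemma base_hom_cring:
  "openin X U \<Longrightarrow> openin X V \<Longrightarrow> V \<subseteq> U \<Longrightarrow>
   ring_hom_cring (sect OX U) (sect OX V) (restr OX U V)"
  by (simp add: ring_hom_cring_def ring_hom_cring_axioms_def base_cring base_hom)

lemma restr_separated:
  assumes "openin X U" and "r \<in> carrier (sect OX U)" "s \<in> carrier (sect OX U)"
    and "\<And>p. p \<in> U \<Longrightarrow> \<exists>V. openin X V \<and> p \<in> V \<and> V \<subseteq> U \<and> restr OX U V r = restr OX U V s"
  shows "r = s"
proof -
  \<comment> \<open>All open sets on which the two sections already agree; the pointwise hypothesis
    says that they cover \<open>U\<close>.\<close>
  let ?\<V> = "{V. openin X V \<and> V \<subseteq> U \<and> restr OX U V r = restr OX U V s}"
  have Un: "\<Union>?\<V> = U" using assms(4) by blast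
  have "is_sheaf X OX" using ringed by (simp add: ringed_space_def)
  from sheaf_separated[OF this, of ?\<V> r s] show ?thesis
    unfolding Un using assms(2,3) by blast
qed

text \<open>Gluing for local values that come from choices: \<open>G V c\<close> relates
  \<open>V\<close> to every value obtained from some choice. Compatibility on an overlap is not
  assumed; both restrictions are again related to the overlap by \<open>G\<close>, so
  \<open>G_unique\<close> identifies them.\<close>

lemma restr_glue:
  assumes U: "openin X U"
    and G: "\<And>V c. G V c \<Longrightarrow> openin X V \<and> V \<subseteq> U \<and> c \<in> carrier (sect OX V)"
    and cover: "\<And>p. p \<in> U \<Longrightarrow> \<exists>V c. p \<in> V \<and> G V c"
    and G_restr: "\<And>V W c. G V c \<Longrightarrow> openin X W \<Longrightarrow> W \<subseteq> V \<Longrightarrow> G W (restr OX V W c)"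
    and G_unique: "\<And>V c c'. G V c \<Longrightarrow> G V c' \<Longrightarrow> c = c'"
  shows "\<exists>!d. d \<in> carrier (sect OX U) \<and> (\<forall>V c. G V c \<longrightarrow> restr OX U V d = c)"
proof (rule ex_ex1I)
  let ?\<V> = "{V. \<exists>c. G V c}"
  define \<sigma> where "\<sigma> V = (THE c. G V c)" for V
  have \<sigma>: "\<sigma> V = c" if "G V c" for V c
    unfolding \<sigma>_def using that G_unique by (intro the_equality) blast+
  have Un: "\<Union>?\<V> = U" using G cover by blast
  have sh: "is_sheaf X OX" using ringed by (simp add: ringed_space_def)
  have "\<exists>s\<in>carrier (sect OX (\<Union>?\<V>)). \<forall>V\<in>?\<V>. restr OX (\<Union>?\<V>) V s = \<sigma> V"
  proof (rule sheaf_glue[OF sh])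
    fix V assume "V \<in> ?\<V>"
    then show "openin X V \<and> \<sigma> V \<in> carrier (sect OX V)" using G \<sigma> by auto
  next
    fix V W assume "V \<in> ?\<V>" "W \<in> ?\<V>"
    then obtain c c' where c: "G V c" "G W c'" by blast
    have o: "openin X (V \<inter> W)" using c G by blast
    show "restr OX V (V \<inter> W) (\<sigma> V) = restr OX W (V \<inter> W) (\<sigma> W)"
      unfolding \<sigma>[OF c(1)] \<sigma>[OF c(2)]
      by (rule G_unique[OF G_restr[OF c(1) o] G_restr[OF c(2) o]]) auto
  qed
  then show "\<exists>d. d \<in> carrier (sect OX U) \<and> (\<forall>V c. G V c \<longrightarrow> restr OX U V d = c)"
    unfolding Un using \<sigma> by blast
next
  fix d d'
  assume "d \<in> carrier (sect OX U) \<and> (\<forall>V c. G V c \<longrightarrow> restr OX U V d = c)"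
    "d' \<in> carrier (sect OX U) \<and> (\<forall>V c. G V c \<longrightarrow> restr OX U V d' = c)"
  then show "d = d'"
    using G cover by (intro restr_separated[OF U]) (blast, blast, metis)
qed

end

text \<open>
  For tensor products and sheafifications only the compatibility of the operations with
  restriction matters, and not that the sections form modules.
\<close>

locale linear_presheaf = ringed_base X OX
  for X :: "'p topology" and OX :: "('p, 'r, 'z) presheaf" +
  fixes F :: "('p, 'r, 'm) module_presheaf"
  assumes presheaf: "is_presheaf X F"
    and closed: "openin X U \<Longrightarrow> op_closed (sect OX U) (sect F U)"
    and restr_semilinear: "openin X U \<Longrightarrow> openin X V \<Longrightarrow> V \<subseteq> U \<Longrightarrow>
      semilinear (sect OX U) (restr OX U V) (sect F U) (sect F V) (restr F U V)"
begin

lemma restr_closed [simp]: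
  "openin X U \<Longrightarrow> openin X V \<Longrightarrow> V \<subseteq> U \<Longrightarrow> x \<in> carrier (sect F U) \<Longrightarrow>
   restr F U V x \<in> carrier (sect F V)"
  by (rule semilinearD(1)[OF restr_semilinear])

lemma restr_add:
  "openin X U \<Longrightarrow> openin X V \<Longrightarrow> V \<subseteq> U \<Longrightarrow> x \<in> carrier (sect F U) \<Longrightarrow> y \<in> carrier (sect F U) \<Longrightarrow>
   restr F U V (x \<oplus>\<^bsub>sect F U\<^esub> y) = restr F U V x \<oplus>\<^bsub>sect F V\<^esub> restr F U V y"
  by (rule semilinearD(2)[OF restr_semilinear])

lemma restr_smult:
  "openin X U \<Longrightarrow> openin X V \<Longrightarrow> V \<subseteq> U \<Longrightarrow> r \<in> carrier (sect OX U) \<Longrightarrow> x \<in> carrier (sect F U) \<Longrightarrow>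
   restr F U V (r \<odot>\<^bsub>sect F U\<^esub> x) = restr OX U V r \<odot>\<^bsub>sect F V\<^esub> restr F U V x"
  by (rule semilinearD(3)[OF restr_semilinear])

lemma restr_id [simp]: "openin X U \<Longrightarrow> x \<in> carrier (sect F U) \<Longrightarrow> restr F U U x = x"
  using presheaf by (simp add: is_presheaf_def)

lemma restr_restr [simp]:
  "openin X U \<Longrightarrow> openin X V \<Longrightarrow> openin X W \<Longrightarrow> W \<subseteq> V \<Longrightarrow> V \<subseteq> U \<Longrightarrow> x \<in> carrier (sect F U) \<Longrightarrow>
   restr F V W (restr F U V x) = restr F U W x"
  using presheaf by (simp add: is_presheaf_def)

lemma add_closed [simp]:
  "openin X U \<Longrightarrow> x \<in> carrier (sect F U) \<Longrightarrow> y \<in> carrier (sect F U) \<Longrightarrow>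
   x \<oplus>\<^bsub>sect F U\<^esub> y \<in> carrier (sect F U)"
  using closed by (auto simp: op_closed_def)

lemma smult_closed [simp]:
  "openin X U \<Longrightarrow> r \<in> carrier (sect OX U) \<Longrightarrow> x \<in> carrier (sect F U) \<Longrightarrow>
   r \<odot>\<^bsub>sect F U\<^esub> x \<in> carrier (sect F U)"
  using closed by (auto simp: op_closed_def)

end

locale modular_presheaf = linear_presheaf +
  assumes sect_module: "openin X U \<Longrightarrow> Module.module (sect OX U) (sect F U)"

lemma linear_presheafI:
  assumes "ringed_space X OX"
    and "\<And>U. openin X U \<Longrightarrow> op_closed (sect OX U) (sect F U)"
    and "\<And>U V. openin X U \<Longrightarrow> openin X V \<Longrightarrow> V \<subseteq> U \<Longrightarrow>
      semilinear (sect OX U) (restr OX U V) (sect F U) (sect F V) (restr F U V)"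
    and "\<And>U x. openin X U \<Longrightarrow> x \<in> carrier (sect F U) \<Longrightarrow> restr F U U x = x"
    and "\<And>U V W x. openin X U \<Longrightarrow> openin X V \<Longrightarrow> openin X W \<Longrightarrow> W \<subseteq> V \<Longrightarrow> V \<subseteq> U \<Longrightarrow>
      x \<in> carrier (sect F U) \<Longrightarrow> restr F V W (restr F U V x) = restr F U W x"
  shows "linear_presheaf X OX F"
proof unfold_locales
  show "is_presheaf X F"
    unfolding is_presheaf_def using assms(3-5) by (auto dest: semilinearD(1))
qed (use assms in auto)

lemma modular_presheafI:
  assumes "ringed_space X OX"
    and "\<And>U. openin X U \<Longrightarrow> Module.module (sect OX U) (sect F U)"
    and "\<And>U V. openin X U \<Longrightarrow> openin X V \<Longrightarrow> V \<subseteq> U \<Longrightarrow>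
      semilinear (sect OX U) (restr OX U V) (sect F U) (sect F V) (restr F U V)"
    and "\<And>U x. openin X U \<Longrightarrow> x \<in> carrier (sect F U) \<Longrightarrow> restr F U U x = x"
    and "\<And>U V W x. openin X U \<Longrightarrow> openin X V \<Longrightarrow> openin X W \<Longrightarrow> W \<subseteq> V \<Longrightarrow> V \<subseteq> U \<Longrightarrow>
      x \<in> carrier (sect F U) \<Longrightarrow> restr F V W (restr F U V x) = restr F U W x"
  shows "modular_presheaf X OX F"
proof (intro modular_presheaf.intro modular_presheaf_axioms.intro)
  show "linear_presheaf X OX F"
    by (rule linear_presheafI[OF assms(1) module_op_closed[OF assms(2)] assms(3-5)])
qed (rule assms(2))

lemma module_sheaf_modular:
  assumes "ringed_space X OX" "module_sheaf X OX F"
  shows "modular_presheaf X OX F"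
proof (rule modular_presheafI[OF assms(1)])
  have p: "is_presheaf X F" using assms(2) by (simp add: module_sheaf_def is_sheaf_def)
  fix U assume U: "openin X U"
  show "Module.module (sect OX U) (sect F U)"
    using assms(2) U by (simp add: module_sheaf_def)
  show "restr F U U x = x" if "x \<in> carrier (sect F U)" for x
    using p U that by (simp add: is_presheaf_def)
  fix V assume V: "openin X V" "V \<subseteq> U"
  show "semilinear (sect OX U) (restr OX U V) (sect F U) (sect F V) (restr F U V)"
    using assms(2) p U V by (simp add: module_sheaf_def is_presheaf_def semilinear_def)
  show "restr F V W (restr F U V x) = restr F U W x"
    if "openin X W" "W \<subseteq> V" "x \<in> carrier (sect F U)" for W x
    using p U V that by (simp add: is_presheaf_def)
qed

context modular_presheaf
begin

lemma sect_plain: "openin X U \<Longrightarrow> plain_module (sect OX U) (sect F U)"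
  by (simp add: plain_module_def sect_module)

lemma restr_minus:
  "openin X U \<Longrightarrow> openin X V \<Longrightarrow> V \<subseteq> U \<Longrightarrow> x \<in> carrier (sect F U) \<Longrightarrow> y \<in> carrier (sect F U) \<Longrightarrow>
   restr F U V (x \<ominus>\<^bsub>sect F U\<^esub> y) = restr F U V x \<ominus>\<^bsub>sect F V\<^esub> restr F U V y"
  by (rule semilinear_minus[OF sect_module sect_module restr_semilinear])

text \<open>The union defining the restriction of a coset is constant because a difference in
  \<open>N U\<close> restricts into \<open>N V\<close>. All laws of the quotient are then inherited
  from representatives.\<close>

lemma
  assumes N: "\<And>U. openin X U \<Longrightarrow> submodule (N U) (sect OX U) (sect F U)"
    and N_restr: "\<And>U V. openin X U \<Longrightarrow> openin X V \<Longrightarrow> V \<subseteq> U \<Longrightarrow> restr F U V ` N U \<subseteq> N V"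
  shows quotient_restr: "\<And>U V x. openin X U \<Longrightarrow> openin X V \<Longrightarrow> V \<subseteq> U \<Longrightarrow> x \<in> carrier (sect F U) \<Longrightarrow>
      restr (quotient_presheaf F N) U V (N U +>\<^bsub>sect F U\<^esub> x) = N V +>\<^bsub>sect F V\<^esub> restr F U V x"
    and quotient_modular: "modular_presheaf X OX (quotient_presheaf F N)"
proof -
  let ?Q = "quotient_presheaf F N"
  have sQ: "sect ?Q U = quotient_module (sect F U) (N U)" for U
    by (simp add: quotient_presheaf_def)
  show rQ: "restr ?Q U V (N U +>\<^bsub>sect F U\<^esub> x) = N V +>\<^bsub>sect F V\<^esub> restr F U V x"
    if U: "openin X U" and V: "openin X V" "V \<subseteq> U" and x: "x \<in> carrier (sect F U)" for U V x
    unfolding quotient_presheaf_def presheaf.select_convs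
  proof (rule plain_module.coset_map[OF sect_plain[OF U] N[OF U] x])
    fix y assume y: "y \<in> carrier (sect F U)" "y \<ominus>\<^bsub>sect F U\<^esub> x \<in> N U"
    then have "restr F U V y \<ominus>\<^bsub>sect F V\<^esub> restr F U V x \<in> N V"
      using N_restr[OF U V] U V x by (auto simp: restr_minus[symmetric])
    then show "N V +>\<^bsub>sect F V\<^esub> restr F U V y = N V +>\<^bsub>sect F V\<^esub> restr F U V x"
      using U V x y by (simp add: plain_module.coset_eq_iff[OF sect_plain[OF V(1)] N[OF V(1)]])
  qed
  note q = plain_module.quotient_add[OF sect_plain N] plain_module.quotient_smult[OF sect_plain N]
  show "modular_presheaf X OX ?Q"
  proof (rule modular_presheafI[OF ringed])
    fix U V assume "openin X U" "openin X V" "V \<subseteq> U"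
    then show "semilinear (sect OX U) (restr OX U V) (sect ?Q U) (sect ?Q V) (restr ?Q U V)"
      unfolding semilinear_def
      by (auto simp: sQ quotient_module_carrier q rQ restr_add restr_smult)
  qed (auto simp: sQ quotient_module_carrier rQ intro: plain_module.quotient_is_module[OF sect_plain N])
qed

end

section \<open>Tensor products\<close>

text \<open>The generators of \<open>tensor_relations\<close>, named so that restriction can be
  checked on them and carried over to the span by \<open>semilinear_span\<close>.\<close>

definition bilinear_relations ::
    "('r, 'z) ring_scheme \<Rightarrow> ('r, 'm) module \<Rightarrow> ('r, 'n) module \<Rightarrow> ('m \<times> 'n \<Rightarrow> 'r) set" where
  "bilinear_relations R M N =
     {free_gen R (x \<oplus>\<^bsub>M\<^esub> x', y) \<ominus>\<^bsub>tensor_free R M N\<^esub>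
         (free_gen R (x, y) \<oplus>\<^bsub>tensor_free R M N\<^esub> free_gen R (x', y)) | x x' y.
         x \<in> carrier M \<and> x' \<in> carrier M \<and> y \<in> carrier N} \<union>
      {free_gen R (x, y \<oplus>\<^bsub>N\<^esub> y') \<ominus>\<^bsub>tensor_free R M N\<^esub>
         (free_gen R (x, y) \<oplus>\<^bsub>tensor_free R M N\<^esub> free_gen R (x, y')) | x y y'.
         x \<in> carrier M \<and> y \<in> carrier N \<and> y' \<in> carrier N} \<union>
      {free_gen R (r \<odot>\<^bsub>M\<^esub> x, y) \<ominus>\<^bsub>tensor_free R M N\<^esub>
         (r \<odot>\<^bsub>tensor_free R M N\<^esub> free_gen R (x, y)) | r x y.
         r \<in> carrier R \<and> x \<in> carrier M \<and> y \<in> carrier N} \<union>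
      {free_gen R (x, r \<odot>\<^bsub>N\<^esub> y) \<ominus>\<^bsub>tensor_free R M N\<^esub>
         (r \<odot>\<^bsub>tensor_free R M N\<^esub> free_gen R (x, y)) | r x y.
         r \<in> carrier R \<and> x \<in> carrier M \<and> y \<in> carrier N}"

lemma bilinear_relationsI:
  "x \<in> carrier M \<Longrightarrow> x' \<in> carrier M \<Longrightarrow> y \<in> carrier N \<Longrightarrow>
   free_gen R (x \<oplus>\<^bsub>M\<^esub> x', y) \<ominus>\<^bsub>tensor_free R M N\<^esub>
    (free_gen R (x, y) \<oplus>\<^bsub>tensor_free R M N\<^esub> free_gen R (x', y)) \<in> bilinear_relations R M N"
  "x \<in> carrier M \<Longrightarrow> y \<in> carrier N \<Longrightarrow> y' \<in> carrier N \<Longrightarrow>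
   free_gen R (x, y \<oplus>\<^bsub>N\<^esub> y') \<ominus>\<^bsub>tensor_free R M N\<^esub>
    (free_gen R (x, y) \<oplus>\<^bsub>tensor_free R M N\<^esub> free_gen R (x, y')) \<in> bilinear_relations R M N"
  "r \<in> carrier R \<Longrightarrow> x \<in> carrier M \<Longrightarrow> y \<in> carrier N \<Longrightarrow>
   free_gen R (r \<odot>\<^bsub>M\<^esub> x, y) \<ominus>\<^bsub>tensor_free R M N\<^esub>
    (r \<odot>\<^bsub>tensor_free R M N\<^esub> free_gen R (x, y)) \<in> bilinear_relations R M N"
  "r \<in> carrier R \<Longrightarrow> x \<in> carrier M \<Longrightarrow> y \<in> carrier N \<Longrightarrow>
   free_gen R (x, r \<odot>\<^bsub>N\<^esub> y) \<ominus>\<^bsub>tensor_free R M N\<^esub>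
    (r \<odot>\<^bsub>tensor_free R M N\<^esub> free_gen R (x, y)) \<in> bilinear_relations R M N"
  unfolding bilinear_relations_def by blast+

lemma tensor_relations_eq:
  "tensor_relations R M N = submodule_span R (tensor_free R M N) (bilinear_relations R M N)"
  by (simp only: tensor_relations_def bilinear_relations_def)

locale tensor_product =
  R: cring R for R :: "('r, 'z) ring_scheme" (structure) and M :: "('r, 'm) module" and N :: "('r, 'n) module" +
  assumes M_closed: "op_closed R M" and N_closed: "op_closed R N"
begin

sublocale F: plain_module R "tensor_free R M N"
  by (simp add: plain_module_def R.free_module_is_module)

lemma gen_closed [simp]:
  "x \<in> carrier M \<Longrightarrow> y \<in> carrier N \<Longrightarrow> free_gen R (x, y) \<in> carrier (tensor_free R M N)"
  by (rule R.free_gen_closed) simp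

lemma ops_closed [simp]:
  "x \<in> carrier M \<Longrightarrow> x' \<in> carrier M \<Longrightarrow> x \<oplus>\<^bsub>M\<^esub> x' \<in> carrier M"
  "y \<in> carrier N \<Longrightarrow> y' \<in> carrier N \<Longrightarrow> y \<oplus>\<^bsub>N\<^esub> y' \<in> carrier N"
  "r \<in> carrier R \<Longrightarrow> x \<in> carrier M \<Longrightarrow> r \<odot>\<^bsub>M\<^esub> x \<in> carrier M"
  "r \<in> carrier R \<Longrightarrow> y \<in> carrier N \<Longrightarrow> r \<odot>\<^bsub>N\<^esub> y \<in> carrier N"
  using M_closed N_closed by (auto simp: op_closed_def)

lemma bilinear_relations_closed: "bilinear_relations R M N \<subseteq> carrier (tensor_free R M N)"
  by (auto simp: bilinear_relations_def)

lemma relations_submodule: "submodule (tensor_relations R M N) R (tensor_free R M N)"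
  unfolding tensor_relations_eq by (rule F.span_submodule[OF bilinear_relations_closed])

lemma relation: "f \<in> bilinear_relations R M N \<Longrightarrow> f \<in> tensor_relations R M N"
  unfolding tensor_relations_eq by (rule subsetD[OF span_superset])

lemma tensor_is_module: "Module.module R (tensor_module R M N)"
  unfolding tensor_module_def by (rule F.quotient_is_module[OF relations_submodule])

lemma pure_tensor_closed [simp]:
  "x \<in> carrier M \<Longrightarrow> y \<in> carrier N \<Longrightarrow> pure_tensor R M N x y \<in> carrier (tensor_module R M N)"
  by (auto simp: tensor_module_def quotient_module_carrier pure_tensor_def)

lemma tensor_add:
  "f \<in> carrier (tensor_free R M N) \<Longrightarrow> g \<in> carrier (tensor_free R M N) \<Longrightarrow>
   (tensor_relations R M N +>\<^bsub>tensor_free R M N\<^esub> f) \<oplus>\<^bsub>tensor_module R M N\<^esub>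
   (tensor_relations R M N +>\<^bsub>tensor_free R M N\<^esub> g) =
   tensor_relations R M N +>\<^bsub>tensor_free R M N\<^esub> (f \<oplus>\<^bsub>tensor_free R M N\<^esub> g)"
  unfolding tensor_module_def by (rule F.quotient_add[OF relations_submodule])

lemma tensor_smult:
  "r \<in> carrier R \<Longrightarrow> f \<in> carrier (tensor_free R M N) \<Longrightarrow>
   r \<odot>\<^bsub>tensor_module R M N\<^esub> (tensor_relations R M N +>\<^bsub>tensor_free R M N\<^esub> f) =
   tensor_relations R M N +>\<^bsub>tensor_free R M N\<^esub> (r \<odot>\<^bsub>tensor_free R M N\<^esub> f)"
  unfolding tensor_module_def by (rule F.quotient_smult[OF relations_submodule])

lemma relation_eq:
  assumes "f \<ominus>\<^bsub>tensor_free R M N\<^esub> g \<in> bilinear_relations R M N"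
    and "f \<in> carrier (tensor_free R M N)" "g \<in> carrier (tensor_free R M N)"
  shows "tensor_relations R M N +>\<^bsub>tensor_free R M N\<^esub> f = tensor_relations R M N +>\<^bsub>tensor_free R M N\<^esub> g"
  using F.coset_eq_iff[OF relations_submodule assms(2,3)] relation[OF assms(1)] by simp

lemma pure_tensor_add_left:
  assumes x: "x \<in> carrier M" "x' \<in> carrier M" and y: "y \<in> carrier N"
  shows "pure_tensor R M N (x \<oplus>\<^bsub>M\<^esub> x') y =
    pure_tensor R M N x y \<oplus>\<^bsub>tensor_module R M N\<^esub> pure_tensor R M N x' y"
  unfolding pure_tensor_def tensor_add[OF gen_closed[OF x(1) y] gen_closed[OF x(2) y]]
  by (rule relation_eq) (use assms in \<open>simp_all add: bilinear_relationsI\<close>)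

lemma pure_tensor_add_right:
  assumes x: "x \<in> carrier M" and y: "y \<in> carrier N" "y' \<in> carrier N"
  shows "pure_tensor R M N x (y \<oplus>\<^bsub>N\<^esub> y') =
    pure_tensor R M N x y \<oplus>\<^bsub>tensor_module R M N\<^esub> pure_tensor R M N x y'"
  unfolding pure_tensor_def tensor_add[OF gen_closed[OF x y(1)] gen_closed[OF x y(2)]]
  by (rule relation_eq) (use assms in \<open>simp_all add: bilinear_relationsI\<close>)

lemma pure_tensor_smult_left:
  assumes r: "r \<in> carrier R" and x: "x \<in> carrier M" and y: "y \<in> carrier N"
  shows "pure_tensor R M N (r \<odot>\<^bsub>M\<^esub> x) y = r \<odot>\<^bsub>tensor_module R M N\<^esub> pure_tensor R M N x y"
  unfolding pure_tensor_def tensor_smult[OF r gen_closed[OF x y]]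
  by (rule relation_eq) (use assms in \<open>simp_all add: bilinear_relationsI\<close>)

lemma pure_tensor_smult_right:
  assumes r: "r \<in> carrier R" and x: "x \<in> carrier M" and y: "y \<in> carrier N"
  shows "pure_tensor R M N x (r \<odot>\<^bsub>N\<^esub> y) = r \<odot>\<^bsub>tensor_module R M N\<^esub> pure_tensor R M N x y"
  unfolding pure_tensor_def tensor_smult[OF r gen_closed[OF x y]]
  by (rule relation_eq) (use assms in \<open>simp_all add: bilinear_relationsI\<close>)

end

section \<open>Tensor products of presheaves\<close>

definition free_presheaf ::
    "('p, 'r, 'z) presheaf \<Rightarrow> ('p, 'r, 'm) module_presheaf \<Rightarrow> ('p, 'r, 'n) module_presheaf \<Rightarrow>
     ('p, 'r, 'm \<times> 'n \<Rightarrow> 'r) module_presheaf" where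
  "free_presheaf OX M N = \<lparr>
     sect = (\<lambda>U. tensor_free (sect OX U) (sect M U) (sect N U)),
     restr = (\<lambda>U V. free_map (sect OX U) (sect OX V) (carrier (sect M V) \<times> carrier (sect N V))
       (restr OX U V) (\<lambda>k. (restr M U V (fst k), restr N U V (snd k)))) \<rparr>"

text \<open>Presents the tensor product as a quotient of a presheaf of free modules, so that
  \<open>quotient_modular\<close> and \<open>quotient_restr\<close> apply to it.\<close>

lemma tensor_presheaf_eq:
  "tensor_presheaf OX M N =
   quotient_presheaf (free_presheaf OX M N) (\<lambda>U. tensor_relations (sect OX U) (sect M U) (sect N U))"
  by (simp add: tensor_presheaf_def quotient_presheaf_def free_presheaf_def tensor_module_def free_map_def)

locale two_linear_presheaves =
  M: linear_presheaf X OX M + N: linear_presheaf X OX N for X OX M N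
begin

lemma tensor_sect: "openin X U \<Longrightarrow> tensor_product (sect OX U) (sect M U) (sect N U)"
  by (simp add: tensor_product_def tensor_product_axioms_def M.base_cring M.closed N.closed)

lemma
  assumes "openin X U" "openin X V" "V \<subseteq> U"
  shows free_restr_semilinear: "semilinear (sect OX U) (restr OX U V)
      (sect (free_presheaf OX M N) U) (sect (free_presheaf OX M N) V) (restr (free_presheaf OX M N) U V)"
    and free_restr_gen: "\<And>x y. x \<in> carrier (sect M U) \<Longrightarrow> y \<in> carrier (sect N U) \<Longrightarrow>
      restr (free_presheaf OX M N) U V (free_gen (sect OX U) (x, y)) =
      free_gen (sect OX V) (restr M U V x, restr N U V y)"
proof -
  let ?k = "\<lambda>k. (restr M U V (fst k), restr N U V (snd k))"
  have k: "?k \<in> carrier (sect M U) \<times> carrier (sect N U) \<rightarrow> carrier (sect M V) \<times> carrier (sect N V)"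
    using assms by auto
  note f = free_map[OF M.base_cring[OF assms(1)] M.base_cring[OF assms(2)] M.base_hom[OF assms] k]
  show "semilinear (sect OX U) (restr OX U V)
      (sect (free_presheaf OX M N) U) (sect (free_presheaf OX M N) V) (restr (free_presheaf OX M N) U V)"
    using f(1) by (simp add: free_presheaf_def)
  show "\<And>x y. x \<in> carrier (sect M U) \<Longrightarrow> y \<in> carrier (sect N U) \<Longrightarrow>
      restr (free_presheaf OX M N) U V (free_gen (sect OX U) (x, y)) =
      free_gen (sect OX V) (restr M U V x, restr N U V y)"
    using f(2)[of "(_, _)"] by (simp add: free_presheaf_def)
qed

lemma free_sect: "sect (free_presheaf OX M N) U = tensor_free (sect OX U) (sect M U) (sect N U)"
  by (simp add: free_presheaf_def)

sublocale free: modular_presheaf X OX "free_presheaf OX M N"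
proof (rule modular_presheafI[OF M.ringed])
  let ?F = "free_presheaf OX M N"
  fix U assume U: "openin X U"
  show sm: "Module.module (sect OX U) (sect ?F U)"
    using cring.free_module_is_module[OF M.base_cring[OF U]] by (simp add: free_sect)
  fix f assume f: "f \<in> carrier (sect ?F U)"
  have "semilinear (sect OX U) (\<lambda>r. r) (sect ?F U) (sect ?F U) (\<lambda>f. f)"
    by (simp add: semilinear_def)
  note id = this[unfolded free_sect[of U]] and 1 = free_restr_semilinear[OF U U order.refl, unfolded free_sect[of U]]
  show "restr ?F U U f = f"
    by (rule semilinear_free_eq[OF M.base_cring[OF U] sm[unfolded free_sect[of U]] 1 id _ _ f[unfolded free_sect]])
       (use U in \<open>auto simp: free_restr_gen\<close>)
next
  let ?F = "free_presheaf OX M N"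
  fix U V W f
  assume U: "openin X U" "openin X V" "openin X W" "W \<subseteq> V" "V \<subseteq> U" and f: "f \<in> carrier (sect ?F U)"
  have WU: "W \<subseteq> U" using U by auto
  have W: "Module.module (sect OX W) (sect ?F W)"
    using cring.free_module_is_module[OF M.base_cring[OF U(3)]] by (simp add: free_sect)
  note 1 = free_restr_semilinear[OF U(1,2,5)] and 2 = free_restr_semilinear[OF U(2,3,4)]
    and 3 = free_restr_semilinear[OF U(1,3) WU]
  have c: "semilinear (sect OX U) (\<lambda>r. restr OX V W (restr OX U V r)) (sect ?F U)
    (sect ?F W) (\<lambda>f. restr ?F V W (restr ?F U V f))"
    unfolding semilinear_def
    using semilinearD[OF 1] semilinearD[OF 2] U by (auto intro!: M.base_closed)
  show "restr ?F V W (restr ?F U V f) = restr ?F U W f"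
    by (rule semilinear_free_eq[OF M.base_cring[OF U(1)] W c[unfolded free_sect[of U]]
          3[unfolded free_sect[of U]] _ _ f[unfolded free_sect]])
       (use U WU in \<open>auto simp: free_restr_gen\<close>)
qed (rule free_restr_semilinear)

lemma free_relations:
  "openin X U \<Longrightarrow> submodule (tensor_relations (sect OX U) (sect M U) (sect N U)) (sect OX U) (sect (free_presheaf OX M N) U)"
  using tensor_product.relations_submodule[OF tensor_sect] by (simp add: free_sect)

lemma free_relations_restr:
  assumes U: "openin X U" and V: "openin X V" "V \<subseteq> U"
  shows "restr (free_presheaf OX M N) U V ` tensor_relations (sect OX U) (sect M U) (sect N U)
    \<subseteq> tensor_relations (sect OX V) (sect M V) (sect N V)"
proof -
  interpret U: tensor_product "sect OX U" "sect M U" "sect N U" by (rule tensor_sect[OF U])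
  interpret V: tensor_product "sect OX V" "sect M V" "sect N V" by (rule tensor_sect[OF V(1)])
  \<comment> \<open>Each of the four kinds of relation restricts to the relation of the same kind
    between the restricted elements.\<close>
  have "restr (free_presheaf OX M N) U V ` bilinear_relations (sect OX U) (sect M U) (sect N U)
    \<subseteq> bilinear_relations (sect OX V) (sect M V) (sect N V)"
  proof (rule image_subsetI)
    note r = free.restr_minus[OF U V, unfolded free_sect] free.restr_add[OF U V, unfolded free_sect]
      free.restr_smult[OF U V, unfolded free_sect] free_restr_gen[OF U V]
      M.restr_add[OF U V] N.restr_add[OF U V] M.restr_smult[OF U V] N.restr_smult[OF U V]
    note c = M.restr_closed[OF U V] N.restr_closed[OF U V] M.base_closed[OF U V]
    fix f assume "f \<in> bilinear_relations (sect OX U) (sect M U) (sect N U)"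
    then show "restr (free_presheaf OX M N) U V f \<in> bilinear_relations (sect OX V) (sect M V) (sect N V)"
      by (subst (asm) bilinear_relations_def, elim UnE CollectE exE conjE)
         (simp_all add: r c bilinear_relationsI)
  qed
  then show ?thesis
    unfolding tensor_relations_eq[of "sect OX U"]
    using V.relation U.bilinear_relations_closed U.F.plain_module_axioms V.F.module_axioms
      V.relations_submodule free_restr_semilinear[OF U V] U V
    by (intro semilinear_span[where \<rho> = "restr OX U V" and R' = "sect OX V" and M' = "tensor_free (sect OX V) (sect M V) (sect N V)"])
       (auto simp: free_sect)
qed

sublocale tensor: modular_presheaf X OX "tensor_presheaf OX M N"
  unfolding tensor_presheaf_eq by (rule free.quotient_modular[OF free_relations free_relations_restr])

lemma tensor_presheaf_sect:
  "sect (tensor_presheaf OX M N) U = tensor_module (sect OX U) (sect M U) (sect N U)"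
  by (simp add: tensor_presheaf_def)

lemma restr_pure_tensor:
  assumes "openin X U" "openin X V" "V \<subseteq> U" "x \<in> carrier (sect M U)" "y \<in> carrier (sect N U)"
  shows "restr (tensor_presheaf OX M N) U V (pure_tensor (sect OX U) (sect M U) (sect N U) x y) =
    pure_tensor (sect OX V) (sect M V) (sect N V) (restr M U V x) (restr N U V y)"
  using free.quotient_restr[OF free_relations free_relations_restr assms(1-3), of "free_gen (sect OX U) (x, y)"]
    tensor_product.gen_closed[OF tensor_sect[OF assms(1)] assms(4,5)] assms
  by (simp add: pure_tensor_def free_sect tensor_presheaf_eq free_restr_gen)

end

section \<open>Exterior squares\<close>

text \<open>The exterior product of sections over one open set, before sheafification. Identities
  are proved at this level, where the module axioms are at hand, and then passed on to
  \<open>wedge_sect\<close>.\<close>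

definition wedge :: "('r, 'z) ring_scheme \<Rightarrow> ('r, 'm) module \<Rightarrow> 'm \<Rightarrow> 'm \<Rightarrow> ('m \<times> 'm \<Rightarrow> 'r) set set" where
  "wedge R M x y = square_tensors R M +>\<^bsub>tensor_module R M M\<^esub> pure_tensor R M M x y"

abbreviation ext_square :: "('r, 'z) ring_scheme \<Rightarrow> ('r, 'm) module \<Rightarrow> ('r, ('m \<times> 'm \<Rightarrow> 'r) set set) module" where
  "ext_square R M \<equiv> quotient_module (tensor_module R M M) (square_tensors R M)"

locale tensor_square = tensor_product R M M for R :: "('r, 'z) ring_scheme" (structure) and M :: "('r, 'm) module"
begin

sublocale T: plain_module R "tensor_module R M M"
  by (simp add: plain_module_def tensor_is_module)

lemma square_tensors_submodule: "submodule (square_tensors R M) R (tensor_module R M M)"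
  unfolding square_tensors_def by (rule T.span_submodule) auto

sublocale E: plain_module R "ext_square R M"
  by (simp add: plain_module_def T.quotient_is_module square_tensors_submodule)

lemma wedge_closed [simp]:
  "x \<in> carrier M \<Longrightarrow> y \<in> carrier M \<Longrightarrow> wedge R M x y \<in> carrier (ext_square R M)"
  by (auto simp: quotient_module_carrier wedge_def)

lemma wedge_add_left:
  "x \<in> carrier M \<Longrightarrow> x' \<in> carrier M \<Longrightarrow> y \<in> carrier M \<Longrightarrow>
   wedge R M (x \<oplus>\<^bsub>M\<^esub> x') y = wedge R M x y \<oplus>\<^bsub>ext_square R M\<^esub> wedge R M x' y"
  by (simp add: wedge_def pure_tensor_add_left T.quotient_add[OF square_tensors_submodule])

lemma wedge_add_right:
  "x \<in> carrier M \<Longrightarrow> y \<in> carrier M \<Longrightarrow> y' \<in> carrier M \<Longrightarrow>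
   wedge R M x (y \<oplus>\<^bsub>M\<^esub> y') = wedge R M x y \<oplus>\<^bsub>ext_square R M\<^esub> wedge R M x y'"
  by (simp add: wedge_def pure_tensor_add_right T.quotient_add[OF square_tensors_submodule])

lemma wedge_smult_left:
  "r \<in> carrier R \<Longrightarrow> x \<in> carrier M \<Longrightarrow> y \<in> carrier M \<Longrightarrow>
   wedge R M (r \<odot>\<^bsub>M\<^esub> x) y = r \<odot>\<^bsub>ext_square R M\<^esub> wedge R M x y"
  by (simp add: wedge_def pure_tensor_smult_left T.quotient_smult[OF square_tensors_submodule])

lemma wedge_smult_right:
  "r \<in> carrier R \<Longrightarrow> x \<in> carrier M \<Longrightarrow> y \<in> carrier M \<Longrightarrow>
   wedge R M x (r \<odot>\<^bsub>M\<^esub> y) = r \<odot>\<^bsub>ext_square R M\<^esub> wedge R M x y"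
  by (simp add: wedge_def pure_tensor_smult_right T.quotient_smult[OF square_tensors_submodule])

lemma wedge_self [simp]:
  assumes "x \<in> carrier M" shows "wedge R M x x = \<zero>\<^bsub>ext_square R M\<^esub>"
proof -
  interpret S: abelian_subgroup "square_tensors R M" "tensor_module R M M"
    by (rule T.submodule_abelian_subgroup[OF square_tensors_submodule])
  have "pure_tensor R M M x x \<in> square_tensors R M"
    unfolding square_tensors_def by (rule subsetD[OF span_superset]) (use assms in simp)
  then show ?thesis by (simp add: wedge_def S.a_rcos_const quotient_module_zero)
qed

text \<open>Polarization: expand the vanishing wedge of \<open>x + y\<close> with itself.\<close>

lemma wedge_swap:
  assumes x: "x \<in> carrier M" and y: "y \<in> carrier M"
  shows "wedge R M y x = \<ominus>\<^bsub>ext_square R M\<^esub> wedge R M x y"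
proof -
  have "\<zero>\<^bsub>ext_square R M\<^esub> = wedge R M (x \<oplus>\<^bsub>M\<^esub> y) (x \<oplus>\<^bsub>M\<^esub> y)"
    using x y by simp
  also have "\<dots> = wedge R M y x \<oplus>\<^bsub>ext_square R M\<^esub> wedge R M x y"
    using x y wedge_self[OF x] wedge_self[OF y]
    by (simp add: wedge_add_left wedge_add_right E.M.a_comm del: wedge_self)
  finally show ?thesis
    using x y by (metis E.M.minus_equality wedge_closed)
qed

end

section \<open>Exterior squares of presheaves\<close>

locale exterior_presheaf = linear_presheaf
begin

sublocale square: two_linear_presheaves X OX F F ..

lemma square_sect: "openin X U \<Longrightarrow> tensor_square (sect OX U) (sect F U)"
  by (simp add: tensor_square_def square.tensor_sect)

lemma square_tensors_sub:
  "openin X U \<Longrightarrow> submodule (square_tensors (sect OX U) (sect F U)) (sect OX U) (sect (tensor_presheaf OX F F) U)"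
  using tensor_square.square_tensors_submodule[OF square_sect] by (simp add: square.tensor_presheaf_sect)

lemma square_tensors_restr:
  assumes U: "openin X U" and V: "openin X V" "V \<subseteq> U"
  shows "restr (tensor_presheaf OX F F) U V ` square_tensors (sect OX U) (sect F U)
    \<subseteq> square_tensors (sect OX V) (sect F V)"
proof -
  have \<rho>: "restr OX U V \<in> carrier (sect OX U) \<rightarrow> carrier (sect OX V)"
    using U V by auto
  have c: "pure_tensor (sect OX U) (sect F U) (sect F U) x x \<in> carrier (sect (tensor_presheaf OX F F) U)"
    if "x \<in> carrier (sect F U)" for x
    using tensor_product.pure_tensor_closed[OF square.tensor_sect[OF U] that that]
    by (simp add: square.tensor_presheaf_sect)
  have "(\<lambda>x. pure_tensor (sect OX V) (sect F V) (sect F V) x x) ` carrier (sect F V)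
      \<subseteq> square_tensors (sect OX V) (sect F V)"
    unfolding square_tensors_def by (rule span_superset)
  then have "restr (tensor_presheaf OX F F) U V `
      (\<lambda>x. pure_tensor (sect OX U) (sect F U) (sect F U) x x) ` carrier (sect F U)
      \<subseteq> square_tensors (sect OX V) (sect F V)"
    using U V by (auto simp: square.restr_pure_tensor)
  from semilinear_span[OF square.tensor.sect_plain[OF U] square.tensor.sect_module[OF V(1)]
      square.tensor.restr_semilinear[OF U V] \<rho> square_tensors_sub[OF V(1)] _ this]
  show ?thesis
    using c by (simp add: square_tensors_def[of "sect OX U"] square.tensor_presheaf_sect image_subset_iff)
qed

sublocale ext2: modular_presheaf X OX "ext2_presheaf OX F"
  unfolding ext2_presheaf_def
  by (rule square.tensor.quotient_modular[OF square_tensors_sub square_tensors_restr])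

lemma ext2_sect: "sect (ext2_presheaf OX F) U = ext_square (sect OX U) (sect F U)"
  by (simp add: ext2_presheaf_def quotient_presheaf_def square.tensor_presheaf_sect)

lemma restr_wedge:
  assumes "openin X U" "openin X V" "V \<subseteq> U" "x \<in> carrier (sect F U)" "y \<in> carrier (sect F U)"
  shows "restr (ext2_presheaf OX F) U V (wedge (sect OX U) (sect F U) x y) =
    wedge (sect OX V) (sect F V) (restr F U V x) (restr F U V y)"
  using square.tensor.quotient_restr[OF square_tensors_sub square_tensors_restr assms(1-3),
      of "pure_tensor (sect OX U) (sect F U) (sect F U) x y"]
    tensor_product.pure_tensor_closed[OF square.tensor_sect[OF assms(1)] assms(4,5)] assms
  by (simp add: wedge_def ext2_presheaf_def square.tensor_presheaf_sect square.restr_pure_tensor)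

lemma wedge_sect_eq:
  "wedge_sect X OX F U x y = to_sheafify X (ext2_presheaf OX F) U (wedge (sect OX U) (sect F U) x y)"
  by (simp add: wedge_sect_def wedge_def)

end

section \<open>Germs and sheafification\<close>

context linear_presheaf
begin

lemma germ_mem_iff:
  "(V, y) \<in> germ X F p U x \<longleftrightarrow> openin X V \<and> p \<in> V \<and> y \<in> carrier (sect F V) \<and>
     (\<exists>W. openin X W \<and> p \<in> W \<and> W \<subseteq> U \<inter> V \<and> restr F U W x = restr F V W y)"
  by (simp add: germ_def)

lemma germ_self: "openin X U \<Longrightarrow> p \<in> U \<Longrightarrow> x \<in> carrier (sect F U) \<Longrightarrow> (U, x) \<in> germ X F p U x"
  by (auto simp: germ_mem_iff)

text \<open>Transitivity of agreement near \<open>p\<close>: the neighbourhood on which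
  \<open>x\<close> and \<open>y\<close> agree is intersected with the one on which \<open>x\<close>
  and a third section agree.\<close>

lemma germ_subset:
  assumes U: "openin X U" "x \<in> carrier (sect F U)" and V: "openin X V" "y \<in> carrier (sect F V)"
    and W: "openin X W" "p \<in> W" "W \<subseteq> U \<inter> V" "restr F U W x = restr F V W y"
  shows "germ X F p U x \<subseteq> germ X F p V y"
proof (clarsimp simp: germ_mem_iff)
  fix V' z W' assume z: "openin X V'" "p \<in> V'" "z \<in> carrier (sect F V')"
    and W': "openin X W'" "p \<in> W'" "W' \<subseteq> U" "W' \<subseteq> V'" "restr F U W' x = restr F V' W' z"
  have o: "openin X (W \<inter> W')" using W W' by auto
  have "restr F V (W \<inter> W') y = restr F W (W \<inter> W') (restr F V W y)"
    using V W(1,3) o by simp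
  also have "\<dots> = restr F W (W \<inter> W') (restr F U W x)" using W(4) by simp
  also have "\<dots> = restr F W' (W \<inter> W') (restr F U W' x)"
    using U W(1,3) W'(1,3) o by simp
  also have "\<dots> = restr F V' (W \<inter> W') z"
    unfolding W'(5) using z W'(1,4) o by simp
  finally show "\<exists>W. openin X W \<and> p \<in> W \<and> W \<subseteq> V \<and> W \<subseteq> V' \<and> restr F V W y = restr F V' W z"
    using o W W' by (intro exI[of _ "W \<inter> W'"]) auto
qed

lemma germ_eq_iff:
  assumes U: "openin X U" "p \<in> U" "x \<in> carrier (sect F U)"
    and V: "openin X V" "p \<in> V" "y \<in> carrier (sect F V)"
  shows "germ X F p U x = germ X F p V y \<longleftrightarrow>
    (\<exists>W. openin X W \<and> p \<in> W \<and> W \<subseteq> U \<inter> V \<and> restr F U W x = restr F V W y)"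
proof
  assume "germ X F p U x = germ X F p V y"
  then have "(V, y) \<in> germ X F p U x" using germ_self[OF V] by simp
  then show "\<exists>W. openin X W \<and> p \<in> W \<and> W \<subseteq> U \<inter> V \<and> restr F U W x = restr F V W y"
    by (simp add: germ_mem_iff)
next
  assume "\<exists>W. openin X W \<and> p \<in> W \<and> W \<subseteq> U \<inter> V \<and> restr F U W x = restr F V W y"
  then obtain W where W: "openin X W" "p \<in> W" "W \<subseteq> U \<inter> V" "restr F U W x = restr F V W y"
    by blast
  show "germ X F p U x = germ X F p V y"
    using germ_subset[OF U(1,3) V(1,3) W] germ_subset[OF V(1,3) U(1,3) W(1,2) _ W(4)[symmetric]] W
    by blast
qed

lemma germ_memD:
  assumes "(V, y) \<in> germ X F p U x" "openin X U" "p \<in> U" "x \<in> carrier (sect F U)"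
  shows "openin X V" "p \<in> V" "y \<in> carrier (sect F V)" "germ X F p V y = germ X F p U x"
  using assms germ_eq_iff[of U p x V y] by (auto simp: germ_mem_iff)

lemma germ_restr:
  assumes "openin X U" "openin X V" "V \<subseteq> U" "p \<in> V" "x \<in> carrier (sect F U)"
  shows "germ X F p V (restr F U V x) = germ X F p U x"
  using assms by (subst germ_eq_iff) auto

text \<open>The operations of a sheafification are unions over all representatives of a germ. As
  with cosets, a union whose body does not depend on the representative collapses.\<close>

lemma UN_germ:
  assumes "openin X U" "p \<in> U" "x \<in> carrier (sect F U)"
    and "\<And>V y. (V, y) \<in> germ X F p U x \<Longrightarrow> g V y = c"
  shows "(\<Union>(V, y)\<in>germ X F p U x. g V y) = c"
proof -
  have "(\<Union>(V, y)\<in>germ X F p U x. g V y) = (\<Union>(V, y)\<in>germ X F p U x. c)"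
    by (intro SUP_cong refl) (use assms(4) in auto)
  then show ?thesis using germ_self[OF assms(1-3)] by auto
qed

text \<open>Moves representatives over \<open>V\<close> and \<open>W\<close> to the common open set
  \<open>V \<inter> W\<close>, as required by \<open>sheafify_add_germ\<close>.\<close>

lemma germ_cases:
  assumes "s p = germ X F p V x" "t p = germ X F p W y"
    and "openin X V" "p \<in> V" "x \<in> carrier (sect F V)" "openin X W" "p \<in> W" "y \<in> carrier (sect F W)"
  shows "s p = germ X F p (V \<inter> W) (restr F V (V \<inter> W) x) \<and> t p = germ X F p (V \<inter> W) (restr F W (V \<inter> W) y)"
  using assms by (simp add: germ_restr openin_Int)

section \<open>Operations and gluing in the sheafification\<close>

lemma sheafify_simps:
  "sect (sheafify X OX F) U = \<lparr>
       carrier = {s \<in> extensional U.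
         \<forall>p\<in>U. \<exists>V. openin X V \<and> p \<in> V \<and> V \<subseteq> U \<and>
           (\<exists>x\<in>carrier (sect F V). \<forall>q\<in>V. s q = germ X F q V x)},
       monoid.mult = undefined, one = undefined,
       zero = (\<lambda>p\<in>U. germ X F p U \<zero>\<^bsub>sect F U\<^esub>),
       add = (\<lambda>s t. \<lambda>p\<in>U. \<Union>(V, x)\<in>s p. \<Union>(W, y)\<in>t p.
         germ X F p (V \<inter> W)
           (restr F V (V \<inter> W) x \<oplus>\<^bsub>sect F (V \<inter> W)\<^esub> restr F W (V \<inter> W) y)),
       smult = (\<lambda>r s. \<lambda>p\<in>U. \<Union>(V, x)\<in>s p.
         germ X F p (U \<inter> V)
           (restr OX U (U \<inter> V) r \<odot>\<^bsub>sect F (U \<inter> V)\<^esub> restr F V (U \<inter> V) x)) \<rparr>"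
  "restr (sheafify X OX F) U V s = restrict s V"
  by (simp_all add: sheafify_def)

lemma sheafify_carrier:
  "s \<in> carrier (sect (sheafify X OX F) U) \<longleftrightarrow> s \<in> extensional U \<and>
     (\<forall>p\<in>U. \<exists>V. openin X V \<and> p \<in> V \<and> V \<subseteq> U \<and>
        (\<exists>x\<in>carrier (sect F V). \<forall>q\<in>V. s q = germ X F q V x))"
  by (simp add: sheafify_simps)

lemma sheafify_local:
  assumes "s \<in> carrier (sect (sheafify X OX F) U)" "p \<in> U"
  obtains V x where "openin X V" "p \<in> V" "V \<subseteq> U" "x \<in> carrier (sect F V)"
    "\<And>q. q \<in> V \<Longrightarrow> s q = germ X F q V x"
proof -
  have "\<exists>V. openin X V \<and> p \<in> V \<and> V \<subseteq> U \<and>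
        (\<exists>x\<in>carrier (sect F V). \<forall>q\<in>V. s q = germ X F q V x)"
    using assms by (simp add: sheafify_carrier)
  then show ?thesis using that by blast
qed

text \<open>Arbitrary representatives of the two germs agree with \<open>x\<close> and
  \<open>y\<close> on neighbourhoods \<open>W1\<close> and \<open>W2\<close> of \<open>p\<close>; on
  the intersection of these the two sums agree, so the union defining the sum has a constant
  body.\<close>

lemma sheafify_add_germ:
  assumes p: "p \<in> U" and V: "openin X V" "p \<in> V" "x \<in> carrier (sect F V)" "y \<in> carrier (sect F V)"
    and s: "s p = germ X F p V x" and t: "t p = germ X F p V y"
  shows "(s \<oplus>\<^bsub>sect (sheafify X OX F) U\<^esub> t) p = germ X F p V (x \<oplus>\<^bsub>sect F V\<^esub> y)"
proof -
  have "germ X F p (V1 \<inter> V2) (restr F V1 (V1 \<inter> V2) x1 \<oplus>\<^bsub>sect F (V1 \<inter> V2)\<^esub> restr F V2 (V1 \<inter> V2) y2) =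
      germ X F p V (x \<oplus>\<^bsub>sect F V\<^esub> y)"
    if m: "(V1, x1) \<in> germ X F p V x" "(V2, y2) \<in> germ X F p V y" for V1 x1 V2 y2
  proof -
    note 1 = germ_memD[OF m(1) V(1,2,3)] and 2 = germ_memD[OF m(2) V(1,2,4)]
    obtain W1 where W1: "openin X W1" "p \<in> W1" "W1 \<subseteq> V1 \<inter> V" "restr F V1 W1 x1 = restr F V W1 x"
      using 1 germ_eq_iff[OF 1(1-3) V(1-3)] by auto
    obtain W2 where W2: "openin X W2" "p \<in> W2" "W2 \<subseteq> V2 \<inter> V" "restr F V2 W2 y2 = restr F V W2 y"
      using 2 germ_eq_iff[OF 2(1-3) V(1,2,4)] by auto
    let ?W = "W1 \<inter> W2"
    have o: "openin X ?W" "openin X (V1 \<inter> V2)" "?W \<subseteq> V1 \<inter> V2" "?W \<subseteq> V"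
      using W1 W2 1 2 by auto
    have "restr F V1 ?W x1 = restr F W1 ?W (restr F V1 W1 x1)" using 1 W1(1-3) o by simp
    also have "\<dots> = restr F V ?W x" unfolding W1(4) using V W1(1-3) o by simp
    finally have x: "restr F V1 ?W x1 = restr F V ?W x" .
    have "restr F V2 ?W y2 = restr F W2 ?W (restr F V2 W2 y2)" using 2 W2(1-3) o by simp
    also have "\<dots> = restr F V ?W y" unfolding W2(4) using V W2(1-3) o by simp
    finally have y: "restr F V2 ?W y2 = restr F V ?W y" .
    show ?thesis
    proof (subst germ_eq_iff)
      show "\<exists>W. openin X W \<and> p \<in> W \<and> W \<subseteq> V1 \<inter> V2 \<inter> V \<and>
        restr F (V1 \<inter> V2) W (restr F V1 (V1 \<inter> V2) x1 \<oplus>\<^bsub>sect F (V1 \<inter> V2)\<^esub> restr F V2 (V1 \<inter> V2) y2) =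
        restr F V W (x \<oplus>\<^bsub>sect F V\<^esub> y)"
        using o W1 W2 V 1 2 x y by (intro exI[of _ ?W]) (auto simp: restr_add)
    qed (use o V 1 2 in auto)
  qed
  then show ?thesis
    using p by (simp add: sheafify_simps s t UN_germ[OF V(1,2,3)] UN_germ[OF V(1,2,4)])
qed

lemma sheafify_smult_germ:
  assumes U: "openin X U" "r \<in> carrier (sect OX U)"
    and V: "openin X V" "p \<in> V" "V \<subseteq> U" "x \<in> carrier (sect F V)" and s: "s p = germ X F p V x"
  shows "(r \<odot>\<^bsub>sect (sheafify X OX F) U\<^esub> s) p = germ X F p V (restr OX U V r \<odot>\<^bsub>sect F V\<^esub> x)"
proof -
  have "germ X F p (U \<inter> V1) (restr OX U (U \<inter> V1) r \<odot>\<^bsub>sect F (U \<inter> V1)\<^esub> restr F V1 (U \<inter> V1) x1) =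
      germ X F p V (restr OX U V r \<odot>\<^bsub>sect F V\<^esub> x)"
    if m: "(V1, x1) \<in> germ X F p V x" for V1 x1
  proof -
    note 1 = germ_memD[OF m V(1,2,4)]
    obtain W where W: "openin X W" "p \<in> W" "W \<subseteq> V1 \<inter> V" "restr F V1 W x1 = restr F V W x"
      using 1 germ_eq_iff[OF 1(1-3) V(1,2,4)] by auto
    have o: "openin X (U \<inter> V1)" "W \<subseteq> U \<inter> V1" "p \<in> U \<inter> V1" "W \<subseteq> V" "W \<subseteq> V1" using U 1 W V by auto
    show ?thesis
    proof (subst germ_eq_iff)
      show "\<exists>W. openin X W \<and> p \<in> W \<and> W \<subseteq> U \<inter> V1 \<inter> V \<and>
        restr F (U \<inter> V1) W (restr OX U (U \<inter> V1) r \<odot>\<^bsub>sect F (U \<inter> V1)\<^esub> restr F V1 (U \<inter> V1) x1) =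
        restr F V W (restr OX U V r \<odot>\<^bsub>sect F V\<^esub> x)"
        using o W V 1 U by (intro exI[of _ W]) (auto simp: restr_smult)
    qed (use o V 1 U in auto)
  qed
  then show ?thesis
    using V by (simp add: sheafify_simps s UN_germ[OF V(1,2,4)] subset_iff)
qed

lemma sheafify_linear: "linear_presheaf X OX (sheafify X OX F)"
proof (rule linear_presheafI[OF ringed])
  let ?S = "sheafify X OX F"
  fix U assume U: "openin X U"
  show "op_closed (sect OX U) (sect ?S U)"
    unfolding op_closed_def
  proof (intro conjI ballI)
    fix s t assume s: "s \<in> carrier (sect ?S U)" and t: "t \<in> carrier (sect ?S U)"
    show "s \<oplus>\<^bsub>sect ?S U\<^esub> t \<in> carrier (sect ?S U)"
      unfolding sheafify_carrier
    proof (intro conjI ballI)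
      show "s \<oplus>\<^bsub>sect ?S U\<^esub> t \<in> extensional U" by (simp add: sheafify_simps)
      fix p assume p: "p \<in> U"
      obtain V x where V: "openin X V" "p \<in> V" "V \<subseteq> U" "x \<in> carrier (sect F V)"
        "\<And>q. q \<in> V \<Longrightarrow> s q = germ X F q V x" using sheafify_local[OF s p] by metis
      obtain W y where W: "openin X W" "p \<in> W" "W \<subseteq> U" "y \<in> carrier (sect F W)"
        "\<And>q. q \<in> W \<Longrightarrow> t q = germ X F q W y" using sheafify_local[OF t p] by metis
      have o: "openin X (V \<inter> W)" using V W by auto
      have "(s \<oplus>\<^bsub>sect ?S U\<^esub> t) q =
          germ X F q (V \<inter> W) (restr F V (V \<inter> W) x \<oplus>\<^bsub>sect F (V \<inter> W)\<^esub> restr F W (V \<inter> W) y)"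
        if q: "q \<in> V \<inter> W" for q
        using germ_cases[of s q V x t W y] q V W o by (intro sheafify_add_germ) auto
      then show "\<exists>V. openin X V \<and> p \<in> V \<and> V \<subseteq> U \<and>
          (\<exists>x\<in>carrier (sect F V). \<forall>q\<in>V. (s \<oplus>\<^bsub>sect ?S U\<^esub> t) q = germ X F q V x)"
        using V W o by (intro exI[of _ "V \<inter> W"] conjI bexI ballI) auto
    qed
  next
    fix r s assume r: "r \<in> carrier (sect OX U)" and s: "s \<in> carrier (sect ?S U)"
    show "r \<odot>\<^bsub>sect ?S U\<^esub> s \<in> carrier (sect ?S U)"
      unfolding sheafify_carrier
    proof (intro conjI ballI)
      show "r \<odot>\<^bsub>sect ?S U\<^esub> s \<in> extensional U" by (simp add: sheafify_simps)
      fix p assume p: "p \<in> U"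
      obtain V x where V: "openin X V" "p \<in> V" "V \<subseteq> U" "x \<in> carrier (sect F V)"
        "\<And>q. q \<in> V \<Longrightarrow> s q = germ X F q V x" using sheafify_local[OF s p] by metis
      have "(r \<odot>\<^bsub>sect ?S U\<^esub> s) q = germ X F q V (restr OX U V r \<odot>\<^bsub>sect F V\<^esub> x)"
        if q: "q \<in> V" for q
        using V U r q by (intro sheafify_smult_germ) auto
      then show "\<exists>V. openin X V \<and> p \<in> V \<and> V \<subseteq> U \<and>
          (\<exists>x\<in>carrier (sect F V). \<forall>q\<in>V. (r \<odot>\<^bsub>sect ?S U\<^esub> s) q = germ X F q V x)"
        using V U r by (intro exI[of _ "V"] conjI bexI[of _ "restr OX U V r \<odot>\<^bsub>sect F V\<^esub> x"] ballI) auto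
    qed
  qed
  show "restr ?S U U s = s" if "s \<in> carrier (sect ?S U)" for s
    using that by (simp add: sheafify_simps extensional_restrict)
  fix V assume V: "openin X V" "V \<subseteq> U"
  show "restr ?S V W (restr ?S U V s) = restr ?S U W s" if "W \<subseteq> V" for W s
    using that by (simp add: sheafify_simps Int_absorb1)
  show "semilinear (sect OX U) (restr OX U V) (sect ?S U) (sect ?S V) (restr ?S U V)"
    unfolding semilinear_def
  proof (intro conjI ballI funcsetI)
    fix s assume s: "s \<in> carrier (sect ?S U)"
    show "restr ?S U V s \<in> carrier (sect ?S V)"
      unfolding sheafify_carrier
    proof (intro conjI ballI)
      show "restr ?S U V s \<in> extensional V" by (simp add: sheafify_simps)
      fix p assume p: "p \<in> V"
      then have "p \<in> U" using V by auto
      obtain W x where W: "openin X W" "p \<in> W" "W \<subseteq> U" "x \<in> carrier (sect F W)"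
        "\<And>q. q \<in> W \<Longrightarrow> s q = germ X F q W x" using sheafify_local[OF s \<open>p \<in> U\<close>] by metis
      have o: "openin X (W \<inter> V)" using V W by auto
      have "restr ?S U V s q = germ X F q (W \<inter> V) (restr F W (W \<inter> V) x)" if "q \<in> W \<inter> V" for q
        using that W o by (simp add: sheafify_simps germ_restr)
      then show "\<exists>W. openin X W \<and> p \<in> W \<and> W \<subseteq> V \<and>
          (\<exists>x\<in>carrier (sect F W). \<forall>q\<in>W. restr ?S U V s q = germ X F q W x)"
        using W o p by (intro exI[of _ "W \<inter> V"] conjI bexI ballI) auto
    qed
    show "restr ?S U V (s \<oplus>\<^bsub>sect ?S U\<^esub> t) = restr ?S U V s \<oplus>\<^bsub>sect ?S V\<^esub> restr ?S U V t" for t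
      using V by (intro ext) (auto simp: sheafify_simps restrict_def)
  next
    fix r s assume r: "r \<in> carrier (sect OX U)" and s: "s \<in> carrier (sect ?S U)"
    \<comment> \<open>Unlike addition, scalar multiplication refers to the open set over which the
      scalar lives. Both sides are therefore computed from a representative of \<open>s\<close> over
      a set contained in \<open>V\<close>.\<close>
    show "restr ?S U V (r \<odot>\<^bsub>sect ?S U\<^esub> s) = restr OX U V r \<odot>\<^bsub>sect ?S V\<^esub> restr ?S U V s"
    proof
      fix p
      show "restr ?S U V (r \<odot>\<^bsub>sect ?S U\<^esub> s) p = (restr OX U V r \<odot>\<^bsub>sect ?S V\<^esub> restr ?S U V s) p"
      proof (cases "p \<in> V")
        case True
        then have "p \<in> U" using V by auto
        obtain W x where W: "openin X W" "p \<in> W" "W \<subseteq> U" "x \<in> carrier (sect F W)"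
          "\<And>q. q \<in> W \<Longrightarrow> s q = germ X F q W x" using sheafify_local[OF s \<open>p \<in> U\<close>] by metis
        let ?W = "W \<inter> V"
        have o: "openin X ?W" "?W \<subseteq> U" "?W \<subseteq> V" using W V by auto
        have sp: "s p = germ X F p ?W (restr F W ?W x)" using W o True by (simp add: germ_restr)
        have "(r \<odot>\<^bsub>sect ?S U\<^esub> s) p = germ X F p ?W (restr OX U ?W r \<odot>\<^bsub>sect F ?W\<^esub> restr F W ?W x)"
          using sp True W o U r by (intro sheafify_smult_germ) auto
        moreover have "(restr OX U V r \<odot>\<^bsub>sect ?S V\<^esub> restr ?S U V s) p =
            germ X F p ?W (restr OX V ?W (restr OX U V r) \<odot>\<^bsub>sect F ?W\<^esub> restr F W ?W x)"
          using sp True W o U V r by (intro sheafify_smult_germ) (auto simp: sheafify_simps(2))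
        ultimately show ?thesis
          using True U V o r by (simp add: sheafify_simps(2))
      qed (simp add: sheafify_simps)
    qed
  qed
qed

lemma to_sheafify_closed [simp]:
  "openin X U \<Longrightarrow> x \<in> carrier (sect F U) \<Longrightarrow> to_sheafify X F U x \<in> carrier (sect (sheafify X OX F) U)"
  unfolding sheafify_carrier by (auto simp: to_sheafify_def)

lemma to_sheafify_restr:
  assumes "openin X U" "openin X V" "V \<subseteq> U" "x \<in> carrier (sect F U)"
  shows "restr (sheafify X OX F) U V (to_sheafify X F U x) = to_sheafify X F V (restr F U V x)"
  using assms by (intro ext) (auto simp: sheafify_simps(2) to_sheafify_def restrict_def germ_restr)

lemma to_sheafify_add:
  assumes "openin X U" "x \<in> carrier (sect F U)" "y \<in> carrier (sect F U)"
  shows "to_sheafify X F U (x \<oplus>\<^bsub>sect F U\<^esub> y) =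
    to_sheafify X F U x \<oplus>\<^bsub>sect (sheafify X OX F) U\<^esub> to_sheafify X F U y"
proof
  fix p
  show "to_sheafify X F U (x \<oplus>\<^bsub>sect F U\<^esub> y) p =
    (to_sheafify X F U x \<oplus>\<^bsub>sect (sheafify X OX F) U\<^esub> to_sheafify X F U y) p"
  proof (cases "p \<in> U")
    case True
    then show ?thesis
      using assms sheafify_add_germ[of p U U x y "to_sheafify X F U x" "to_sheafify X F U y"]
      by (simp add: to_sheafify_def)
  qed (simp add: to_sheafify_def sheafify_simps)
qed

lemma to_sheafify_smult:
  assumes "openin X U" "r \<in> carrier (sect OX U)" "x \<in> carrier (sect F U)"
  shows "to_sheafify X F U (r \<odot>\<^bsub>sect F U\<^esub> x) = r \<odot>\<^bsub>sect (sheafify X OX F) U\<^esub> to_sheafify X F U x"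
proof
  fix p
  show "to_sheafify X F U (r \<odot>\<^bsub>sect F U\<^esub> x) p = (r \<odot>\<^bsub>sect (sheafify X OX F) U\<^esub> to_sheafify X F U x) p"
  proof (cases "p \<in> U")
    case True
    then show ?thesis
      using assms sheafify_smult_germ[of U r U p x "to_sheafify X F U x"]
      by (simp add: to_sheafify_def)
  qed (simp add: to_sheafify_def sheafify_simps)
qed

text \<open>Sections of the presheaf need only have equal germs at common points in order to define
  a section of the sheafification: the glued section sends \<open>p\<close> to the common
  germ.\<close>

lemma sheafify_glue:
  assumes G: "\<And>V c. G V c \<Longrightarrow> openin X V \<and> V \<subseteq> U \<and> c \<in> carrier (sect F V)"
    and cover: "\<And>p. p \<in> U \<Longrightarrow> \<exists>V c. p \<in> V \<and> G V c"
    and compat: "\<And>p V c V' c'. G V c \<Longrightarrow> G V' c' \<Longrightarrow> p \<in> V \<Longrightarrow> p \<in> V' \<Longrightarrow> germ X F p V c = germ X F p V' c'"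
  shows "\<exists>!z. z \<in> carrier (sect (sheafify X OX F) U) \<and>
    (\<forall>V c. G V c \<longrightarrow> restr (sheafify X OX F) U V z = to_sheafify X F V c)"
proof (rule ex_ex1I)
  define z where "z = (\<lambda>p\<in>U. THE g. \<exists>V c. G V c \<and> p \<in> V \<and> g = germ X F p V c)"
  have z: "z p = germ X F p V c" if "G V c" "p \<in> V" for p V c
  proof -
    have "(THE g. \<exists>V c. G V c \<and> p \<in> V \<and> g = germ X F p V c) = germ X F p V c"
      using that compat by (intro the_equality) blast+
    then show ?thesis using G[OF that(1)] that(2) by (auto simp: z_def)
  qed
  have "z \<in> carrier (sect (sheafify X OX F) U)"
    unfolding sheafify_carrier
  proof (intro conjI ballI)
    fix p assume "p \<in> U"
    then obtain V c where V: "p \<in> V" "G V c" using cover by blast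
    then show "\<exists>V. openin X V \<and> p \<in> V \<and> V \<subseteq> U \<and> (\<exists>x\<in>carrier (sect F V). \<forall>q\<in>V. z q = germ X F q V x)"
      using G[OF V(2)] z[OF V(2)] by blast
  qed (simp add: z_def)
  moreover have "restr (sheafify X OX F) U V z = to_sheafify X F V c" if "G V c" for V c
    using z[OF that] by (intro ext) (auto simp: sheafify_simps(2) to_sheafify_def restrict_def)
  ultimately show "\<exists>z. z \<in> carrier (sect (sheafify X OX F) U) \<and>
    (\<forall>V c. G V c \<longrightarrow> restr (sheafify X OX F) U V z = to_sheafify X F V c)" by blast
next
  fix z z'
  assume z: "z \<in> carrier (sect (sheafify X OX F) U) \<and>
      (\<forall>V c. G V c \<longrightarrow> restr (sheafify X OX F) U V z = to_sheafify X F V c)"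
    and z': "z' \<in> carrier (sect (sheafify X OX F) U) \<and>
      (\<forall>V c. G V c \<longrightarrow> restr (sheafify X OX F) U V z' = to_sheafify X F V c)"
  show "z = z'"
  proof (rule extensionalityI)
    show "z \<in> extensional U" "z' \<in> extensional U" using z z' by (auto simp: sheafify_carrier)
    fix p assume "p \<in> U"
    then obtain V c where V: "p \<in> V" "G V c" using cover by blast
    have "restrict z V p = restrict z' V p"
      using z z' V(2) by (simp add: sheafify_simps(2))
    then show "z p = z' p" using V by simp
  qed
qed

end

section \<open>Free modules of rank two\<close>

lemma (in cring) mat_det_2:
  assumes a: "\<And>i j. i < 2 \<Longrightarrow> j < 2 \<Longrightarrow> a i j \<in> carrier R"
  shows "mat_det R 2 a = a 0 0 \<otimes> a 1 1 \<ominus> a 0 1 \<otimes> a 1 0"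
proof -
  have c: "a 0 0 \<in> carrier R" "a 0 1 \<in> carrier R" "a 1 0 \<in> carrier R" "a 1 1 \<in> carrier R"
    by (simp_all add: a)
  have two: "{..<2} = {0, 1::nat}" by auto
  have perms: "{\<sigma>. \<sigma> permutes {0, 1::nat}} = {id, Transposition.transpose 0 1}"
    by (auto simp: permutes_doubleton_iff)
  \<comment> \<open>The two permutations have to be distinct for the sum over them to have two
    terms.\<close>
  have ne: "id \<noteq> Transposition.transpose 0 (1::nat)"
    by (metis id_apply transpose_apply_first zero_neq_one)
  show ?thesis
    unfolding mat_det_def two perms
    using ne c by (simp add: evenperm_swap a_minus_def l_minus m_comm)
qed

lemma UP_coeff_eq: "p \<in> carrier (UP R) \<Longrightarrow> coeff (UP R) p = p"
  by (simp add: UP_def)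

text \<open>The determinant of \<open>X - a\<close> expands in the polynomial ring to
  \<open>X^2 - t X + d\<close>, whose coefficients are read off. The coefficient at 0 is what later
  turns pseudoregularity into an equality of determinants.\<close>

lemma (in cring) mat_charpoly_2:
  assumes a: "\<And>i j. i < 2 \<Longrightarrow> j < 2 \<Longrightarrow> a i j \<in> carrier R"
  shows "mat_charpoly R 2 a = (\<lambda>k. if k = 0 then a 0 0 \<otimes> a 1 1 \<ominus> a 0 1 \<otimes> a 1 0
    else if k = 1 then \<ominus> (a 0 0 \<oplus> a 1 1) else if k = 2 then \<one> else \<zero>)"
proof -
  interpret UP_cring R "UP R" by unfold_locales auto
  have c: "a 0 0 \<in> carrier R" "a 0 1 \<in> carrier R" "a 1 0 \<in> carrier R" "a 1 1 \<in> carrier R"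
    by (simp_all add: a)
  let ?P = "UP R"
  let ?x = "monom ?P \<one> 1"
  let ?m = "\<lambda>i j. monom ?P (a i j) 0"
  have m: "?x \<in> carrier ?P" "?m 0 0 \<in> carrier ?P" "?m 0 1 \<in> carrier ?P" "?m 1 0 \<in> carrier ?P" "?m 1 1 \<in> carrier ?P"
    using c by auto
  have "mat_charpoly R 2 a =
    (?x \<ominus>\<^bsub>?P\<^esub> ?m 0 0) \<otimes>\<^bsub>?P\<^esub> (?x \<ominus>\<^bsub>?P\<^esub> ?m 1 1) \<ominus>\<^bsub>?P\<^esub> (\<zero>\<^bsub>?P\<^esub> \<ominus>\<^bsub>?P\<^esub> ?m 0 1) \<otimes>\<^bsub>?P\<^esub> (\<zero>\<^bsub>?P\<^esub> \<ominus>\<^bsub>?P\<^esub> ?m 1 0)"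
    unfolding mat_charpoly_def using a by (subst P.mat_det_2) (auto simp: a_minus_def)
  also have "\<dots> = ?x \<otimes>\<^bsub>?P\<^esub> ?x \<ominus>\<^bsub>?P\<^esub> (?m 0 0 \<oplus>\<^bsub>?P\<^esub> ?m 1 1) \<otimes>\<^bsub>?P\<^esub> ?x
      \<oplus>\<^bsub>?P\<^esub> (?m 0 0 \<otimes>\<^bsub>?P\<^esub> ?m 1 1 \<ominus>\<^bsub>?P\<^esub> ?m 0 1 \<otimes>\<^bsub>?P\<^esub> ?m 1 0)"
    using m by algebra
  also have "\<dots> = monom ?P \<one> 2 \<ominus>\<^bsub>?P\<^esub> monom ?P (a 0 0 \<oplus> a 1 1) 1
      \<oplus>\<^bsub>?P\<^esub> monom ?P (a 0 0 \<otimes> a 1 1 \<ominus> a 0 1 \<otimes> a 1 0) 0"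
    using c by (simp add: P.l_distr monom_mult[symmetric] a_minus_def numeral_2_eq_2 del: monom_mult)
  finally have eq: "mat_charpoly R 2 a = \<dots>" .
  let ?q = "monom ?P \<one> 2 \<ominus>\<^bsub>?P\<^esub> monom ?P (a 0 0 \<oplus> a 1 1) 1
      \<oplus>\<^bsub>?P\<^esub> monom ?P (a 0 0 \<otimes> a 1 1 \<ominus> a 0 1 \<otimes> a 1 0) 0"
  have q: "?q \<in> carrier ?P" using c by simp
  have "coeff ?P ?q k = (if k = 0 then a 0 0 \<otimes> a 1 1 \<ominus> a 0 1 \<otimes> a 1 0
    else if k = 1 then \<ominus> (a 0 0 \<oplus> a 1 1) else if k = 2 then \<one> else \<zero>)" for k
    using c by (simp add: coeff_minus a_minus_def)
  then show ?thesis
    unfolding eq UP_coeff_eq[OF q] by (rule ext)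
qed

text \<open>A frame of length two with a pair of scalars in place of an extensional function on
  \<open>{..<2}\<close>, so that changes of coordinates become explicit identities in the
  ring.\<close>

definition basis2 :: "('r, 'z) ring_scheme \<Rightarrow> ('r, 'm, 'w) module_scheme \<Rightarrow> 'm \<Rightarrow> 'm \<Rightarrow> bool" where
  "basis2 R M u v \<longleftrightarrow> u \<in> carrier M \<and> v \<in> carrier M \<and>
     (\<forall>x\<in>carrier M. \<exists>a\<in>carrier R. \<exists>b\<in>carrier R. x = a \<odot>\<^bsub>M\<^esub> u \<oplus>\<^bsub>M\<^esub> b \<odot>\<^bsub>M\<^esub> v) \<and>
     (\<forall>a\<in>carrier R. \<forall>b\<in>carrier R. \<forall>a'\<in>carrier R. \<forall>b'\<in>carrier R.
        a \<odot>\<^bsub>M\<^esub> u \<oplus>\<^bsub>M\<^esub> b \<odot>\<^bsub>M\<^esub> v = a' \<odot>\<^bsub>M\<^esub> u \<oplus>\<^bsub>M\<^esub> b' \<odot>\<^bsub>M\<^esub> v \<longrightarrow> a = a' \<and> b = b')"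

context plain_module
begin

lemma finsum_2:
  assumes "f 0 \<in> carrier M" "f 1 \<in> carrier M"
  shows "(\<Oplus>\<^bsub>M\<^esub>i\<in>{..<2::nat}. f i) = f 0 \<oplus>\<^bsub>M\<^esub> f 1"
proof -
  have "{..<2} = {0, 1::nat}" by auto
  then show ?thesis using assms by simp
qed

lemma basis2_iff:
  assumes e: "e 0 \<in> carrier M" "e 1 \<in> carrier M"
  shows "(\<forall>x\<in>carrier M. \<exists>!c. c \<in> {..<2::nat} \<rightarrow>\<^sub>E carrier R \<and> x = (\<Oplus>\<^bsub>M\<^esub>i\<in>{..<2}. c i \<odot>\<^bsub>M\<^esub> e i))
    \<longleftrightarrow> basis2 R M (e 0) (e 1)" (is "?L \<longleftrightarrow> ?R")
proof -
  have two: "i < 2 \<longleftrightarrow> i = 0 \<or> i = 1" for i :: nat by (rule less_2_cases_iff[simplified One_nat_def[symmetric]])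
  have sum: "(\<Oplus>\<^bsub>M\<^esub>i\<in>{..<2}. c i \<odot>\<^bsub>M\<^esub> e i) = c 0 \<odot>\<^bsub>M\<^esub> e 0 \<oplus>\<^bsub>M\<^esub> c 1 \<odot>\<^bsub>M\<^esub> e 1"
    if "c \<in> {..<2::nat} \<rightarrow>\<^sub>E carrier R" for c
  proof -
    have "c 0 \<in> carrier R" "c 1 \<in> carrier R" using PiE_mem[OF that] by simp_all
    then show ?thesis using e by (intro finsum_2 smult_closed)
  qed
  define mk where "mk a b = (\<lambda>i\<in>{..<2::nat}. if i = 0 then a else b)" for a b :: 'r
  have mk: "mk a b \<in> {..<2} \<rightarrow>\<^sub>E carrier R" "mk a b 0 = a" "mk a b 1 = b"
    if "a \<in> carrier R" "b \<in> carrier R" for a b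
    using that by (simp_all add: mk_def)
  show ?thesis
  proof
    assume L: ?L
    show ?R
      unfolding basis2_def
    proof (intro conjI ballI impI)
      fix x assume "x \<in> carrier M"
      then obtain c where c: "c \<in> {..<2::nat} \<rightarrow>\<^sub>E carrier R" "x = (\<Oplus>\<^bsub>M\<^esub>i\<in>{..<2}. c i \<odot>\<^bsub>M\<^esub> e i)"
        using L by blast
      moreover have "c 0 \<in> carrier R" "c 1 \<in> carrier R" using PiE_mem[OF c(1)] by simp_all
      ultimately show "\<exists>a\<in>carrier R. \<exists>b\<in>carrier R. x = a \<odot>\<^bsub>M\<^esub> e 0 \<oplus>\<^bsub>M\<^esub> b \<odot>\<^bsub>M\<^esub> e 1"
        using sum by blast
    next
      fix a b a' b' assume ab: "a \<in> carrier R" "b \<in> carrier R" "a' \<in> carrier R" "b' \<in> carrier R"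
        and eq: "a \<odot>\<^bsub>M\<^esub> e 0 \<oplus>\<^bsub>M\<^esub> b \<odot>\<^bsub>M\<^esub> e 1 = a' \<odot>\<^bsub>M\<^esub> e 0 \<oplus>\<^bsub>M\<^esub> b' \<odot>\<^bsub>M\<^esub> e 1"
      let ?x = "a \<odot>\<^bsub>M\<^esub> e 0 \<oplus>\<^bsub>M\<^esub> b \<odot>\<^bsub>M\<^esub> e 1"
      have "?x \<in> carrier M" using e ab by simp
      then have "\<exists>!c. c \<in> {..<2::nat} \<rightarrow>\<^sub>E carrier R \<and> ?x = (\<Oplus>\<^bsub>M\<^esub>i\<in>{..<2}. c i \<odot>\<^bsub>M\<^esub> e i)" using L by blast
      moreover have "?x = (\<Oplus>\<^bsub>M\<^esub>i\<in>{..<2}. mk a b i \<odot>\<^bsub>M\<^esub> e i)" "?x = (\<Oplus>\<^bsub>M\<^esub>i\<in>{..<2}. mk a' b' i \<odot>\<^bsub>M\<^esub> e i)"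
        by (simp_all only: sum[OF mk(1)[OF ab(1,2)]] sum[OF mk(1)[OF ab(3,4)]] mk(2,3)[OF ab(1,2)] mk(2,3)[OF ab(3,4)] eq)
      ultimately have "mk a b = mk a' b'" using mk(1) ab by blast
      then show "a = a'" "b = b'" using mk(2,3) ab by metis+
    qed (use e in auto)
  next
    assume R: ?R
    show ?L
    proof (intro ballI ex_ex1I)
      fix x assume "x \<in> carrier M"
      then obtain a b where "a \<in> carrier R" "b \<in> carrier R" "x = a \<odot>\<^bsub>M\<^esub> e 0 \<oplus>\<^bsub>M\<^esub> b \<odot>\<^bsub>M\<^esub> e 1"
        using R unfolding basis2_def by blast
      then show "\<exists>c. c \<in> {..<2::nat} \<rightarrow>\<^sub>E carrier R \<and> x = (\<Oplus>\<^bsub>M\<^esub>i\<in>{..<2}. c i \<odot>\<^bsub>M\<^esub> e i)"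
        using mk by (intro exI[of _ "mk a b"]) (simp only: sum)
    next
      fix x c c' assume c: "c \<in> {..<2::nat} \<rightarrow>\<^sub>E carrier R \<and> x = (\<Oplus>\<^bsub>M\<^esub>i\<in>{..<2}. c i \<odot>\<^bsub>M\<^esub> e i)"
        "c' \<in> {..<2::nat} \<rightarrow>\<^sub>E carrier R \<and> x = (\<Oplus>\<^bsub>M\<^esub>i\<in>{..<2}. c' i \<odot>\<^bsub>M\<^esub> e i)"
      then have m: "c \<in> {..<2} \<rightarrow>\<^sub>E carrier R" "c' \<in> {..<2} \<rightarrow>\<^sub>E carrier R" by blast+
      then have cl: "c 0 \<in> carrier R" "c 1 \<in> carrier R" "c' 0 \<in> carrier R" "c' 1 \<in> carrier R"
        using PiE_mem[OF m(1)] PiE_mem[OF m(2)] by simp_all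
      have "c 0 \<odot>\<^bsub>M\<^esub> e 0 \<oplus>\<^bsub>M\<^esub> c 1 \<odot>\<^bsub>M\<^esub> e 1 = c' 0 \<odot>\<^bsub>M\<^esub> e 0 \<oplus>\<^bsub>M\<^esub> c' 1 \<odot>\<^bsub>M\<^esub> e 1"
        using c sum[OF m(1)] sum[OF m(2)] by simp
      with R cl have "c 0 = c' 0 \<and> c 1 = c' 1" unfolding basis2_def by blast
      then show "c = c'" using m by (intro PiE_ext[OF m]) (auto simp: two)
    qed
  qed
qed

lemma comb_comb:
  assumes "p \<in> carrier R" "q \<in> carrier R" "a \<in> carrier R" "b \<in> carrier R" "c \<in> carrier R" "d \<in> carrier R"
    and "u \<in> carrier M" "v \<in> carrier M"
  shows "p \<odot>\<^bsub>M\<^esub> (a \<odot>\<^bsub>M\<^esub> u \<oplus>\<^bsub>M\<^esub> b \<odot>\<^bsub>M\<^esub> v) \<oplus>\<^bsub>M\<^esub> q \<odot>\<^bsub>M\<^esub> (c \<odot>\<^bsub>M\<^esub> u \<oplus>\<^bsub>M\<^esub> d \<odot>\<^bsub>M\<^esub> v) =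
    (p \<otimes> a \<oplus> q \<otimes> c) \<odot>\<^bsub>M\<^esub> u \<oplus>\<^bsub>M\<^esub> (p \<otimes> b \<oplus> q \<otimes> d) \<odot>\<^bsub>M\<^esub> v"
  using assms by (simp add: smult_r_distr smult_l_distr smult_assoc1 M.a_ac)

lemma basis2_exists:
  "basis2 R M u v \<Longrightarrow> x \<in> carrier M \<Longrightarrow>
   \<exists>a\<in>carrier R. \<exists>b\<in>carrier R. x = a \<odot>\<^bsub>M\<^esub> u \<oplus>\<^bsub>M\<^esub> b \<odot>\<^bsub>M\<^esub> v"
  by (simp add: basis2_def)

lemma basis2_unique:
  "basis2 R M u v \<Longrightarrow> a \<odot>\<^bsub>M\<^esub> u \<oplus>\<^bsub>M\<^esub> b \<odot>\<^bsub>M\<^esub> v = a' \<odot>\<^bsub>M\<^esub> u \<oplus>\<^bsub>M\<^esub> b' \<odot>\<^bsub>M\<^esub> v \<Longrightarrow>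
   a \<in> carrier R \<Longrightarrow> b \<in> carrier R \<Longrightarrow> a' \<in> carrier R \<Longrightarrow> b' \<in> carrier R \<Longrightarrow> a = a' \<and> b = b'"
  unfolding basis2_def by blast

text \<open>\<delta> is an inverse of the determinant of the new pair. Cramer's rule gives the
  coordinates with respect to it, and the same formulas recover the coordinates from a combination,
  whence uniqueness.\<close>

lemma basis2_change:
  assumes b: "basis2 R M u v"
    and c: "p \<in> carrier R" "q \<in> carrier R" "r \<in> carrier R" "s \<in> carrier R" "\<delta> \<in> carrier R"
    and \<delta>: "\<delta> \<otimes> (p \<otimes> s \<ominus> q \<otimes> r) = \<one>"
  shows "basis2 R M (p \<odot>\<^bsub>M\<^esub> u \<oplus>\<^bsub>M\<^esub> q \<odot>\<^bsub>M\<^esub> v) (r \<odot>\<^bsub>M\<^esub> u \<oplus>\<^bsub>M\<^esub> s \<odot>\<^bsub>M\<^esub> v)" (is "basis2 R M ?u ?v")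
  unfolding basis2_def
proof (intro conjI ballI impI)
  have uv: "u \<in> carrier M" "v \<in> carrier M" using b by (auto simp: basis2_def)
  show "?u \<in> carrier M" "?v \<in> carrier M" using c uv by auto
  fix x assume x: "x \<in> carrier M"
  obtain a b where ab: "a \<in> carrier R" "b \<in> carrier R" "x = a \<odot>\<^bsub>M\<^esub> u \<oplus>\<^bsub>M\<^esub> b \<odot>\<^bsub>M\<^esub> v"
    using basis2_exists[OF b x] by blast
  let ?a = "\<delta> \<otimes> (a \<otimes> s \<ominus> b \<otimes> r)" and ?b = "\<delta> \<otimes> (b \<otimes> p \<ominus> a \<otimes> q)"
  have "?a \<otimes> p \<oplus> ?b \<otimes> r = a \<otimes> (\<delta> \<otimes> (p \<otimes> s \<ominus> q \<otimes> r))" using ab c by algebra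
  moreover have "?a \<otimes> q \<oplus> ?b \<otimes> s = b \<otimes> (\<delta> \<otimes> (p \<otimes> s \<ominus> q \<otimes> r))" using ab c by algebra
  ultimately have "x = ?a \<odot>\<^bsub>M\<^esub> ?u \<oplus>\<^bsub>M\<^esub> ?b \<odot>\<^bsub>M\<^esub> ?v"
    using ab c uv by (subst comb_comb) (simp_all add: \<delta>)
  then show "\<exists>a\<in>carrier R. \<exists>b\<in>carrier R. x = a \<odot>\<^bsub>M\<^esub> ?u \<oplus>\<^bsub>M\<^esub> b \<odot>\<^bsub>M\<^esub> ?v"
    using ab c by (intro bexI[of _ ?a] bexI[of _ ?b]) auto
next
  have uv: "u \<in> carrier M" "v \<in> carrier M" using b by (auto simp: basis2_def)
  fix a d a' d' assume ab: "a \<in> carrier R" "d \<in> carrier R" "a' \<in> carrier R" "d' \<in> carrier R"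
    and eq: "a \<odot>\<^bsub>M\<^esub> ?u \<oplus>\<^bsub>M\<^esub> d \<odot>\<^bsub>M\<^esub> ?v = a' \<odot>\<^bsub>M\<^esub> ?u \<oplus>\<^bsub>M\<^esub> d' \<odot>\<^bsub>M\<^esub> ?v"
  have "(a \<otimes> p \<oplus> d \<otimes> r) \<odot>\<^bsub>M\<^esub> u \<oplus>\<^bsub>M\<^esub> (a \<otimes> q \<oplus> d \<otimes> s) \<odot>\<^bsub>M\<^esub> v =
      (a' \<otimes> p \<oplus> d' \<otimes> r) \<odot>\<^bsub>M\<^esub> u \<oplus>\<^bsub>M\<^esub> (a' \<otimes> q \<oplus> d' \<otimes> s) \<odot>\<^bsub>M\<^esub> v"
    using eq ab c uv by (simp add: comb_comb)
  from basis2_unique[OF b this]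
  have *: "a \<otimes> p \<oplus> d \<otimes> r = a' \<otimes> p \<oplus> d' \<otimes> r" "a \<otimes> q \<oplus> d \<otimes> s = a' \<otimes> q \<oplus> d' \<otimes> s"
    using ab c by auto
  have 1: "(\<delta> \<otimes> (p \<otimes> s \<ominus> q \<otimes> r)) \<otimes> y = \<delta> \<otimes> ((y \<otimes> p \<oplus> z \<otimes> r) \<otimes> s \<ominus> (y \<otimes> q \<oplus> z \<otimes> s) \<otimes> r)"
    and 2: "(\<delta> \<otimes> (p \<otimes> s \<ominus> q \<otimes> r)) \<otimes> z = \<delta> \<otimes> ((y \<otimes> q \<oplus> z \<otimes> s) \<otimes> p \<ominus> (y \<otimes> p \<oplus> z \<otimes> r) \<otimes> q)"
    if "y \<in> carrier R" "z \<in> carrier R" for y z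
    using that c by algebra+
  show "a = a'" using 1[OF ab(1,2)] 1[OF ab(3,4)] * ab by (simp add: \<delta>)
  show "d = d'" using 2[OF ab(1,2)] 2[OF ab(3,4)] * ab by (simp add: \<delta>)
qed

text \<open>Conjugation invariance of trace and determinant. Writing \<open>f u'\<close> and
  \<open>f v'\<close> in the basis \<open>u, v\<close> in two ways equates two products of matrices;
  the base change determinant \<open>?D\<close> times either invariant is a polynomial in the
  entries of such a product, and \<open>?D\<close> can be cancelled.\<close>

lemma basis2_invariants:
  assumes b: "basis2 R M u v" and b': "basis2 R M u' v'"
    and f: "semilinear R (\<lambda>r. r) M M f"
    and c: "a \<in> carrier R" "b \<in> carrier R" "c \<in> carrier R" "d \<in> carrier R"
    and c': "a' \<in> carrier R" "b' \<in> carrier R" "c' \<in> carrier R" "d' \<in> carrier R"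
    and fu: "f u = a \<odot>\<^bsub>M\<^esub> u \<oplus>\<^bsub>M\<^esub> c \<odot>\<^bsub>M\<^esub> v" "f v = b \<odot>\<^bsub>M\<^esub> u \<oplus>\<^bsub>M\<^esub> d \<odot>\<^bsub>M\<^esub> v"
    and fu': "f u' = a' \<odot>\<^bsub>M\<^esub> u' \<oplus>\<^bsub>M\<^esub> c' \<odot>\<^bsub>M\<^esub> v'" "f v' = b' \<odot>\<^bsub>M\<^esub> u' \<oplus>\<^bsub>M\<^esub> d' \<odot>\<^bsub>M\<^esub> v'"
  shows "a \<oplus> d = a' \<oplus> d'" "a \<otimes> d \<ominus> b \<otimes> c = a' \<otimes> d' \<ominus> b' \<otimes> c'"
proof -
  have uv: "u \<in> carrier M" "v \<in> carrier M" using b by (auto simp: basis2_def)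
  have uv': "u' \<in> carrier M" "v' \<in> carrier M" using b' by (auto simp: basis2_def)
  obtain p q where p: "p \<in> carrier R" "q \<in> carrier R" "u' = p \<odot>\<^bsub>M\<^esub> u \<oplus>\<^bsub>M\<^esub> q \<odot>\<^bsub>M\<^esub> v"
    using basis2_exists[OF b uv'(1)] by blast
  obtain r s where r: "r \<in> carrier R" "s \<in> carrier R" "v' = r \<odot>\<^bsub>M\<^esub> u \<oplus>\<^bsub>M\<^esub> s \<odot>\<^bsub>M\<^esub> v"
    using basis2_exists[OF b uv'(2)] by blast
  obtain p' q' where p': "p' \<in> carrier R" "q' \<in> carrier R" "u = p' \<odot>\<^bsub>M\<^esub> u' \<oplus>\<^bsub>M\<^esub> q' \<odot>\<^bsub>M\<^esub> v'"
    using basis2_exists[OF b' uv(1)] by blast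
  obtain r' s' where r': "r' \<in> carrier R" "s' \<in> carrier R" "v = r' \<odot>\<^bsub>M\<^esub> u' \<oplus>\<^bsub>M\<^esub> s' \<odot>\<^bsub>M\<^esub> v'"
    using basis2_exists[OF b' uv(2)] by blast
  have "\<one> \<odot>\<^bsub>M\<^esub> u \<oplus>\<^bsub>M\<^esub> \<zero> \<odot>\<^bsub>M\<^esub> v = (p' \<otimes> p \<oplus> q' \<otimes> r) \<odot>\<^bsub>M\<^esub> u \<oplus>\<^bsub>M\<^esub> (p' \<otimes> q \<oplus> q' \<otimes> s) \<odot>\<^bsub>M\<^esub> v"
  proof -
    have "u = p' \<odot>\<^bsub>M\<^esub> (p \<odot>\<^bsub>M\<^esub> u \<oplus>\<^bsub>M\<^esub> q \<odot>\<^bsub>M\<^esub> v) \<oplus>\<^bsub>M\<^esub> q' \<odot>\<^bsub>M\<^esub> (r \<odot>\<^bsub>M\<^esub> u \<oplus>\<^bsub>M\<^esub> s \<odot>\<^bsub>M\<^esub> v)"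
      unfolding p(3)[symmetric] r(3)[symmetric] by (rule p'(3))
    also have "\<dots> = (p' \<otimes> p \<oplus> q' \<otimes> r) \<odot>\<^bsub>M\<^esub> u \<oplus>\<^bsub>M\<^esub> (p' \<otimes> q \<oplus> q' \<otimes> s) \<odot>\<^bsub>M\<^esub> v"
      using comb_comb p(1,2) r(1,2) p'(1,2) uv by blast
    finally show ?thesis using uv by simp
  qed
  then have i1: "\<one> = p' \<otimes> p \<oplus> q' \<otimes> r \<and> \<zero> = p' \<otimes> q \<oplus> q' \<otimes> s"
    using basis2_unique[OF b] p(1,2) r(1,2) p'(1,2) by blast
  have "\<zero> \<odot>\<^bsub>M\<^esub> u \<oplus>\<^bsub>M\<^esub> \<one> \<odot>\<^bsub>M\<^esub> v = (r' \<otimes> p \<oplus> s' \<otimes> r) \<odot>\<^bsub>M\<^esub> u \<oplus>\<^bsub>M\<^esub> (r' \<otimes> q \<oplus> s' \<otimes> s) \<odot>\<^bsub>M\<^esub> v"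
  proof -
    have "v = r' \<odot>\<^bsub>M\<^esub> (p \<odot>\<^bsub>M\<^esub> u \<oplus>\<^bsub>M\<^esub> q \<odot>\<^bsub>M\<^esub> v) \<oplus>\<^bsub>M\<^esub> s' \<odot>\<^bsub>M\<^esub> (r \<odot>\<^bsub>M\<^esub> u \<oplus>\<^bsub>M\<^esub> s \<odot>\<^bsub>M\<^esub> v)"
      unfolding p(3)[symmetric] r(3)[symmetric] by (rule r'(3))
    also have "\<dots> = (r' \<otimes> p \<oplus> s' \<otimes> r) \<odot>\<^bsub>M\<^esub> u \<oplus>\<^bsub>M\<^esub> (r' \<otimes> q \<oplus> s' \<otimes> s) \<odot>\<^bsub>M\<^esub> v"
      using comb_comb p(1,2) r(1,2) r'(1,2) uv by blast
    finally show ?thesis using uv by simp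
  qed
  then have i2: "\<zero> = r' \<otimes> p \<oplus> s' \<otimes> r \<and> \<one> = r' \<otimes> q \<oplus> s' \<otimes> s"
    using basis2_unique[OF b] p(1,2) r(1,2) r'(1,2) by blast
  let ?D = "p \<otimes> s \<ominus> q \<otimes> r" and ?D' = "p' \<otimes> s' \<ominus> q' \<otimes> r'"
  \<comment> \<open>Multiplicativity of the determinant for the two base changes, whose product is
    the identity matrix by \<open>i1\<close> and \<open>i2\<close>.\<close>
  have "?D' \<otimes> ?D = (p' \<otimes> p \<oplus> q' \<otimes> r) \<otimes> (r' \<otimes> q \<oplus> s' \<otimes> s) \<ominus> (p' \<otimes> q \<oplus> q' \<otimes> s) \<otimes> (r' \<otimes> p \<oplus> s' \<otimes> r)"
    using p(1,2) r(1,2) p'(1,2) r'(1,2) by algebra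
  also have "\<dots> = \<one>" 
    unfolding i1[THEN conjunct1, symmetric] i1[THEN conjunct2, symmetric]
      i2[THEN conjunct1, symmetric] i2[THEN conjunct2, symmetric] by (simp add: a_minus_def)
  finally have D: "?D' \<otimes> ?D = \<one>" .
  have cl: "?D \<in> carrier R" "?D' \<in> carrier R" using p(1,2) r(1,2) p'(1,2) r'(1,2) by auto
  have cancel: "y = z" if "?D \<otimes> y = ?D \<otimes> z" "y \<in> carrier R" "z \<in> carrier R" for y z
  proof -
    have "(?D' \<otimes> ?D) \<otimes> y = (?D' \<otimes> ?D) \<otimes> z"
      using that cl by (simp add: m_assoc)
    then show ?thesis using that by (simp add: D)
  qed
  have "f u' = p \<odot>\<^bsub>M\<^esub> f u \<oplus>\<^bsub>M\<^esub> q \<odot>\<^bsub>M\<^esub> f v"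
    unfolding p(3) using p(1,2) uv by (simp add: semilinearD(2,3)[OF f])
  then have "p \<odot>\<^bsub>M\<^esub> f u \<oplus>\<^bsub>M\<^esub> q \<odot>\<^bsub>M\<^esub> f v = a' \<odot>\<^bsub>M\<^esub> u' \<oplus>\<^bsub>M\<^esub> c' \<odot>\<^bsub>M\<^esub> v'"
    unfolding fu'(1)[symmetric] by (rule sym)
  then have e1: "(p \<otimes> a \<oplus> q \<otimes> b) \<odot>\<^bsub>M\<^esub> u \<oplus>\<^bsub>M\<^esub> (p \<otimes> c \<oplus> q \<otimes> d) \<odot>\<^bsub>M\<^esub> v =
      (a' \<otimes> p \<oplus> c' \<otimes> r) \<odot>\<^bsub>M\<^esub> u \<oplus>\<^bsub>M\<^esub> (a' \<otimes> q \<oplus> c' \<otimes> s) \<odot>\<^bsub>M\<^esub> v"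
    unfolding fu p(3) r(3) using p(1,2) r(1,2) c c' uv by (simp add: comb_comb)
  then have e1: "p \<otimes> a \<oplus> q \<otimes> b = a' \<otimes> p \<oplus> c' \<otimes> r" "p \<otimes> c \<oplus> q \<otimes> d = a' \<otimes> q \<oplus> c' \<otimes> s"
    using basis2_unique[OF b e1] p(1,2) r(1,2) c c' by auto
  have "f v' = r \<odot>\<^bsub>M\<^esub> f u \<oplus>\<^bsub>M\<^esub> s \<odot>\<^bsub>M\<^esub> f v"
    unfolding r(3) using r(1,2) uv by (simp add: semilinearD(2,3)[OF f])
  then have "r \<odot>\<^bsub>M\<^esub> f u \<oplus>\<^bsub>M\<^esub> s \<odot>\<^bsub>M\<^esub> f v = b' \<odot>\<^bsub>M\<^esub> u' \<oplus>\<^bsub>M\<^esub> d' \<odot>\<^bsub>M\<^esub> v'"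
    unfolding fu'(2)[symmetric] by (rule sym)
  then have e2: "(r \<otimes> a \<oplus> s \<otimes> b) \<odot>\<^bsub>M\<^esub> u \<oplus>\<^bsub>M\<^esub> (r \<otimes> c \<oplus> s \<otimes> d) \<odot>\<^bsub>M\<^esub> v =
      (b' \<otimes> p \<oplus> d' \<otimes> r) \<odot>\<^bsub>M\<^esub> u \<oplus>\<^bsub>M\<^esub> (b' \<otimes> q \<oplus> d' \<otimes> s) \<odot>\<^bsub>M\<^esub> v"
    unfolding fu p(3) r(3) using p(1,2) r(1,2) c c' uv by (simp add: comb_comb)
  then have e2: "r \<otimes> a \<oplus> s \<otimes> b = b' \<otimes> p \<oplus> d' \<otimes> r" "r \<otimes> c \<oplus> s \<otimes> d = b' \<otimes> q \<oplus> d' \<otimes> s"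
    using basis2_unique[OF b e2] p(1,2) r(1,2) c c' by auto
  \<comment> \<open>With \<open>P = ((p, q), (r, s))\<close> and \<open>B = ((a, c), (b, d))\<close>
    acting on rows of coordinates, this is the trace of \<open>P B adj(P)\<close>. The entries of
    \<open>P B\<close> are then replaced by means of \<open>e1\<close> and
    \<open>e2\<close>.\<close>
  have "?D \<otimes> (a \<oplus> d) = (p \<otimes> a \<oplus> q \<otimes> b) \<otimes> s \<ominus> (r \<otimes> a \<oplus> s \<otimes> b) \<otimes> q
      \<oplus> ((r \<otimes> c \<oplus> s \<otimes> d) \<otimes> p \<ominus> (p \<otimes> c \<oplus> q \<otimes> d) \<otimes> r)"
    using p(1,2) r(1,2) c by algebra
  also have "\<dots> = ?D \<otimes> (a' \<oplus> d')"
    unfolding e1 e2 using p(1,2) r(1,2) c' by algebra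
  finally show "a \<oplus> d = a' \<oplus> d'" by (rule cancel) (use c c' in auto)
  have "?D \<otimes> (a \<otimes> d \<ominus> b \<otimes> c) = (p \<otimes> a \<oplus> q \<otimes> b) \<otimes> (r \<otimes> c \<oplus> s \<otimes> d) \<ominus> (r \<otimes> a \<oplus> s \<otimes> b) \<otimes> (p \<otimes> c \<oplus> q \<otimes> d)"
    using p(1,2) r(1,2) c by algebra
  also have "\<dots> = ?D \<otimes> (a' \<otimes> d' \<ominus> b' \<otimes> c')"
    unfolding e1 e2 using p(1,2) r(1,2) c' by algebra
  finally show "a \<otimes> d \<ominus> b \<otimes> c = a' \<otimes> d' \<ominus> b' \<otimes> c'" by (rule cancel) (use c c' in auto)
qed

lemma is_matrix_of_2:
  assumes "e 0 \<in> carrier M" "e 1 \<in> carrier M"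
  shows "(\<forall>i<2. \<forall>j<2. a i j \<in> carrier R) \<and>
     (\<forall>j<2. f (e j) = (\<Oplus>\<^bsub>M\<^esub>i\<in>{..<2::nat}. a i j \<odot>\<^bsub>M\<^esub> e i)) \<longleftrightarrow>
     a 0 0 \<in> carrier R \<and> a 0 1 \<in> carrier R \<and> a 1 0 \<in> carrier R \<and> a 1 1 \<in> carrier R \<and>
     f (e 0) = a 0 0 \<odot>\<^bsub>M\<^esub> e 0 \<oplus>\<^bsub>M\<^esub> a 1 0 \<odot>\<^bsub>M\<^esub> e 1 \<and> f (e 1) = a 0 1 \<odot>\<^bsub>M\<^esub> e 0 \<oplus>\<^bsub>M\<^esub> a 1 1 \<odot>\<^bsub>M\<^esub> e 1"
proof -
  have two: "(\<forall>i<2. P i) \<longleftrightarrow> P 0 \<and> P 1" for P :: "nat \<Rightarrow> bool"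
    by (auto simp: less_2_cases_iff)
  show ?thesis
    unfolding two using assms by (auto simp: finsum_2)
qed

end

section \<open>Determinants and characteristic polynomials of endomorphisms\<close>

context plain_module
begin

lemma is_matrix_of_iff:
  assumes "e 0 \<in> carrier M" "e 1 \<in> carrier M"
  shows "is_matrix_of R M 2 e f a \<longleftrightarrow>
     a 0 0 \<in> carrier R \<and> a 0 1 \<in> carrier R \<and> a 1 0 \<in> carrier R \<and> a 1 1 \<in> carrier R \<and>
     f (e 0) = a 0 0 \<odot>\<^bsub>M\<^esub> e 0 \<oplus>\<^bsub>M\<^esub> a 1 0 \<odot>\<^bsub>M\<^esub> e 1 \<and> f (e 1) = a 0 1 \<odot>\<^bsub>M\<^esub> e 0 \<oplus>\<^bsub>M\<^esub> a 1 1 \<odot>\<^bsub>M\<^esub> e 1"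
  unfolding is_matrix_of_def by (rule is_matrix_of_2[OF assms])

lemma is_matrix_of_exists:
  assumes b: "basis2 R M (e 0) (e 1)" and f: "f (e 0) \<in> carrier M" "f (e 1) \<in> carrier M"
  shows "\<exists>a. is_matrix_of R M 2 e f a"
proof -
  have e: "e 0 \<in> carrier M" "e 1 \<in> carrier M" using b by (auto simp: basis2_def)
  obtain a c where a: "a \<in> carrier R" "c \<in> carrier R" "f (e 0) = a \<odot>\<^bsub>M\<^esub> e 0 \<oplus>\<^bsub>M\<^esub> c \<odot>\<^bsub>M\<^esub> e 1"
    using basis2_exists[OF b f(1)] by blast
  obtain b d where b: "b \<in> carrier R" "d \<in> carrier R" "f (e 1) = b \<odot>\<^bsub>M\<^esub> e 0 \<oplus>\<^bsub>M\<^esub> d \<odot>\<^bsub>M\<^esub> e 1"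
    using basis2_exists[OF b f(2)] by blast
  show ?thesis
    unfolding is_matrix_of_iff[OF e] using a b
    by (intro exI[of _ "\<lambda>i j. if i = 0 then if j = 0 then a else b else if j = 0 then c else d"]) simp
qed

lemma matrix_invariants:
  assumes b: "basis2 R M (e 0) (e 1)" "basis2 R M (e' 0) (e' 1)"
    and f: "semilinear R (\<lambda>r. r) M M f"
    and a: "is_matrix_of R M 2 e f a" "is_matrix_of R M 2 e' f a'"
  shows "a 0 0 \<oplus>\<^bsub>R\<^esub> a 1 1 = a' 0 0 \<oplus>\<^bsub>R\<^esub> a' 1 1"
    and "a 0 0 \<otimes>\<^bsub>R\<^esub> a 1 1 \<ominus>\<^bsub>R\<^esub> a 0 1 \<otimes>\<^bsub>R\<^esub> a 1 0 = a' 0 0 \<otimes>\<^bsub>R\<^esub> a' 1 1 \<ominus>\<^bsub>R\<^esub> a' 0 1 \<otimes>\<^bsub>R\<^esub> a' 1 0"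
proof -
  have e: "e 0 \<in> carrier M" "e 1 \<in> carrier M" "e' 0 \<in> carrier M" "e' 1 \<in> carrier M"
    using b by (auto simp: basis2_def)
  note a' = a[unfolded is_matrix_of_iff[OF e(1,2)] is_matrix_of_iff[OF e(3,4)]]
  show "a 0 0 \<oplus>\<^bsub>R\<^esub> a 1 1 = a' 0 0 \<oplus>\<^bsub>R\<^esub> a' 1 1"
    by (rule basis2_invariants(1)[OF b f, of _ "a 0 1" "a 1 0" _ _ "a' 0 1" "a' 1 0"]) (use a' in blast)+
  show "a 0 0 \<otimes>\<^bsub>R\<^esub> a 1 1 \<ominus>\<^bsub>R\<^esub> a 0 1 \<otimes>\<^bsub>R\<^esub> a 1 0 = a' 0 0 \<otimes>\<^bsub>R\<^esub> a' 1 1 \<ominus>\<^bsub>R\<^esub> a' 0 1 \<otimes>\<^bsub>R\<^esub> a' 1 0"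
    by (rule basis2_invariants(2)[OF b f]) (use a' in blast)+
qed

end

section \<open>Frames of length two and their restriction\<close>

context modular_presheaf
begin

lemma frame_on_iff:
  "frame_on X OX F 2 U e \<longleftrightarrow> openin X U \<and> e 0 \<in> carrier (sect F U) \<and> e 1 \<in> carrier (sect F U) \<and>
     (\<forall>V. openin X V \<and> V \<subseteq> U \<longrightarrow> basis2 (sect OX V) (sect F V) (restr F U V (e 0)) (restr F U V (e 1)))"
proof -
  have two: "(\<forall>i<2. e i \<in> carrier (sect F U)) \<longleftrightarrow> e 0 \<in> carrier (sect F U) \<and> e 1 \<in> carrier (sect F U)"
    by (auto simp: less_2_cases_iff)
  have "(\<forall>x\<in>carrier (sect F V). \<exists>!c. c \<in> {..<2} \<rightarrow>\<^sub>E carrier (sect OX V) \<and>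
           x = (\<Oplus>\<^bsub>sect F V\<^esub>i\<in>{..<2}. c i \<odot>\<^bsub>sect F V\<^esub> restr F U V (e i))) \<longleftrightarrow>
      basis2 (sect OX V) (sect F V) (restr F U V (e 0)) (restr F U V (e 1))"
    if "openin X U" "e 0 \<in> carrier (sect F U)" "e 1 \<in> carrier (sect F U)" "openin X V" "V \<subseteq> U" for V
    using that by (intro plain_module.basis2_iff[OF sect_plain]) auto
  then show ?thesis
    unfolding frame_on_def two conj_assoc
    by (intro conj_cong refl all_cong1 imp_cong) (erule conjE, assumption)
qed

lemma frame_onD:
  assumes "frame_on X OX F 2 U e"
  shows "openin X U" "e 0 \<in> carrier (sect F U)" "e 1 \<in> carrier (sect F U)"
    "basis2 (sect OX U) (sect F U) (e 0) (e 1)"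
  using assms unfolding frame_on_iff by (auto dest!: spec[of _ U])

lemma frame_on_restrict:
  assumes "frame_on X OX F 2 U e" "openin X W" "W \<subseteq> U"
  shows "frame_on X OX F 2 W (\<lambda>i. restr F U W (e i))"
proof -
  note e = frame_onD[OF assms(1)]
  have "basis2 (sect OX V) (sect F V) (restr F W V (restr F U W (e 0))) (restr F W V (restr F U W (e 1)))"
    if "openin X V" "V \<subseteq> W" for V
    using assms that e unfolding frame_on_iff by (subst (1 2) restr_restr) auto
  then show ?thesis using assms e unfolding frame_on_iff by auto
qed

lemma restr_comb:
  assumes "openin X U" "openin X V" "V \<subseteq> U" "a \<in> carrier (sect OX U)" "b \<in> carrier (sect OX U)"
    "u \<in> carrier (sect F U)" "v \<in> carrier (sect F U)"
  shows "restr F U V (a \<odot>\<^bsub>sect F U\<^esub> u \<oplus>\<^bsub>sect F U\<^esub> b \<odot>\<^bsub>sect F U\<^esub> v) =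
    restr OX U V a \<odot>\<^bsub>sect F V\<^esub> restr F U V u \<oplus>\<^bsub>sect F V\<^esub> restr OX U V b \<odot>\<^bsub>sect F V\<^esub> restr F U V v"
  using assms by (simp add: restr_add restr_smult)

end

locale rank_two = modular_presheaf +
  assumes frames: "p \<in> topspace X \<Longrightarrow> \<exists>U e. p \<in> U \<and> frame_on X OX F 2 U e"
begin

lemma frame_near:
  assumes "openin X U" "p \<in> U"
  shows "\<exists>V e. p \<in> V \<and> V \<subseteq> U \<and> frame_on X OX F 2 V e"
proof -
  have "p \<in> topspace X" using assms openin_subset by blast
  then obtain W e where "p \<in> W" "frame_on X OX F 2 W e" using frames by blast
  then show ?thesis
    using frame_on_restrict[of W e "U \<inter> W"] frame_onD(1)[of W e] assms by (metis IntI inf_le1 inf_le2 openin_Int)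
qed

end

lemma locally_free_rank_two:
  "ringed_space X OX \<Longrightarrow> locally_free X OX F 2 \<Longrightarrow> rank_two X OX F"
  by (auto simp: locally_free_def rank_two_def rank_two_axioms_def intro: module_sheaf_modular)

section \<open>Gluing the invariants of an endomorphism over an open set\<close>

locale rank_two_endo = rank_two +
  fixes U f
  assumes U: "openin X U"
    and f_semilinear: "openin X V \<Longrightarrow> V \<subseteq> U \<Longrightarrow> semilinear (sect OX V) (\<lambda>r. r) (sect F V) (sect F V) (f V)"
    and f_restr: "openin X V \<Longrightarrow> openin X W \<Longrightarrow> W \<subseteq> V \<Longrightarrow> V \<subseteq> U \<Longrightarrow> x \<in> carrier (sect F V) \<Longrightarrow>
      restr F V W (f V x) = f W (restr F V W x)"
begin

text \<open>Exactly the condition over which \<open>endo_det\<close> and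
  \<open>endo_charpoly\<close> quantify, so that both descriptions unfold to statements about
  it.\<close>

definition framed_matrix where
  "framed_matrix V e a \<longleftrightarrow> V \<subseteq> U \<and> frame_on X OX F 2 V e \<and> is_matrix_of (sect OX V) (sect F V) 2 e (f V) a"

lemma framed_matrixD:
  assumes "framed_matrix V e a"
  shows "V \<subseteq> U" "frame_on X OX F 2 V e" "is_matrix_of (sect OX V) (sect F V) 2 e (f V) a"
    "openin X V" "i < 2 \<Longrightarrow> j < 2 \<Longrightarrow> a i j \<in> carrier (sect OX V)"
  using assms frame_onD[of V e] by (auto simp: framed_matrix_def is_matrix_of_def)

lemma framed_matrix_near:
  assumes "p \<in> U" shows "\<exists>V e a. p \<in> V \<and> framed_matrix V e a"
proof -
  obtain V e where V: "p \<in> V" "V \<subseteq> U" "frame_on X OX F 2 V e" using frame_near[OF U assms] by blast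
  note e = frame_onD[OF V(3)]
  have "\<exists>a. is_matrix_of (sect OX V) (sect F V) 2 e (f V) a"
    using e V f_semilinear
    by (intro plain_module.is_matrix_of_exists[OF sect_plain]) (auto intro: semilinearD(1))
  then show ?thesis using V by (auto simp: framed_matrix_def)
qed

lemma framed_matrix_restrict:
  assumes "framed_matrix V e a" "openin X W" "W \<subseteq> V"
  shows "framed_matrix W (\<lambda>i. restr F V W (e i)) (\<lambda>i j. restr OX V W (a i j))"
proof -
  note m = framed_matrixD[OF assms(1)]
  note e = frame_onD[OF m(2)]
  note a = m(3)[unfolded plain_module.is_matrix_of_iff[OF sect_plain[OF e(1)] e(2,3)]]
  have "f W (restr F V W (e i)) = restr F V W (f V (e i))" if "i = 0 \<or> i = 1" for i
    using that e m assms by (auto simp: f_restr)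
  then have "is_matrix_of (sect OX W) (sect F W) 2 (\<lambda>i. restr F V W (e i)) (f W) (\<lambda>i j. restr OX V W (a i j))"
    using e a assms by (subst plain_module.is_matrix_of_iff[OF sect_plain]) (auto simp: restr_comb)
  then show ?thesis
    using frame_on_restrict[OF m(2) assms(2,3)] m assms by (auto simp: framed_matrix_def)
qed

lemma framed_matrix_invariants:
  assumes "framed_matrix V e a" "framed_matrix V e' a'"
  shows "a 0 0 \<oplus>\<^bsub>sect OX V\<^esub> a 1 1 = a' 0 0 \<oplus>\<^bsub>sect OX V\<^esub> a' 1 1"
    and "mat_det (sect OX V) 2 a = mat_det (sect OX V) 2 a'"
proof -
  note m = framed_matrixD[OF assms(1)] and m' = framed_matrixD[OF assms(2)]
  note inv = plain_module.matrix_invariants[OF sect_plain[OF m(4)] frame_onD(4)[OF m(2)] frame_onD(4)[OF m'(2)]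
      f_semilinear[OF m(4,1)] m(3) m'(3)]
  show "a 0 0 \<oplus>\<^bsub>sect OX V\<^esub> a 1 1 = a' 0 0 \<oplus>\<^bsub>sect OX V\<^esub> a' 1 1" by (rule inv(1))
  show "mat_det (sect OX V) 2 a = mat_det (sect OX V) 2 a'"
    using inv(2) m(5) m'(5) by (simp add: cring.mat_det_2[OF base_cring[OF m(4)]])
qed

text \<open>Applied with \<phi> the determinant and with \<phi> the trace. Independence of the frame
  is what makes the local value unique in \<open>restr_glue\<close>.\<close>

lemma invariant_glue:
  assumes closed: "\<And>V e a. framed_matrix V e a \<Longrightarrow> \<phi> V a \<in> carrier (sect OX V)"
    and restr: "\<And>V W e a. framed_matrix V e a \<Longrightarrow> openin X W \<Longrightarrow> W \<subseteq> V \<Longrightarrow>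
      restr OX V W (\<phi> V a) = \<phi> W (\<lambda>i j. restr OX V W (a i j))"
    and indep: "\<And>V e a e' a'. framed_matrix V e a \<Longrightarrow> framed_matrix V e' a' \<Longrightarrow> \<phi> V a = \<phi> V a'"
  shows "\<exists>!d. d \<in> carrier (sect OX U) \<and> (\<forall>V e a. framed_matrix V e a \<longrightarrow> restr OX U V d = \<phi> V a)"
proof -
  let ?G = "\<lambda>V c. \<exists>e a. framed_matrix V e a \<and> c = \<phi> V a"
  have "\<exists>!d. d \<in> carrier (sect OX U) \<and> (\<forall>V c. ?G V c \<longrightarrow> restr OX U V d = c)"
  proof (rule restr_glue[OF U])
    fix V c assume "?G V c"
    then show "openin X V \<and> V \<subseteq> U \<and> c \<in> carrier (sect OX V)"
      using framed_matrixD(1,4) closed by blast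
  next
    fix p assume "p \<in> U"
    then show "\<exists>V c. p \<in> V \<and> ?G V c" using framed_matrix_near by meson
  next
    fix V W c assume "?G V c" "openin X W" "W \<subseteq> V"
    then show "?G W (restr OX V W c)" using framed_matrix_restrict restr by meson
  next
    fix V c c' assume "?G V c" "?G V c'" then show "c = c'" using indep by blast
  qed
  moreover have "(\<forall>V c. ?G V c \<longrightarrow> restr OX U V d = c) \<longleftrightarrow>
      (\<forall>V e a. framed_matrix V e a \<longrightarrow> restr OX U V d = \<phi> V a)" for d by blast
  ultimately show ?thesis by simp
qed

lemma det_restr:
  assumes "framed_matrix V e a" "openin X W" "W \<subseteq> V"
  shows "restr OX V W (mat_det (sect OX V) 2 a) = mat_det (sect OX W) 2 (\<lambda>i j. restr OX V W (a i j))"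
proof -
  note m = framed_matrixD[OF assms(1)]
  interpret h: ring_hom_cring "sect OX V" "sect OX W" "restr OX V W"
    using m assms by (intro base_hom_cring) auto
  show ?thesis using m(5) by (simp add: h.R.mat_det_2 h.S.mat_det_2 a_minus_def)
qed

lemma det_closed: "framed_matrix V e a \<Longrightarrow> mat_det (sect OX V) 2 a \<in> carrier (sect OX V)"
  using framed_matrixD(4,5)[of V e a] base_cring[of V]
  by (simp add: cring.mat_det_2 ring.ring_simprules cring.axioms)

lemma endo_det:
  shows endo_det_closed: "endo_det X OX F 2 U f \<in> carrier (sect OX U)"
    and endo_det_restr: "framed_matrix V e a \<Longrightarrow> restr OX U V (endo_det X OX F 2 U f) = mat_det (sect OX V) 2 a"
proof -
  have "\<exists>!d. d \<in> carrier (sect OX U) \<and> (\<forall>V e a. framed_matrix V e a \<longrightarrow> restr OX U V d = mat_det (sect OX V) 2 a)"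
    by (rule invariant_glue[OF det_closed det_restr framed_matrix_invariants(2)])
  from theI'[OF this]
  have "endo_det X OX F 2 U f \<in> carrier (sect OX U) \<and>
    (\<forall>V e a. framed_matrix V e a \<longrightarrow> restr OX U V (endo_det X OX F 2 U f) = mat_det (sect OX V) 2 a)"
    unfolding endo_det_def framed_matrix_def .
  then show "endo_det X OX F 2 U f \<in> carrier (sect OX U)"
    and "framed_matrix V e a \<Longrightarrow> restr OX U V (endo_det X OX F 2 U f) = mat_det (sect OX V) 2 a"
    by blast+
qed

text \<open>The polynomial is assembled globally as \<open>X^2 - t X + d\<close> from the glued
  trace \<open>t\<close> and the glued determinant \<open>d\<close>. Uniqueness is checked
  coefficient by coefficient on the cover by framed open sets.\<close>

lemma endo_charpoly_restr:
  assumes "framed_matrix V e a"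
  shows "(\<lambda>k. restr OX U V (endo_charpoly X OX F 2 U f k)) = mat_charpoly (sect OX V) 2 a"
proof -
  have "\<exists>!t. t \<in> carrier (sect OX U) \<and>
    (\<forall>V e a. framed_matrix V e a \<longrightarrow> restr OX U V t = a 0 0 \<oplus>\<^bsub>sect OX V\<^esub> a 1 1)"
  proof (rule invariant_glue)
    fix V e a assume m: "framed_matrix V e a"
    interpret cring "sect OX V" by (rule base_cring[OF framed_matrixD(4)[OF m]])
    show "a 0 0 \<oplus>\<^bsub>sect OX V\<^esub> a 1 1 \<in> carrier (sect OX V)"
      using framed_matrixD(5)[OF m] by simp
    fix W assume W: "openin X W" "W \<subseteq> V"
    interpret h: ring_hom_cring "sect OX V" "sect OX W" "restr OX V W"
      using framed_matrixD[OF m] W by (intro base_hom_cring) auto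
    show "restr OX V W (a 0 0 \<oplus>\<^bsub>sect OX V\<^esub> a 1 1) = restr OX V W (a 0 0) \<oplus>\<^bsub>sect OX W\<^esub> restr OX V W (a 1 1)"
      using framed_matrixD(5)[OF m] by simp
  qed (rule framed_matrix_invariants(1))
  then obtain t where t: "t \<in> carrier (sect OX U)"
    "\<And>V e a. framed_matrix V e a \<Longrightarrow> restr OX U V t = a 0 0 \<oplus>\<^bsub>sect OX V\<^esub> a 1 1" by blast
  interpret U: cring "sect OX U" by (rule base_cring[OF U])
  define q where "q = (\<lambda>k::nat. if k = 0 then endo_det X OX F 2 U f else
    if k = 1 then \<ominus>\<^bsub>sect OX U\<^esub> t else if k = 2 then \<one>\<^bsub>sect OX U\<^esub> else \<zero>\<^bsub>sect OX U\<^esub>)"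
  have "q \<in> up (sect OX U)"
    using t(1) endo_det_closed by (intro mem_upI exI[of _ 2] bound.intro) (auto simp: q_def)
  then have q: "q \<in> carrier (UP (sect OX U))" by (simp add: UP_def)
  have q_restr: "(\<lambda>k. restr OX U V (q k)) = mat_charpoly (sect OX V) 2 a" if m: "framed_matrix V e a" for V e a
  proof -
    interpret h: ring_hom_cring "sect OX U" "sect OX V" "restr OX U V"
      using framed_matrixD[OF m] U by (intro base_hom_cring) auto
    show ?thesis
      using framed_matrixD(5)[OF m] endo_det_restr[OF m] t(2)[OF m] t(1)
      by (auto simp: h.S.mat_charpoly_2 h.S.mat_det_2 q_def)
  qed
  have "\<exists>!q. q \<in> carrier (UP (sect OX U)) \<and>
    (\<forall>V e a. framed_matrix V e a \<longrightarrow> (\<lambda>k. restr OX U V (q k)) = mat_charpoly (sect OX V) 2 a)"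
  proof (intro ex_ex1I exI[of _ q] conjI allI impI q q_restr)
    fix r s assume r: "r \<in> carrier (UP (sect OX U)) \<and>
      (\<forall>V e a. framed_matrix V e a \<longrightarrow> (\<lambda>k. restr OX U V (r k)) = mat_charpoly (sect OX V) 2 a)"
      and s: "s \<in> carrier (UP (sect OX U)) \<and>
      (\<forall>V e a. framed_matrix V e a \<longrightarrow> (\<lambda>k. restr OX U V (s k)) = mat_charpoly (sect OX V) 2 a)"
    show "r = s"
    proof (rule ext, rule restr_separated[OF U])
      fix k show "r k \<in> carrier (sect OX U)" "s k \<in> carrier (sect OX U)"
        using r s by (auto simp: UP_def)
      fix p assume "p \<in> U"
      then obtain V e a where V: "p \<in> V" "framed_matrix V e a" using framed_matrix_near by blast
      have "restr OX U V (r k) = restr OX U V (s k)"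
        using r s V(2) by (metis (no_types, lifting))
      then show "\<exists>V. openin X V \<and> p \<in> V \<and> V \<subseteq> U \<and> restr OX U V (r k) = restr OX U V (s k)"
        using V framed_matrixD(1,4)[OF V(2)] by blast
    qed
  qed
  from theI'[OF this]
  have "endo_charpoly X OX F 2 U f \<in> carrier (UP (sect OX U)) \<and>
    (\<forall>V e a. framed_matrix V e a \<longrightarrow>
      (\<lambda>k. restr OX U V (endo_charpoly X OX F 2 U f k)) = mat_charpoly (sect OX V) 2 a)"
    unfolding endo_charpoly_def framed_matrix_def .
  then show ?thesis using assms by blast
qed

text \<open>The constant term of a characteristic polynomial is the determinant of
  \<open>- a\<close>, which in rank two is that of \<open>a\<close>.\<close>

lemma endo_charpoly_det:
  assumes "framed_matrix V e a"
  shows "restr OX U V (endo_charpoly X OX F 2 U f 0) = mat_det (sect OX V) 2 a"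
proof -
  note m = framed_matrixD[OF assms]
  have "restr OX U V (endo_charpoly X OX F 2 U f 0) = mat_charpoly (sect OX V) 2 a 0"
    by (rule fun_cong[OF endo_charpoly_restr[OF assms]])
  then show ?thesis
    using m(5) by (simp add: cring.mat_charpoly_2[OF base_cring[OF m(4)]] cring.mat_det_2[OF base_cring[OF m(4)]])
qed

end

section \<open>Sections of locally free sheaves on affine schemes\<close>

lemma (in cring) cring_idealI:
  assumes "J \<subseteq> carrier R" "\<zero> \<in> J" and add: "\<And>a b. a \<in> J \<Longrightarrow> b \<in> J \<Longrightarrow> a \<oplus> b \<in> J"
    and mult: "\<And>r a. r \<in> carrier R \<Longrightarrow> a \<in> J \<Longrightarrow> r \<otimes> a \<in> J"
  shows "ideal J R"
proof (intro idealI ring_axioms group.subgroupI a_group)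
  fix a assume a: "a \<in> J"
  then have "\<ominus> a = \<ominus> \<one> \<otimes> a" using assms(1) by (auto simp: l_minus)
  then show "inv\<^bsub>add_monoid R\<^esub> a \<in> J"
    using mult[OF _ a, of "\<ominus> \<one>"] by (simp add: a_inv_def[symmetric])
  have ac: "a \<in> carrier R" using a assms(1) by blast
  fix x assume x: "x \<in> carrier R"
  show "x \<otimes> a \<in> J" by (rule mult[OF x a])
  then show "a \<otimes> x \<in> J" by (simp add: m_comm[OF ac x])
qed (use assms in auto)

text \<open>
  The properties of the distinguished open sets of an affine open set \<open>W\<close> with coordinate ring \<open>A\<close>
  that are needed to extend sections: \<open>D f\<close> is the locus where \<open>f\<close> does not vanish and \<open>\<iota>\<close> maps
  \<open>A\<close> to the sections over \<open>W\<close>.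
\<close>

locale affine_chart = ringed_base X OX + A: cring A
  for X :: "'p topology" and OX :: "('p, 'r, 'z) presheaf" and A :: "('b, 'y) ring_scheme" (structure) +
  fixes W :: "'p set" and D :: "'b \<Rightarrow> 'p set" and \<iota> :: "'b \<Rightarrow> 'r"
  assumes W: "openin X W" and \<iota>: "\<iota> \<in> ring_hom A (sect OX W)"
    and D_open: "f \<in> carrier A \<Longrightarrow> openin X (D f)"
    and D_sub: "f \<in> carrier A \<Longrightarrow> D f \<subseteq> W"
    and D_basis: "openin X V \<Longrightarrow> V \<subseteq> W \<Longrightarrow> p \<in> V \<Longrightarrow> \<exists>f\<in>carrier A. p \<in> D f \<and> D f \<subseteq> V"
    and D_mult: "f \<in> carrier A \<Longrightarrow> g \<in> carrier A \<Longrightarrow> D (f \<otimes> g) = D f \<inter> D g"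
    and D_add: "f \<in> carrier A \<Longrightarrow> g \<in> carrier A \<Longrightarrow> D (f \<oplus> g) \<subseteq> D f \<union> D g"
    and D_one: "D \<one> = W" and D_zero: "D \<zero> = {}"
    and D_compact: "ideal J A \<Longrightarrow> f \<in> carrier A \<Longrightarrow> (\<And>p. p \<in> D f \<Longrightarrow> \<exists>r\<in>J. p \<in> D r) \<Longrightarrow>
      \<exists>n::nat. f [^] n \<in> J"
    and D_unit: "f \<in> carrier A \<Longrightarrow> \<exists>u\<in>carrier (sect OX (D f)).
      u \<otimes>\<^bsub>sect OX (D f)\<^esub> restr OX W (D f) (\<iota> f) = \<one>\<^bsub>sect OX (D f)\<^esub>"
    and D_rep: "openin X V \<Longrightarrow> V \<subseteq> W \<Longrightarrow> p \<in> V \<Longrightarrow> s \<in> carrier (sect OX V) \<Longrightarrow>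
      \<exists>h\<in>carrier A. \<exists>a\<in>carrier A. \<exists>t\<in>carrier A. p \<in> D h \<and> D h \<subseteq> V \<and> D h \<subseteq> D t \<and>
        restr OX W (D h) (\<iota> t) \<otimes>\<^bsub>sect OX (D h)\<^esub> restr OX V (D h) s = restr OX W (D h) (\<iota> a)"
    and D_zero_local: "a \<in> carrier A \<Longrightarrow> g \<in> carrier A \<Longrightarrow>
      restr OX W (D g) (\<iota> a) = \<zero>\<^bsub>sect OX (D g)\<^esub> \<Longrightarrow> p \<in> D g \<Longrightarrow>
      \<exists>u\<in>carrier A. p \<in> D u \<and> u \<otimes> a = \<zero>"
begin

definition loc where "loc V a = restr OX W V (\<iota> a)"

lemma loc_hom: "openin X V \<Longrightarrow> V \<subseteq> W \<Longrightarrow> ring_hom_cring A (sect OX V) (loc V)"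
proof -
  assume V: "openin X V" "V \<subseteq> W"
  have "restr OX W V \<circ> \<iota> \<in> ring_hom A (sect OX V)"
    using ring_hom_trans[OF \<iota> base_hom[OF W V]] .
  moreover have "restr OX W V \<circ> \<iota> = loc V" by (auto simp: loc_def)
  ultimately show "ring_hom_cring A (sect OX V) (loc V)"
    using V base_cring A.is_cring by (simp add: ring_hom_cring_def ring_hom_cring_axioms_def)
qed

lemma \<iota>_closed: "a \<in> carrier A \<Longrightarrow> \<iota> a \<in> carrier (sect OX W)"
  using \<iota> by (rule ring_hom_closed)

lemma loc_closed [simp]: "openin X V \<Longrightarrow> V \<subseteq> W \<Longrightarrow> a \<in> carrier A \<Longrightarrow> loc V a \<in> carrier (sect OX V)"
  by (simp add: loc_def W \<iota>_closed)

lemma restr_loc [simp]: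
  "openin X V \<Longrightarrow> openin X V' \<Longrightarrow> V' \<subseteq> V \<Longrightarrow> V \<subseteq> W \<Longrightarrow> a \<in> carrier A \<Longrightarrow> restr OX V V' (loc V a) = loc V' a"
  by (simp add: loc_def W \<iota>_closed)

lemma loc_mult:
  "openin X V \<Longrightarrow> V \<subseteq> W \<Longrightarrow> a \<in> carrier A \<Longrightarrow> b \<in> carrier A \<Longrightarrow>
   loc V (a \<otimes> b) = loc V a \<otimes>\<^bsub>sect OX V\<^esub> loc V b"
  using loc_hom[of V] by (simp add: ring_hom_cring.homh ring_hom_mult)

lemma D_pow: "f \<in> carrier A \<Longrightarrow> D f \<subseteq> D (f [^] (n::nat))"
  by (induction n) (auto simp: D_one D_mult dest: D_sub)

lemma loc_unit:
  assumes "f \<in> carrier A" "openin X V" "V \<subseteq> D f"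
  shows "loc V f \<in> Units (sect OX V)"
proof -
  have VW: "V \<subseteq> W" using assms D_sub by blast
  interpret h: ring_hom_cring "sect OX (D f)" "sect OX V" "restr OX (D f) V"
    using assms D_open by (intro base_hom_cring) auto
  obtain u where u: "u \<in> carrier (sect OX (D f))" "u \<otimes>\<^bsub>sect OX (D f)\<^esub> loc (D f) f = \<one>\<^bsub>sect OX (D f)\<^esub>"
    using D_unit[OF assms(1)] unfolding loc_def by blast
  have l: "loc (D f) f \<in> carrier (sect OX (D f))" using assms D_open D_sub by simp
  have "restr OX (D f) V u \<otimes>\<^bsub>sect OX V\<^esub> loc V f = \<one>\<^bsub>sect OX V\<^esub>"
    using arg_cong[OF u(2), of "restr OX (D f) V"] u(1) l assms D_open D_sub by simp
  moreover have "restr OX (D f) V u \<in> carrier (sect OX V)" "loc V f \<in> carrier (sect OX V)"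
    using u(1) assms VW by auto
  ultimately show ?thesis
    by (auto simp: Units_def h.S.m_comm intro!: bexI[of _ "restr OX (D f) V u"])
qed

section \<open>Quasi-compactness, torsion and denominators on a chart\<close>

lemma unit_cancel_zero:
  assumes "cring R" "x \<in> Units R" "y \<in> carrier R" "x \<otimes>\<^bsub>R\<^esub> y = \<zero>\<^bsub>R\<^esub>"
  shows "y = \<zero>\<^bsub>R\<^esub>"
proof -
  interpret cring R by fact
  show ?thesis using assms Units_l_cancel[of x y "\<zero>\<^bsub>R\<^esub>"] by (simp add: Units_closed)
qed

text \<open>Near each point of \<open>D g\<close> some element not vanishing there kills
  \<open>a\<close>. The loci of the annihilator of \<open>a\<close> thus cover \<open>D g\<close>,
  and this ideal contains a power of \<open>g\<close>.\<close>

lemma annihilator_pow: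
  assumes a: "a \<in> carrier A" and g: "g \<in> carrier A" and z: "loc (D g) a = \<zero>\<^bsub>sect OX (D g)\<^esub>"
  shows "\<exists>n::nat. g [^] n \<otimes> a = \<zero>"
proof -
  let ?J = "{r \<in> carrier A. r \<otimes> a = \<zero>}"
  have "ideal ?J A"
    using a by (intro A.cring_idealI) (auto simp: A.l_distr A.m_assoc)
  moreover have "\<exists>r\<in>?J. p \<in> D r" if "p \<in> D g" for p
    using D_zero_local[OF a g z[unfolded loc_def] that] by blast
  ultimately have "\<exists>n::nat. g [^] n \<in> ?J" by (rule D_compact[OF _ g])
  then show ?thesis by blast
qed

text \<open>Quasi-compactness of \<open>D g\<close> as an induction rule. By \<open>union\<close>,
  the elements satisfying \<open>Q\<close> form an ideal, since \<open>D (r + r')\<close> lies in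
  the union of \<open>D r\<close> and \<open>D r'\<close>; by \<open>local\<close>, their loci cover
  \<open>D g\<close>. Hence \<open>Q\<close> holds for some \<open>g^n\<close>, and it descends to
  \<open>g\<close> because \<open>D g\<close> is contained in \<open>D (g^n)\<close>.\<close>

lemma compact_induct:
  assumes g: "g \<in> carrier A"
    and empty: "\<And>t. t \<in> carrier A \<Longrightarrow> D t = {} \<Longrightarrow> Q t"
    and union: "\<And>r r' t. r \<in> carrier A \<Longrightarrow> r' \<in> carrier A \<Longrightarrow> t \<in> carrier A \<Longrightarrow> Q r \<Longrightarrow> Q r' \<Longrightarrow>
      D t \<subseteq> D r \<union> D r' \<Longrightarrow> Q t"
    and local: "\<And>p. p \<in> D g \<Longrightarrow> \<exists>h\<in>carrier A. p \<in> D h \<and> Q h"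
  shows "Q g"
proof -
  let ?J = "{r \<in> carrier A. Q r}"
  have anti: "Q t" if "r \<in> carrier A" "t \<in> carrier A" "Q r" "D t \<subseteq> D r" for r t
    by (rule union[of r r t]) (use that in auto)
  have "ideal ?J A"
  proof (rule A.cring_idealI)
    show "\<zero> \<in> ?J" using empty D_zero by simp
    fix r r' assume "r \<in> ?J" "r' \<in> ?J"
    then show "r \<oplus> r' \<in> ?J" using union[OF _ _ _ _ _ D_add] by simp
  next
    fix x r assume "x \<in> carrier A" "r \<in> ?J"
    then show "x \<otimes> r \<in> ?J" using anti[of r "x \<otimes> r"] by (simp add: D_mult)
  qed auto
  moreover have "\<exists>r\<in>?J. p \<in> D r" if "p \<in> D g" for p using local[OF that] by blast
  ultimately have "\<exists>n::nat. g [^] n \<in> ?J" by (rule D_compact[OF _ g])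
  then obtain n :: nat where "Q (g [^] n)" by blast
  then show ?thesis by (rule anti[rotated 2]) (use g D_pow[OF g] in auto)
qed

lemma pow_add: "f \<in> carrier A \<Longrightarrow> f [^] (m + n :: nat) = f [^] m \<otimes> f [^] n"
  by (simp add: A.nat_pow_mult)

text \<open>On a small \<open>D h\<close> the section is a fraction \<open>a / t\<close>. Its
  vanishing on \<open>D (h f)\<close> gives \<open>(h f)^n a = 0\<close>, and \<open>h\<close> and
  \<open>t\<close> are invertible on \<open>D h\<close>, so \<open>f^n s\<close> vanishes there.
  \<open>compact_induct\<close> turns the local exponents into a single one.\<close>

lemma torsion_base:
  assumes g: "g \<in> carrier A" and f: "f \<in> carrier A" and s: "s \<in> carrier (sect OX (D g))"
    and z: "restr OX (D g) (D g \<inter> D f) s = \<zero>\<^bsub>sect OX (D g \<inter> D f)\<^esub>"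
  shows "\<exists>n::nat. loc (D g) (f [^] n) \<otimes>\<^bsub>sect OX (D g)\<^esub> s = \<zero>\<^bsub>sect OX (D g)\<^esub>"
proof -
  note o = D_open[OF g] D_open[OF f] and sub = D_sub[OF g]
  interpret O: cring "sect OX (D g)" by (rule base_cring[OF o(1)])
  let ?x = "\<lambda>n::nat. loc (D g) (f [^] n) \<otimes>\<^bsub>sect OX (D g)\<^esub> s"
  let ?Z = "\<lambda>V n. restr OX (D g) V (?x n) = \<zero>\<^bsub>sect OX V\<^esub>"
  have xc: "?x n \<in> carrier (sect OX (D g))" for n using o sub f s by simp
  have mono: "?Z V (m + n)" if V: "openin X V" "V \<subseteq> D g" and "?Z V n" for V m n
  proof -
    interpret h: ring_hom_cring "sect OX (D g)" "sect OX V" "restr OX (D g) V"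
      by (rule base_hom_cring[OF o(1) V])
    have "?x (m + n) = loc (D g) (f [^] m) \<otimes>\<^bsub>sect OX (D g)\<^esub> ?x n"
      using o sub f s by (simp add: pow_add loc_mult O.m_assoc)
    then show ?thesis using that o sub f xc by simp
  qed
  \<comment> \<open>The property carried through the induction is vanishing on
    \<open>D g \<inter> D r\<close>, since an arbitrary \<open>D r\<close> need not lie in
    \<open>D g\<close>; the case \<open>r = g\<close> is the claim.\<close>
  have "\<exists>n. ?Z (D g \<inter> D g) n"
  proof (rule compact_induct[where Q = "\<lambda>r. \<exists>n. ?Z (D g \<inter> D r) n", OF g])
    fix t assume t: "t \<in> carrier A" "D t = {}"
    interpret E: cring "sect OX {}" by (rule base_cring) simp
    \<comment> \<open>Over the empty set all sections coincide, as the condition at points is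
      vacuous.\<close>
    have "?Z {} 0" by (rule restr_separated[of "{}"]) (use o xc[of 0] in auto)
    then show "\<exists>n. ?Z (D g \<inter> D t) n" using t by (intro exI[of _ 0]) simp
  next
    fix r r' t assume r: "r \<in> carrier A" "r' \<in> carrier A" and t: "t \<in> carrier A" "D t \<subseteq> D r \<union> D r'"
      and "\<exists>n. ?Z (D g \<inter> D r) n" "\<exists>n. ?Z (D g \<inter> D r') n"
    then obtain m n where "?Z (D g \<inter> D r) m" "?Z (D g \<inter> D r') n" by blast
    \<comment> \<open>Vanishing persists for larger exponents, so both pieces can use
      \<open>m + n\<close>.\<close>
    then have mn: "?Z (D g \<inter> D r) (m + n)" "?Z (D g \<inter> D r') (m + n)"
      using mono[where V = "D g \<inter> D r" and m = n and n = m] mono[where V = "D g \<inter> D r'" and m = m and n = n] o r D_open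
      by (auto simp: add.commute)
    let ?V = "D g \<inter> D t"
    have V: "openin X ?V" "?V \<subseteq> D g" using o t D_open by auto
    interpret V: cring "sect OX ?V" by (rule base_cring[OF V(1)])
    have part: "restr OX ?V (?V \<inter> D k) (restr OX (D g) ?V (?x (m + n))) = restr OX ?V (?V \<inter> D k) \<zero>\<^bsub>sect OX ?V\<^esub>"
      if k: "k \<in> carrier A" "?Z (D g \<inter> D k) (m + n)" for k
    proof -
      have Vk: "openin X (?V \<inter> D k)" "openin X (D g \<inter> D k)" "?V \<inter> D k \<subseteq> D g \<inter> D k"
        "?V \<inter> D k \<subseteq> D t" "?V \<inter> D k \<subseteq> D k"
        using V k D_open o by auto
      interpret h: ring_hom_cring "sect OX ?V" "sect OX (?V \<inter> D k)" "restr OX ?V (?V \<inter> D k)"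
        using V Vk by (intro base_hom_cring) auto
      interpret h': ring_hom_cring "sect OX (D g \<inter> D k)" "sect OX (?V \<inter> D k)" "restr OX (D g \<inter> D k) (?V \<inter> D k)"
        using V Vk by (intro base_hom_cring) auto
      have "restr OX ?V (?V \<inter> D k) (restr OX (D g) ?V (?x (m + n))) =
          restr OX (D g \<inter> D k) (?V \<inter> D k) (restr OX (D g) (D g \<inter> D k) (?x (m + n)))"
        using V Vk o xc by simp
      then show ?thesis unfolding k(2) by simp
    qed
    have "?Z ?V (m + n)"
    proof (rule restr_separated[OF V(1)])
      fix p assume "p \<in> ?V"
      then have "p \<in> ?V \<inter> D r \<or> p \<in> ?V \<inter> D r'" using t by auto
      then show "\<exists>V'. openin X V' \<and> p \<in> V' \<and> V' \<subseteq> ?V \<and>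
          restr OX ?V V' (restr OX (D g) ?V (?x (m + n))) = restr OX ?V V' \<zero>\<^bsub>sect OX ?V\<^esub>"
        using part[OF r(1) mn(1)] part[OF r(2) mn(2)] V r D_open by (metis inf_le1 openin_Int)
    qed (use xc V o in auto)
    then show "\<exists>n. ?Z ?V n" by blast
  next
    fix p assume p: "p \<in> D g"
    obtain h a t where h: "h \<in> carrier A" "a \<in> carrier A" "t \<in> carrier A" "p \<in> D h" "D h \<subseteq> D g" "D h \<subseteq> D t"
      and rep: "loc (D h) t \<otimes>\<^bsub>sect OX (D h)\<^esub> restr OX (D g) (D h) s = loc (D h) a"
      using D_rep[OF o(1) sub p s] unfolding loc_def by blast
    note oh = D_open[OF h(1)] and subh = D_sub[OF h(1)]
    let ?V = "D (h \<otimes> f)"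
    have V: "openin X ?V" "?V \<subseteq> D h" "?V \<subseteq> D g \<inter> D f" using h f D_open[of "h \<otimes> f"] by (auto simp: D_mult)
    interpret h: ring_hom_cring "sect OX (D h)" "sect OX ?V" "restr OX (D h) ?V"
      using V oh by (intro base_hom_cring) auto
    interpret h': ring_hom_cring "sect OX (D g \<inter> D f)" "sect OX ?V" "restr OX (D g \<inter> D f) ?V"
      using V o by (intro base_hom_cring) auto
    interpret h'': ring_hom_cring "sect OX (D g)" "sect OX (D h)" "restr OX (D g) (D h)"
      using h oh o by (intro base_hom_cring) auto
    have sh: "restr OX (D g) (D h) s \<in> carrier (sect OX (D h))" using s h o oh by simp
    have "restr OX (D g) ?V s = restr OX (D g \<inter> D f) ?V (restr OX (D g) (D g \<inter> D f) s)"
      using s V(1,3) o by (intro base_restr[symmetric]) auto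
    then have "restr OX (D g) ?V s = \<zero>\<^bsub>sect OX ?V\<^esub>" unfolding z by simp
    then have "loc ?V a = \<zero>\<^bsub>sect OX ?V\<^esub>"
      using arg_cong[OF rep, of "restr OX (D h) ?V"] h V o oh subh s sh by simp
    from annihilator_pow[OF h(2) _ this] obtain n :: nat where n: "(h \<otimes> f) [^] n \<otimes> a = \<zero>"
      using h f by auto
    then have "h [^] n \<otimes> (f [^] n \<otimes> a) = \<zero>"
      using h f by (simp add: A.nat_pow_distrib A.m_assoc)
    then have "loc (D h) (h [^] n \<otimes> (f [^] n \<otimes> a)) = \<zero>\<^bsub>sect OX (D h)\<^esub>"
      using ring_hom_cring.hom_zero[OF loc_hom[OF oh subh]] by simp
    then have hfa: "loc (D h) (h [^] n) \<otimes>\<^bsub>sect OX (D h)\<^esub> loc (D h) (f [^] n \<otimes> a) = \<zero>\<^bsub>sect OX (D h)\<^esub>"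
      using h f oh subh by (subst loc_mult[symmetric]) auto
    have u: "loc (D h) (h [^] n) \<in> Units (sect OX (D h))" "loc (D h) t \<in> Units (sect OX (D h))"
      by (rule loc_unit; use h oh D_pow[OF h(1)] in simp)+
    have fa: "loc (D h) (f [^] n \<otimes> a) = \<zero>\<^bsub>sect OX (D h)\<^esub>"
      by (rule unit_cancel_zero[OF base_cring[OF oh] u(1) _ hfa]) (use h f oh subh in simp)
    have ts: "loc (D h) t \<otimes>\<^bsub>sect OX (D h)\<^esub> (loc (D h) (f [^] n) \<otimes>\<^bsub>sect OX (D h)\<^esub> restr OX (D g) (D h) s) = \<zero>\<^bsub>sect OX (D h)\<^esub>"
      using fa h f oh subh sh by (simp add: loc_mult[OF oh subh] rep[symmetric] h.R.m_lcomm)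
    have "loc (D h) (f [^] n) \<otimes>\<^bsub>sect OX (D h)\<^esub> restr OX (D g) (D h) s = \<zero>\<^bsub>sect OX (D h)\<^esub>"
      by (rule unit_cancel_zero[OF base_cring[OF oh] u(2) _ ts]) (use h f oh subh sh in simp)
    then have "?Z (D h) n" using h f o oh sub s by simp
    moreover have "D g \<inter> D h = D h" using h by auto
    ultimately show "\<exists>h\<in>carrier A. p \<in> D h \<and> (\<exists>n. ?Z (D g \<inter> D h) n)"
      using h(1,4) by (intro bexI[of _ h] conjI exI[of _ n]) simp_all
  qed
  then show ?thesis using xc o by auto
qed

text \<open>The elements \<open>r\<close> for which \<open>r s\<close> comes from \<open>A\<close>
  form an ideal, so it suffices to find one of them near each point of \<open>D f\<close>. A local
  denominator of \<open>s\<close> is not yet such an element, but becomes one after multiplication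
  by a power of \<open>h\<close>.\<close>

lemma extend_base:
  assumes f: "f \<in> carrier A" and s: "s \<in> carrier (sect OX (D f))"
  shows "\<exists>n::nat. \<exists>a\<in>carrier A. loc (D f) (f [^] n) \<otimes>\<^bsub>sect OX (D f)\<^esub> s = loc (D f) a"
proof -
  note o = D_open[OF f] and sub = D_sub[OF f]
  interpret h: ring_hom_cring A "sect OX (D f)" "loc (D f)" by (rule loc_hom[OF o sub])
  let ?J = "{r \<in> carrier A. \<exists>a\<in>carrier A. loc (D f) r \<otimes>\<^bsub>sect OX (D f)\<^esub> s = loc (D f) a}"
  have "ideal ?J A"
  proof (rule A.cring_idealI)
    show "\<zero> \<in> ?J" using s by (auto intro!: bexI[of _ \<zero>])
  next
    fix r r' assume "r \<in> ?J" "r' \<in> ?J"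
    then obtain a a' where "r \<in> carrier A" "a \<in> carrier A" "loc (D f) r \<otimes>\<^bsub>sect OX (D f)\<^esub> s = loc (D f) a"
      "r' \<in> carrier A" "a' \<in> carrier A" "loc (D f) r' \<otimes>\<^bsub>sect OX (D f)\<^esub> s = loc (D f) a'" by blast
    then show "r \<oplus> r' \<in> ?J"
      using s by (auto simp: h.S.l_distr intro!: bexI[of _ "a \<oplus> a'"])
  next
    fix x r assume "r \<in> ?J" and x: "x \<in> carrier A"
    then obtain a where "r \<in> carrier A" "a \<in> carrier A" "loc (D f) r \<otimes>\<^bsub>sect OX (D f)\<^esub> s = loc (D f) a" by blast
    then show "x \<otimes> r \<in> ?J" using s x by (auto simp: h.S.m_assoc intro!: bexI[of _ "x \<otimes> a"])
  qed auto
  moreover have "\<exists>r\<in>?J. p \<in> D r" if p: "p \<in> D f" for p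
  proof -
    obtain h a t where h: "h \<in> carrier A" "a \<in> carrier A" "t \<in> carrier A" "p \<in> D h" "D h \<subseteq> D f" "D h \<subseteq> D t"
      and rep: "loc (D h) t \<otimes>\<^bsub>sect OX (D h)\<^esub> restr OX (D f) (D h) s = loc (D h) a"
      using D_rep[OF o sub p s] unfolding loc_def by blast
    note oh = D_open[OF h(1)]
    interpret r: ring_hom_cring "sect OX (D f)" "sect OX (D h)" "restr OX (D f) (D h)"
      using h oh o by (intro base_hom_cring) auto
    \<comment> \<open>The error committed by using the local equation \<open>t s = a\<close> on all
      of \<open>D f\<close>. It vanishes on \<open>D h\<close>, hence is killed on
      \<open>D f\<close> by a power \<open>h^n\<close>, and \<open>h^n t\<close> belongs to
      \<open>?J\<close>.\<close>
    let ?d = "loc (D f) t \<otimes>\<^bsub>sect OX (D f)\<^esub> s \<ominus>\<^bsub>sect OX (D f)\<^esub> loc (D f) a"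
    have fh: "D f \<inter> D h = D h" using h by auto
    have "restr OX (D f) (D h) ?d = \<zero>\<^bsub>sect OX (D h)\<^esub>"
      using h o oh sub s rep by (simp add: a_minus_def r.S.r_neg)
    then obtain n :: nat where n: "loc (D f) (h [^] n) \<otimes>\<^bsub>sect OX (D f)\<^esub> ?d = \<zero>\<^bsub>sect OX (D f)\<^esub>"
      using torsion_base[OF f h(1), of ?d] fh h o sub s by auto
    have "loc (D f) (h [^] n \<otimes> t) \<otimes>\<^bsub>sect OX (D f)\<^esub> s = loc (D f) (h [^] n \<otimes> a)
        \<oplus>\<^bsub>sect OX (D f)\<^esub> loc (D f) (h [^] n) \<otimes>\<^bsub>sect OX (D f)\<^esub> ?d"
    proof -
      have c: "loc (D f) (h [^] n) \<in> carrier (sect OX (D f))" "loc (D f) t \<in> carrier (sect OX (D f))"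
        "loc (D f) a \<in> carrier (sect OX (D f))" using h o sub by auto
      have "loc (D f) (h [^] n) \<otimes>\<^bsub>sect OX (D f)\<^esub> loc (D f) t \<otimes>\<^bsub>sect OX (D f)\<^esub> s =
        loc (D f) (h [^] n) \<otimes>\<^bsub>sect OX (D f)\<^esub> loc (D f) a \<oplus>\<^bsub>sect OX (D f)\<^esub> loc (D f) (h [^] n) \<otimes>\<^bsub>sect OX (D f)\<^esub> ?d"
        using c s by algebra
      then show ?thesis using h by simp
    qed
    then have "h [^] n \<otimes> t \<in> ?J" using n h o sub by (auto intro!: bexI[of _ "h [^] n \<otimes> a"])
    moreover have "p \<in> D (h [^] n \<otimes> t)" using h D_pow[OF h(1)] by (auto simp: D_mult)
    ultimately show ?thesis by blast
  qed
  ultimately have "\<exists>n::nat. f [^] n \<in> ?J" by (rule D_compact[OF _ f])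
  then show ?thesis by blast
qed

end

section \<open>Sections of a module over an affine chart\<close>

lemma (in modular_presheaf) restr_zero:
  assumes "openin X U" "openin X V" "V \<subseteq> U"
  shows "restr F U V \<zero>\<^bsub>sect F U\<^esub> = \<zero>\<^bsub>sect F V\<^esub>"
  by (rule abelian_group_hom.hom_zero[OF semilinear_group_hom[OF sect_module[OF assms(1)]
          sect_module[OF assms(2)] restr_semilinear[OF assms]]])

locale affine_module = affine_chart X OX A W D \<iota> + rank_two X OX F
  for X :: "'p topology" and OX :: "('p, 'r, 'z) presheaf" and A :: "('b, 'y) ring_scheme" (structure)
    and W :: "'p set" and D :: "'b \<Rightarrow> 'p set" and \<iota> :: "'b \<Rightarrow> 'r" and F :: "('p, 'r, 'm) module_presheaf" +
  assumes sheaf: "is_sheaf X F"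
begin

lemma sections_separated:
  assumes "openin X U" and s: "s \<in> carrier (sect F U)" "t \<in> carrier (sect F U)"
    and cover: "\<And>p. p \<in> U \<Longrightarrow> \<exists>V. openin X V \<and> p \<in> V \<and> V \<subseteq> U \<and> restr F U V s = restr F U V t"
  shows "s = t"
proof -
  let ?\<V> = "{V. openin X V \<and> V \<subseteq> U \<and> restr F U V s = restr F U V t}"
  have Un: "\<Union>?\<V> = U" using cover by blast
  from sheaf_separated[OF sheaf, of ?\<V> s t] show ?thesis
    unfolding Un using s by blast
qed

lemma sections_glue:
  assumes V: "openin X V1" "openin X V2" and s: "s1 \<in> carrier (sect F V1)" "s2 \<in> carrier (sect F V2)"
    and eq: "restr F V1 (V1 \<inter> V2) s1 = restr F V2 (V1 \<inter> V2) s2"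
  shows "\<exists>z\<in>carrier (sect F (V1 \<union> V2)). restr F (V1 \<union> V2) V1 z = s1 \<and> restr F (V1 \<union> V2) V2 z = s2"
proof -
  define \<sigma> where "\<sigma> V = (if V = V1 then s1 else s2)" for V
  have 1: "\<sigma> V1 = s1" by (simp add: \<sigma>_def)
  \<comment> \<open>If the two open sets coincide, \<sigma> takes the value \<open>s1\<close> there,
    which equals \<open>s2\<close> by the agreement on the overlap.\<close>
  have 2: "\<sigma> V2 = s2"
  proof (cases "V1 = V2")
    case True
    then show ?thesis using eq s V by (simp add: \<sigma>_def)
  qed (simp add: \<sigma>_def)
  have "\<exists>z\<in>carrier (sect F (\<Union>{V1, V2})). \<forall>V\<in>{V1, V2}. restr F (\<Union>{V1, V2}) V z = \<sigma> V"
  proof (rule sheaf_glue[OF sheaf])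
    fix V assume "V \<in> {V1, V2}"
    then show "openin X V \<and> \<sigma> V \<in> carrier (sect F V)" using V s 1 2 by auto
  next
    fix V V' assume "V \<in> {V1, V2}" "V' \<in> {V1, V2}"
    then show "restr F V (V \<inter> V') (\<sigma> V) = restr F V' (V \<inter> V') (\<sigma> V')"
      using eq 1 2 by (auto simp: Int_commute[of V2 V1])
  qed
  then show ?thesis using 1 2 by simp
qed

lemma chart_frame:
  assumes "openin X V" "V \<subseteq> W" "p \<in> V"
  shows "\<exists>h\<in>carrier A. \<exists>e. p \<in> D h \<and> D h \<subseteq> V \<and> frame_on X OX F 2 (D h) e"
proof -
  obtain V' e where V': "p \<in> V'" "V' \<subseteq> V" "frame_on X OX F 2 V' e"
    using frame_near[OF assms(1,3)] by blast
  obtain h where h: "h \<in> carrier A" "p \<in> D h" "D h \<subseteq> V'"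
    using D_basis[OF frame_onD(1)[OF V'(3)] _ V'(1)] V' assms by blast
  show ?thesis using frame_on_restrict[OF V'(3) D_open[OF h(1)] h(3)] h V' by blast
qed

text \<open>The induction of \<open>torsion_base\<close> again. Near a point, the two coordinates of
  \<open>s\<close> in a frame vanish where \<open>f\<close> does not, so each is killed by a power
  of \<open>f\<close>, and the product of the two powers kills \<open>s\<close>.\<close>

lemma torsion:
  assumes g: "g \<in> carrier A" and f: "f \<in> carrier A" and s: "s \<in> carrier (sect F (D g))"
    and z: "restr F (D g) (D g \<inter> D f) s = \<zero>\<^bsub>sect F (D g \<inter> D f)\<^esub>"
  shows "\<exists>n::nat. loc (D g) (f [^] n) \<odot>\<^bsub>sect F (D g)\<^esub> s = \<zero>\<^bsub>sect F (D g)\<^esub>"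
proof -
  note o = D_open[OF g] D_open[OF f] and sub = D_sub[OF g]
  interpret G: Module.module "sect OX (D g)" "sect F (D g)" by (rule sect_module[OF o(1)])
  let ?x = "\<lambda>n::nat. loc (D g) (f [^] n) \<odot>\<^bsub>sect F (D g)\<^esub> s"
  let ?Z = "\<lambda>V n. restr F (D g) V (?x n) = \<zero>\<^bsub>sect F V\<^esub>"
  have xc: "?x n \<in> carrier (sect F (D g))" for n using o sub f s by simp
  have mono: "?Z V (m + n)" if V: "openin X V" "V \<subseteq> D g" and Z: "?Z V n" for V m n
  proof -
    interpret V: Module.module "sect OX V" "sect F V" by (rule sect_module[OF V(1)])
    have "?x (m + n) = loc (D g) (f [^] m) \<odot>\<^bsub>sect F (D g)\<^esub> ?x n"
      using o sub f s by (simp add: pow_add loc_mult G.smult_assoc1)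
    moreover have "restr F (D g) V (loc (D g) (f [^] m) \<odot>\<^bsub>sect F (D g)\<^esub> ?x n) =
        restr OX (D g) V (loc (D g) (f [^] m)) \<odot>\<^bsub>sect F V\<^esub> restr F (D g) V (?x n)"
      by (rule restr_smult[OF o(1) V]) (use o sub f xc in simp_all)
    ultimately show ?thesis unfolding Z using V o sub f by simp
  qed
  have "\<exists>n. ?Z (D g \<inter> D g) n"
  proof (rule compact_induct[where Q = "\<lambda>r. \<exists>n. ?Z (D g \<inter> D r) n", OF g])
    fix t assume t: "t \<in> carrier A" "D t = {}"
    have "openin X {}" by simp
    then interpret E: Module.module "sect OX {}" "sect F {}" by (rule sect_module)
    have "?Z {} 0" by (rule sections_separated[of "{}"]) (use o xc[of 0] in auto)
    then show "\<exists>n. ?Z (D g \<inter> D t) n" using t by (intro exI[of _ 0]) simp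
  next
    fix r r' t assume r: "r \<in> carrier A" "r' \<in> carrier A" and t: "t \<in> carrier A" "D t \<subseteq> D r \<union> D r'"
      and "\<exists>n. ?Z (D g \<inter> D r) n" "\<exists>n. ?Z (D g \<inter> D r') n"
    then obtain m n where "?Z (D g \<inter> D r) m" "?Z (D g \<inter> D r') n" by blast
    then have mn: "?Z (D g \<inter> D r) (m + n)" "?Z (D g \<inter> D r') (m + n)"
      using mono[where V = "D g \<inter> D r" and m = n and n = m] mono[where V = "D g \<inter> D r'" and m = m and n = n] o r D_open
      by (auto simp: add.commute)
    let ?V = "D g \<inter> D t"
    have V: "openin X ?V" "?V \<subseteq> D g" using o t D_open by auto
    interpret V: Module.module "sect OX ?V" "sect F ?V" by (rule sect_module[OF V(1)])
    have part: "restr F ?V (?V \<inter> D k) (restr F (D g) ?V (?x (m + n))) = restr F ?V (?V \<inter> D k) \<zero>\<^bsub>sect F ?V\<^esub>"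
      if k: "k \<in> carrier A" "?Z (D g \<inter> D k) (m + n)" for k
    proof -
      have Vk: "openin X (?V \<inter> D k)" "openin X (D g \<inter> D k)" "?V \<inter> D k \<subseteq> D g \<inter> D k" "?V \<inter> D k \<subseteq> ?V"
        using V k D_open o by auto
      have "restr F ?V (?V \<inter> D k) (restr F (D g) ?V (?x (m + n))) = restr F (D g) (?V \<inter> D k) (?x (m + n))"
        by (rule restr_restr[OF o(1) V(1) Vk(1,4) V(2) xc])
      also have "\<dots> = restr F (D g \<inter> D k) (?V \<inter> D k) (restr F (D g) (D g \<inter> D k) (?x (m + n)))"
        by (rule restr_restr[OF o(1) Vk(2,1,3) _ xc, symmetric]) auto
      also have "\<dots> = \<zero>\<^bsub>sect F (?V \<inter> D k)\<^esub>" unfolding k(2) by (rule restr_zero[OF Vk(2,1,3)])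
      also have "\<dots> = restr F ?V (?V \<inter> D k) \<zero>\<^bsub>sect F ?V\<^esub>" by (rule restr_zero[OF V(1) Vk(1,4), symmetric])
      finally show ?thesis .
    qed
    have "?Z ?V (m + n)"
    proof (rule sections_separated[OF V(1)])
      fix p assume "p \<in> ?V"
      then have "p \<in> ?V \<inter> D r \<or> p \<in> ?V \<inter> D r'" using t by auto
      then show "\<exists>V'. openin X V' \<and> p \<in> V' \<and> V' \<subseteq> ?V \<and>
          restr F ?V V' (restr F (D g) ?V (?x (m + n))) = restr F ?V V' \<zero>\<^bsub>sect F ?V\<^esub>"
        using part[OF r(1) mn(1)] part[OF r(2) mn(2)] V r D_open by (metis inf_le1 openin_Int)
    qed (use xc V o in auto)
    then show "\<exists>n. ?Z ?V n" by blast
  next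
    fix p assume p: "p \<in> D g"
    obtain h e where h: "h \<in> carrier A" "p \<in> D h" "D h \<subseteq> D g" and e: "frame_on X OX F 2 (D h) e"
      using chart_frame[OF o(1) sub p] by blast
    note oh = D_open[OF h(1)] and subh = D_sub[OF h(1)] and e' = frame_onD[OF e]
    interpret H: plain_module "sect OX (D h)" "sect F (D h)" by (rule sect_plain[OF oh])
    have sh: "restr F (D g) (D h) s \<in> carrier (sect F (D h))" using s h o oh by simp
    obtain c0 c1 where c: "c0 \<in> carrier (sect OX (D h))" "c1 \<in> carrier (sect OX (D h))"
      "restr F (D g) (D h) s = c0 \<odot>\<^bsub>sect F (D h)\<^esub> e 0 \<oplus>\<^bsub>sect F (D h)\<^esub> c1 \<odot>\<^bsub>sect F (D h)\<^esub> e 1"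
      using H.basis2_exists[OF e'(4) sh] by blast
    let ?V = "D h \<inter> D f"
    have V: "openin X ?V" "?V \<subseteq> D h" "?V \<subseteq> D g \<inter> D f" "?V \<subseteq> D g" "openin X (D g \<inter> D f)" using h oh o by auto
    interpret V: plain_module "sect OX ?V" "sect F ?V" by (rule sect_plain[OF V(1)])
    note eV = frame_onD[OF frame_on_restrict[OF e V(1,2)]]
    have "restr F (D h) ?V (restr F (D g) (D h) s) = restr F (D g) ?V s"
      by (rule restr_restr[OF o(1) oh V(1,2) h(3) s])
    also have "\<dots> = restr F (D g \<inter> D f) ?V (restr F (D g) (D g \<inter> D f) s)"
      by (rule restr_restr[OF o(1) V(5,1,3) _ s, symmetric]) auto
    also have "\<dots> = \<zero>\<^bsub>sect F ?V\<^esub>" unfolding z by (rule restr_zero[OF V(5,1,3)])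
    finally have "restr OX (D h) ?V c0 \<odot>\<^bsub>sect F ?V\<^esub> restr F (D h) ?V (e 0) \<oplus>\<^bsub>sect F ?V\<^esub>
        restr OX (D h) ?V c1 \<odot>\<^bsub>sect F ?V\<^esub> restr F (D h) ?V (e 1) = \<zero>\<^bsub>sect F ?V\<^esub>"
      unfolding c(3) restr_comb[OF oh V(1,2) c(1,2) e'(2,3)] .
    moreover have "\<zero>\<^bsub>sect OX ?V\<^esub> \<odot>\<^bsub>sect F ?V\<^esub> restr F (D h) ?V (e 0) \<oplus>\<^bsub>sect F ?V\<^esub>
        \<zero>\<^bsub>sect OX ?V\<^esub> \<odot>\<^bsub>sect F ?V\<^esub> restr F (D h) ?V (e 1) = \<zero>\<^bsub>sect F ?V\<^esub>"
      using eV(2,3) by simp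
    ultimately have "restr OX (D h) ?V c0 = \<zero>\<^bsub>sect OX ?V\<^esub> \<and> restr OX (D h) ?V c1 = \<zero>\<^bsub>sect OX ?V\<^esub>"
      using c oh V by (intro V.basis2_unique[OF eV(4)]) auto
    then obtain n0 n1 :: nat where n0: "loc (D h) (f [^] n0) \<otimes>\<^bsub>sect OX (D h)\<^esub> c0 = \<zero>\<^bsub>sect OX (D h)\<^esub>"
      and n1: "loc (D h) (f [^] n1) \<otimes>\<^bsub>sect OX (D h)\<^esub> c1 = \<zero>\<^bsub>sect OX (D h)\<^esub>"
      using torsion_base[OF h(1) f c(1)] torsion_base[OF h(1) f c(2)] by blast
    define l where "l n = loc (D h) (f [^] n)" for n :: nat
    have l: "l n \<in> carrier (sect OX (D h))" for n using oh subh f by (simp add: l_def)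
    have ladd: "l (n0 + n1) = l n0 \<otimes>\<^bsub>sect OX (D h)\<^esub> l n1" using oh subh f by (simp add: l_def pow_add loc_mult)
    have z0: "l (n0 + n1) \<otimes>\<^bsub>sect OX (D h)\<^esub> c0 = \<zero>\<^bsub>sect OX (D h)\<^esub>"
    proof -
      have "l (n0 + n1) \<otimes>\<^bsub>sect OX (D h)\<^esub> c0 = l n1 \<otimes>\<^bsub>sect OX (D h)\<^esub> (l n0 \<otimes>\<^bsub>sect OX (D h)\<^esub> c0)"
        unfolding ladd using l[of n0] l[of n1] c(1) by (simp add: H.R.m_ac)
      then show ?thesis unfolding n0[folded l_def] using l by simp
    qed
    have z1: "l (n0 + n1) \<otimes>\<^bsub>sect OX (D h)\<^esub> c1 = \<zero>\<^bsub>sect OX (D h)\<^esub>"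
    proof -
      have "l (n0 + n1) \<otimes>\<^bsub>sect OX (D h)\<^esub> c1 = l n0 \<otimes>\<^bsub>sect OX (D h)\<^esub> (l n1 \<otimes>\<^bsub>sect OX (D h)\<^esub> c1)"
        unfolding ladd using l[of n0] l[of n1] c(2) by (simp add: H.R.m_ac)
      then show ?thesis unfolding n1[folded l_def] using l by simp
    qed
    have "restr F (D g) (D h) (?x (n0 + n1)) = l (n0 + n1) \<odot>\<^bsub>sect F (D h)\<^esub> restr F (D g) (D h) s"
      using o oh h sub f s by (simp add: restr_smult l_def)
    also have "\<dots> = (l (n0 + n1) \<otimes>\<^bsub>sect OX (D h)\<^esub> c0) \<odot>\<^bsub>sect F (D h)\<^esub> e 0 \<oplus>\<^bsub>sect F (D h)\<^esub>
        (l (n0 + n1) \<otimes>\<^bsub>sect OX (D h)\<^esub> c1) \<odot>\<^bsub>sect F (D h)\<^esub> e 1"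
      unfolding c(3) using c(1,2) e'(2,3) l[of "n0 + n1"] by (simp add: H.smult_r_distr H.smult_assoc1)
    also have "\<dots> = \<zero>\<^bsub>sect F (D h)\<^esub>" unfolding z0 z1 using e'(2,3) by simp
    finally have "?Z (D h) (n0 + n1)" .
    moreover have "D g \<inter> D h = D h" using h by auto
    ultimately show "\<exists>h\<in>carrier A. p \<in> D h \<and> (\<exists>n. ?Z (D g \<inter> D h) n)"
      using h(1,2) by (intro bexI[of _ h] conjI exI[of _ "n0 + n1"]) simp_all
  qed
  then obtain n where "?Z (D g) n" by auto
  then show ?thesis using xc o by auto
qed

end

context affine_module
begin

text \<open>The induction runs over \<open>E r n s\<close>: the section \<open>s\<close> over
  \<open>D r\<close> extends \<open>f^n \<gamma>\<close> from \<open>D r \<inter> D f\<close>.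
  Locally such an extension comes from clearing the denominators of the coordinates of \<gamma> in a
  frame. Two extensions may differ on the overlap away from \<open>D f\<close>, and a further power
  of \<open>f\<close> removes the difference, so that they can be glued.\<close>

lemma extend:
  assumes f: "f \<in> carrier A" and \<gamma>: "\<gamma> \<in> carrier (sect F (D f))"
  shows "\<exists>n::nat. \<exists>s\<in>carrier (sect F W). restr F W (D f) s = loc (D f) (f [^] n) \<odot>\<^bsub>sect F (D f)\<^esub> \<gamma>"
proof -
  note o = D_open[OF f] and sub = D_sub[OF f]
  interpret G: Module.module "sect OX (D f)" "sect F (D f)" by (rule sect_module[OF o])
  define Y where "Y n = loc (D f) (f [^] n) \<odot>\<^bsub>sect F (D f)\<^esub> \<gamma>" for n :: nat
  have Yc: "Y n \<in> carrier (sect F (D f))" for n using o sub f \<gamma> by (simp add: Y_def)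
  have Yadd: "Y (m + n) = loc (D f) (f [^] m) \<odot>\<^bsub>sect F (D f)\<^esub> Y n" for m n
    using o sub f \<gamma> by (simp add: Y_def pow_add loc_mult G.smult_assoc1)
  define E where "E r n s \<longleftrightarrow> s \<in> carrier (sect F (D r)) \<and>
    restr F (D r) (D r \<inter> D f) s = restr F (D f) (D r \<inter> D f) (Y n)" for r n s
  have raise: "E r (m + n) (loc (D r) (f [^] m) \<odot>\<^bsub>sect F (D r)\<^esub> s)" if r: "r \<in> carrier A" and s: "E r n s" for r m n s
  proof -
    note or = D_open[OF r] and subr = D_sub[OF r]
    have V: "openin X (D r \<inter> D f)" "D r \<inter> D f \<subseteq> D r" "D r \<inter> D f \<subseteq> D f" using or o by auto
    have sc: "s \<in> carrier (sect F (D r))" and sY: "restr F (D r) (D r \<inter> D f) s = restr F (D f) (D r \<inter> D f) (Y n)"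
      using s by (auto simp: E_def)
    have lr: "loc (D r) (f [^] m) \<in> carrier (sect OX (D r))" "loc (D f) (f [^] m) \<in> carrier (sect OX (D f))"
      using or subr o sub f by simp_all
    have "restr F (D r) (D r \<inter> D f) (loc (D r) (f [^] m) \<odot>\<^bsub>sect F (D r)\<^esub> s) =
        restr F (D f) (D r \<inter> D f) (Y (m + n))"
      unfolding restr_smult[OF or V(1,2) lr(1) sc] Yadd restr_smult[OF o V(1,3) lr(2) Yc] sY
      using V or subr o sub f by simp
    then show ?thesis using lr sc or by (simp add: E_def)
  qed
  \<comment> \<open>\<open>D \<one>\<close> is all of \<open>W\<close>.\<close>
  have "\<exists>n s. E \<one> n s"
  proof (rule compact_induct[where Q = "\<lambda>r. \<exists>n s. E r n s"])
    fix t assume t: "t \<in> carrier A" "D t = {}"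
    have e: "openin X {}" by simp
    interpret Z: Module.module "sect OX {}" "sect F {}" by (rule sect_module[OF e])
    have "restr F {} {} \<zero>\<^bsub>sect F {}\<^esub> = restr F (D f) {} (Y 0)"
      by (rule sections_separated[of "{}"]) (use o e Yc[of 0] in auto)
    then have "E t 0 \<zero>\<^bsub>sect F {}\<^esub>" using t o e Yc[of 0] by (simp add: E_def)
    then show "\<exists>n s. E t n s" by blast
  next
    fix r r' t assume r: "r \<in> carrier A" "r' \<in> carrier A" and t: "t \<in> carrier A" "D t \<subseteq> D r \<union> D r'"
      and "\<exists>n s. E r n s" "\<exists>n s. E r' n s"
    then obtain n s n' s' where "E r n s" "E r' n' s'" by blast
    \<comment> \<open>Each extension is multiplied by the power of \<open>f\<close> belonging to the
      other, which makes the exponents equal.\<close>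
    then have "E r (n' + n) (loc (D r) (f [^] n') \<odot>\<^bsub>sect F (D r)\<^esub> s)"
      "E r' (n + n') (loc (D r') (f [^] n) \<odot>\<^bsub>sect F (D r')\<^esub> s')"
      using raise r by blast+
    then obtain N S S' where S: "E r N S" and S': "E r' N S'" by (metis add.commute)
    note or = D_open[OF r(1)] and or' = D_open[OF r(2)] and ot = D_open[OF t(1)]
    let ?V = "D r \<inter> D r'"
    have rr: "r \<otimes> r' \<in> carrier A" using r by simp
    have V: "openin X ?V" "?V \<subseteq> D r" "?V \<subseteq> D r'" "?V \<subseteq> W" using or or' D_sub[OF r(1)] by auto
    interpret V: Module.module "sect OX ?V" "sect F ?V" by (rule sect_module[OF V(1)])
    have Sc: "S \<in> carrier (sect F (D r))" "S' \<in> carrier (sect F (D r'))" using S S' by (auto simp: E_def)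
    let ?d = "restr F (D r) ?V S \<ominus>\<^bsub>sect F ?V\<^esub> restr F (D r') ?V S'"
    have Sv: "restr F (D r) ?V S \<in> carrier (sect F ?V)" "restr F (D r') ?V S' \<in> carrier (sect F ?V)"
      using Sc V or or' by simp_all
    have dc: "?d \<in> carrier (sect F ?V)" using Sv by simp
    have Vf: "openin X (?V \<inter> D f)" "?V \<inter> D f \<subseteq> ?V" using V o by auto
    interpret Vf: Module.module "sect OX (?V \<inter> D f)" "sect F (?V \<inter> D f)" by (rule sect_module[OF Vf(1)])
    have onV: "restr F ?V (?V \<inter> D f) (restr F (D k) ?V s) = restr F (D f) (?V \<inter> D f) (Y M)"
      if k: "k \<in> carrier A" "?V \<subseteq> D k" and s: "E k M s" for k s M
    proof -
      note ok = D_open[OF k(1)]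
      have i: "openin X (D k \<inter> D f)" "?V \<inter> D f \<subseteq> D k \<inter> D f" using ok o k by auto
      have sc: "s \<in> carrier (sect F (D k))" and sY: "restr F (D k) (D k \<inter> D f) s = restr F (D f) (D k \<inter> D f) (Y M)"
        using s by (auto simp: E_def)
      have "restr F ?V (?V \<inter> D f) (restr F (D k) ?V s) = restr F (D k) (?V \<inter> D f) s"
        by (rule restr_restr[OF ok V(1) Vf(1,2) k(2) sc])
      also have "\<dots> = restr F (D k \<inter> D f) (?V \<inter> D f) (restr F (D k) (D k \<inter> D f) s)"
        by (rule restr_restr[OF ok i(1) Vf(1) i(2) _ sc, symmetric]) auto
      also have "\<dots> = restr F (D f) (?V \<inter> D f) (Y M)"
        unfolding sY by (rule restr_restr[OF o i(1) Vf(1) i(2) _ Yc]) auto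
      finally show ?thesis .
    qed
    have YV: "restr F (D f) (?V \<inter> D f) (Y N) \<in> carrier (sect F (?V \<inter> D f))" using o Vf Yc by simp
    have "restr F ?V (?V \<inter> D f) ?d = \<zero>\<^bsub>sect F (?V \<inter> D f)\<^esub>"
      unfolding restr_minus[OF V(1) Vf Sv] onV[OF r(1) V(2) S] onV[OF r(2) V(3) S']
      using YV by (simp add: a_minus_def Vf.M.r_neg)
    \<comment> \<open>The overlap is \<open>D (r r')\<close>, a distinguished set, so the torsion
      lemma applies to the difference of the two extensions on it.\<close>
    from torsion[OF rr f, unfolded D_mult[OF r], OF dc this]
    obtain m :: nat where m: "loc ?V (f [^] m) \<odot>\<^bsub>sect F ?V\<^esub> ?d = \<zero>\<^bsub>sect F ?V\<^esub>" by blast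
    define T where "T = loc (D r) (f [^] m) \<odot>\<^bsub>sect F (D r)\<^esub> S"
    define T' where "T' = loc (D r') (f [^] m) \<odot>\<^bsub>sect F (D r')\<^esub> S'"
    have T: "E r (m + N) T" "E r' (m + N) T'"
      unfolding T_def T'_def using raise r S S' by blast+
    have Tc: "T \<in> carrier (sect F (D r))" "T' \<in> carrier (sect F (D r'))" using T by (auto simp: E_def)
    have lV: "loc ?V (f [^] m) \<in> carrier (sect OX ?V)" using V f by simp
    have TV: "restr F (D r) ?V T = loc ?V (f [^] m) \<odot>\<^bsub>sect F ?V\<^esub> restr F (D r) ?V S"
      "restr F (D r') ?V T' = loc ?V (f [^] m) \<odot>\<^bsub>sect F ?V\<^esub> restr F (D r') ?V S'"
      unfolding T_def T'_def using or or' V D_sub r f Sc by (simp_all add: restr_smult)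
    have "loc ?V (f [^] m) \<odot>\<^bsub>sect F ?V\<^esub> restr F (D r) ?V S \<ominus>\<^bsub>sect F ?V\<^esub>
        loc ?V (f [^] m) \<odot>\<^bsub>sect F ?V\<^esub> restr F (D r') ?V S' = \<zero>\<^bsub>sect F ?V\<^esub>"
      using m plain_module.smult_minus_distr[OF sect_plain[OF V(1)] lV Sv] by simp
    then have TT: "restr F (D r) ?V T = restr F (D r') ?V T'"
      unfolding TV using lV Sv by (metis V.M.add.inv_solve_right V.M.l_zero V.M.minus_eq V.M.zero_closed V.smult_closed)
    obtain z where z: "z \<in> carrier (sect F (D r \<union> D r'))" "restr F (D r \<union> D r') (D r) z = T"
      "restr F (D r \<union> D r') (D r') z = T'"
      using sections_glue[OF or or' Tc TT] by blast
    have oU: "openin X (D r \<union> D r')" using or or' by auto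
    let ?z = "restr F (D r \<union> D r') (D t) z"
    have zc: "?z \<in> carrier (sect F (D t))" using z oU ot t by simp
    have tf: "openin X (D t \<inter> D f)" "D t \<inter> D f \<subseteq> D t" "D t \<inter> D f \<subseteq> D f" using ot o by auto
    \<comment> \<open>\<open>z\<close> is known only through its restrictions to \<open>D r\<close>
      and \<open>D r'\<close>, so the extension property over \<open>D t\<close> is verified after a
      further restriction to one of them.\<close>
    have loc_eq: "restr F (D t \<inter> D f) (D t \<inter> D f \<inter> D k) (restr F (D t) (D t \<inter> D f) ?z) =
        restr F (D t \<inter> D f) (D t \<inter> D f \<inter> D k) (restr F (D f) (D t \<inter> D f) (Y (m + N)))"
      if k: "k \<in> carrier A" "D k \<subseteq> D r \<union> D r'" and s: "E k (m + N) (restr F (D r \<union> D r') (D k) z)" for k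
    proof -
      note ok = D_open[OF k(1)]
      have i: "openin X (D t \<inter> D f \<inter> D k)" "D t \<inter> D f \<inter> D k \<subseteq> D t \<inter> D f" "openin X (D k \<inter> D f)"
        "D t \<inter> D f \<inter> D k \<subseteq> D k \<inter> D f" "D t \<inter> D f \<inter> D k \<subseteq> D t" "D t \<inter> D f \<inter> D k \<subseteq> D k" "D k \<inter> D f \<subseteq> D k" "D k \<inter> D f \<subseteq> D f"
        using ok ot o by auto
      have kc: "restr F (D r \<union> D r') (D k) z \<in> carrier (sect F (D k))"
        and kY: "restr F (D k) (D k \<inter> D f) (restr F (D r \<union> D r') (D k) z) = restr F (D f) (D k \<inter> D f) (Y (m + N))"
        using s by (auto simp: E_def)
      have "restr F (D t \<inter> D f) (D t \<inter> D f \<inter> D k) (restr F (D t) (D t \<inter> D f) ?z) = restr F (D t) (D t \<inter> D f \<inter> D k) ?z"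
        by (rule restr_restr[OF ot tf(1) i(1,2) tf(2) zc])
      also have "\<dots> = restr F (D r \<union> D r') (D t \<inter> D f \<inter> D k) z"
        by (rule restr_restr[OF oU ot i(1,5) t(2) z(1)])
      also have "\<dots> = restr F (D k) (D t \<inter> D f \<inter> D k) (restr F (D r \<union> D r') (D k) z)"
        by (rule restr_restr[OF oU ok i(1,6) k(2) z(1), symmetric])
      also have "\<dots> = restr F (D k \<inter> D f) (D t \<inter> D f \<inter> D k) (restr F (D k) (D k \<inter> D f) (restr F (D r \<union> D r') (D k) z))"
        by (rule restr_restr[OF ok i(3,1,4,7) kc, symmetric])
      also have "\<dots> = restr F (D f) (D t \<inter> D f \<inter> D k) (Y (m + N))"
        unfolding kY by (rule restr_restr[OF o i(3,1,4,8) Yc])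
      also have "\<dots> = restr F (D t \<inter> D f) (D t \<inter> D f \<inter> D k) (restr F (D f) (D t \<inter> D f) (Y (m + N)))"
        by (rule restr_restr[OF o tf(1) i(1,2) tf(3) Yc, symmetric])
      finally show ?thesis .
    qed
    have "restr F (D t) (D t \<inter> D f) ?z = restr F (D f) (D t \<inter> D f) (Y (m + N))"
    proof (rule sections_separated[OF tf(1)])
      show "restr F (D t) (D t \<inter> D f) ?z \<in> carrier (sect F (D t \<inter> D f))"
        "restr F (D f) (D t \<inter> D f) (Y (m + N)) \<in> carrier (sect F (D t \<inter> D f))"
        using zc Yc ot o tf by (auto intro: restr_closed)
      fix p assume p: "p \<in> D t \<inter> D f"
      then obtain k where k: "k = r \<or> k = r'" "p \<in> D t \<inter> D f \<inter> D k" using t by auto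
      have "restr F (D t \<inter> D f) (D t \<inter> D f \<inter> D k) (restr F (D t) (D t \<inter> D f) ?z) =
        restr F (D t \<inter> D f) (D t \<inter> D f \<inter> D k) (restr F (D f) (D t \<inter> D f) (Y (m + N)))"
        using k(1) T z(2,3) r by (intro loc_eq) auto
      moreover have "openin X (D t \<inter> D f \<inter> D k)" using k(1) tf or or' by auto
      ultimately show "\<exists>V. openin X V \<and> p \<in> V \<and> V \<subseteq> D t \<inter> D f \<and>
          restr F (D t \<inter> D f) V (restr F (D t) (D t \<inter> D f) ?z) =
          restr F (D t \<inter> D f) V (restr F (D f) (D t \<inter> D f) (Y (m + N)))"
        using k(2) by (intro exI[of _ "D t \<inter> D f \<inter> D k"] conjI inf_le1)
    qed
    then have "E t (m + N) ?z" using zc by (simp add: E_def)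
    then show "\<exists>n s. E t n s" by blast
  next
    fix p assume "p \<in> D \<one>"
    then have p: "p \<in> W" by (simp add: D_one)
    obtain h e where h: "h \<in> carrier A" "p \<in> D h" and e: "frame_on X OX F 2 (D h) e"
      using chart_frame[OF W order.refl p] by blast
    note oh = D_open[OF h(1)] and subh = D_sub[OF h(1)] and e' = frame_onD[OF e]
    interpret H: plain_module "sect OX (D h)" "sect F (D h)" by (rule sect_plain[OF oh])
    let ?V = "D h \<inter> D f"
    have hf: "h \<otimes> f \<in> carrier A" "D (h \<otimes> f) = ?V" using h f by (auto simp: D_mult)
    have V: "openin X ?V" "?V \<subseteq> D h" "?V \<subseteq> D f" "?V \<subseteq> W" using oh o sub by auto
    interpret V: plain_module "sect OX ?V" "sect F ?V" by (rule sect_plain[OF V(1)])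
    interpret l: ring_hom_cring A "sect OX ?V" "loc ?V" by (rule loc_hom[OF V(1,4)])
    note eV = frame_onD[OF frame_on_restrict[OF e V(1,2)]]
    let ?g = "restr F (D f) ?V \<gamma>"
    have gc: "?g \<in> carrier (sect F ?V)" using \<gamma> o V by simp
    obtain c0 c1 where c: "c0 \<in> carrier (sect OX ?V)" "c1 \<in> carrier (sect OX ?V)"
      "?g = c0 \<odot>\<^bsub>sect F ?V\<^esub> restr F (D h) ?V (e 0) \<oplus>\<^bsub>sect F ?V\<^esub> c1 \<odot>\<^bsub>sect F ?V\<^esub> restr F (D h) ?V (e 1)"
      using V.basis2_exists[OF eV(4) gc] by blast
    obtain n0 n1 :: nat and a0 a1 where a: "a0 \<in> carrier A" "a1 \<in> carrier A"
      and a0: "loc ?V ((h \<otimes> f) [^] n0) \<otimes>\<^bsub>sect OX ?V\<^esub> c0 = loc ?V a0"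
      and a1: "loc ?V ((h \<otimes> f) [^] n1) \<otimes>\<^bsub>sect OX ?V\<^esub> c1 = loc ?V a1"
      using extend_base[OF hf(1), unfolded hf(2), OF c(1)] extend_base[OF hf(1), unfolded hf(2), OF c(2)] by blast
    \<comment> \<open>A common exponent for both coordinates; each numerator is multiplied by the
      power of \<open>h f\<close> belonging to the other.\<close>
    define n where "n = n0 + n1"
    define b0 where "b0 = (h \<otimes> f) [^] n1 \<otimes> a0"
    define b1 where "b1 = (h \<otimes> f) [^] n0 \<otimes> a1"
    have b: "b0 \<in> carrier A" "b1 \<in> carrier A" using a hf by (simp_all add: b0_def b1_def)
    define q where "q k = loc ?V ((h \<otimes> f) [^] k)" for k :: nat
    have q: "q k \<in> carrier (sect OX ?V)" for k using V hf by (simp add: q_def)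
    have qadd: "q n = q n0 \<otimes>\<^bsub>sect OX ?V\<^esub> q n1"
      unfolding q_def n_def pow_add[OF hf(1)] by (rule loc_mult[OF V(1,4)]) (use hf in simp_all)
    have b0: "loc ?V b0 = q n \<otimes>\<^bsub>sect OX ?V\<^esub> c0"
    proof -
      have "loc ?V b0 = q n1 \<otimes>\<^bsub>sect OX ?V\<^esub> (q n0 \<otimes>\<^bsub>sect OX ?V\<^esub> c0)"
        unfolding b0_def q_def a0 by (rule loc_mult[OF V(1,4)]) (use hf a in simp_all)
      also have "\<dots> = q n \<otimes>\<^bsub>sect OX ?V\<^esub> c0"
        unfolding qadd using q[of n0] q[of n1] c(1) by (simp add: V.R.m_ac)
      finally show ?thesis .
    qed
    have b1: "loc ?V b1 = q n \<otimes>\<^bsub>sect OX ?V\<^esub> c1"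
    proof -
      have "loc ?V b1 = q n0 \<otimes>\<^bsub>sect OX ?V\<^esub> (q n1 \<otimes>\<^bsub>sect OX ?V\<^esub> c1)"
        unfolding b1_def q_def a1 by (rule loc_mult[OF V(1,4)]) (use hf a in simp_all)
      also have "\<dots> = q n \<otimes>\<^bsub>sect OX ?V\<^esub> c1"
        unfolding qadd using q[of n0] q[of n1] c(2) by (simp add: V.R.m_ac)
      finally show ?thesis .
    qed
    have u: "loc (D h) (h [^] n) \<in> Units (sect OX (D h))"
      by (rule loc_unit) (use h oh D_pow[OF h(1)] in simp_all)
    then obtain v where v: "v \<in> carrier (sect OX (D h))" "v \<otimes>\<^bsub>sect OX (D h)\<^esub> loc (D h) (h [^] n) = \<one>\<^bsub>sect OX (D h)\<^esub>"
      by (auto simp: Units_def)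
    interpret r: ring_hom_cring "sect OX (D h)" "sect OX ?V" "restr OX (D h) ?V"
      by (rule base_hom_cring[OF oh V(1,2)])
    define w where "w = restr OX (D h) ?V v"
    have w: "w \<in> carrier (sect OX ?V)" using v oh V by (simp add: w_def)
    have wh: "w \<otimes>\<^bsub>sect OX ?V\<^esub> loc ?V (h [^] n) = \<one>\<^bsub>sect OX ?V\<^esub>"
    proof -
      have "restr OX (D h) ?V (v \<otimes>\<^bsub>sect OX (D h)\<^esub> loc (D h) (h [^] n)) = w \<otimes>\<^bsub>sect OX ?V\<^esub> restr OX (D h) ?V (loc (D h) (h [^] n))"
        unfolding w_def by (rule r.hom_mult) (use v oh subh h in simp_all)
      moreover have "restr OX (D h) ?V (loc (D h) (h [^] n)) = loc ?V (h [^] n)"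
        by (rule restr_loc) (use oh V subh h in simp_all)
      ultimately show ?thesis unfolding v(2) by simp
    qed
    have lb: "loc (D h) b0 \<in> carrier (sect OX (D h))" "loc (D h) b1 \<in> carrier (sect OX (D h))"
      using oh subh b by simp_all
    define x where "x = loc (D h) b0 \<odot>\<^bsub>sect F (D h)\<^esub> e 0 \<oplus>\<^bsub>sect F (D h)\<^esub> loc (D h) b1 \<odot>\<^bsub>sect F (D h)\<^esub> e 1"
    have xc: "x \<in> carrier (sect F (D h))" unfolding x_def using lb e' by simp
    have lbV: "restr OX (D h) ?V (loc (D h) b0) = loc ?V b0" "restr OX (D h) ?V (loc (D h) b1) = loc ?V b1"
      by (rule restr_loc[OF oh V(1,2) subh b(1)], rule restr_loc[OF oh V(1,2) subh b(2)])
    have xV: "restr F (D h) ?V x = q n \<odot>\<^bsub>sect F ?V\<^esub> ?g"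
      unfolding x_def restr_comb[OF oh V(1,2) lb e'(2,3)] lbV b0 b1 c(3)
      using q[of n] c(1,2) eV(2,3) by (simp add: V.smult_r_distr V.smult_assoc1)
    \<comment> \<open>On \<open>D h \<inter> D f\<close> the section \<open>x\<close> is
      \<open>(h f)^n \<gamma>\<close>. Since \<open>h\<close> is invertible on all of
      \<open>D h\<close>, dividing by \<open>h^n\<close> leaves a section over \<open>D h\<close>,
      and it restricts to \<open>f^n \<gamma>\<close>.\<close>
    let ?s = "v \<odot>\<^bsub>sect F (D h)\<^esub> x"
    have sc: "?s \<in> carrier (sect F (D h))" using v xc oh by simp
    have lc: "loc ?V (h [^] n) \<in> carrier (sect OX ?V)" "loc ?V (f [^] n) \<in> carrier (sect OX ?V)"
      using V h f by simp_all
    have qn: "q n = loc ?V (h [^] n) \<otimes>\<^bsub>sect OX ?V\<^esub> loc ?V (f [^] n)"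
      unfolding q_def A.nat_pow_distrib[OF h(1) f] by (rule loc_mult[OF V(1,4)]) (use h f in simp_all)
    have "restr F (D h) ?V ?s = w \<odot>\<^bsub>sect F ?V\<^esub> (q n \<odot>\<^bsub>sect F ?V\<^esub> ?g)"
      unfolding restr_smult[OF oh V(1,2) v(1) xc] xV w_def ..
    also have "\<dots> = (w \<otimes>\<^bsub>sect OX ?V\<^esub> q n) \<odot>\<^bsub>sect F ?V\<^esub> ?g"
      using w q gc by (simp add: V.smult_assoc1)
    also have "w \<otimes>\<^bsub>sect OX ?V\<^esub> q n = w \<otimes>\<^bsub>sect OX ?V\<^esub> loc ?V (h [^] n) \<otimes>\<^bsub>sect OX ?V\<^esub> loc ?V (f [^] n)"
      unfolding qn by (rule V.R.m_assoc[OF w lc, symmetric])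
    also have "\<dots> = loc ?V (f [^] n)" unfolding wh by (rule V.R.l_one[OF lc(2)])
    also have "loc ?V (f [^] n) \<odot>\<^bsub>sect F ?V\<^esub> ?g = restr F (D f) ?V (Y n)"
    proof -
      have "restr F (D f) ?V (Y n) = restr OX (D f) ?V (loc (D f) (f [^] n)) \<odot>\<^bsub>sect F ?V\<^esub> ?g"
        unfolding Y_def by (rule restr_smult[OF o V(1,3) _ \<gamma>]) (use o sub f in simp)
      moreover have "restr OX (D f) ?V (loc (D f) (f [^] n)) = loc ?V (f [^] n)"
        by (rule restr_loc[OF o V(1,3) sub]) (use f in simp)
      ultimately show ?thesis by simp
    qed
    finally have "E h n ?s" using sc by (simp add: E_def)
    then show "\<exists>h\<in>carrier A. p \<in> D h \<and> (\<exists>n s. E h n s)" using h by blast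
  qed simp
  then obtain n s where s: "E \<one> n s" by blast
  have "W \<inter> D f = D f" using sub by auto
  then have "s \<in> carrier (sect F W)" "restr F W (D f) s = Y n"
    using s o Yc by (auto simp: E_def D_one)
  then show ?thesis unfolding Y_def by blast
qed

end

section \<open>Distinguished open sets of the spectrum\<close>

text \<open>Krull's argument: an ideal maximal among those that contain \<open>J\<close> and no
  power of \<open>f\<close> is prime. If \<open>a\<close> and \<open>b\<close> lie outside it, then
  adjoining either one produces a power of \<open>f\<close>, and the product of these powers would
  lie in the ideal as soon as \<open>a b\<close> does.\<close>

lemma (in cring) prime_avoiding_powers:
  assumes J: "ideal J R" and f: "f \<in> carrier R" and no: "\<And>n::nat. f [^] n \<notin> J"
  shows "\<exists>P. primeideal P R \<and> J \<subseteq> P \<and> f \<notin> P"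
proof -
  let ?A = "{I. ideal I R \<and> J \<subseteq> I \<and> (\<forall>n::nat. f [^] n \<notin> I)}"
  have "\<exists>M\<in>?A. \<forall>I\<in>?A. M \<subseteq> I \<longrightarrow> I = M"
  proof (rule subset_Zorn)
    fix C assume "subset.chain ?A C"
    then have C: "C \<subseteq> ?A" "\<And>I I'. I \<in> C \<Longrightarrow> I' \<in> C \<Longrightarrow> I \<subseteq> I' \<or> I' \<subseteq> I"
      by (auto simp: subset.chain_def)
    show "\<exists>U\<in>?A. \<forall>I\<in>C. I \<subseteq> U"
    proof (cases "C = {}")
      case True
      then show ?thesis using J no by blast
    next
      case False
      have id: "ideal I R" if "I \<in> C" for I using that C(1) by blast
      have "ideal (\<Union>C) R"
      proof (rule cring_idealI)
        show "\<Union>C \<subseteq> carrier R" using ideal.Icarr[OF id] by blast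
        obtain I where "I \<in> C" using False by blast
        then show "\<zero> \<in> \<Union>C" using additive_subgroup.zero_closed[OF ideal.axioms(1)[OF id]] by blast
      next
        fix a b assume "a \<in> \<Union>C" "b \<in> \<Union>C"
        then obtain I I' where I: "a \<in> I" "I \<in> C" "b \<in> I'" "I' \<in> C" by blast
        then obtain K where "K \<in> C" "a \<in> K" "b \<in> K" using C(2)[OF I(2,4)] by blast
        then show "a \<oplus> b \<in> \<Union>C"
          using additive_subgroup.a_closed[OF ideal.axioms(1)[OF id]] by blast
      next
        fix r a assume "r \<in> carrier R" "a \<in> \<Union>C"
        then show "r \<otimes> a \<in> \<Union>C" using ideal.I_l_closed[OF id] by blast
      qed
      moreover have "J \<subseteq> \<Union>C" using False C(1) by blast
      moreover have "\<forall>n::nat. f [^] n \<notin> \<Union>C" using C(1) by blast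
      ultimately show ?thesis by blast
    qed
  qed
  then obtain M where MA: "M \<in> ?A" and mx: "\<forall>I\<in>?A. M \<subseteq> I \<longrightarrow> I = M" by (elim bexE)
  have M: "ideal M R" "J \<subseteq> M" "\<And>n::nat. f [^] n \<notin> M" using MA by simp_all
  have max: "I = M" if "ideal I R" "J \<subseteq> I" "\<And>n::nat. f [^] n \<notin> I" "M \<subseteq> I" for I
    using mx that by simp
  interpret M: ideal M R by (rule M(1))
  have grow: "\<exists>n::nat. \<exists>m\<in>M. \<exists>x\<in>carrier R. f [^] n = m \<oplus> x \<otimes> a" if a: "a \<in> carrier R" "a \<notin> M" for a
  proof (rule ccontr)
    assume neg: "\<not> ?thesis"
    \<comment> \<open>The ideal generated by \<open>M\<close> and \<open>a\<close>. Were it free of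
      powers of \<open>f\<close>, maximality would make it equal to \<open>M\<close>, which does not
      contain \<open>a\<close>.\<close>
    let ?I = "{m \<oplus> x \<otimes> a | m x. m \<in> M \<and> x \<in> carrier R}"
    have "ideal ?I R"
    proof (rule cring_idealI)
      show "?I \<subseteq> carrier R" using a M.Icarr by auto
      show "\<zero> \<in> ?I" using a by (auto intro!: exI[of _ \<zero>])
    next
      fix y z assume "y \<in> ?I" "z \<in> ?I"
      then obtain m x m' x' where m: "y = m \<oplus> x \<otimes> a" "m \<in> M" "x \<in> carrier R"
        "z = m' \<oplus> x' \<otimes> a" "m' \<in> M" "x' \<in> carrier R" by blast
      have "y \<oplus> z = (m \<oplus> m') \<oplus> (x \<oplus> x') \<otimes> a"
        using m a M.Icarr by (simp add: l_distr a_ac)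
      then show "y \<oplus> z \<in> ?I" using m by blast
    next
      fix r y assume r: "r \<in> carrier R" and "y \<in> ?I"
      then obtain m x where m: "y = m \<oplus> x \<otimes> a" "m \<in> M" "x \<in> carrier R" by blast
      have "r \<otimes> y = r \<otimes> m \<oplus> (r \<otimes> x) \<otimes> a"
        using m a r M.Icarr by (simp add: r_distr m_assoc)
      then show "r \<otimes> y \<in> ?I" using m r M.I_l_closed by blast
    qed
    moreover have MI: "M \<subseteq> ?I"
    proof
      fix m assume m: "m \<in> M"
      then have "m = m \<oplus> \<zero> \<otimes> a" using a M.Icarr by simp
      then show "m \<in> ?I" using m by blast
    qed
    moreover have "f [^] n \<notin> ?I" for n :: nat using neg by blast
    ultimately have "?I = M" using max[of ?I] M(2) by (meson order_trans)
    moreover have "a \<in> ?I"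
    proof -
      have "a = \<zero> \<oplus> \<one> \<otimes> a" using a by simp
      then show ?thesis using M.zero_closed by blast
    qed
    ultimately show False using a by simp
  qed
  have "primeideal M R"
  proof (rule primeidealI[OF M(1) cring_axioms])
    \<comment> \<open>Properness is the case of the exponent 0, where the power of \<open>f\<close>
      is 1.\<close>
    show "carrier R \<noteq> M" using M(3)[of 0] by auto
    fix a b assume ab: "a \<in> carrier R" "b \<in> carrier R" "a \<otimes> b \<in> M"
    show "a \<in> M \<or> b \<in> M"
    proof (rule ccontr)
      assume "\<not> (a \<in> M \<or> b \<in> M)"
      then obtain n n' :: nat and m x m' x' where m: "m \<in> M" "x \<in> carrier R" "f [^] n = m \<oplus> x \<otimes> a"
        "m' \<in> M" "x' \<in> carrier R" "f [^] n' = m' \<oplus> x' \<otimes> b"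
        using grow[of a] grow[of b] ab by blast
      have mc: "m \<in> carrier R" "m' \<in> carrier R" using m M.Icarr by auto
      have "f [^] (n + n') = (m \<oplus> x \<otimes> a) \<otimes> (m' \<oplus> x' \<otimes> b)"
        using f m(3,6) by (simp add: nat_pow_mult[symmetric])
      also have "\<dots> = (m' \<oplus> x' \<otimes> b) \<otimes> m \<oplus> ((x \<otimes> a) \<otimes> m' \<oplus> (x \<otimes> x') \<otimes> (a \<otimes> b))"
        using mc m(2,5) ab by algebra
      also have "\<dots> \<in> M"
        by (intro M.a_closed M.I_l_closed[OF m(1)] M.I_l_closed[OF m(4)] M.I_l_closed[OF ab(3)])
           (use mc m(2,5) ab in simp_all)
      finally show False using M(3) by blast
    qed
  qed
  moreover have "f \<notin> M" using M(3)[of 1] f by simp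
  ultimately show ?thesis using M(2) by blast
qed

section \<open>Fractions at a prime ideal\<close>

locale prime_localization = cring A + P: primeideal P A for A (structure) and P
begin

lemma one_notin: "\<one> \<notin> P"
  using P.I_notcarr P.one_imp_carrier by blast

lemma mult_notin: "s \<in> carrier A - P \<Longrightarrow> t \<in> carrier A - P \<Longrightarrow> s \<otimes> t \<in> carrier A - P"
  using P.I_prime by auto

lemma frac_mem_iff:
  "(b, t) \<in> local_frac A P a s \<longleftrightarrow> b \<in> carrier A \<and> t \<in> carrier A - P \<and>
     (\<exists>u\<in>carrier A - P. u \<otimes> (a \<otimes> t \<ominus> b \<otimes> s) = \<zero>)"
  by (simp add: local_frac_def)

lemma frac_self:
  assumes "a \<in> carrier A" "s \<in> carrier A - P" shows "(a, s) \<in> local_frac A P a s"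
  unfolding frac_mem_iff using assms one_notin
  by (intro conjI bexI[of _ \<one>]) (auto simp: a_minus_def r_neg)

text \<open>In the presence of zero divisors the middle denominator \<open>t\<close> has to enter
  the witness, which is \<open>u v t\<close>.\<close>

lemma frac_trans:
  assumes c: "a \<in> carrier A" "b \<in> carrier A" "d \<in> carrier A"
    and s: "s \<in> carrier A - P" "t \<in> carrier A - P" "r \<in> carrier A - P"
    and u: "u \<in> carrier A - P" "u \<otimes> (a \<otimes> t \<ominus> b \<otimes> s) = \<zero>"
    and v: "v \<in> carrier A - P" "v \<otimes> (b \<otimes> r \<ominus> d \<otimes> t) = \<zero>"
  shows "\<exists>w\<in>carrier A - P. w \<otimes> (a \<otimes> r \<ominus> d \<otimes> s) = \<zero>"
proof (rule bexI[of _ "(u \<otimes> v) \<otimes> t"])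
  have cl: "s \<in> carrier A" "t \<in> carrier A" "r \<in> carrier A" "u \<in> carrier A" "v \<in> carrier A" using s u v by auto
  have "((u \<otimes> v) \<otimes> t) \<otimes> (a \<otimes> r \<ominus> d \<otimes> s) =
      (v \<otimes> r) \<otimes> (u \<otimes> (a \<otimes> t \<ominus> b \<otimes> s)) \<oplus> (u \<otimes> s) \<otimes> (v \<otimes> (b \<otimes> r \<ominus> d \<otimes> t))"
    using c cl by algebra
  then show "((u \<otimes> v) \<otimes> t) \<otimes> (a \<otimes> r \<ominus> d \<otimes> s) = \<zero>" unfolding u(2) v(2) using cl by simp
  show "(u \<otimes> v) \<otimes> t \<in> carrier A - P" using s u v mult_notin by blast
qed

lemma frac_sym:
  assumes "a \<in> carrier A" "b \<in> carrier A" "s \<in> carrier A" "t \<in> carrier A" "u \<in> carrier A"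
    and "u \<otimes> (a \<otimes> t \<ominus> b \<otimes> s) = \<zero>"
  shows "u \<otimes> (b \<otimes> s \<ominus> a \<otimes> t) = \<zero>"
proof -
  have "u \<otimes> (b \<otimes> s \<ominus> a \<otimes> t) = \<ominus> (u \<otimes> (a \<otimes> t \<ominus> b \<otimes> s))" using assms(1-5) by algebra
  then show ?thesis unfolding assms(6) by simp
qed

lemma frac_eq_iff:
  assumes a: "a \<in> carrier A" "s \<in> carrier A - P" and b: "b \<in> carrier A" "t \<in> carrier A - P"
  shows "local_frac A P a s = local_frac A P b t \<longleftrightarrow> (\<exists>u\<in>carrier A - P. u \<otimes> (a \<otimes> t \<ominus> b \<otimes> s) = \<zero>)"
proof
  assume "local_frac A P a s = local_frac A P b t"
  then have "(b, t) \<in> local_frac A P a s" using frac_self[OF b] by (simp only:)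
  then show "\<exists>u\<in>carrier A - P. u \<otimes> (a \<otimes> t \<ominus> b \<otimes> s) = \<zero>"
    by (simp only: frac_mem_iff)
next
  assume "\<exists>u\<in>carrier A - P. u \<otimes> (a \<otimes> t \<ominus> b \<otimes> s) = \<zero>"
  then obtain u where u: "u \<in> carrier A - P" "u \<otimes> (a \<otimes> t \<ominus> b \<otimes> s) = \<zero>" by blast
  have u': "u \<otimes> (b \<otimes> s \<ominus> a \<otimes> t) = \<zero>" using frac_sym[OF a(1) b(1) _ _ _ u(2)] a b u by blast
  have "(d, r) \<in> local_frac A P a s \<longleftrightarrow> (d, r) \<in> local_frac A P b t" for d r
  proof
    assume "(d, r) \<in> local_frac A P a s"
    then show "(d, r) \<in> local_frac A P b t"
      unfolding frac_mem_iff using frac_trans[OF b(1) a(1) _ b(2) a(2) _ u(1) u'] by blast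
  next
    assume "(d, r) \<in> local_frac A P b t"
    then show "(d, r) \<in> local_frac A P a s"
      unfolding frac_mem_iff using frac_trans[OF a(1) b(1) _ a(2) b(2) _ u] by blast
  qed
  then show "local_frac A P a s = local_frac A P b t" by auto
qed

lemma frac_UN:
  assumes "a \<in> carrier A" "s \<in> carrier A - P"
    and "\<And>b t. (b, t) \<in> local_frac A P a s \<Longrightarrow> g b t = c"
  shows "(\<Union>(b, t)\<in>local_frac A P a s. g b t) = c"
proof -
  have "(\<Union>(b, t)\<in>local_frac A P a s. g b t) = (\<Union>(b, t)\<in>local_frac A P a s. c)"
    by (intro SUP_cong refl) (use assms(3) in auto)
  then show ?thesis using frac_self[OF assms(1,2)] by auto
qed

lemma frac_mult:
  assumes a: "a \<in> carrier A" "s \<in> carrier A - P" and b: "b \<in> carrier A" "t \<in> carrier A - P"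
  shows "local_frac A P a s \<otimes>\<^bsub>localization A P\<^esub> local_frac A P b t = local_frac A P (a \<otimes> b) (s \<otimes> t)"
proof -
  have "local_frac A P (a' \<otimes> b') (s' \<otimes> t') = local_frac A P (a \<otimes> b) (s \<otimes> t)"
    if m: "(a', s') \<in> local_frac A P a s" "(b', t') \<in> local_frac A P b t" for a' s' b' t'
  proof -
    obtain u v where u: "u \<in> carrier A - P" "u \<otimes> (a \<otimes> s' \<ominus> a' \<otimes> s) = \<zero>"
      and v: "v \<in> carrier A - P" "v \<otimes> (b \<otimes> t' \<ominus> b' \<otimes> t) = \<zero>"
      and a': "a' \<in> carrier A" "s' \<in> carrier A - P" and b': "b' \<in> carrier A" "t' \<in> carrier A - P"
      using m by (auto simp: frac_mem_iff)
    have cl: "s \<in> carrier A" "t \<in> carrier A" "s' \<in> carrier A" "t' \<in> carrier A" "u \<in> carrier A" "v \<in> carrier A"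
      using a b a' b' u v by auto
    \<comment> \<open>The difference of the two products is split so that one summand contains the
      expression killed by \<open>u\<close> and the other the one killed by
      \<open>v\<close>.\<close>
    have "(u \<otimes> v) \<otimes> ((a \<otimes> b) \<otimes> (s' \<otimes> t') \<ominus> (a' \<otimes> b') \<otimes> (s \<otimes> t)) =
        (v \<otimes> (b \<otimes> t')) \<otimes> (u \<otimes> (a \<otimes> s' \<ominus> a' \<otimes> s)) \<oplus> (u \<otimes> (a' \<otimes> s)) \<otimes> (v \<otimes> (b \<otimes> t' \<ominus> b' \<otimes> t))"
      using a(1) b(1) a'(1) b'(1) cl by algebra
    also have "\<dots> = \<zero>" unfolding u(2) v(2) using a b a' b' cl by simp
    finally have "local_frac A P (a \<otimes> b) (s \<otimes> t) = local_frac A P (a' \<otimes> b') (s' \<otimes> t')"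
      using a b a' b' u v mult_notin by (subst frac_eq_iff) blast+
    then show ?thesis ..
  qed
  then show ?thesis
    unfolding localization_def monoid.select_convs ring.select_convs
    by (intro frac_UN[OF a] frac_UN[OF b])
qed

lemma frac_add:
  assumes a: "a \<in> carrier A" "s \<in> carrier A - P" and b: "b \<in> carrier A" "t \<in> carrier A - P"
  shows "local_frac A P a s \<oplus>\<^bsub>localization A P\<^esub> local_frac A P b t =
    local_frac A P (a \<otimes> t \<oplus> b \<otimes> s) (s \<otimes> t)"
proof -
  have "local_frac A P (a' \<otimes> t' \<oplus> b' \<otimes> s') (s' \<otimes> t') = local_frac A P (a \<otimes> t \<oplus> b \<otimes> s) (s \<otimes> t)"
    if m: "(a', s') \<in> local_frac A P a s" "(b', t') \<in> local_frac A P b t" for a' s' b' t'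
  proof -
    obtain u v where u: "u \<in> carrier A - P" "u \<otimes> (a \<otimes> s' \<ominus> a' \<otimes> s) = \<zero>"
      and v: "v \<in> carrier A - P" "v \<otimes> (b \<otimes> t' \<ominus> b' \<otimes> t) = \<zero>"
      and a': "a' \<in> carrier A" "s' \<in> carrier A - P" and b': "b' \<in> carrier A" "t' \<in> carrier A - P"
      using m by (auto simp: frac_mem_iff)
    have cl: "s \<in> carrier A" "t \<in> carrier A" "s' \<in> carrier A" "t' \<in> carrier A" "u \<in> carrier A" "v \<in> carrier A"
      using a b a' b' u v by auto
    have "(u \<otimes> v) \<otimes> ((a \<otimes> t \<oplus> b \<otimes> s) \<otimes> (s' \<otimes> t') \<ominus> (a' \<otimes> t' \<oplus> b' \<otimes> s') \<otimes> (s \<otimes> t)) =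
        (v \<otimes> (t \<otimes> t')) \<otimes> (u \<otimes> (a \<otimes> s' \<ominus> a' \<otimes> s)) \<oplus> (u \<otimes> (s \<otimes> s')) \<otimes> (v \<otimes> (b \<otimes> t' \<ominus> b' \<otimes> t))"
      using a(1) b(1) a'(1) b'(1) cl by algebra
    also have "\<dots> = \<zero>" unfolding u(2) v(2) using a b a' b' cl by simp
    finally have "local_frac A P (a \<otimes> t \<oplus> b \<otimes> s) (s \<otimes> t) = local_frac A P (a' \<otimes> t' \<oplus> b' \<otimes> s') (s' \<otimes> t')"
      using a b a' b' u v mult_notin cl by (subst frac_eq_iff) blast+
    then show ?thesis ..
  qed
  then show ?thesis
    unfolding localization_def monoid.select_convs ring.select_convs
    by (intro frac_UN[OF a] frac_UN[OF b])
qed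

lemma frac_closed: "a \<in> carrier A \<Longrightarrow> s \<in> carrier A - P \<Longrightarrow> local_frac A P a s \<in> carrier (localization A P)"
  by (auto simp: localization_def)

end

section \<open>Distinguished open sets as a basis of the topology\<close>

definition distinguished :: "('r, 'z) ring_scheme \<Rightarrow> 'r \<Rightarrow> 'r set set" where
  "distinguished A f = {P. primeideal P A \<and> f \<notin> P}"

lemma distinguished_open: "f \<in> carrier A \<Longrightarrow> openin (spec_topology A) (distinguished A f)"
  unfolding spec_topology_def distinguished_def by (rule topology_generated_by_Basis) blast

lemma (in cring) distinguished_one: "distinguished R \<one> = {P. primeideal P R}"
  unfolding distinguished_def
  using prime_localization.one_notin[unfolded prime_localization_def] cring_axioms by blast

lemma (in cring) spec_topspace: "topspace (spec_topology R) = {P. primeideal P R}"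
proof -
  have "topspace (spec_topology R) = \<Union>(distinguished R ` carrier R)"
    unfolding spec_topology_def topology_generated_by_topspace distinguished_def ..
  also have "\<dots> = {P. primeideal P R}"
    using distinguished_one by (auto simp: distinguished_def)
  finally show ?thesis .
qed

lemma (in cring) distinguished_mult:
  assumes "f \<in> carrier R" "g \<in> carrier R"
  shows "distinguished R (f \<otimes> g) = distinguished R f \<inter> distinguished R g"
proof -
  have "f \<otimes> g \<in> P \<longleftrightarrow> f \<in> P \<or> g \<in> P" if "primeideal P R" for P
  proof -
    interpret P: primeideal P R by fact
    show ?thesis using assms P.I_prime P.I_l_closed P.I_r_closed by blast
  qed
  then show ?thesis by (auto simp: distinguished_def)
qed

text \<open>Induction over the generated topology; an intersection of two distinguished sets is the
  distinguished set of the product.\<close>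

lemma (in cring) distinguished_basis:
  assumes "openin (spec_topology R) V" "P \<in> V"
  shows "\<exists>f\<in>carrier R. P \<in> distinguished R f \<and> distinguished R f \<subseteq> V"
proof -
  have "generate_topology_on (distinguished R ` carrier R) V"
    using assms(1) unfolding spec_topology_def openin_topology_generated_by_iff distinguished_def .
  then show ?thesis
    using assms(2)
  proof (induction arbitrary: P rule: generate_topology_on.induct)
    case (Int a b)
    then obtain f g where "f \<in> carrier R" "P \<in> distinguished R f" "distinguished R f \<subseteq> a"
      "g \<in> carrier R" "P \<in> distinguished R g" "distinguished R g \<subseteq> b" by blast
    then show ?case by (intro bexI[of _ "f \<otimes> g"]) (auto simp: distinguished_mult)
  next
    case (UN K)
    then show ?case by blast
  qed auto
qed

section \<open>From an isomorphism with a spectrum to a chart\<close>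

locale affine_iso = ringed_base X OX + A: cring A
  for X :: "'p topology" and OX :: "('p, 'r, 'z) presheaf" and A :: "('b, 'y) ring_scheme" (structure) +
  fixes U :: "'p set" and h :: "'p \<Rightarrow> 'b set" and \<phi> :: "'p set \<Rightarrow> 'r \<Rightarrow> 'b set \<Rightarrow> ('b \<times> 'b) set"
  assumes U: "openin X U" and h: "homeomorphic_map (subtopology X U) (spec_topology A) h"
    and \<phi>: "openin X V \<Longrightarrow> V \<subseteq> U \<Longrightarrow> \<phi> V \<in> ring_iso (sect OX V) (sect (spec_sheaf A) (h ` V))"
    and \<phi>_restr: "openin X V \<Longrightarrow> openin X W \<Longrightarrow> W \<subseteq> V \<Longrightarrow> V \<subseteq> U \<Longrightarrow> s \<in> carrier (sect OX V) \<Longrightarrow>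
      \<phi> W (restr OX V W s) = restr (spec_sheaf A) (h ` V) (h ` W) (\<phi> V s)"
begin

lemma topspace_U: "topspace (subtopology X U) = U"
  using openin_subset[OF U] by auto

lemma h_inj: "inj_on h U"
  using homeomorphic_imp_injective_map[OF h] unfolding topspace_U .

lemma h_image: "h ` U = {P. primeideal P A}"
  using homeomorphic_imp_surjective_map[OF h] unfolding topspace_U A.spec_topspace .

lemma h_prime: "p \<in> U \<Longrightarrow> prime_localization A (h p)"
  using h_image A.cring_axioms by (auto simp: prime_localization_def)

lemma h_open: "openin X V \<Longrightarrow> V \<subseteq> U \<Longrightarrow> openin (spec_topology A) (h ` V)"
  using homeomorphic_imp_open_map[OF h] U by (simp add: open_map_def openin_open_subtopology)

lemma h_preimage:
  assumes "openin (spec_topology A) N" shows "openin X {p \<in> U. h p \<in> N}"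
proof -
  have "openin (subtopology X U) {p \<in> topspace (subtopology X U). h p \<in> N}"
    using homeomorphic_imp_continuous_map[OF h] assms by (rule openin_continuous_map_preimage)
  then show ?thesis unfolding topspace_U openin_open_subtopology[OF U] by simp
qed

text \<open>The value of \<open>s\<close> in the localization of \<open>A\<close> at the prime
  corresponding to \<open>p\<close>. Equations between sections of \<open>OX\<close> are proved by
  comparing these values, via \<open>val_at_ext\<close>.\<close>

definition val_at where "val_at V s p = \<phi> V s (h p)"

lemma sheaf_mult: "f \<otimes>\<^bsub>sect (spec_sheaf A) N\<^esub> g = (\<lambda>P\<in>N. f P \<otimes>\<^bsub>localization A P\<^esub> g P)"
  and sheaf_add: "f \<oplus>\<^bsub>sect (spec_sheaf A) N\<^esub> g = (\<lambda>P\<in>N. f P \<oplus>\<^bsub>localization A P\<^esub> g P)"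
  and sheaf_one: "\<one>\<^bsub>sect (spec_sheaf A) N\<^esub> = (\<lambda>P\<in>N. local_frac A P \<one> \<one>)"
  and sheaf_carrier: "carrier (sect (spec_sheaf A) N) = {f \<in> (\<Pi>\<^sub>E P\<in>N. carrier (localization A P)).
         \<forall>P\<in>N. \<exists>V. \<exists>a\<in>carrier A. \<exists>s\<in>carrier A.
           openin (spec_topology A) V \<and> P \<in> V \<and> V \<subseteq> N \<and> (\<forall>Q\<in>V. s \<notin> Q \<and> f Q = local_frac A Q a s)}"
  and sheaf_restr: "restr (spec_sheaf A) N N' f = restrict f N'"
  by (simp_all add: spec_sheaf_def localization_def)

lemma \<phi>_closed: "openin X V \<Longrightarrow> V \<subseteq> U \<Longrightarrow> s \<in> carrier (sect OX V) \<Longrightarrow> \<phi> V s \<in> carrier (sect (spec_sheaf A) (h ` V))"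
  by (rule ring_iso_memE(1)[OF \<phi>])

lemma val_at_mult:
  assumes "openin X V" "V \<subseteq> U" "s \<in> carrier (sect OX V)" "t \<in> carrier (sect OX V)" "p \<in> V"
  shows "val_at V (s \<otimes>\<^bsub>sect OX V\<^esub> t) p = val_at V s p \<otimes>\<^bsub>localization A (h p)\<^esub> val_at V t p"
  using assms ring_iso_memE(2)[OF \<phi>[OF assms(1,2)] assms(3,4)] by (simp add: val_at_def sheaf_mult)

lemma val_at_add:
  assumes "openin X V" "V \<subseteq> U" "s \<in> carrier (sect OX V)" "t \<in> carrier (sect OX V)" "p \<in> V"
  shows "val_at V (s \<oplus>\<^bsub>sect OX V\<^esub> t) p = val_at V s p \<oplus>\<^bsub>localization A (h p)\<^esub> val_at V t p"
  using assms ring_iso_memE(3)[OF \<phi>[OF assms(1,2)] assms(3,4)] by (simp add: val_at_def sheaf_add)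

lemma val_at_one:
  assumes "openin X V" "V \<subseteq> U" "p \<in> V"
  shows "val_at V \<one>\<^bsub>sect OX V\<^esub> p = local_frac A (h p) \<one> \<one>"
  using assms ring_iso_memE(4)[OF \<phi>[OF assms(1,2)]] by (simp add: val_at_def sheaf_one)

lemma val_at_restr:
  assumes "openin X V" "openin X W" "W \<subseteq> V" "V \<subseteq> U" "s \<in> carrier (sect OX V)" "p \<in> W"
  shows "val_at W (restr OX V W s) p = val_at V s p"
  using assms by (simp add: val_at_def \<phi>_restr sheaf_restr)

lemma val_at_ext:
  assumes V: "openin X V" "V \<subseteq> U" and s: "s \<in> carrier (sect OX V)" "t \<in> carrier (sect OX V)"
    and eq: "\<And>p. p \<in> V \<Longrightarrow> val_at V s p = val_at V t p"
  shows "s = t"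
proof -
  have "\<phi> V s \<in> extensional (h ` V)" "\<phi> V t \<in> extensional (h ` V)"
    using \<phi>_closed[OF V s(1)] \<phi>_closed[OF V s(2)] unfolding sheaf_carrier by (auto simp: PiE_def)
  then have "\<phi> V s = \<phi> V t"
    using eq by (intro extensionalityI[of _ "h ` V"]) (auto simp: val_at_def)
  moreover have "inj_on (\<phi> V) (carrier (sect OX V))"
    using ring_iso_memE(5)[OF \<phi>[OF V]] by (rule bij_betw_imp_inj_on)
  ultimately show ?thesis using s by (simp add: inj_on_eq_iff)
qed

text \<open>The neighbourhood in the spectrum supplied by the definition of a section is pulled back
  along \<open>h\<close>; it lies in \<open>V\<close> because \<open>h\<close> is injective on
  \<open>U\<close>.\<close>

lemma val_at_local:
  assumes V: "openin X V" "V \<subseteq> U" and s: "s \<in> carrier (sect OX V)" and p: "p \<in> V"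
  shows "\<exists>V' a t. openin X V' \<and> p \<in> V' \<and> V' \<subseteq> V \<and> a \<in> carrier A \<and> t \<in> carrier A \<and>
    (\<forall>q\<in>V'. t \<notin> h q \<and> val_at V s q = local_frac A (h q) a t)"
proof -
  have "\<exists>N. \<exists>a\<in>carrier A. \<exists>t\<in>carrier A. openin (spec_topology A) N \<and> h p \<in> N \<and> N \<subseteq> h ` V \<and>
      (\<forall>Q\<in>N. t \<notin> Q \<and> \<phi> V s Q = local_frac A Q a t)"
    using \<phi>_closed[OF V s] p unfolding sheaf_carrier by simp
  then obtain N a t where N: "a \<in> carrier A" "t \<in> carrier A" "openin (spec_topology A) N" "h p \<in> N" "N \<subseteq> h ` V"
    "\<forall>Q\<in>N. t \<notin> Q \<and> \<phi> V s Q = local_frac A Q a t" by blast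
  let ?V' = "{q \<in> U. h q \<in> N}"
  have "?V' \<subseteq> V"
  proof
    fix q assume q: "q \<in> ?V'"
    then obtain q' where q': "q' \<in> V" "h q = h q'" using N(5) by blast
    then have "q = q'" using h_inj q V(2) by (auto dest: inj_onD)
    then show "q \<in> V" using q' by simp
  qed
  then show ?thesis
    using h_preimage[OF N(3)] N V p
    by (intro exI[where x = "?V'"] exI[where x = a] exI[where x = t] conjI ballI) (simp_all add: val_at_def subset_iff)
qed

text \<open>A single fraction whose denominator vanishes nowhere on \<open>h\<close>
  V\<open>is a section there, with\<close>h \<open>V\<close> itself as neighbourhood of each point;
  \<open>\<phi> V\<close> is surjective.\<close>

lemma val_at_realize:
  assumes V: "openin X V" "V \<subseteq> U" and a: "a \<in> carrier A" "t \<in> carrier A" and t: "\<And>p. p \<in> V \<Longrightarrow> t \<notin> h p"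
  shows "\<exists>s\<in>carrier (sect OX V). \<forall>p\<in>V. val_at V s p = local_frac A (h p) a t"
proof -
  let ?f = "\<lambda>P\<in>h ` V. local_frac A P a t"
  have fc: "local_frac A P a t \<in> carrier (localization A P)" if P: "P \<in> h ` V" for P
  proof -
    obtain p where p: "p \<in> V" "P = h p" using P by (rule imageE) blast
    have "prime_localization A P" unfolding p(2) by (rule h_prime) (use p V in blast)
    then show ?thesis using a t p by (intro prime_localization.frac_closed) simp_all
  qed
  have nt: "t \<notin> P" if "P \<in> h ` V" for P using that t by (elim imageE) simp
  have "?f \<in> (\<Pi>\<^sub>E P\<in>h ` V. carrier (localization A P))" using fc by simp
  moreover have "\<forall>P\<in>h ` V. \<exists>N. \<exists>b\<in>carrier A. \<exists>s\<in>carrier A.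
        openin (spec_topology A) N \<and> P \<in> N \<and> N \<subseteq> h ` V \<and> (\<forall>Q\<in>N. s \<notin> Q \<and> ?f Q = local_frac A Q b s)"
  proof
    fix P assume P: "P \<in> h ` V"
    have "\<forall>Q\<in>h ` V. t \<notin> Q \<and> ?f Q = local_frac A Q a t" using nt by simp
    then have "openin (spec_topology A) (h ` V) \<and> P \<in> h ` V \<and> h ` V \<subseteq> h ` V \<and> (\<forall>Q\<in>h ` V. t \<notin> Q \<and> ?f Q = local_frac A Q a t)"
      using h_open[OF V] P by blast
    then show "\<exists>N. \<exists>b\<in>carrier A. \<exists>s\<in>carrier A.
        openin (spec_topology A) N \<and> P \<in> N \<and> N \<subseteq> h ` V \<and> (\<forall>Q\<in>N. s \<notin> Q \<and> ?f Q = local_frac A Q b s)"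
      by (rule exI[where x = "h ` V", OF bexI[where x = a, OF bexI[where x = t]]]) (rule a)+
  qed
  ultimately have "?f \<in> carrier (sect (spec_sheaf A) (h ` V))"
    unfolding sheaf_carrier by simp
  moreover have "\<phi> V ` carrier (sect OX V) = carrier (sect (spec_sheaf A) (h ` V))"
    using ring_iso_memE(5)[OF \<phi>[OF V]] by (rule bij_betw_imp_surj_on)
  ultimately obtain s where s: "s \<in> carrier (sect OX V)" "\<phi> V s = ?f" by (metis imageE)
  then show ?thesis by (intro bexI[of _ s]) (auto simp: val_at_def)
qed

definition D where "D f = {p \<in> U. f \<notin> h p}"

text \<open>The function on \<open>U\<close> with value \<open>a / 1\<close> everywhere. It exists
  by \<open>val_at_realize\<close>, and \<open>val_at_ext\<close> makes it the only one, so the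
  choice is harmless.\<close>

definition \<iota> where "\<iota> a = (SOME s. s \<in> carrier (sect OX U) \<and> (\<forall>p\<in>U. val_at U s p = local_frac A (h p) a \<one>))"

lemma \<iota>:
  assumes "a \<in> carrier A"
  shows "\<iota> a \<in> carrier (sect OX U)" "p \<in> U \<Longrightarrow> val_at U (\<iota> a) p = local_frac A (h p) a \<one>"
proof -
  have "\<exists>s\<in>carrier (sect OX U). \<forall>p\<in>U. val_at U s p = local_frac A (h p) a \<one>"
    using assms prime_localization.one_notin[OF h_prime] by (intro val_at_realize[OF U]) auto
  then have "\<exists>s. s \<in> carrier (sect OX U) \<and> (\<forall>p\<in>U. val_at U s p = local_frac A (h p) a \<one>)" by blast
  from someI_ex[OF this] show "\<iota> a \<in> carrier (sect OX U)" "p \<in> U \<Longrightarrow> val_at U (\<iota> a) p = local_frac A (h p) a \<one>"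
    unfolding \<iota>_def by blast+
qed

lemma D_eq: "D f = {p \<in> U. h p \<in> distinguished A f}"
  using h_image by (auto simp: D_def distinguished_def)

lemma val_at_\<iota>_restr:
  assumes "a \<in> carrier A" "openin X V" "V \<subseteq> U" "p \<in> V"
  shows "val_at V (restr OX U V (\<iota> a)) p = local_frac A (h p) a \<one>"
  using assms by (subst val_at_restr[OF U]) (auto simp: \<iota>)

lemma \<iota>_hom: "\<iota> \<in> ring_hom A (sect OX U)"
proof (rule ring_hom_memI)
  interpret O: cring "sect OX U" by (rule base_cring[OF U])
  show "\<iota> a \<in> carrier (sect OX U)" if "a \<in> carrier A" for a using \<iota>(1)[OF that] .
  fix a b assume a: "a \<in> carrier A" and b: "b \<in> carrier A"
  show "\<iota> (a \<otimes> b) = \<iota> a \<otimes>\<^bsub>sect OX U\<^esub> \<iota> b"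
  proof (rule val_at_ext[OF U order.refl])
    fix p assume p: "p \<in> U"
    interpret prime_localization A "h p" by (rule h_prime[OF p])
    show "val_at U (\<iota> (a \<otimes> b)) p = val_at U (\<iota> a \<otimes>\<^bsub>sect OX U\<^esub> \<iota> b) p"
      using p a b one_notin by (simp add: val_at_mult[OF U] \<iota> frac_mult)
  qed (use a b in \<open>simp_all add: \<iota>\<close>)
  show "\<iota> (a \<oplus> b) = \<iota> a \<oplus>\<^bsub>sect OX U\<^esub> \<iota> b"
  proof (rule val_at_ext[OF U order.refl])
    fix p assume p: "p \<in> U"
    interpret prime_localization A "h p" by (rule h_prime[OF p])
    show "val_at U (\<iota> (a \<oplus> b)) p = val_at U (\<iota> a \<oplus>\<^bsub>sect OX U\<^esub> \<iota> b) p"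
      using p a b one_notin by (simp add: val_at_add[OF U] \<iota> frac_add)
  qed (use a b in \<open>simp_all add: \<iota>\<close>)
next
  interpret O: cring "sect OX U" by (rule base_cring[OF U])
  show "\<iota> \<one> = \<one>\<^bsub>sect OX U\<^esub>"
    by (rule val_at_ext[OF U order.refl]) (simp_all add: \<iota> val_at_one[OF U])
qed

text \<open>The zero section is \<open>\<iota> \<zero>\<close>, whose values are known.\<close>

lemma val_at_zero:
  assumes V: "openin X V" "V \<subseteq> U" and p: "p \<in> V"
  shows "val_at V \<zero>\<^bsub>sect OX V\<^esub> p = local_frac A (h p) \<zero> \<one>"
proof -
  interpret r: ring_hom_cring "sect OX U" "sect OX V" "restr OX U V" by (rule base_hom_cring[OF U V])
  have "\<iota> \<zero> = \<zero>\<^bsub>sect OX U\<^esub>" by (rule ring_hom_zero[OF \<iota>_hom A.ring_axioms r.R.ring_axioms])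
  then have "restr OX U V (\<iota> \<zero>) = \<zero>\<^bsub>sect OX V\<^esub>" by simp
  then show ?thesis using val_at_\<iota>_restr[OF A.zero_closed V p] by simp
qed

lemma D_open: "f \<in> carrier A \<Longrightarrow> openin X (D f)"
  unfolding D_eq by (rule h_preimage[OF distinguished_open])

lemma D_basis:
  assumes V: "openin X V" "V \<subseteq> U" and p: "p \<in> V"
  shows "\<exists>f\<in>carrier A. p \<in> D f \<and> D f \<subseteq> V"
proof -
  obtain f where f: "f \<in> carrier A" "h p \<in> distinguished A f" "distinguished A f \<subseteq> h ` V"
    using A.distinguished_basis[OF h_open[OF V], of "h p"] p by blast
  have "D f \<subseteq> V"
  proof
    fix q assume q: "q \<in> D f"
    then obtain q' where q': "q' \<in> V" "h q = h q'" using f(3) by (auto simp: D_eq)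
    then have "q = q'" using h_inj q V(2) by (auto simp: D_def dest: inj_onD)
    then show "q \<in> V" using q' by simp
  qed
  then show ?thesis using f V p by (auto simp: D_eq)
qed

lemma chart: "affine_chart X OX A U D \<iota>"
proof (unfold_locales)
  show "openin X U" by (rule U)
  show "\<iota> \<in> ring_hom A (sect OX U)" by (rule \<iota>_hom)
  show "openin X (D f)" if "f \<in> carrier A" for f using that by (rule D_open)
  show "D f \<subseteq> U" for f by (auto simp: D_def)
  show "\<exists>f\<in>carrier A. p \<in> D f \<and> D f \<subseteq> V" if "openin X V" "V \<subseteq> U" "p \<in> V" for V p
    using that by (rule D_basis)
  show "D (f \<otimes> g) = D f \<inter> D g" if "f \<in> carrier A" "g \<in> carrier A" for f g
    using that by (auto simp: D_eq A.distinguished_mult)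
  show "D (f \<oplus> g) \<subseteq> D f \<union> D g" if "f \<in> carrier A" "g \<in> carrier A" for f g
  proof
    fix p assume p: "p \<in> D (f \<oplus> g)"
    then interpret prime_localization A "h p" by (intro h_prime) (simp add: D_def)
    show "p \<in> D f \<union> D g" using p P.a_closed by (auto simp: D_def)
  qed
  show "D \<one> = U" using prime_localization.one_notin[OF h_prime] by (auto simp: D_def)
  show "D \<zero> = {}"
  proof -
    have "\<zero> \<in> h p" if "p \<in> U" for p
    proof -
      interpret prime_localization A "h p" by (rule h_prime[OF that])
      show ?thesis by simp
    qed
    then show ?thesis by (auto simp: D_def)
  qed
  \<comment> \<open>Otherwise a prime ideal containing \<open>J\<close> but not \<open>f\<close>
    gives a point of \<open>D f\<close> that lies in no \<open>D r\<close> with \<open>r\<close> in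
    \<open>J\<close>.\<close>
  show "\<exists>n::nat. f [^] n \<in> J"
    if J: "ideal J A" "f \<in> carrier A" and r: "\<And>p. p \<in> D f \<Longrightarrow> \<exists>r\<in>J. p \<in> D r" for J f
  proof (rule ccontr)
    assume "\<not> ?thesis"
    then obtain P where P: "primeideal P A" "J \<subseteq> P" "f \<notin> P"
      using A.prime_avoiding_powers[OF J] by blast
    then obtain p where "p \<in> U" "P = h p" using h_image by blast
    then show False using r[of p] P by (auto simp: D_def)
  qed
  show "\<exists>u\<in>carrier (sect OX (D f)). u \<otimes>\<^bsub>sect OX (D f)\<^esub> restr OX U (D f) (\<iota> f) = \<one>\<^bsub>sect OX (D f)\<^esub>"
    if f: "f \<in> carrier A" for f
  proof -
    have V: "openin X (D f)" "D f \<subseteq> U" using D_open[OF f] by (auto simp: D_def)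
    interpret O: cring "sect OX (D f)" by (rule base_cring[OF V(1)])
    \<comment> \<open>The inverse of \<open>f\<close> is the section with values
      \<open>1 / f\<close>.\<close>
    obtain u where u: "u \<in> carrier (sect OX (D f))" "\<And>p. p \<in> D f \<Longrightarrow> val_at (D f) u p = local_frac A (h p) \<one> f"
      using val_at_realize[OF V A.one_closed f] by (auto simp: D_def)
    have rc: "restr OX U (D f) (\<iota> f) \<in> carrier (sect OX (D f))" using U V \<iota>(1)[OF f] by simp
    have "u \<otimes>\<^bsub>sect OX (D f)\<^esub> restr OX U (D f) (\<iota> f) = \<one>\<^bsub>sect OX (D f)\<^esub>"
    proof (rule val_at_ext[OF V])
      fix p assume p: "p \<in> D f"
      then interpret prime_localization A "h p" by (intro h_prime) (simp add: D_def)
      have fp: "f \<in> carrier A - h p" "\<one> \<in> carrier A - h p" using f p one_notin by (auto simp: D_def)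
      have "val_at (D f) (u \<otimes>\<^bsub>sect OX (D f)\<^esub> restr OX U (D f) (\<iota> f)) p =
          local_frac A (h p) \<one> f \<otimes>\<^bsub>localization A (h p)\<^esub> local_frac A (h p) f \<one>"
        using val_at_mult[OF V u(1) rc p] u(2)[OF p] val_at_\<iota>_restr[OF f V p] by simp
      also have "\<dots> = local_frac A (h p) f f" using f fp by (simp add: frac_mult)
      also have "\<dots> = local_frac A (h p) \<one> \<one>"
        using f fp by (subst frac_eq_iff) (auto intro!: bexI[of _ \<one>] simp: a_minus_def A.r_neg)
      also have "\<dots> = val_at (D f) \<one>\<^bsub>sect OX (D f)\<^esub> p" using val_at_one[OF V p] by simp
      finally show "val_at (D f) (u \<otimes>\<^bsub>sect OX (D f)\<^esub> restr OX U (D f) (\<iota> f)) p = val_at (D f) \<one>\<^bsub>sect OX (D f)\<^esub> p" .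
    qed (use u rc in auto)
    then show ?thesis using u by blast
  qed
  \<comment> \<open>Near \<open>p\<close> the section is one fraction \<open>a / t\<close>, and
    \<open>D k\<close> is chosen inside that neighbourhood. Since \<open>t\<close> lies in none of
    the corresponding primes, \<open>D k\<close> is contained in \<open>D t\<close>.\<close>
  show "\<exists>k\<in>carrier A. \<exists>a\<in>carrier A. \<exists>t\<in>carrier A. p \<in> D k \<and> D k \<subseteq> V \<and> D k \<subseteq> D t \<and>
        restr OX U (D k) (\<iota> t) \<otimes>\<^bsub>sect OX (D k)\<^esub> restr OX V (D k) s = restr OX U (D k) (\<iota> a)"
    if V: "openin X V" "V \<subseteq> U" "p \<in> V" and s: "s \<in> carrier (sect OX V)" for V p s
  proof -
    obtain V' a t where V': "openin X V'" "p \<in> V'" "V' \<subseteq> V" and a: "a \<in> carrier A" "t \<in> carrier A"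
      and eq: "\<And>q. q \<in> V' \<Longrightarrow> t \<notin> h q \<and> val_at V s q = local_frac A (h q) a t"
      using val_at_local[OF V(1,2) s V(3)] by blast
    have "V' \<subseteq> U" using V V' by auto
    obtain k where k: "k \<in> carrier A" "p \<in> D k" "D k \<subseteq> V'" using D_basis[OF V'(1) \<open>V' \<subseteq> U\<close> V'(2)] by blast
    have K: "openin X (D k)" "D k \<subseteq> U" "D k \<subseteq> V" using D_open[OF k(1)] k V' V by auto
    interpret O: cring "sect OX (D k)" by (rule base_cring[OF K(1)])
    have c: "restr OX U (D k) (\<iota> t) \<in> carrier (sect OX (D k))" "restr OX V (D k) s \<in> carrier (sect OX (D k))"
      "restr OX U (D k) (\<iota> a) \<in> carrier (sect OX (D k))"
      using U V K s \<iota>(1)[OF a(1)] \<iota>(1)[OF a(2)] by auto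
    have "restr OX U (D k) (\<iota> t) \<otimes>\<^bsub>sect OX (D k)\<^esub> restr OX V (D k) s = restr OX U (D k) (\<iota> a)"
    proof (rule val_at_ext[OF K(1,2)])
      fix q assume q: "q \<in> D k"
      then interpret prime_localization A "h q" by (intro h_prime) (simp add: D_def)
      have tq: "t \<in> carrier A - h q" "\<one> \<in> carrier A - h q" using a eq q k one_notin by auto
      have "val_at (D k) (restr OX U (D k) (\<iota> t) \<otimes>\<^bsub>sect OX (D k)\<^esub> restr OX V (D k) s) q =
          local_frac A (h q) t \<one> \<otimes>\<^bsub>localization A (h q)\<^esub> local_frac A (h q) a t"
        using val_at_mult[OF K(1,2) c(1,2) q] val_at_\<iota>_restr[OF a(2) K(1,2) q]
          val_at_restr[OF V(1) K(1,3) V(2) s q] eq[of q] k q by auto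
      also have "\<dots> = local_frac A (h q) (t \<otimes> a) t" using a tq by (simp add: frac_mult)
      also have "\<dots> = local_frac A (h q) a \<one>"
        using a tq by (subst frac_eq_iff) (auto intro!: bexI[of _ \<one>] simp: a_minus_def A.r_neg A.m_comm)
      also have "\<dots> = val_at (D k) (restr OX U (D k) (\<iota> a)) q" using val_at_\<iota>_restr[OF a(1) K(1,2) q] by simp
      finally show "val_at (D k) (restr OX U (D k) (\<iota> t) \<otimes>\<^bsub>sect OX (D k)\<^esub> restr OX V (D k) s) q =
        val_at (D k) (restr OX U (D k) (\<iota> a)) q" .
    qed (use c in auto)
    moreover have "D k \<subseteq> D t"
    proof
      fix q assume "q \<in> D k"
      then show "q \<in> D t" using eq[of q] k(3) K(2) by (auto simp: D_def)
    qed
    ultimately show ?thesis using k a K by blast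
  qed
  \<comment> \<open>That \<open>a / 1\<close> is zero in the localization means that
    \<open>a\<close> is killed by an element outside the prime.\<close>
  show "\<exists>u\<in>carrier A. p \<in> D u \<and> u \<otimes> a = \<zero>"
    if a: "a \<in> carrier A" and g: "g \<in> carrier A" and z: "restr OX U (D g) (\<iota> a) = \<zero>\<^bsub>sect OX (D g)\<^esub>" and p: "p \<in> D g" for a g p
  proof -
    have V: "openin X (D g)" "D g \<subseteq> U" using D_open[OF g] by (auto simp: D_def)
    interpret prime_localization A "h p" by (rule h_prime) (use p V in blast)
    have "local_frac A (h p) a \<one> = local_frac A (h p) \<zero> \<one>"
      using val_at_\<iota>_restr[OF a V p] val_at_zero[OF V p] by (simp add: z)
    then obtain u where "u \<in> carrier A - h p" "u \<otimes> (a \<otimes> \<one> \<ominus> \<zero> \<otimes> \<one>) = \<zero>"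
      using a one_notin by (subst (asm) frac_eq_iff) auto
    then show ?thesis using a p V by (intro bexI[of _ u]) (auto simp: D_def a_minus_def)
  qed
qed

end

lemma affine_open_chart:
  fixes OX :: "('p, 'r) ring_presheaf"
  assumes "ringed_space X OX" "affine_open X OX U"
  shows "\<exists>(A :: 'r ring) D \<iota>. affine_chart X OX A U D \<iota>"
proof -
  obtain A :: "'r ring" and h \<phi> where A: "cring A"
    and h: "homeomorphic_map (subtopology X U) (spec_topology A) h"
    and \<phi>: "\<forall>V. openin X V \<and> V \<subseteq> U \<longrightarrow> \<phi> V \<in> ring_iso (sect OX V) (sect (spec_sheaf A) (h ` V))"
    and \<phi>_restr: "\<forall>V W. openin X V \<and> openin X W \<and> W \<subseteq> V \<and> V \<subseteq> U \<longrightarrow>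
           (\<forall>s\<in>carrier (sect OX V). \<phi> W (restr OX V W s) = restr (spec_sheaf A) (h ` V) (h ` W) (\<phi> V s))"
    using assms(2) unfolding affine_open_def by (elim conjE exE) (rule that)
  have U: "openin X U" using assms(2) by (simp add: affine_open_def)
  have "affine_iso X OX A U h \<phi>"
    by (intro affine_iso.intro affine_iso_axioms.intro ringed_base.intro A h U assms(1))
       (use \<phi> \<phi>_restr in simp_all)
  from affine_iso.chart[OF this] show ?thesis by (intro exI)
qed

section \<open>The norm of a section acting on a pseudoregular module\<close>

lemma restrict_scalars_simps [simp]:
  "carrier (sect (restrict_scalars A M) U) = carrier (sect M U)"
  "add (sect (restrict_scalars A M) U) = add (sect M U)"
  "zero (sect (restrict_scalars A M) U) = zero (sect M U)"
  "r \<odot>\<^bsub>sect (restrict_scalars A M) U\<^esub> x = (r \<odot>\<^bsub>sect A U\<^esub> \<one>\<^bsub>sect A U\<^esub>) \<odot>\<^bsub>sect M U\<^esub> x"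
  "restr (restrict_scalars A M) = restr M"
  by (simp_all add: restrict_scalars_def)

locale quadratic_module =
  fixes X :: "'p topology" and OX :: "('p, 'r) ring_presheaf"
    and OY :: "('p, 'r, 'a) module_presheaf" and I :: "('p, 'a, 'm) module_presheaf"
  assumes X: "scheme X OX" and OY: "quadratic_algebra X OX OY" and I: "module_sheaf X OY I"
    and I_free: "locally_free X OX (restrict_scalars OY I) 2"
begin

abbreviation M where "M \<equiv> restrict_scalars OY I"

lemma OX_ringed: "ringed_space X OX" using X by (simp add: scheme_def)

sublocale Y: rank_two X OX OY
  using OY OX_ringed by (intro locally_free_rank_two) (auto simp: quadratic_algebra_def)

sublocale M: rank_two X OX "restrict_scalars OY I"
  by (rule locally_free_rank_two[OF OX_ringed I_free])

lemma OY_algebra: "openin X U \<Longrightarrow> Module.algebra (sect OX U) (sect OY U)"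
  using OY by (simp add: quadratic_algebra_def algebra_sheaf_def)

text \<open>\<open>X\<close> with \<open>OY\<close> is itself a ringed space. The general facts on
  presheaves of modules thus serve \<open>I\<close> twice: over \<open>OY\<close>, and over
  \<open>OX\<close> after restriction of scalars.\<close>

lemma OY_ringed: "ringed_space X OY"
  using OY OY_algebra unfolding quadratic_algebra_def algebra_sheaf_def ringed_space_def module_sheaf_def
  by (auto intro: Module.algebra.M_cring)

lemma OY_sheaf: "is_sheaf X OY"
  using OY by (simp add: quadratic_algebra_def algebra_sheaf_def module_sheaf_def)

sublocale I: modular_presheaf X OY I
  by (rule module_sheaf_modular[OF OY_ringed I])

lemma restr_act:
  assumes "openin X V" "openin X W" "W \<subseteq> V" "c \<in> carrier (sect OY V)" "x \<in> carrier (sect I V)"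
  shows "restr I V W (c \<odot>\<^bsub>sect I V\<^esub> x) = restr OY V W c \<odot>\<^bsub>sect I W\<^esub> restr I V W x"
  by (rule I.restr_smult[OF assms])

lemma restr_mult:
  assumes "openin X V" "openin X W" "W \<subseteq> V" "c \<in> carrier (sect OY V)" "x \<in> carrier (sect OY V)"
  shows "restr OY V W (c \<otimes>\<^bsub>sect OY V\<^esub> x) = restr OY V W c \<otimes>\<^bsub>sect OY W\<^esub> restr OY V W x"
  by (rule ring_hom_mult[OF I.base_hom[OF assms(1-3)] assms(4,5)])

lemma restr_one: "openin X V \<Longrightarrow> openin X W \<Longrightarrow> W \<subseteq> V \<Longrightarrow> restr OY V W \<one>\<^bsub>sect OY V\<^esub> = \<one>\<^bsub>sect OY W\<^esub>"
  by (rule ring_hom_one[OF I.base_hom])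

lemma mult_endo:
  assumes U: "openin X U" and c: "c \<in> carrier (sect OY U)"
  shows "rank_two_endo X OX OY U (\<lambda>V y. restr OY U V c \<otimes>\<^bsub>sect OY V\<^esub> y)"
proof (unfold_locales)
  show "openin X U" by fact
  fix V assume V: "openin X V" "V \<subseteq> U"
  interpret S: cring "sect OY V" by (rule I.base_cring[OF V(1)])
  interpret Module.algebra "sect OX V" "sect OY V" by (rule OY_algebra[OF V(1)])
  have cV: "restr OY U V c \<in> carrier (sect OY V)" using U V c by simp
  show "semilinear (sect OX V) (\<lambda>r. r) (sect OY V) (sect OY V) (\<lambda>y. restr OY U V c \<otimes>\<^bsub>sect OY V\<^esub> y)"
    unfolding semilinear_def using cV
    by (auto simp: S.r_distr) (simp add: S.m_comm[OF cV] smult_assoc2)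
  fix W y assume W: "openin X W" "W \<subseteq> V" "y \<in> carrier (sect OY V)"
  show "restr OY V W (restr OY U V c \<otimes>\<^bsub>sect OY V\<^esub> y) = restr OY U W c \<otimes>\<^bsub>sect OY W\<^esub> restr OY V W y"
    using U V W c cV by (simp add: restr_mult)
qed

text \<open>Linearity over \<open>OX\<close> rests on the commutativity of \<open>OY\<close>,
  because \<open>OX\<close> acts on \<open>I\<close> through multiples of the unit of
  \<open>OY\<close>.\<close>

lemma act_endo:
  assumes U: "openin X U" and c: "c \<in> carrier (sect OY U)"
  shows "rank_two_endo X OX M U (\<lambda>V x. restr OY U V c \<odot>\<^bsub>sect I V\<^esub> x)"
proof (unfold_locales)
  show "openin X U" by fact
  fix V assume V: "openin X V" "V \<subseteq> U"
  interpret S: cring "sect OY V" by (rule I.base_cring[OF V(1)])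
  interpret Module.algebra "sect OX V" "sect OY V" by (rule OY_algebra[OF V(1)])
  interpret I: Module.module "sect OY V" "sect I V" by (rule I.sect_module[OF V(1)])
  have cV: "restr OY U V c \<in> carrier (sect OY V)" using U V c by simp
  show "semilinear (sect OX V) (\<lambda>r. r) (sect M V) (sect M V) (\<lambda>x. restr OY U V c \<odot>\<^bsub>sect I V\<^esub> x)"
    unfolding semilinear_def using cV
    by (auto simp: I.smult_r_distr) (simp add: I.smult_assoc1[symmetric] S.m_comm[OF cV])
  fix W y assume W: "openin X W" "W \<subseteq> V" "y \<in> carrier (sect M V)"
  show "restr M V W (restr OY U V c \<odot>\<^bsub>sect I V\<^esub> y) = restr OY U W c \<odot>\<^bsub>sect I W\<^esub> restr M V W y"
    using U V W c cV by (simp add: restr_act)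
qed

lemma det_scale:
  assumes "cring R" and l: "l \<in> carrier R" and a: "\<And>i j. i < 2 \<Longrightarrow> j < 2 \<Longrightarrow> a i j \<in> carrier R"
  shows "mat_det R 2 (\<lambda>i j. l \<otimes>\<^bsub>R\<^esub> a i j) = (l \<otimes>\<^bsub>R\<^esub> l) \<otimes>\<^bsub>R\<^esub> mat_det R 2 a"
proof -
  interpret cring R by fact
  have c: "a 0 0 \<in> carrier R" "a 0 1 \<in> carrier R" "a 1 0 \<in> carrier R" "a 1 1 \<in> carrier R"
    by (simp_all add: a)
  have "mat_det R 2 (\<lambda>i j. l \<otimes>\<^bsub>R\<^esub> a i j) =
      (l \<otimes>\<^bsub>R\<^esub> a 0 0) \<otimes>\<^bsub>R\<^esub> (l \<otimes>\<^bsub>R\<^esub> a 1 1) \<ominus>\<^bsub>R\<^esub> (l \<otimes>\<^bsub>R\<^esub> a 0 1) \<otimes>\<^bsub>R\<^esub> (l \<otimes>\<^bsub>R\<^esub> a 1 0)"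
    using l a by (intro mat_det_2) simp
  also have "\<dots> = (l \<otimes>\<^bsub>R\<^esub> l) \<otimes>\<^bsub>R\<^esub> (a 0 0 \<otimes>\<^bsub>R\<^esub> a 1 1 \<ominus>\<^bsub>R\<^esub> a 0 1 \<otimes>\<^bsub>R\<^esub> a 1 0)"
    using l c by algebra
  finally show ?thesis using mat_det_2[OF a] by simp
qed

lemma matrix_scale:
  assumes "plain_module R N" and e: "e 0 \<in> carrier N" "e 1 \<in> carrier N" and l: "l \<in> carrier R"
    and a: "is_matrix_of R N 2 e f a"
    and g: "g (e 0) = l \<odot>\<^bsub>N\<^esub> f (e 0)" "g (e 1) = l \<odot>\<^bsub>N\<^esub> f (e 1)"
  shows "is_matrix_of R N 2 e g (\<lambda>i j. l \<otimes>\<^bsub>R\<^esub> a i j)"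
proof -
  interpret plain_module R N by fact
  show ?thesis
    using a l e unfolding is_matrix_of_iff[OF e] g by (auto simp: smult_r_distr smult_assoc1)
qed

text \<open>Pseudoregularity in the form consumed by \<open>expression_act\<close>: the norm is
  expressed by a matrix of \<open>c\<close> on \<open>I\<close>. The characteristic polynomials
  enter only through their constant terms.\<close>

theorem norm_det_local:
  assumes pr: "pseudoregular X OX OY I" and U: "openin X U" and c: "c \<in> carrier (sect OY U)" and p: "p \<in> U"
  shows "\<exists>V e a. p \<in> V \<and> rank_two_endo.framed_matrix X OX M U (\<lambda>V x. restr OY U V c \<odot>\<^bsub>sect I V\<^esub> x) V e a \<and>
    restr OX U V (Nm X OX OY U c) = mat_det (sect OX V) 2 a"
proof -
  interpret cY: rank_two_endo X OX OY U "\<lambda>V y. restr OY U V c \<otimes>\<^bsub>sect OY V\<^esub> y" by (rule mult_endo[OF U c])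
  interpret cM: rank_two_endo X OX M U "\<lambda>V x. restr OY U V c \<odot>\<^bsub>sect I V\<^esub> x" by (rule act_endo[OF U c])
  have "p \<in> topspace X" using p openin_subset[OF U] by blast
  then obtain W where W: "affine_open X OX W" "p \<in> W" using X unfolding scheme_def by blast
  obtain A :: "'r ring" and D \<iota> where ch: "affine_chart X OX A W D \<iota>"
    using affine_open_chart[OF OX_ringed W(1)] by blast
  interpret C: affine_chart X OX A W D \<iota> by (rule ch)
  interpret C: affine_module X OX A W D \<iota> OY
    by (intro affine_module.intro affine_module_axioms.intro ch Y.rank_two_axioms OY_sheaf)
  obtain f where f: "f \<in> carrier A" "p \<in> D f" "D f \<subseteq> U \<inter> W"
    using C.D_basis[of "U \<inter> W" p] U C.W p W(2) by auto
  note oD = C.D_open[OF f(1)]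
  have DU: "D f \<subseteq> U" "D f \<subseteq> W" using f by auto
  let ?cf = "restr OY U (D f) c"
  have cf: "?cf \<in> carrier (sect OY (D f))" using U oD DU c by simp
  obtain n s where s: "s \<in> carrier (sect OY W)"
    "restr OY W (D f) s = C.loc (D f) (f [^]\<^bsub>A\<^esub> (n::nat)) \<odot>\<^bsub>sect OY (D f)\<^esub> ?cf"
    using C.extend[OF f(1) cf] by blast
  interpret sY: rank_two_endo X OX OY W "\<lambda>V y. restr OY W V s \<otimes>\<^bsub>sect OY V\<^esub> y" by (rule mult_endo[OF C.W s(1)])
  interpret sM: rank_two_endo X OX M W "\<lambda>V x. restr OY W V s \<odot>\<^bsub>sect I V\<^esub> x" by (rule act_endo[OF C.W s(1)])
  obtain V1 e1 a1 where V1: "p \<in> V1" "cY.framed_matrix V1 e1 a1" using cY.framed_matrix_near[OF p] by blast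
  obtain V2 e2 a2 where V2: "p \<in> V2" "cM.framed_matrix V2 e2 a2" using cM.framed_matrix_near[OF p] by blast
  \<comment> \<open>Small enough to carry a frame of \<open>OY\<close> and one of \<open>I\<close>,
    and to make the power of \<open>f\<close> invertible.\<close>
  define V where "V = V1 \<inter> V2 \<inter> D f"
  have V: "openin X V" "V \<subseteq> V1" "V \<subseteq> V2" "V \<subseteq> D f" "p \<in> V" "V \<subseteq> W" "V \<subseteq> U"
    using cY.framed_matrixD(4)[OF V1(2)] cM.framed_matrixD(4)[OF V2(2)] oD V1(1) V2(1) f(2) DU by (auto simp: V_def)
  obtain e a where m: "cY.framed_matrix V e a" using cY.framed_matrix_restrict[OF V1(2) V(1,2)] by blast
  obtain e' a' where m': "cM.framed_matrix V e' a'" using cM.framed_matrix_restrict[OF V2(2) V(1,3)] by blast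
  note d = cY.framed_matrixD[OF m] and d' = cM.framed_matrixD[OF m']
  note fr = Y.frame_onD[OF d(2)] and fr' = M.frame_onD[OF d'(2)]
  interpret V: Module.algebra "sect OX V" "sect OY V" by (rule OY_algebra[OF V(1)])
  interpret IV: Module.module "sect OY V" "sect I V" by (rule I.sect_module[OF V(1)])
  let ?l = "C.loc V (f [^]\<^bsub>A\<^esub> n)" and ?cV = "restr OY U V c"
  have l: "?l \<in> carrier (sect OX V)" using V f by simp
  have cV: "?cV \<in> carrier (sect OY V)" using U V c by simp
  have sV: "restr OY W V s = ?l \<odot>\<^bsub>sect OY V\<^esub> ?cV"
  proof -
    have lD: "C.loc (D f) (f [^]\<^bsub>A\<^esub> n) \<in> carrier (sect OX (D f))" using oD DU f by simp
    have "restr OY W V s = restr OY (D f) V (restr OY W (D f) s)"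
      by (rule Y.restr_restr[OF C.W oD V(1,4) DU(2) s(1), symmetric])
    also have "\<dots> = restr OX (D f) V (C.loc (D f) (f [^]\<^bsub>A\<^esub> n)) \<odot>\<^bsub>sect OY V\<^esub> restr OY (D f) V ?cf"
      unfolding s(2) by (rule Y.restr_smult[OF oD V(1,4) lD cf])
    also have "restr OX (D f) V (C.loc (D f) (f [^]\<^bsub>A\<^esub> n)) = ?l"
      by (rule C.restr_loc[OF oD V(1,4) DU(2)]) (use f in simp)
    also have "restr OY (D f) V ?cf = ?cV" by (rule Y.restr_restr[OF U oD V(1,4) DU(1) c])
    finally show ?thesis .
  qed
  have "sY.framed_matrix V e (\<lambda>i j. ?l \<otimes>\<^bsub>sect OX V\<^esub> a i j)"
    unfolding sY.framed_matrix_def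
  proof (intro conjI V(6) d(2) matrix_scale[OF Y.sect_plain[OF V(1)] fr(2,3) l d(3)])
    show "restr OY W V s \<otimes>\<^bsub>sect OY V\<^esub> e 0 = ?l \<odot>\<^bsub>sect OY V\<^esub> (?cV \<otimes>\<^bsub>sect OY V\<^esub> e 0)"
      "restr OY W V s \<otimes>\<^bsub>sect OY V\<^esub> e 1 = ?l \<odot>\<^bsub>sect OY V\<^esub> (?cV \<otimes>\<^bsub>sect OY V\<^esub> e 1)"
      unfolding sV using V.smult_assoc2[OF l cV] fr(2,3) by simp_all
  qed
  from sY.endo_charpoly_det[OF this]
  have q: "restr OX W V (endo_charpoly X OX OY 2 W (\<lambda>V y. restr OY W V s \<otimes>\<^bsub>sect OY V\<^esub> y) 0) =
      (?l \<otimes>\<^bsub>sect OX V\<^esub> ?l) \<otimes>\<^bsub>sect OX V\<^esub> mat_det (sect OX V) 2 a"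
    using det_scale[OF V.R_cring l, of a] d(5) by simp
  have act: "restr OY W V s \<odot>\<^bsub>sect I V\<^esub> x = ?l \<odot>\<^bsub>sect M V\<^esub> (?cV \<odot>\<^bsub>sect I V\<^esub> x)" if x: "x \<in> carrier (sect I V)" for x
  proof -
    \<comment> \<open>A scalar of \<open>OX\<close> acts on \<open>I\<close> through its multiple of
      1, so \<open>l c\<close> is rewritten as a product in \<open>OY\<close> before associativity
      of the action can be used.\<close>
    have "?l \<odot>\<^bsub>sect OY V\<^esub> ?cV = (?l \<odot>\<^bsub>sect OY V\<^esub> \<one>\<^bsub>sect OY V\<^esub>) \<otimes>\<^bsub>sect OY V\<^esub> ?cV"
      using l cV by (simp add: V.smult_assoc2)
    then show ?thesis unfolding sV using l cV x by (simp add: IV.smult_assoc1)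
  qed
  have "sM.framed_matrix V e' (\<lambda>i j. ?l \<otimes>\<^bsub>sect OX V\<^esub> a' i j)"
    unfolding sM.framed_matrix_def
    by (intro conjI V(6) d'(2) matrix_scale[OF M.sect_plain[OF V(1)] fr'(2,3) l d'(3)] act)
       (use fr'(2,3) in simp_all)
  from sM.endo_charpoly_det[OF this]
  have q': "restr OX W V (endo_charpoly X OX M 2 W (\<lambda>V x. restr OY W V s \<odot>\<^bsub>sect I V\<^esub> x) 0) =
      (?l \<otimes>\<^bsub>sect OX V\<^esub> ?l) \<otimes>\<^bsub>sect OX V\<^esub> mat_det (sect OX V) 2 a'"
    using det_scale[OF V.R_cring l, of a'] d'(5) by simp
  have "endo_charpoly X OX OY 2 W (\<lambda>V y. restr OY W V s \<otimes>\<^bsub>sect OY V\<^esub> y) =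
      endo_charpoly X OX M 2 W (\<lambda>V x. restr OY W V s \<odot>\<^bsub>sect I V\<^esub> x)"
    using pr W(1) s(1) unfolding pseudoregular_def by blast
  then have ll: "(?l \<otimes>\<^bsub>sect OX V\<^esub> ?l) \<otimes>\<^bsub>sect OX V\<^esub> mat_det (sect OX V) 2 a =
      (?l \<otimes>\<^bsub>sect OX V\<^esub> ?l) \<otimes>\<^bsub>sect OX V\<^esub> mat_det (sect OX V) 2 a'"
    using q q' by simp
  have "?l \<in> Units (sect OX V)"
    using C.D_pow[OF f(1), of n] V f by (intro C.loc_unit) auto
  then have "?l \<otimes>\<^bsub>sect OX V\<^esub> ?l \<in> Units (sect OX V)" by simp
  then have "mat_det (sect OX V) 2 a = mat_det (sect OX V) 2 a'"
    using ll cY.det_closed[OF m] cM.det_closed[OF m'] by (simp add: V.R.Units_l_cancel)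
  then have "restr OX U V (Nm X OX OY U c) = mat_det (sect OX V) 2 a'"
    using cY.endo_det_restr[OF m] by (simp add: Nm_def)
  then show ?thesis using m' V(5) by blast
qed

lemma Nm_closed: "openin X U \<Longrightarrow> c \<in> carrier (sect OY U) \<Longrightarrow> Nm X OX OY U c \<in> carrier (sect OX U)"
  unfolding Nm_def by (rule rank_two_endo.endo_det_closed[OF mult_endo])

end

section \<open>Dual sheaves\<close>

context linear_presheaf
begin

text \<open>Makes a family of maps extensional both in the open set and in the section. Sums and
  multiples in the dual sheaf have this form by definition.\<close>

definition family where
  "family \<phi> U = (\<lambda>V\<in>{V. openin X V \<and> V \<subseteq> U}. \<lambda>x\<in>carrier (sect F V). \<phi> V x)"

lemma family_apply: "openin X V \<Longrightarrow> V \<subseteq> U \<Longrightarrow> x \<in> carrier (sect F V) \<Longrightarrow> family \<phi> U V x = \<phi> V x"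
  by (simp add: family_def)

lemma dual_ops:
  "l \<oplus>\<^bsub>sect (dual_sheaf X OX F) U\<^esub> l' = family (\<lambda>V x. l V x \<oplus>\<^bsub>sect OX V\<^esub> l' V x) U"
  "r \<odot>\<^bsub>sect (dual_sheaf X OX F) U\<^esub> l = family (\<lambda>V x. restr OX U V r \<otimes>\<^bsub>sect OX V\<^esub> l V x) U"
  "restr (dual_sheaf X OX F) U W l = restrict l {V. openin X V \<and> V \<subseteq> W}"
  by (simp_all add: dual_sheaf_def family_def)

lemma dual_carrier:
  "l \<in> carrier (sect (dual_sheaf X OX F) U) \<longleftrightarrow>
    l \<in> (\<Pi>\<^sub>E V\<in>{V. openin X V \<and> V \<subseteq> U}. carrier (sect F V) \<rightarrow>\<^sub>E carrier (sect OX V)) \<and>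
         (\<forall>V. openin X V \<and> V \<subseteq> U \<longrightarrow>
            (\<forall>x\<in>carrier (sect F V). \<forall>y\<in>carrier (sect F V).
               l V (x \<oplus>\<^bsub>sect F V\<^esub> y) = l V x \<oplus>\<^bsub>sect OX V\<^esub> l V y) \<and>
            (\<forall>r\<in>carrier (sect OX V). \<forall>x\<in>carrier (sect F V).
               l V (r \<odot>\<^bsub>sect F V\<^esub> x) = r \<otimes>\<^bsub>sect OX V\<^esub> l V x)) \<and>
         (\<forall>V W. openin X V \<and> openin X W \<and> W \<subseteq> V \<and> V \<subseteq> U \<longrightarrow>
            (\<forall>x\<in>carrier (sect F V). l W (restr F V W x) = restr OX V W (l V x)))"
  by (simp add: dual_sheaf_def)

lemma dualD:
  assumes "l \<in> carrier (sect (dual_sheaf X OX F) U)" "openin X V" "V \<subseteq> U" "x \<in> carrier (sect F V)"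
  shows "l V x \<in> carrier (sect OX V)"
    and "y \<in> carrier (sect F V) \<Longrightarrow> l V (x \<oplus>\<^bsub>sect F V\<^esub> y) = l V x \<oplus>\<^bsub>sect OX V\<^esub> l V y"
    and "r \<in> carrier (sect OX V) \<Longrightarrow> l V (r \<odot>\<^bsub>sect F V\<^esub> x) = r \<otimes>\<^bsub>sect OX V\<^esub> l V x"
    and "openin X W \<Longrightarrow> W \<subseteq> V \<Longrightarrow> l W (restr F V W x) = restr OX V W (l V x)"
proof -
  have "l V \<in> carrier (sect F V) \<rightarrow>\<^sub>E carrier (sect OX V)"
    using assms(1)[unfolded dual_carrier, THEN conjunct1] assms(2,3) by (auto dest: PiE_mem)
  then show "l V x \<in> carrier (sect OX V)" using assms(4) by (rule PiE_mem)
qed (use assms in \<open>simp_all add: dual_carrier\<close>)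

lemma family_dual:
  assumes "\<And>V x. openin X V \<Longrightarrow> V \<subseteq> U \<Longrightarrow> x \<in> carrier (sect F V) \<Longrightarrow> \<phi> V x \<in> carrier (sect OX V)"
    and "\<And>V x y. openin X V \<Longrightarrow> V \<subseteq> U \<Longrightarrow> x \<in> carrier (sect F V) \<Longrightarrow> y \<in> carrier (sect F V) \<Longrightarrow>
      \<phi> V (x \<oplus>\<^bsub>sect F V\<^esub> y) = \<phi> V x \<oplus>\<^bsub>sect OX V\<^esub> \<phi> V y"
    and "\<And>V r x. openin X V \<Longrightarrow> V \<subseteq> U \<Longrightarrow> r \<in> carrier (sect OX V) \<Longrightarrow> x \<in> carrier (sect F V) \<Longrightarrow>
      \<phi> V (r \<odot>\<^bsub>sect F V\<^esub> x) = r \<otimes>\<^bsub>sect OX V\<^esub> \<phi> V x"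
    and "\<And>V W x. openin X V \<Longrightarrow> openin X W \<Longrightarrow> W \<subseteq> V \<Longrightarrow> V \<subseteq> U \<Longrightarrow> x \<in> carrier (sect F V) \<Longrightarrow>
      \<phi> W (restr F V W x) = restr OX V W (\<phi> V x)"
  shows "family \<phi> U \<in> carrier (sect (dual_sheaf X OX F) U)"
  unfolding dual_carrier
proof (intro conjI allI impI ballI)
  show "family \<phi> U \<in> (\<Pi>\<^sub>E V\<in>{V. openin X V \<and> V \<subseteq> U}. carrier (sect F V) \<rightarrow>\<^sub>E carrier (sect OX V))"
    unfolding family_def using assms(1) by (intro restrict_PiE_iff[THEN iffD2] ballI) (simp add: PiE_iff)
  fix V assume V: "openin X V \<and> V \<subseteq> U"
  fix x assume x: "x \<in> carrier (sect F V)"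
  show "family \<phi> U V (x \<oplus>\<^bsub>sect F V\<^esub> y) = family \<phi> U V x \<oplus>\<^bsub>sect OX V\<^esub> family \<phi> U V y" if "y \<in> carrier (sect F V)" for y
    using V x that assms(2) by (simp add: family_apply)
  show "family \<phi> U V (r \<odot>\<^bsub>sect F V\<^esub> x) = r \<otimes>\<^bsub>sect OX V\<^esub> family \<phi> U V x" if "r \<in> carrier (sect OX V)" for r
    using V x that assms(3) by (simp add: family_apply)
next
  fix V W x assume V: "openin X V \<and> openin X W \<and> W \<subseteq> V \<and> V \<subseteq> U" and x: "x \<in> carrier (sect F V)"
  then have "W \<subseteq> U" by auto
  then show "family \<phi> U W (restr F V W x) = restr OX V W (family \<phi> U V x)"
    using V x assms(4) by (simp add: family_apply)
qed

lemma dual_eqI: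
  assumes l: "l \<in> carrier (sect (dual_sheaf X OX F) U)" "l' \<in> carrier (sect (dual_sheaf X OX F) U)"
    and eq: "\<And>V x. openin X V \<Longrightarrow> V \<subseteq> U \<Longrightarrow> x \<in> carrier (sect F V) \<Longrightarrow> l V x = l' V x"
  shows "l = l'"
proof (rule PiE_ext[OF l(1)[unfolded dual_carrier, THEN conjunct1] l(2)[unfolded dual_carrier, THEN conjunct1]])
  fix V assume V: "V \<in> {V. openin X V \<and> V \<subseteq> U}"
  show "l V = l' V"
    using V eq
    by (intro PiE_ext[OF PiE_mem[OF l(1)[unfolded dual_carrier, THEN conjunct1] V]
          PiE_mem[OF l(2)[unfolded dual_carrier, THEN conjunct1] V]]) simp
qed

lemma dual_add_closed:
  assumes U: "openin X U"
    and l: "l \<in> carrier (sect (dual_sheaf X OX F) U)" "l' \<in> carrier (sect (dual_sheaf X OX F) U)"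
  shows "l \<oplus>\<^bsub>sect (dual_sheaf X OX F) U\<^esub> l' \<in> carrier (sect (dual_sheaf X OX F) U)"
  unfolding dual_ops
proof (rule family_dual)
  fix V x assume V: "openin X V" "V \<subseteq> U" and x: "x \<in> carrier (sect F V)"
  interpret cring "sect OX V" by (rule base_cring[OF V(1)])
  note c = dualD(1)[OF l(1) V] dualD(1)[OF l(2) V]
  show "l V x \<oplus>\<^bsub>sect OX V\<^esub> l' V x \<in> carrier (sect OX V)" using c x by simp
  show "l V (x \<oplus>\<^bsub>sect F V\<^esub> y) \<oplus>\<^bsub>sect OX V\<^esub> l' V (x \<oplus>\<^bsub>sect F V\<^esub> y) =
    (l V x \<oplus>\<^bsub>sect OX V\<^esub> l' V x) \<oplus>\<^bsub>sect OX V\<^esub> (l V y \<oplus>\<^bsub>sect OX V\<^esub> l' V y)" if "y \<in> carrier (sect F V)" for y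
    using c[OF x] c[OF that] dualD(2)[OF l(1) V x that] dualD(2)[OF l(2) V x that] by (simp add: a_ac)
  show "l V (r \<odot>\<^bsub>sect F V\<^esub> x) \<oplus>\<^bsub>sect OX V\<^esub> l' V (r \<odot>\<^bsub>sect F V\<^esub> x) =
    r \<otimes>\<^bsub>sect OX V\<^esub> (l V x \<oplus>\<^bsub>sect OX V\<^esub> l' V x)" if "r \<in> carrier (sect OX V)" for r
    using c[OF x] that dualD(3)[OF l(1) V x that] dualD(3)[OF l(2) V x that] by (simp add: r_distr)
  fix W assume W: "openin X W" "W \<subseteq> V"
  interpret r: ring_hom_cring "sect OX V" "sect OX W" "restr OX V W" by (rule base_hom_cring[OF V(1) W])
  show "l W (restr F V W x) \<oplus>\<^bsub>sect OX W\<^esub> l' W (restr F V W x) = restr OX V W (l V x \<oplus>\<^bsub>sect OX V\<^esub> l' V x)"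
    using c[OF x] dualD(4)[OF l(1) V x W] dualD(4)[OF l(2) V x W] by simp
qed

lemma dual_smult_closed:
  assumes U: "openin X U" and s: "s \<in> carrier (sect OX U)" and l: "l \<in> carrier (sect (dual_sheaf X OX F) U)"
  shows "s \<odot>\<^bsub>sect (dual_sheaf X OX F) U\<^esub> l \<in> carrier (sect (dual_sheaf X OX F) U)"
  unfolding dual_ops
proof (rule family_dual)
  fix V x assume V: "openin X V" "V \<subseteq> U" and x: "x \<in> carrier (sect F V)"
  interpret cring "sect OX V" by (rule base_cring[OF V(1)])
  note c = dualD(1)[OF l(1) V]
  have sV: "restr OX U V s \<in> carrier (sect OX V)" using U V s by simp
  show "restr OX U V s \<otimes>\<^bsub>sect OX V\<^esub> l V x \<in> carrier (sect OX V)" using c x sV by simp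
  show "restr OX U V s \<otimes>\<^bsub>sect OX V\<^esub> l V (x \<oplus>\<^bsub>sect F V\<^esub> y) =
    restr OX U V s \<otimes>\<^bsub>sect OX V\<^esub> l V x \<oplus>\<^bsub>sect OX V\<^esub> restr OX U V s \<otimes>\<^bsub>sect OX V\<^esub> l V y" if "y \<in> carrier (sect F V)" for y
    using c[OF x] c[OF that] sV dualD(2)[OF l(1) V x that] by (simp add: r_distr)
  show "restr OX U V s \<otimes>\<^bsub>sect OX V\<^esub> l V (r \<odot>\<^bsub>sect F V\<^esub> x) =
    r \<otimes>\<^bsub>sect OX V\<^esub> (restr OX U V s \<otimes>\<^bsub>sect OX V\<^esub> l V x)" if "r \<in> carrier (sect OX V)" for r
    using c[OF x] that sV dualD(3)[OF l(1) V x that] by (simp add: m_lcomm)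
  fix W assume W: "openin X W" "W \<subseteq> V"
  interpret r: ring_hom_cring "sect OX V" "sect OX W" "restr OX V W" by (rule base_hom_cring[OF V(1) W])
  have "restr OX V W (restr OX U V s) = restr OX U W s" using U V W s by simp
  then show "restr OX U W s \<otimes>\<^bsub>sect OX W\<^esub> l W (restr F V W x) = restr OX V W (restr OX U V s \<otimes>\<^bsub>sect OX V\<^esub> l V x)"
    using c[OF x] sV dualD(4)[OF l(1) V x W] by simp
qed

lemma dual_restr_closed:
  assumes "W \<subseteq> U" "l \<in> carrier (sect (dual_sheaf X OX F) U)"
  shows "restr (dual_sheaf X OX F) U W l \<in> carrier (sect (dual_sheaf X OX F) W)"
proof -
  have "family l W \<in> carrier (sect (dual_sheaf X OX F) W)"
  proof (rule family_dual)
    fix V x assume V: "openin X V" "V \<subseteq> W" and x: "x \<in> carrier (sect F V)"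
    have VU: "V \<subseteq> U" using V assms by auto
    note d = dualD[OF assms(2) V(1) VU x]
    show "l V x \<in> carrier (sect OX V)" by (rule d)
    show "l V (x \<oplus>\<^bsub>sect F V\<^esub> y) = l V x \<oplus>\<^bsub>sect OX V\<^esub> l V y" if "y \<in> carrier (sect F V)" for y by (rule d(2)[OF that])
    show "l V (r \<odot>\<^bsub>sect F V\<^esub> x) = r \<otimes>\<^bsub>sect OX V\<^esub> l V x" if "r \<in> carrier (sect OX V)" for r by (rule d(3)[OF that])
    show "l W' (restr F V W' x) = restr OX V W' (l V x)" if "openin X W'" "W' \<subseteq> V" for W' by (rule d(4)[OF that])
  qed
  \<comment> \<open>A section of the dual is already extensional in its inner argument, so cutting
    down the outer one is all that \<open>family\<close> does.\<close>
  moreover have "family l W = restr (dual_sheaf X OX F) U W l"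
    unfolding dual_ops(3) family_def
  proof (rule restrict_ext)
    fix V assume V: "V \<in> {V. openin X V \<and> V \<subseteq> W}"
    then have "l V \<in> carrier (sect F V) \<rightarrow>\<^sub>E carrier (sect OX V)"
      using PiE_mem[OF assms(2)[unfolded dual_carrier, THEN conjunct1], of V] assms(1) by auto
    then show "(\<lambda>x\<in>carrier (sect F V). l V x) = l V"
      by (simp add: PiE_restrict)
  qed
  ultimately show ?thesis by simp
qed

lemma dual_linear: "linear_presheaf X OX (dual_sheaf X OX F)"
proof (rule linear_presheafI[OF ringed])
  let ?D = "dual_sheaf X OX F"
  fix U assume U: "openin X U"
  show "op_closed (sect OX U) (sect ?D U)"
    unfolding op_closed_def using dual_add_closed[OF U] dual_smult_closed[OF U] by blast
  show "restr ?D U U l = l" if "l \<in> carrier (sect ?D U)" for l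
    using dual_restr_closed[OF order.refl that] that by (rule dual_eqI) (simp add: dual_ops(3))
  fix V assume V: "openin X V" "V \<subseteq> U"
  show "restr ?D V W (restr ?D U V l) = restr ?D U W l" if "W \<subseteq> V" for W l
    unfolding dual_ops(3) using that by (auto simp: restrict_def fun_eq_iff)
  show "semilinear (sect OX U) (restr OX U V) (sect ?D U) (sect ?D V) (restr ?D U V)"
    unfolding semilinear_def
  proof (intro conjI ballI funcsetI)
    show "restr ?D U V l \<in> carrier (sect ?D V)" if "l \<in> carrier (sect ?D U)" for l
      using V(2) that by (rule dual_restr_closed)
  next
    fix l l' assume l: "l \<in> carrier (sect ?D U)" "l' \<in> carrier (sect ?D U)"
    show "restr ?D U V (l \<oplus>\<^bsub>sect ?D U\<^esub> l') = restr ?D U V l \<oplus>\<^bsub>sect ?D V\<^esub> restr ?D U V l'"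
    proof (rule dual_eqI)
      show "restr ?D U V (l \<oplus>\<^bsub>sect ?D U\<^esub> l') \<in> carrier (sect ?D V)"
        by (rule dual_restr_closed[OF V(2) dual_add_closed[OF U l]])
      show "restr ?D U V l \<oplus>\<^bsub>sect ?D V\<^esub> restr ?D U V l' \<in> carrier (sect ?D V)"
        by (rule dual_add_closed[OF V(1) dual_restr_closed[OF V(2) l(1)] dual_restr_closed[OF V(2) l(2)]])
      fix W x assume W: "openin X W" "W \<subseteq> V" "x \<in> carrier (sect F W)"
      moreover have "W \<subseteq> U" using W V by auto
      ultimately show "restr ?D U V (l \<oplus>\<^bsub>sect ?D U\<^esub> l') W x = (restr ?D U V l \<oplus>\<^bsub>sect ?D V\<^esub> restr ?D U V l') W x"
        by (simp add: dual_ops family_apply)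
    qed
  next
    fix r l assume r: "r \<in> carrier (sect OX U)" and l: "l \<in> carrier (sect ?D U)"
    have rV: "restr OX U V r \<in> carrier (sect OX V)" using U V r by simp
    show "restr ?D U V (r \<odot>\<^bsub>sect ?D U\<^esub> l) = restr OX U V r \<odot>\<^bsub>sect ?D V\<^esub> restr ?D U V l"
    proof (rule dual_eqI)
      show "restr ?D U V (r \<odot>\<^bsub>sect ?D U\<^esub> l) \<in> carrier (sect ?D V)"
        by (rule dual_restr_closed[OF V(2) dual_smult_closed[OF U r l]])
      show "restr OX U V r \<odot>\<^bsub>sect ?D V\<^esub> restr ?D U V l \<in> carrier (sect ?D V)"
        by (rule dual_smult_closed[OF V(1) rV dual_restr_closed[OF V(2) l]])
      fix W x assume W: "openin X W" "W \<subseteq> V" "x \<in> carrier (sect F W)"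
      moreover have "W \<subseteq> U" using W V by auto
      moreover have "restr OX V W (restr OX U V r) = restr OX U W r" using U V W r by simp
      ultimately show "restr ?D U V (r \<odot>\<^bsub>sect ?D U\<^esub> l) W x = (restr OX U V r \<odot>\<^bsub>sect ?D V\<^esub> restr ?D U V l) W x"
        by (simp add: dual_ops family_apply)
    qed
  qed
qed

end

section \<open>The quotient by the base ring and its dual\<close>

context quadratic_module
begin

abbreviation Q where "Q \<equiv> quotient_presheaf OY (base_image OX OY)"

lemma base_image_submodule:
  assumes U: "openin X U" shows "submodule (base_image OX OY U) (sect OX U) (sect OY U)"
proof -
  interpret S: cring "sect OY U" by (rule I.base_cring[OF U])
  interpret Y: Module.module "sect OX U" "sect OY U" by (rule Y.sect_module[OF U])
  show ?thesis
  proof (rule Y.submoduleI)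
    show "\<zero>\<^bsub>sect OY U\<^esub> \<in> base_image OX OY U"
      unfolding base_image_def by (rule image_eqI[of _ _ "\<zero>\<^bsub>sect OX U\<^esub>"]) simp_all
  qed (auto simp: base_image_def Y.smult_l_minus[symmetric] Y.smult_l_distr[symmetric] Y.smult_assoc1[symmetric])
qed

lemma base_image_restr:
  assumes "openin X U" "openin X V" "V \<subseteq> U"
  shows "restr OY U V ` base_image OX OY U \<subseteq> base_image OX OY V"
proof -
  interpret S: cring "sect OY U" by (rule I.base_cring[OF assms(1)])
  have "restr OY U V (r \<odot>\<^bsub>sect OY U\<^esub> \<one>\<^bsub>sect OY U\<^esub>) = restr OX U V r \<odot>\<^bsub>sect OY V\<^esub> \<one>\<^bsub>sect OY V\<^esub>"
    if "r \<in> carrier (sect OX U)" for r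
    using that assms by (simp add: Y.restr_smult restr_one)
  then show ?thesis using assms by (auto simp: base_image_def)
qed

sublocale Q: modular_presheaf X OX "quotient_presheaf OY (base_image OX OY)"
  by (rule Y.quotient_modular[OF base_image_submodule base_image_restr])

sublocale QS: linear_presheaf X OX "alg_quotient X OX OY"
  unfolding alg_quotient_def by (rule Q.sheafify_linear)

sublocale dual: linear_presheaf X OX "alg_dual X OX OY"
  by (rule QS.dual_linear)

abbreviation cls where "cls V y \<equiv> base_image OX OY V +>\<^bsub>sect OY V\<^esub> y"

lemma Q_sect: "sect Q V = quotient_module (sect OY V) (base_image OX OY V)"
  by (simp add: quotient_presheaf_def)

lemma cls_closed [simp]: "y \<in> carrier (sect OY V) \<Longrightarrow> cls V y \<in> carrier (sect Q V)"
  by (auto simp: Q_sect quotient_module_carrier)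

text \<open>The multiple of 1 lies in the image of the base ring and disappears in the
  quotient.\<close>

lemma cls_comb:
  assumes V: "openin X V" and c: "b \<in> carrier (sect OX V)" "a \<in> carrier (sect OX V)" "\<alpha> \<in> carrier (sect OY V)"
  shows "cls V (b \<odot>\<^bsub>sect OY V\<^esub> \<one>\<^bsub>sect OY V\<^esub> \<oplus>\<^bsub>sect OY V\<^esub> a \<odot>\<^bsub>sect OY V\<^esub> \<alpha>) = a \<odot>\<^bsub>sect Q V\<^esub> cls V \<alpha>"
proof -
  interpret S: cring "sect OY V" by (rule I.base_cring[OF V])
  interpret Y: plain_module "sect OX V" "sect OY V" by (rule Y.sect_plain[OF V])
  have "(b \<odot>\<^bsub>sect OY V\<^esub> \<one>\<^bsub>sect OY V\<^esub> \<oplus>\<^bsub>sect OY V\<^esub> a \<odot>\<^bsub>sect OY V\<^esub> \<alpha>) \<ominus>\<^bsub>sect OY V\<^esub> a \<odot>\<^bsub>sect OY V\<^esub> \<alpha> = b \<odot>\<^bsub>sect OY V\<^esub> \<one>\<^bsub>sect OY V\<^esub>"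
    using c by (simp add: a_minus_def S.a_assoc S.r_neg)
  then show ?thesis
    unfolding Q_sect Y.quotient_smult[OF base_image_submodule[OF V] c(2,3)]
    using c by (subst Y.coset_eq_iff[OF base_image_submodule[OF V]]) (auto simp: base_image_def)
qed

lemma cls_restr:
  "openin X U \<Longrightarrow> openin X V \<Longrightarrow> V \<subseteq> U \<Longrightarrow> y \<in> carrier (sect OY U) \<Longrightarrow> restr Q U V (cls U y) = cls V (restr OY U V y)"
  by (rule Y.quotient_restr[OF base_image_submodule base_image_restr])

text \<open>The condition \<open>OY = OX \<oplus> OX \<alpha>\<close> over \<open>V\<close>, in the
  exact form in which \<open>norm_map\<close> quantifies over it.\<close>

definition generator where
  "generator V \<alpha> \<longleftrightarrow> frame_on X OX OY 2 V (\<lambda>i. if i = 0 then \<one>\<^bsub>sect OY V\<^esub> else \<alpha>)"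

lemma generatorD:
  assumes "generator V \<alpha>"
  shows "openin X V" "\<alpha> \<in> carrier (sect OY V)" "basis2 (sect OX V) (sect OY V) \<one>\<^bsub>sect OY V\<^esub> \<alpha>"
  using Y.frame_onD[OF assms[unfolded generator_def]] by simp_all

lemma generator_restrict:
  assumes "generator V \<alpha>" "openin X W" "W \<subseteq> V"
  shows "generator W (restr OY V W \<alpha>)"
proof -
  have "(\<lambda>i. restr OY V W (if i = 0 then \<one>\<^bsub>sect OY V\<^esub> else \<alpha>)) = (\<lambda>i::nat. if i = 0 then \<one>\<^bsub>sect OY W\<^esub> else restr OY V W \<alpha>)"
    using restr_one[OF generatorD(1)[OF assms(1)] assms(2,3)] by auto
  then show ?thesis
    using Y.frame_on_restrict[OF assms(1)[unfolded generator_def] assms(2,3)] by (simp add: generator_def)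
qed

section \<open>Freeness of the quotient sheaf on the class of a generator\<close>

lemma class_eq: "alg_class X OX OY V y = to_sheafify X Q V (cls V y)"
  by (simp add: alg_class_def)

lemma class_closed [simp]:
  "openin X V \<Longrightarrow> y \<in> carrier (sect OY V) \<Longrightarrow> alg_class X OX OY V y \<in> carrier (sect (alg_quotient X OX OY) V)"
  unfolding class_eq alg_quotient_def by (rule Q.to_sheafify_closed) simp_all

lemma class_restr:
  "openin X V \<Longrightarrow> openin X W \<Longrightarrow> W \<subseteq> V \<Longrightarrow> y \<in> carrier (sect OY V) \<Longrightarrow>
   restr (alg_quotient X OX OY) V W (alg_class X OX OY V y) = alg_class X OX OY W (restr OY V W y)"
  unfolding class_eq alg_quotient_def by (simp add: Q.to_sheafify_restr cls_restr)

lemma class_comb: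
  assumes "openin X V" "b \<in> carrier (sect OX V)" "a \<in> carrier (sect OX V)" "\<alpha> \<in> carrier (sect OY V)"
  shows "alg_class X OX OY V (b \<odot>\<^bsub>sect OY V\<^esub> \<one>\<^bsub>sect OY V\<^esub> \<oplus>\<^bsub>sect OY V\<^esub> a \<odot>\<^bsub>sect OY V\<^esub> \<alpha>) =
    a \<odot>\<^bsub>sect (alg_quotient X OX OY) V\<^esub> alg_class X OX OY V \<alpha>"
  unfolding class_eq alg_quotient_def cls_comb[OF assms]
  by (rule Q.to_sheafify_smult) (use assms in simp_all)

text \<open>Equality in the sheafified quotient descends to the presheaf quotient only near each
  point. There the difference of the two multiples of \<alpha> is a multiple of 1, and the
  coordinates in the basis \<open>1, \<alpha>\<close> can be compared; separatedness of
  \<open>OX\<close> concludes.\<close>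

lemma class_coeff_unique:
  assumes g: "generator V \<alpha>" and a: "a \<in> carrier (sect OX V)" "a' \<in> carrier (sect OX V)"
    and eq: "a \<odot>\<^bsub>sect (alg_quotient X OX OY) V\<^esub> alg_class X OX OY V \<alpha> =
      a' \<odot>\<^bsub>sect (alg_quotient X OX OY) V\<^esub> alg_class X OX OY V \<alpha>"
  shows "a = a'"
proof (rule Y.restr_separated[OF generatorD(1)[OF g] a])
  note V = generatorD[OF g]
  fix p assume p: "p \<in> V"
  have ca: "a \<odot>\<^bsub>sect Q V\<^esub> cls V \<alpha> \<in> carrier (sect Q V)" "a' \<odot>\<^bsub>sect Q V\<^esub> cls V \<alpha> \<in> carrier (sect Q V)"
    using V a by simp_all
  have "to_sheafify X Q V (a \<odot>\<^bsub>sect Q V\<^esub> cls V \<alpha>) = to_sheafify X Q V (a' \<odot>\<^bsub>sect Q V\<^esub> cls V \<alpha>)"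
    using eq V a unfolding class_eq alg_quotient_def by (simp add: Q.to_sheafify_smult)
  then have "germ X Q p V (a \<odot>\<^bsub>sect Q V\<^esub> cls V \<alpha>) = germ X Q p V (a' \<odot>\<^bsub>sect Q V\<^esub> cls V \<alpha>)"
    by (drule_tac fun_cong[where x = p]) (use p in \<open>simp add: to_sheafify_def\<close>)
  then obtain W where W: "openin X W" "p \<in> W" "W \<subseteq> V"
    and WQ: "restr Q V W (a \<odot>\<^bsub>sect Q V\<^esub> cls V \<alpha>) = restr Q V W (a' \<odot>\<^bsub>sect Q V\<^esub> cls V \<alpha>)"
    using Q.germ_eq_iff[OF V(1) p ca(1) V(1) p ca(2)] by auto
  note gW = generatorD[OF generator_restrict[OF g W(1,3)]]
  interpret S: cring "sect OY W" by (rule I.base_cring[OF W(1)])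
  interpret Y: plain_module "sect OX W" "sect OY W" by (rule Y.sect_plain[OF W(1)])
  let ?b = "restr OX V W a" and ?b' = "restr OX V W a'" and ?\<beta> = "restr OY V W \<alpha>"
  have b: "?b \<in> carrier (sect OX W)" "?b' \<in> carrier (sect OX W)" using V W a by simp_all
  have "?b \<odot>\<^bsub>sect Q W\<^esub> cls W ?\<beta> = ?b' \<odot>\<^bsub>sect Q W\<^esub> cls W ?\<beta>"
    using WQ V W a by (simp add: Q.restr_smult cls_restr)
  then have "cls W (?b \<odot>\<^bsub>sect OY W\<^esub> ?\<beta>) = cls W (?b' \<odot>\<^bsub>sect OY W\<^esub> ?\<beta>)"
    unfolding Q_sect using b gW(2) by (simp add: Y.quotient_smult[OF base_image_submodule[OF W(1)]])
  then have "?b \<odot>\<^bsub>sect OY W\<^esub> ?\<beta> \<ominus>\<^bsub>sect OY W\<^esub> ?b' \<odot>\<^bsub>sect OY W\<^esub> ?\<beta> \<in> base_image OX OY W"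
    using b gW(2) Y.coset_eq_iff[OF base_image_submodule[OF W(1)]] by simp
  then obtain r where r: "r \<in> carrier (sect OX W)"
    "?b \<odot>\<^bsub>sect OY W\<^esub> ?\<beta> \<ominus>\<^bsub>sect OY W\<^esub> ?b' \<odot>\<^bsub>sect OY W\<^esub> ?\<beta> = r \<odot>\<^bsub>sect OY W\<^esub> \<one>\<^bsub>sect OY W\<^esub>"
    by (auto simp: base_image_def)
  have bb: "?b \<odot>\<^bsub>sect OY W\<^esub> ?\<beta> \<in> carrier (sect OY W)" "?b' \<odot>\<^bsub>sect OY W\<^esub> ?\<beta> \<in> carrier (sect OY W)"
    using b gW(2) by simp_all
  have "?b \<odot>\<^bsub>sect OY W\<^esub> ?\<beta> = (?b \<odot>\<^bsub>sect OY W\<^esub> ?\<beta> \<ominus>\<^bsub>sect OY W\<^esub> ?b' \<odot>\<^bsub>sect OY W\<^esub> ?\<beta>) \<oplus>\<^bsub>sect OY W\<^esub> ?b' \<odot>\<^bsub>sect OY W\<^esub> ?\<beta>"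
    using bb by (simp add: a_minus_def S.a_assoc S.l_neg)
  also have "\<dots> = r \<odot>\<^bsub>sect OY W\<^esub> \<one>\<^bsub>sect OY W\<^esub> \<oplus>\<^bsub>sect OY W\<^esub> ?b' \<odot>\<^bsub>sect OY W\<^esub> ?\<beta>" unfolding r(2) ..
  finally have "\<zero>\<^bsub>sect OX W\<^esub> \<odot>\<^bsub>sect OY W\<^esub> \<one>\<^bsub>sect OY W\<^esub> \<oplus>\<^bsub>sect OY W\<^esub> ?b \<odot>\<^bsub>sect OY W\<^esub> ?\<beta> =
      r \<odot>\<^bsub>sect OY W\<^esub> \<one>\<^bsub>sect OY W\<^esub> \<oplus>\<^bsub>sect OY W\<^esub> ?b' \<odot>\<^bsub>sect OY W\<^esub> ?\<beta>"
    using bb by simp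
  then have "?b = ?b'" using Y.basis2_unique[OF gW(3)] b r(1) by blast
  then show "\<exists>W. openin X W \<and> p \<in> W \<and> W \<subseteq> V \<and> restr OX V W a = restr OX V W a'" using W by blast
qed

text \<open>Locally a section of the quotient is the class of some \<open>b + a \<alpha>\<close>,
  hence \<open>a\<close> times the class of \<alpha>. The local coefficients are unique, so they
  glue to one over \<open>V\<close>.\<close>

lemma class_coeff_exists:
  assumes g: "generator V \<alpha>" and s: "s \<in> carrier (sect (alg_quotient X OX OY) V)"
  shows "\<exists>a\<in>carrier (sect OX V). s = a \<odot>\<^bsub>sect (alg_quotient X OX OY) V\<^esub> alg_class X OX OY V \<alpha>"
proof -
  note V = generatorD[OF g]
  let ?S = "alg_quotient X OX OY"
  let ?c = "\<lambda>W. alg_class X OX OY W (restr OY V W \<alpha>)"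
  let ?G = "\<lambda>W c. openin X W \<and> W \<subseteq> V \<and> c \<in> carrier (sect OX W) \<and> restr ?S V W s = c \<odot>\<^bsub>sect ?S W\<^esub> ?c W"
  have cc: "?c W \<in> carrier (sect ?S W)" if "openin X W" "W \<subseteq> V" for W using that V by simp
  have cover: "\<exists>W c. p \<in> W \<and> ?G W c" if p: "p \<in> V" for p
  proof -
    obtain W t where W: "openin X W" "p \<in> W" "W \<subseteq> V" "t \<in> carrier (sect Q W)"
      and st: "\<And>q. q \<in> W \<Longrightarrow> s q = germ X Q q W t"
      using Q.sheafify_local[OF s[unfolded alg_quotient_def] p] by metis
    obtain y where y: "y \<in> carrier (sect OY W)" "t = cls W y"
      using W(4) unfolding Q_sect quotient_module_carrier by blast
    note gW = generatorD[OF generator_restrict[OF g W(1,3)]]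
    interpret Y: plain_module "sect OX W" "sect OY W" by (rule Y.sect_plain[OF W(1)])
    obtain b a where ba: "b \<in> carrier (sect OX W)" "a \<in> carrier (sect OX W)"
      "y = b \<odot>\<^bsub>sect OY W\<^esub> \<one>\<^bsub>sect OY W\<^esub> \<oplus>\<^bsub>sect OY W\<^esub> a \<odot>\<^bsub>sect OY W\<^esub> restr OY V W \<alpha>"
      using Y.basis2_exists[OF gW(3) y(1)] by blast
    have "restr ?S V W s = to_sheafify X Q W t"
      using st by (auto simp: alg_quotient_def Q.sheafify_simps(2) to_sheafify_def restrict_def fun_eq_iff)
    also have "\<dots> = alg_class X OX OY W y" unfolding y(2) class_eq ..
    also have "\<dots> = a \<odot>\<^bsub>sect ?S W\<^esub> ?c W" unfolding ba(3) by (rule class_comb[OF W(1) ba(1,2) gW(2)])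
    finally have "?G W a" using W ba by blast
    then show ?thesis using W(2) by blast
  qed
  have "\<exists>!d. d \<in> carrier (sect OX V) \<and> (\<forall>W c. ?G W c \<longrightarrow> restr OX V W d = c)"
  proof (rule Y.restr_glue[OF V(1) _ cover])
    fix W W' c assume G: "?G W c" and W': "openin X W'" "W' \<subseteq> W"
    then have W: "openin X W" "W \<subseteq> V" "c \<in> carrier (sect OX W)" and sW: "restr ?S V W s = c \<odot>\<^bsub>sect ?S W\<^esub> ?c W" by blast+
    have "restr ?S V W' s = restr ?S W W' (restr ?S V W s)"
      by (rule QS.restr_restr[OF V(1) W(1) W'(1,2) W(2) s, symmetric])
    also have "\<dots> = restr OX W W' c \<odot>\<^bsub>sect ?S W'\<^esub> restr ?S W W' (?c W)"
      unfolding sW by (rule QS.restr_smult[OF W(1) W' W(3) cc[OF W(1,2)]])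
    also have "restr ?S W W' (?c W) = ?c W'" using V W W' by (simp add: class_restr)
    finally show "?G W' (restr OX W W' c)" using W W' by auto
  next
    fix W c c' assume G: "?G W c" "?G W c'"
    then have W: "openin X W" "W \<subseteq> V" by blast+
    show "c = c'" using class_coeff_unique[OF generator_restrict[OF g W]] G by simp
  qed simp
  then obtain d where d: "d \<in> carrier (sect OX V)" "\<And>W c. ?G W c \<Longrightarrow> restr OX V W d = c" by blast
  let ?t = "d \<odot>\<^bsub>sect ?S V\<^esub> alg_class X OX OY V \<alpha>"
  have t: "?t \<in> carrier (sect ?S V)" using V d(1) by simp
  \<comment> \<open>Both are functions on points, and on the members of the cover their restrictions
    agree.\<close>
  have "s = ?t"
  proof (rule extensionalityI)
    show "s \<in> extensional V" "?t \<in> extensional V"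
      using s t unfolding alg_quotient_def Q.sheafify_carrier by blast+
    fix p assume "p \<in> V"
    then obtain W c where W: "p \<in> W" and G: "?G W c" using cover by blast
    have "restr ?S V W ?t = restr OX V W d \<odot>\<^bsub>sect ?S W\<^esub> restr ?S V W (alg_class X OX OY V \<alpha>)"
      using V d(1) G by (intro QS.restr_smult) simp_all
    also have "\<dots> = restr ?S V W s" using V G d(2)[OF G] by (simp add: class_restr)
    finally have "restrict ?t W = restrict s W" by (simp add: alg_quotient_def Q.sheafify_simps(2))
    then show "s p = ?t p" using W by (metis restrict_apply')
  qed
  then show ?thesis using d by blast
qed

text \<open>The coefficient with respect to the class of \<alpha> is the required functional.
  Conversely, a functional is determined by its value on the generator, because every section over a
  smaller open set is a multiple of the restricted generator.\<close>

lemma dual_class_exists: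
  assumes g: "generator V \<alpha>"
  shows "\<exists>!l. l \<in> carrier (sect (alg_dual X OX OY) V) \<and> l V (alg_class X OX OY V \<alpha>) = \<one>\<^bsub>sect OX V\<^esub>"
proof (rule ex_ex1I)
  note V = generatorD[OF g]
  let ?S = "alg_quotient X OX OY"
  let ?c = "\<lambda>W. alg_class X OX OY W (restr OY V W \<alpha>)"
  have gW: "generator W (restr OY V W \<alpha>)" if "openin X W" "W \<subseteq> V" for W
    by (rule generator_restrict[OF g that])
  have cc: "?c W \<in> carrier (sect ?S W)" if "openin X W" "W \<subseteq> V" for W using that V by simp
  \<comment> \<open>The coordinate of \<open>s\<close> on the restricted generator.\<close>
  define k where "k W s = (THE a. a \<in> carrier (sect OX W) \<and> s = a \<odot>\<^bsub>sect ?S W\<^esub> ?c W)" for W s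
  have k: "k W (a \<odot>\<^bsub>sect ?S W\<^esub> ?c W) = a" if "openin X W" "W \<subseteq> V" "a \<in> carrier (sect OX W)" for W a
    unfolding k_def using that(3) class_coeff_unique[OF gW[OF that(1,2)]] by (intro the_equality) auto
  have ex: "\<exists>a\<in>carrier (sect OX W). s = a \<odot>\<^bsub>sect ?S W\<^esub> ?c W" if "openin X W" "W \<subseteq> V" "s \<in> carrier (sect ?S W)" for W s
    by (rule class_coeff_exists[OF gW[OF that(1,2)] that(3)])
  \<comment> \<open>The module laws on multiples of the generator are computed in \<open>Q\<close>,
    whose sections form modules, and transported by \<open>to_sheafify\<close>.\<close>
  have lin: "(a \<odot>\<^bsub>sect ?S W\<^esub> ?c W) \<oplus>\<^bsub>sect ?S W\<^esub> (b \<odot>\<^bsub>sect ?S W\<^esub> ?c W) = (a \<oplus>\<^bsub>sect OX W\<^esub> b) \<odot>\<^bsub>sect ?S W\<^esub> ?c W"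
    "r \<odot>\<^bsub>sect ?S W\<^esub> (a \<odot>\<^bsub>sect ?S W\<^esub> ?c W) = (r \<otimes>\<^bsub>sect OX W\<^esub> a) \<odot>\<^bsub>sect ?S W\<^esub> ?c W"
    if W: "openin X W" "W \<subseteq> V" and c: "a \<in> carrier (sect OX W)" "b \<in> carrier (sect OX W)" "r \<in> carrier (sect OX W)" for W a b r
  proof -
    let ?q = "cls W (restr OY V W \<alpha>)"
    interpret O: cring "sect OX W" by (rule Y.base_cring[OF W(1)])
    interpret Qm: Module.module "sect OX W" "sect Q W" by (rule Q.sect_module[OF W(1)])
    have q: "?q \<in> carrier (sect Q W)" using W V by simp
    have sm: "x \<odot>\<^bsub>sect ?S W\<^esub> ?c W = to_sheafify X Q W (x \<odot>\<^bsub>sect Q W\<^esub> ?q)" if "x \<in> carrier (sect OX W)" for x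
      unfolding class_eq alg_quotient_def using W(1) that q by (simp add: Q.to_sheafify_smult)
    have xq: "x \<odot>\<^bsub>sect Q W\<^esub> ?q \<in> carrier (sect Q W)" if "x \<in> carrier (sect OX W)" for x
      using W(1) that q by simp
    have "(a \<odot>\<^bsub>sect ?S W\<^esub> ?c W) \<oplus>\<^bsub>sect ?S W\<^esub> (b \<odot>\<^bsub>sect ?S W\<^esub> ?c W) =
        to_sheafify X Q W (a \<odot>\<^bsub>sect Q W\<^esub> ?q \<oplus>\<^bsub>sect Q W\<^esub> b \<odot>\<^bsub>sect Q W\<^esub> ?q)"
      unfolding sm[OF c(1)] sm[OF c(2)] unfolding alg_quotient_def by (rule Q.to_sheafify_add[OF W(1) xq[OF c(1)] xq[OF c(2)], symmetric])
    also have "\<dots> = (a \<oplus>\<^bsub>sect OX W\<^esub> b) \<odot>\<^bsub>sect ?S W\<^esub> ?c W"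
      using sm[of "a \<oplus>\<^bsub>sect OX W\<^esub> b"] c q by (simp add: Qm.smult_l_distr)
    finally show "(a \<odot>\<^bsub>sect ?S W\<^esub> ?c W) \<oplus>\<^bsub>sect ?S W\<^esub> (b \<odot>\<^bsub>sect ?S W\<^esub> ?c W) = (a \<oplus>\<^bsub>sect OX W\<^esub> b) \<odot>\<^bsub>sect ?S W\<^esub> ?c W" .
    have "r \<odot>\<^bsub>sect ?S W\<^esub> (a \<odot>\<^bsub>sect ?S W\<^esub> ?c W) = to_sheafify X Q W (r \<odot>\<^bsub>sect Q W\<^esub> (a \<odot>\<^bsub>sect Q W\<^esub> ?q))"
      unfolding sm[OF c(1)] unfolding alg_quotient_def by (rule Q.to_sheafify_smult[OF W(1) c(3) xq[OF c(1)], symmetric])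
    also have "\<dots> = (r \<otimes>\<^bsub>sect OX W\<^esub> a) \<odot>\<^bsub>sect ?S W\<^esub> ?c W"
      using sm[of "r \<otimes>\<^bsub>sect OX W\<^esub> a"] c q by (simp add: Qm.smult_assoc1)
    finally show "r \<odot>\<^bsub>sect ?S W\<^esub> (a \<odot>\<^bsub>sect ?S W\<^esub> ?c W) = (r \<otimes>\<^bsub>sect OX W\<^esub> a) \<odot>\<^bsub>sect ?S W\<^esub> ?c W" .
  qed
  have "QS.family k V \<in> carrier (sect (alg_dual X OX OY) V)"
  proof (rule QS.family_dual)
    fix W s assume W: "openin X W" "W \<subseteq> V" and "s \<in> carrier (sect ?S W)"
    then obtain a where a: "a \<in> carrier (sect OX W)" "s = a \<odot>\<^bsub>sect ?S W\<^esub> ?c W" using ex by blast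
    interpret O: cring "sect OX W" by (rule Y.base_cring[OF W(1)])
    show "k W s \<in> carrier (sect OX W)" using a k[OF W] by simp
    show "k W (s \<oplus>\<^bsub>sect ?S W\<^esub> t) = k W s \<oplus>\<^bsub>sect OX W\<^esub> k W t" if t: "t \<in> carrier (sect ?S W)" for t
    proof -
      obtain b where b: "b \<in> carrier (sect OX W)" "t = b \<odot>\<^bsub>sect ?S W\<^esub> ?c W" using ex W t by blast
      show ?thesis unfolding a(2) b(2) lin(1)[OF W a(1) b(1) a(1)] using a b by (simp add: k[OF W])
    qed
    show "k W (r \<odot>\<^bsub>sect ?S W\<^esub> s) = r \<otimes>\<^bsub>sect OX W\<^esub> k W s" if r: "r \<in> carrier (sect OX W)" for r
      unfolding a(2) lin(2)[OF W a(1) a(1) r] using a r by (simp add: k[OF W])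
    fix W' assume W': "openin X W'" "W' \<subseteq> W"
    have WV: "W' \<subseteq> V" using W W' by auto
    have aW: "restr OX W W' a \<in> carrier (sect OX W')" using a W W' by simp
    have "restr ?S W W' s = restr OX W W' a \<odot>\<^bsub>sect ?S W'\<^esub> restr ?S W W' (?c W)"
      unfolding a(2) by (rule QS.restr_smult[OF W(1) W' a(1) cc[OF W]])
    also have "restr ?S W W' (?c W) = ?c W'" using V W W' by (simp add: class_restr)
    finally show "k W' (restr ?S W W' s) = restr OX W W' (k W s)"
      using k[OF W'(1) WV aW] k[OF W a(1)] a(2) by simp
  qed
  moreover have "QS.family k V V (alg_class X OX OY V \<alpha>) = \<one>\<^bsub>sect OX V\<^esub>"
  proof -
    interpret O: cring "sect OX V" by (rule Y.base_cring[OF V(1)])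
    interpret Qm: Module.module "sect OX V" "sect Q V" by (rule Q.sect_module[OF V(1)])
    have "\<one>\<^bsub>sect OX V\<^esub> \<odot>\<^bsub>sect ?S V\<^esub> alg_class X OX OY V \<alpha> = alg_class X OX OY V \<alpha>"
      unfolding class_eq alg_quotient_def using V by (simp add: Q.to_sheafify_smult[symmetric])
    then show ?thesis using k[OF V(1) order.refl O.one_closed] V by (simp add: QS.family_apply)
  qed
  ultimately show "\<exists>l. l \<in> carrier (sect (alg_dual X OX OY) V) \<and> l V (alg_class X OX OY V \<alpha>) = \<one>\<^bsub>sect OX V\<^esub>" by blast
next
  note V = generatorD[OF g]
  let ?S = "alg_quotient X OX OY"
  fix l l'
  assume l: "l \<in> carrier (sect (alg_dual X OX OY) V) \<and> l V (alg_class X OX OY V \<alpha>) = \<one>\<^bsub>sect OX V\<^esub>"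
    and l': "l' \<in> carrier (sect (alg_dual X OX OY) V) \<and> l' V (alg_class X OX OY V \<alpha>) = \<one>\<^bsub>sect OX V\<^esub>"
  show "l = l'"
  proof (rule QS.dual_eqI)
    fix W s assume W: "openin X W" "W \<subseteq> V" and s: "s \<in> carrier (sect ?S W)"
    obtain a where a: "a \<in> carrier (sect OX W)" "s = a \<odot>\<^bsub>sect ?S W\<^esub> alg_class X OX OY W (restr OY V W \<alpha>)"
      using class_coeff_exists[OF generator_restrict[OF g W] s] by blast
    \<comment> \<open>Linearity and compatibility with restriction reduce the value at
      \<open>s\<close> to the normalized value on the generator over \<open>V\<close>, the same for
      \<open>l\<close> and \<open>l'\<close>.\<close>
    have "m W s = a \<otimes>\<^bsub>sect OX W\<^esub> restr OX V W \<one>\<^bsub>sect OX V\<^esub>"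
      if m: "m \<in> carrier (sect (alg_dual X OX OY) V) \<and> m V (alg_class X OX OY V \<alpha>) = \<one>\<^bsub>sect OX V\<^esub>" for m
    proof -
      have "m W s = a \<otimes>\<^bsub>sect OX W\<^esub> m W (alg_class X OX OY W (restr OY V W \<alpha>))"
        unfolding a(2) using m W V a(1) by (intro QS.dualD(3)[of m V]) auto
      also have "alg_class X OX OY W (restr OY V W \<alpha>) = restr ?S V W (alg_class X OX OY V \<alpha>)"
        using V W by (simp add: class_restr)
      also have "m W (restr ?S V W (alg_class X OX OY V \<alpha>)) = restr OX V W (m V (alg_class X OX OY V \<alpha>))"
        using m W V by (intro QS.dualD(4)[of m V]) auto
      finally show ?thesis using m by simp
    qed
    then show "l W s = l' W s" using l l' by metis
  qed (use l l' in blast)+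
qed

section \<open>The dual generator under restriction and change of generator\<close>

lemma dual_class:
  assumes "generator V \<alpha>"
  shows dual_class_closed: "dual_class X OX OY V \<alpha> \<in> carrier (sect (alg_dual X OX OY) V)"
    and dual_class_one: "dual_class X OX OY V \<alpha> V (alg_class X OX OY V \<alpha>) = \<one>\<^bsub>sect OX V\<^esub>"
  using theI'[OF dual_class_exists[OF assms]] unfolding dual_class_def by blast+

lemma dual_class_eqI:
  assumes "generator V \<alpha>" "l \<in> carrier (sect (alg_dual X OX OY) V)" "l V (alg_class X OX OY V \<alpha>) = \<one>\<^bsub>sect OX V\<^esub>"
  shows "dual_class X OX OY V \<alpha> = l"
  unfolding dual_class_def by (rule the1_equality[OF dual_class_exists[OF assms(1)]]) (use assms in blast)

lemma dual_class_restr: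
  assumes g: "generator V \<alpha>" and W: "openin X W" "W \<subseteq> V"
  shows "restr (alg_dual X OX OY) V W (dual_class X OX OY V \<alpha>) = dual_class X OX OY W (restr OY V W \<alpha>)"
proof (rule dual_class_eqI[OF generator_restrict[OF g W], symmetric])
  note V = generatorD[OF g]
  let ?l = "dual_class X OX OY V \<alpha>"
  interpret r: ring_hom_cring "sect OX V" "sect OX W" "restr OX V W" by (rule Y.base_hom_cring[OF V(1) W])
  show "restr (alg_dual X OX OY) V W ?l \<in> carrier (sect (alg_dual X OX OY) W)"
    by (rule QS.dual_restr_closed[OF W(2) dual_class_closed[OF g]])
  have "restr (alg_dual X OX OY) V W ?l W (alg_class X OX OY W (restr OY V W \<alpha>)) =
      ?l W (restr (alg_quotient X OX OY) V W (alg_class X OX OY V \<alpha>))"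
    using V W by (simp add: QS.dual_ops(3) class_restr)
  also have "\<dots> = restr OX V W (?l V (alg_class X OX OY V \<alpha>))"
    using V W by (intro QS.dualD(4)[OF dual_class_closed[OF g]]) auto
  finally show "restr (alg_dual X OX OY) V W ?l W (alg_class X OX OY W (restr OY V W \<alpha>)) = \<one>\<^bsub>sect OX W\<^esub>"
    by (simp add: dual_class_one[OF g])
qed

text \<open>Modulo \<open>OX\<close> the generator \<beta> is \<open>a \<alpha>\<close>, so
  \<open>a\<close> times the functional dual to \<beta> takes the value 1 on \<alpha>. The factor
  sits on the side opposite to the one in the wedge, where it will cancel.\<close>

lemma dual_class_change:
  assumes g: "generator V \<alpha>" and g': "generator V \<beta>"
    and c: "b \<in> carrier (sect OX V)" "a \<in> carrier (sect OX V)"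
    and \<beta>: "\<beta> = b \<odot>\<^bsub>sect OY V\<^esub> \<one>\<^bsub>sect OY V\<^esub> \<oplus>\<^bsub>sect OY V\<^esub> a \<odot>\<^bsub>sect OY V\<^esub> \<alpha>"
  shows "dual_class X OX OY V \<alpha> = a \<odot>\<^bsub>sect (alg_dual X OX OY) V\<^esub> dual_class X OX OY V \<beta>"
proof (rule dual_class_eqI[OF g])
  note V = generatorD[OF g]
  let ?l = "dual_class X OX OY V \<beta>" and ?c = "alg_class X OX OY V \<alpha>"
  have l: "?l \<in> carrier (sect (alg_dual X OX OY) V)" by (rule dual_class_closed[OF g'])
  show "a \<odot>\<^bsub>sect (alg_dual X OX OY) V\<^esub> ?l \<in> carrier (sect (alg_dual X OX OY) V)"
    by (rule QS.dual_smult_closed[OF V(1) c(2) l])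
  have cc: "?c \<in> carrier (sect (alg_quotient X OX OY) V)" using V by simp
  have "(a \<odot>\<^bsub>sect (alg_dual X OX OY) V\<^esub> ?l) V ?c = a \<otimes>\<^bsub>sect OX V\<^esub> ?l V ?c"
    using V c cc by (simp add: QS.dual_ops(2) QS.family_apply)
  also have "\<dots> = ?l V (a \<odot>\<^bsub>sect (alg_quotient X OX OY) V\<^esub> ?c)"
    using QS.dualD(3)[OF l V(1) order.refl cc c(2)] by simp
  also have "a \<odot>\<^bsub>sect (alg_quotient X OX OY) V\<^esub> ?c = alg_class X OX OY V \<beta>"
    unfolding \<beta> using class_comb[OF V(1) c V(2)] by simp
  also have "?l V (alg_class X OX OY V \<beta>) = \<one>\<^bsub>sect OX V\<^esub>" by (rule dual_class_one[OF g'])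
  finally show "(a \<odot>\<^bsub>sect (alg_dual X OX OY) V\<^esub> ?l) V ?c = \<one>\<^bsub>sect OX V\<^esub>" .
qed

end

section \<open>The norm map\<close>

context tensor_square
begin

text \<open>In the bilinear expansion the square terms vanish, and \<open>v \<and> u\<close>
  contributes the negative product.\<close>

lemma wedge_comb:
  assumes "plain_module R M" and e: "u \<in> carrier M" "v \<in> carrier M"
    and c: "p \<in> carrier R" "q \<in> carrier R" "r \<in> carrier R" "s \<in> carrier R"
  shows "wedge R M (p \<odot>\<^bsub>M\<^esub> u \<oplus>\<^bsub>M\<^esub> q \<odot>\<^bsub>M\<^esub> v) (r \<odot>\<^bsub>M\<^esub> u \<oplus>\<^bsub>M\<^esub> s \<odot>\<^bsub>M\<^esub> v) =
    (p \<otimes> s \<ominus> q \<otimes> r) \<odot>\<^bsub>ext_square R M\<^esub> wedge R M u v"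
proof -
  let ?w = "wedge R M u v"
  have w: "?w \<in> carrier (ext_square R M)" using e by simp
  have "wedge R M (p \<odot>\<^bsub>M\<^esub> u \<oplus>\<^bsub>M\<^esub> q \<odot>\<^bsub>M\<^esub> v) (r \<odot>\<^bsub>M\<^esub> u \<oplus>\<^bsub>M\<^esub> s \<odot>\<^bsub>M\<^esub> v) =
      r \<odot>\<^bsub>ext_square R M\<^esub> (q \<odot>\<^bsub>ext_square R M\<^esub> wedge R M v u) \<oplus>\<^bsub>ext_square R M\<^esub>
      s \<odot>\<^bsub>ext_square R M\<^esub> (p \<odot>\<^bsub>ext_square R M\<^esub> ?w)"
    using e c by (simp add: wedge_add_left wedge_add_right wedge_smult_left wedge_smult_right)
  also have "\<dots> = \<ominus>\<^bsub>ext_square R M\<^esub> ((q \<otimes> r) \<odot>\<^bsub>ext_square R M\<^esub> ?w) \<oplus>\<^bsub>ext_square R M\<^esub> (p \<otimes> s) \<odot>\<^bsub>ext_square R M\<^esub> ?w"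
    unfolding wedge_swap[OF e] using w c
    by (simp add: E.smult_r_minus E.smult_assoc1[symmetric] R.m_comm)
  also have "\<dots> = (p \<otimes> s \<ominus> q \<otimes> r) \<odot>\<^bsub>ext_square R M\<^esub> ?w"
    using w c by (simp add: a_minus_def E.smult_l_distr E.smult_l_minus E.M.a_comm)
  finally show ?thesis .
qed

text \<open>Both sides are multiples of the wedge of \<open>e 0\<close> and \<open>e 1\<close>.
  Comparing coefficients leaves the multiplicativity of two by two determinants: that of the
  coordinates of \<open>y\<close> and \<open>x\<close>, and that of \<open>f\<close>.\<close>

lemma wedge_det:
  assumes M: "plain_module R M" and b: "basis2 R M (e 0) (e 1)" and f: "semilinear R (\<lambda>r. r) M M f"
    and a: "is_matrix_of R M 2 e f a" and y: "y \<in> carrier M" and x: "x \<in> carrier M"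
  shows "wedge R M (f y) (f x) = mat_det R 2 a \<odot>\<^bsub>ext_square R M\<^esub> wedge R M y x"
proof -
  interpret P: plain_module R M by (rule M)
  have e: "e 0 \<in> carrier M" "e 1 \<in> carrier M" using b by (auto simp: basis2_def)
  note m = a[unfolded P.is_matrix_of_iff[OF e]]
  have ac: "a 0 0 \<in> carrier R" "a 0 1 \<in> carrier R" "a 1 0 \<in> carrier R" "a 1 1 \<in> carrier R" using m by blast+
  have fe: "f (e 0) = a 0 0 \<odot>\<^bsub>M\<^esub> e 0 \<oplus>\<^bsub>M\<^esub> a 1 0 \<odot>\<^bsub>M\<^esub> e 1" "f (e 1) = a 0 1 \<odot>\<^bsub>M\<^esub> e 0 \<oplus>\<^bsub>M\<^esub> a 1 1 \<odot>\<^bsub>M\<^esub> e 1"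
    using m by blast+
  have fcomb: "f (p \<odot>\<^bsub>M\<^esub> e 0 \<oplus>\<^bsub>M\<^esub> q \<odot>\<^bsub>M\<^esub> e 1) =
      (p \<otimes> a 0 0 \<oplus> q \<otimes> a 0 1) \<odot>\<^bsub>M\<^esub> e 0 \<oplus>\<^bsub>M\<^esub> (p \<otimes> a 1 0 \<oplus> q \<otimes> a 1 1) \<odot>\<^bsub>M\<^esub> e 1"
    if "p \<in> carrier R" "q \<in> carrier R" for p q
  proof -
    have "f (p \<odot>\<^bsub>M\<^esub> e 0 \<oplus>\<^bsub>M\<^esub> q \<odot>\<^bsub>M\<^esub> e 1) = p \<odot>\<^bsub>M\<^esub> f (e 0) \<oplus>\<^bsub>M\<^esub> q \<odot>\<^bsub>M\<^esub> f (e 1)"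
      using that e by (simp add: semilinearD(2,3)[OF f])
    then show ?thesis unfolding fe using P.comb_comb[OF that ac(1,3,2,4) e] by simp
  qed
  obtain p q where p: "p \<in> carrier R" "q \<in> carrier R" "y = p \<odot>\<^bsub>M\<^esub> e 0 \<oplus>\<^bsub>M\<^esub> q \<odot>\<^bsub>M\<^esub> e 1"
    using P.basis2_exists[OF b y] by blast
  obtain r s where r: "r \<in> carrier R" "s \<in> carrier R" "x = r \<odot>\<^bsub>M\<^esub> e 0 \<oplus>\<^bsub>M\<^esub> s \<odot>\<^bsub>M\<^esub> e 1"
    using P.basis2_exists[OF b x] by blast
  let ?w = "wedge R M (e 0) (e 1)"
  have w: "?w \<in> carrier (ext_square R M)" using e by simp
  have d: "mat_det R 2 a = a 0 0 \<otimes> a 1 1 \<ominus> a 0 1 \<otimes> a 1 0"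
    using a by (intro R.mat_det_2) (simp add: is_matrix_of_def)
  have "wedge R M (f y) (f x) = ((p \<otimes> a 0 0 \<oplus> q \<otimes> a 0 1) \<otimes> (r \<otimes> a 1 0 \<oplus> s \<otimes> a 1 1) \<ominus>
      (p \<otimes> a 1 0 \<oplus> q \<otimes> a 1 1) \<otimes> (r \<otimes> a 0 0 \<oplus> s \<otimes> a 0 1)) \<odot>\<^bsub>ext_square R M\<^esub> ?w"
    unfolding p(3) r(3) fcomb[OF p(1,2)] fcomb[OF r(1,2)]
    by (rule wedge_comb[OF M e]) (use p(1,2) r(1,2) ac in simp_all)
  also have "(p \<otimes> a 0 0 \<oplus> q \<otimes> a 0 1) \<otimes> (r \<otimes> a 1 0 \<oplus> s \<otimes> a 1 1) \<ominus>
      (p \<otimes> a 1 0 \<oplus> q \<otimes> a 1 1) \<otimes> (r \<otimes> a 0 0 \<oplus> s \<otimes> a 0 1) =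
      (a 0 0 \<otimes> a 1 1 \<ominus> a 0 1 \<otimes> a 1 0) \<otimes> (p \<otimes> s \<ominus> q \<otimes> r)"
    using p(1,2) r(1,2) ac by algebra
  also have "\<dots> \<odot>\<^bsub>ext_square R M\<^esub> ?w = (a 0 0 \<otimes> a 1 1 \<ominus> a 0 1 \<otimes> a 1 0) \<odot>\<^bsub>ext_square R M\<^esub> ((p \<otimes> s \<ominus> q \<otimes> r) \<odot>\<^bsub>ext_square R M\<^esub> ?w)"
    by (rule E.smult_assoc1[OF _ _ w]) (use p(1,2) r(1,2) ac in simp_all)
  also have "(p \<otimes> s \<ominus> q \<otimes> r) \<odot>\<^bsub>ext_square R M\<^esub> ?w = wedge R M y x"
    unfolding p(3) r(3) by (rule wedge_comb[OF M e p(1,2) r(1,2), symmetric])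
  finally show ?thesis unfolding d .
qed

end

context quadratic_module
begin

text \<open>
  If \<open>1 = a e\<^sub>0 + b e\<^sub>1\<close>, then comparing the coefficients of \<open>e\<^sub>0\<close> in \<open>e\<^sub>0 = a e\<^sub>0\<^sup>2 + b e\<^sub>1 e\<^sub>0\<close> shows that
  \<open>a\<close> and \<open>b\<close> generate the unit ideal, so that \<open>1\<close> is part of a basis.
\<close>

lemma generator_near:
  assumes U: "openin X U" and p: "p \<in> U"
  shows "\<exists>V \<alpha>. p \<in> V \<and> V \<subseteq> U \<and> generator V \<alpha>"
proof -
  obtain V e where V: "p \<in> V" "V \<subseteq> U" "frame_on X OX OY 2 V e" using Y.frame_near[OF U p] by blast
  note f = Y.frame_onD[OF V(3)]
  interpret S: cring "sect OY V" by (rule I.base_cring[OF f(1)])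
  interpret A: Module.algebra "sect OX V" "sect OY V" by (rule OY_algebra[OF f(1)])
  interpret P: plain_module "sect OX V" "sect OY V" by (rule Y.sect_plain[OF f(1)])
  obtain a b where ab: "a \<in> carrier (sect OX V)" "b \<in> carrier (sect OX V)"
    "\<one>\<^bsub>sect OY V\<^esub> = a \<odot>\<^bsub>sect OY V\<^esub> e 0 \<oplus>\<^bsub>sect OY V\<^esub> b \<odot>\<^bsub>sect OY V\<^esub> e 1"
    using P.basis2_exists[OF f(4) S.one_closed] by blast
  have e00: "e 0 \<otimes>\<^bsub>sect OY V\<^esub> e 0 \<in> carrier (sect OY V)" "e 1 \<otimes>\<^bsub>sect OY V\<^esub> e 0 \<in> carrier (sect OY V)"
    using f by simp_all
  obtain c c' where c: "c \<in> carrier (sect OX V)" "c' \<in> carrier (sect OX V)"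
    "e 0 \<otimes>\<^bsub>sect OY V\<^esub> e 0 = c \<odot>\<^bsub>sect OY V\<^esub> e 0 \<oplus>\<^bsub>sect OY V\<^esub> c' \<odot>\<^bsub>sect OY V\<^esub> e 1"
    using P.basis2_exists[OF f(4) e00(1)] by blast
  obtain d d' where d: "d \<in> carrier (sect OX V)" "d' \<in> carrier (sect OX V)"
    "e 1 \<otimes>\<^bsub>sect OY V\<^esub> e 0 = d \<odot>\<^bsub>sect OY V\<^esub> e 0 \<oplus>\<^bsub>sect OY V\<^esub> d' \<odot>\<^bsub>sect OY V\<^esub> e 1"
    using P.basis2_exists[OF f(4) e00(2)] by blast
  have "e 0 = \<one>\<^bsub>sect OY V\<^esub> \<otimes>\<^bsub>sect OY V\<^esub> e 0" using f by simp
  also have "\<dots> = a \<odot>\<^bsub>sect OY V\<^esub> (e 0 \<otimes>\<^bsub>sect OY V\<^esub> e 0) \<oplus>\<^bsub>sect OY V\<^esub> b \<odot>\<^bsub>sect OY V\<^esub> (e 1 \<otimes>\<^bsub>sect OY V\<^esub> e 0)"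
    unfolding ab(3) using f ab(1,2) by (simp add: S.l_distr A.smult_assoc2)
  also have "\<dots> = (a \<otimes>\<^bsub>sect OX V\<^esub> c \<oplus>\<^bsub>sect OX V\<^esub> b \<otimes>\<^bsub>sect OX V\<^esub> d) \<odot>\<^bsub>sect OY V\<^esub> e 0 \<oplus>\<^bsub>sect OY V\<^esub>
      (a \<otimes>\<^bsub>sect OX V\<^esub> c' \<oplus>\<^bsub>sect OX V\<^esub> b \<otimes>\<^bsub>sect OX V\<^esub> d') \<odot>\<^bsub>sect OY V\<^esub> e 1"
    unfolding c(3) d(3) by (rule P.comb_comb[OF ab(1,2) c(1,2) d(1,2) f(2,3)])
  finally have "\<one>\<^bsub>sect OX V\<^esub> \<odot>\<^bsub>sect OY V\<^esub> e 0 \<oplus>\<^bsub>sect OY V\<^esub> \<zero>\<^bsub>sect OX V\<^esub> \<odot>\<^bsub>sect OY V\<^esub> e 1 =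
      (a \<otimes>\<^bsub>sect OX V\<^esub> c \<oplus>\<^bsub>sect OX V\<^esub> b \<otimes>\<^bsub>sect OX V\<^esub> d) \<odot>\<^bsub>sect OY V\<^esub> e 0 \<oplus>\<^bsub>sect OY V\<^esub>
      (a \<otimes>\<^bsub>sect OX V\<^esub> c' \<oplus>\<^bsub>sect OX V\<^esub> b \<otimes>\<^bsub>sect OX V\<^esub> d') \<odot>\<^bsub>sect OY V\<^esub> e 1"
    using f(2,3) by simp
  from P.basis2_unique[OF f(4) this]
  have one: "\<one>\<^bsub>sect OX V\<^esub> = a \<otimes>\<^bsub>sect OX V\<^esub> c \<oplus>\<^bsub>sect OX V\<^esub> b \<otimes>\<^bsub>sect OX V\<^esub> d"
    using ab c d by simp
  \<comment> \<open>The coefficients \<open>(- d, c)\<close> complete \<open>(a, b)\<close> to a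
    matrix of determinant \<open>a c + b d\<close>, which is 1 by \<open>one\<close>.\<close>
  define \<alpha> where "\<alpha> = (\<ominus>\<^bsub>sect OX V\<^esub> d) \<odot>\<^bsub>sect OY V\<^esub> e 0 \<oplus>\<^bsub>sect OY V\<^esub> c \<odot>\<^bsub>sect OY V\<^esub> e 1"
  have nd: "\<ominus>\<^bsub>sect OX V\<^esub> d \<in> carrier (sect OX V)" using d by simp
  have \<alpha>: "\<alpha> \<in> carrier (sect OY V)" unfolding \<alpha>_def using nd c f by simp
  have "basis2 (sect OX W) (sect OY W) (restr OY V W \<one>\<^bsub>sect OY V\<^esub>) (restr OY V W \<alpha>)" if W: "openin X W" "W \<subseteq> V" for W
  proof -
    interpret PW: plain_module "sect OX W" "sect OY W" by (rule Y.sect_plain[OF W(1)])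
    interpret r: ring_hom_cring "sect OX V" "sect OX W" "restr OX V W" by (rule Y.base_hom_cring[OF f(1) W])
    let ?r = "restr OX V W"
    have "?r \<one>\<^bsub>sect OX V\<^esub> = ?r a \<otimes>\<^bsub>sect OX W\<^esub> ?r c \<oplus>\<^bsub>sect OX W\<^esub> ?r b \<otimes>\<^bsub>sect OX W\<^esub> ?r d"
      unfolding one using ab(1,2) c(1) d(1) by simp
    moreover have "?r a \<otimes>\<^bsub>sect OX W\<^esub> ?r c \<oplus>\<^bsub>sect OX W\<^esub> ?r b \<otimes>\<^bsub>sect OX W\<^esub> ?r d =
        \<one>\<^bsub>sect OX W\<^esub> \<otimes>\<^bsub>sect OX W\<^esub> (?r a \<otimes>\<^bsub>sect OX W\<^esub> ?r c \<ominus>\<^bsub>sect OX W\<^esub> ?r b \<otimes>\<^bsub>sect OX W\<^esub> ?r (\<ominus>\<^bsub>sect OX V\<^esub> d))"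
      using ab(1,2) c(1) d(1) by (simp add: a_minus_def PW.R.r_minus)
    ultimately have det: "\<one>\<^bsub>sect OX W\<^esub> \<otimes>\<^bsub>sect OX W\<^esub> (?r a \<otimes>\<^bsub>sect OX W\<^esub> ?r c \<ominus>\<^bsub>sect OX W\<^esub> ?r b \<otimes>\<^bsub>sect OX W\<^esub> ?r (\<ominus>\<^bsub>sect OX V\<^esub> d)) = \<one>\<^bsub>sect OX W\<^esub>"
      by (metis r.hom_one)
    show ?thesis
      unfolding \<alpha>_def ab(3) Y.restr_comb[OF f(1) W ab(1,2) f(2,3)] Y.restr_comb[OF f(1) W nd c(1) f(2,3)]
      by (rule PW.basis2_change[OF Y.frame_onD(4)[OF Y.frame_on_restrict[OF V(3) W]] _ _ _ _ _ det])
         (use ab c nd in simp_all)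
  qed
  then have "generator V \<alpha>"
    unfolding generator_def Y.frame_on_iff using f(1) \<alpha> by simp
  then show ?thesis using V by blast
qed

section \<open>Local expressions of the norm map and their gluing\<close>

sublocale Msq: exterior_presheaf X OX "restrict_scalars OY I"
  by unfold_locales

sublocale E: linear_presheaf X OX "ext2_sheaf X OX (restrict_scalars OY I)"
  unfolding ext2_sheaf_def by (rule Msq.ext2.sheafify_linear)

sublocale T: two_linear_presheaves X OX "ext2_sheaf X OX (restrict_scalars OY I)" "alg_dual X OX OY"
  by unfold_locales

abbreviation "TP \<equiv> tensor_presheaf OX (ext2_sheaf X OX M) (alg_dual X OX OY)"

text \<open>The local formula as a section of the tensor presheaf, before sheafification, so that
  values on overlaps are compared as germs and glued by \<open>sheafify_glue\<close>.\<close>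

definition expression where
  "expression V \<alpha> x = pure_tensor (sect OX V) (sect (ext2_sheaf X OX M) V) (sect (alg_dual X OX OY) V)
     (wedge_sect X OX M V (\<alpha> \<odot>\<^bsub>sect I V\<^esub> x) x) (dual_class X OX OY V \<alpha>)"

lemma norm_sheaf_eq: "norm_sheaf X OX OY I = sheafify X OX TP"
  by (simp add: norm_sheaf_def tensor_sheaf_def)

lemma wedge_sect_closed [simp]:
  assumes "openin X V" "x \<in> carrier (sect I V)" "y \<in> carrier (sect I V)"
  shows "wedge_sect X OX M V x y \<in> carrier (sect (ext2_sheaf X OX M) V)"
  unfolding Msq.wedge_sect_eq ext2_sheaf_def
  by (rule Msq.ext2.to_sheafify_closed[OF assms(1)])
     (use tensor_square.wedge_closed[OF Msq.square_sect[OF assms(1)]] assms in \<open>simp add: Msq.ext2_sect\<close>)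

lemma wedge_sect_restr:
  assumes V: "openin X V" "openin X W" "W \<subseteq> V" and x: "x \<in> carrier (sect I V)" "y \<in> carrier (sect I V)"
  shows "restr (ext2_sheaf X OX M) V W (wedge_sect X OX M V x y) = wedge_sect X OX M W (restr I V W x) (restr I V W y)"
proof -
  have w: "wedge (sect OX V) (sect M V) x y \<in> carrier (sect (ext2_presheaf OX M) V)"
    using tensor_square.wedge_closed[OF Msq.square_sect[OF V(1)]] x by (simp add: Msq.ext2_sect)
  show ?thesis
    unfolding Msq.wedge_sect_eq ext2_sheaf_def Msq.ext2.to_sheafify_restr[OF V w]
    using Msq.restr_wedge[OF V] x by simp
qed

text \<open>Carries an identity from the exterior square over \<open>V\<close>, where the module
  axioms hold, to its sheafification.\<close>

lemma wedge_sect_eq_smult: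
  assumes V: "openin X V" and r: "r \<in> carrier (sect OX V)" and x: "x \<in> carrier (sect I V)" "y \<in> carrier (sect I V)"
    and eq: "wedge (sect OX V) (sect M V) x' y' = r \<odot>\<^bsub>ext_square (sect OX V) (sect M V)\<^esub> wedge (sect OX V) (sect M V) x y"
  shows "wedge_sect X OX M V x' y' = r \<odot>\<^bsub>sect (ext2_sheaf X OX M) V\<^esub> wedge_sect X OX M V x y"
proof -
  have w: "wedge (sect OX V) (sect M V) x y \<in> carrier (sect (ext2_presheaf OX M) V)"
    using tensor_square.wedge_closed[OF Msq.square_sect[OF V]] x by (simp add: Msq.ext2_sect)
  show ?thesis
    unfolding Msq.wedge_sect_eq ext2_sheaf_def eq Msq.ext2.to_sheafify_smult[OF V r w, symmetric]
    by (simp add: Msq.ext2_sect)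
qed

lemma expression_closed:
  assumes g: "generator V \<alpha>" and x: "x \<in> carrier (sect I V)"
  shows "expression V \<alpha> x \<in> carrier (sect TP V)"
  unfolding expression_def T.tensor_presheaf_sect
  using generatorD[OF g] x dual_class_closed[OF g]
  by (intro tensor_product.pure_tensor_closed[OF T.tensor_sect]) simp_all

lemma expression_restr:
  assumes g: "generator V \<alpha>" and W: "openin X W" "W \<subseteq> V" and x: "x \<in> carrier (sect I V)"
  shows "restr TP V W (expression V \<alpha> x) = expression W (restr OY V W \<alpha>) (restr I V W x)"
proof -
  note V = generatorD[OF g]
  have ax: "\<alpha> \<odot>\<^bsub>sect I V\<^esub> x \<in> carrier (sect I V)" using V x by simp
  show ?thesis
    unfolding expression_def
      T.restr_pure_tensor[OF V(1) W wedge_sect_closed[OF V(1) ax x] dual_class_closed[OF g]]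
      wedge_sect_restr[OF V(1) W ax x] dual_class_restr[OF g W] restr_act[OF V(1) W V(2) x] ..
qed

text \<open>For \<open>\<beta> = b + a \<alpha>\<close> the wedge of \<open>\<beta> x\<close> with
  \<open>x\<close> is \<open>a\<close> times that of \<open>\<alpha> x\<close> with
  \<open>x\<close>, as the term \<open>b x\<close> contributes a square. The dual generator changes
  by the same factor in the opposite direction, and the tensor product lets \<open>a\<close> pass
  from one side to the other.\<close>

lemma expression_change:
  assumes g: "generator V \<alpha>" and g': "generator V \<beta>" and x: "x \<in> carrier (sect I V)"
  shows "expression V \<alpha> x = expression V \<beta> x"
proof -
  note V = generatorD[OF g] and V' = generatorD[OF g']
  interpret S: cring "sect OY V" by (rule I.base_cring[OF V(1)])
  interpret A: Module.algebra "sect OX V" "sect OY V" by (rule OY_algebra[OF V(1)])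
  interpret P: plain_module "sect OX V" "sect OY V" by (rule Y.sect_plain[OF V(1)])
  interpret IV: Module.module "sect OY V" "sect I V" by (rule I.sect_module[OF V(1)])
  interpret W: tensor_square "sect OX V" "sect M V" by (rule Msq.square_sect[OF V(1)])
  interpret TV: tensor_product "sect OX V" "sect (ext2_sheaf X OX M) V" "sect (alg_dual X OX OY) V"
    by (rule T.tensor_sect[OF V(1)])
  obtain b a where c: "b \<in> carrier (sect OX V)" "a \<in> carrier (sect OX V)"
    and \<beta>: "\<beta> = b \<odot>\<^bsub>sect OY V\<^esub> \<one>\<^bsub>sect OY V\<^esub> \<oplus>\<^bsub>sect OY V\<^esub> a \<odot>\<^bsub>sect OY V\<^esub> \<alpha>"
    using P.basis2_exists[OF V(3) V'(2)] by blast
  let ?ax = "\<alpha> \<odot>\<^bsub>sect I V\<^esub> x"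
  have ax: "?ax \<in> carrier (sect I V)" using V x by simp
  have "a \<odot>\<^bsub>sect OY V\<^esub> \<alpha> = (a \<odot>\<^bsub>sect OY V\<^esub> \<one>\<^bsub>sect OY V\<^esub>) \<otimes>\<^bsub>sect OY V\<^esub> \<alpha>"
    using c V by (simp add: A.smult_assoc2)
  then have "\<beta> \<odot>\<^bsub>sect I V\<^esub> x = b \<odot>\<^bsub>sect M V\<^esub> x \<oplus>\<^bsub>sect M V\<^esub> a \<odot>\<^bsub>sect M V\<^esub> ?ax"
    unfolding \<beta> using c V x by (simp add: IV.smult_l_distr IV.smult_assoc1)
  then have "wedge (sect OX V) (sect M V) (\<beta> \<odot>\<^bsub>sect I V\<^esub> x) x =
      wedge (sect OX V) (sect M V) (b \<odot>\<^bsub>sect M V\<^esub> x \<oplus>\<^bsub>sect M V\<^esub> a \<odot>\<^bsub>sect M V\<^esub> ?ax) x" by (rule arg_cong)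
  also have "\<dots> = a \<odot>\<^bsub>ext_square (sect OX V) (sect M V)\<^esub> wedge (sect OX V) (sect M V) ?ax x"
  proof -
    have x': "x \<in> carrier (sect M V)" "?ax \<in> carrier (sect M V)" using x ax by simp_all
    have bx: "b \<odot>\<^bsub>sect M V\<^esub> x \<in> carrier (sect M V)" "a \<odot>\<^bsub>sect M V\<^esub> ?ax \<in> carrier (sect M V)"
      by (rule W.ops_closed(3)[OF c(1) x'(1)], rule W.ops_closed(3)[OF c(2) x'(2)])
    show ?thesis
      unfolding W.wedge_add_left[OF bx x'(1)] W.wedge_smult_left[OF c(1) x'(1) x'(1)]
        W.wedge_smult_left[OF c(2) x'(2) x'(1)] W.wedge_self[OF x'(1)]
      using c W.wedge_closed[OF x'(2,1)] by simp
  qed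
  finally have w: "wedge_sect X OX M V (\<beta> \<odot>\<^bsub>sect I V\<^esub> x) x =
      a \<odot>\<^bsub>sect (ext2_sheaf X OX M) V\<^esub> wedge_sect X OX M V ?ax x"
    by (rule wedge_sect_eq_smult[OF V(1) c(2) ax x])
  note wc = wedge_sect_closed[OF V(1) ax x] and dc = dual_class_closed[OF g']
  show ?thesis
    unfolding expression_def dual_class_change[OF g g' c \<beta>] w
      TV.pure_tensor_smult_right[OF c(2) wc dc] TV.pure_tensor_smult_left[OF c(2) wc dc] ..
qed

text \<open>On an overlap, both local expressions restrict to expressions for generators of the same
  open set, and \<open>expression_change\<close> identifies them. \<open>generator_near\<close>
  supplies the cover.\<close>

lemma norm_map_exists:
  assumes U: "openin X U" and x: "x \<in> carrier (sect I U)"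
  shows "\<exists>!z. z \<in> carrier (sect (norm_sheaf X OX OY I) U) \<and>
    (\<forall>V \<alpha>. V \<subseteq> U \<and> generator V \<alpha> \<longrightarrow> restr (norm_sheaf X OX OY I) U V z = to_sheafify X TP V (expression V \<alpha> (restr I U V x)))"
proof -
  let ?G = "\<lambda>V c. \<exists>\<alpha>. V \<subseteq> U \<and> generator V \<alpha> \<and> c = expression V \<alpha> (restr I U V x)"
  have "\<exists>!z. z \<in> carrier (sect (sheafify X OX TP) U) \<and>
    (\<forall>V c. ?G V c \<longrightarrow> restr (sheafify X OX TP) U V z = to_sheafify X TP V c)"
  proof (rule T.tensor.sheafify_glue)
    fix V c assume "?G V c"
    then obtain \<alpha> where V: "V \<subseteq> U" "generator V \<alpha>" and c: "c = expression V \<alpha> (restr I U V x)" by blast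
    note o = generatorD(1)[OF V(2)]
    show "openin X V \<and> V \<subseteq> U \<and> c \<in> carrier (sect TP V)"
      unfolding c using o V(1) expression_closed[OF V(2) I.restr_closed[OF U o V(1) x]] by (intro conjI)
  next
    fix p assume "p \<in> U"
    from generator_near[OF U this] obtain V \<alpha> where "p \<in> V" "V \<subseteq> U" "generator V \<alpha>" by (elim exE conjE)
    then have "p \<in> V \<and> ?G V (expression V \<alpha> (restr I U V x))" by (intro conjI exI[of _ \<alpha>]) (assumption | rule refl)+
    then show "\<exists>V c. p \<in> V \<and> ?G V c" by (intro exI)
  next
    fix p V c V' c'
    assume "?G V c" "?G V' c'" and p: "p \<in> V" "p \<in> V'"
    then obtain \<alpha> \<beta> where V: "V \<subseteq> U" "generator V \<alpha>" "c = expression V \<alpha> (restr I U V x)"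
      and V': "V' \<subseteq> U" "generator V' \<beta>" "c' = expression V' \<beta> (restr I U V' x)" by blast
    note o = generatorD(1)[OF V(2)] generatorD(1)[OF V'(2)]
    let ?W = "V \<inter> V'"
    have W: "openin X ?W" "?W \<subseteq> V" "?W \<subseteq> V'" "p \<in> ?W" using o p by auto
    have xV: "restr I U V x \<in> carrier (sect I V)" "restr I U V' x \<in> carrier (sect I V')" "restr I U ?W x \<in> carrier (sect I ?W)"
      using U o V V' W x by (auto intro!: I.restr_closed)
    have "germ X TP p V c = germ X TP p ?W (restr TP V ?W c)"
      unfolding V(3) by (rule T.tensor.germ_restr[OF o(1) W(1,2,4) expression_closed[OF V(2) xV(1)], symmetric])
    also have "restr TP V ?W c = expression ?W (restr OY V ?W \<alpha>) (restr I U ?W x)"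
      unfolding V(3) expression_restr[OF V(2) W(1,2) xV(1)] I.restr_restr[OF U o(1) W(1,2) V(1) x] ..
    also have "\<dots> = expression ?W (restr OY V' ?W \<beta>) (restr I U ?W x)"
      by (rule expression_change[OF generator_restrict[OF V(2) W(1,2)] generator_restrict[OF V'(2) W(1,3)] xV(3)])
    also have "\<dots> = restr TP V' ?W c'"
      unfolding V'(3) expression_restr[OF V'(2) W(1,3) xV(2)] I.restr_restr[OF U o(2) W(1,3) V'(1) x] ..
    also have "germ X TP p ?W (restr TP V' ?W c') = germ X TP p V' c'"
      unfolding V'(3) by (rule T.tensor.germ_restr[OF o(2) W(1,3,4) expression_closed[OF V'(2) xV(2)]])
    finally show "germ X TP p V c = germ X TP p V' c'" .
  qed
  moreover have "(\<forall>V c. ?G V c \<longrightarrow> restr (sheafify X OX TP) U V z = to_sheafify X TP V c) \<longleftrightarrow>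
      (\<forall>V \<alpha>. V \<subseteq> U \<and> generator V \<alpha> \<longrightarrow> restr (norm_sheaf X OX OY I) U V z = to_sheafify X TP V (expression V \<alpha> (restr I U V x)))" for z
    unfolding norm_sheaf_eq by blast
  ultimately show ?thesis unfolding norm_sheaf_eq by simp
qed

lemma norm_map_eq:
  "norm_map X OX OY I U x = (THE z. z \<in> carrier (sect (norm_sheaf X OX OY I) U) \<and>
    (\<forall>V \<alpha>. V \<subseteq> U \<and> generator V \<alpha> \<longrightarrow> restr (norm_sheaf X OX OY I) U V z = to_sheafify X TP V (expression V \<alpha> (restr I U V x))))"
  by (simp add: norm_map_def tensor_sect_def expression_def generator_def)

lemma norm_map:
  assumes "openin X U" "x \<in> carrier (sect I U)"
  shows norm_map_closed: "norm_map X OX OY I U x \<in> carrier (sect (norm_sheaf X OX OY I) U)"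
    and norm_map_restr: "V \<subseteq> U \<Longrightarrow> generator V \<alpha> \<Longrightarrow>
      restr (norm_sheaf X OX OY I) U V (norm_map X OX OY I U x) = to_sheafify X TP V (expression V \<alpha> (restr I U V x))"
  using theI'[OF norm_map_exists[OF assms]] unfolding norm_map_eq by blast+

lemma expression_act:
  assumes g: "generator V \<alpha>" and c: "c \<in> carrier (sect OY V)" and x: "x \<in> carrier (sect I V)"
    and e: "frame_on X OX M 2 V e"
    and a: "is_matrix_of (sect OX V) (sect M V) 2 e (\<lambda>y. c \<odot>\<^bsub>sect I V\<^esub> y) a"
  shows "expression V \<alpha> (c \<odot>\<^bsub>sect I V\<^esub> x) = mat_det (sect OX V) 2 a \<odot>\<^bsub>sect TP V\<^esub> expression V \<alpha> x"
proof -
  note V = generatorD[OF g]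
  interpret S: cring "sect OY V" by (rule I.base_cring[OF V(1)])
  interpret O: cring "sect OX V" by (rule Y.base_cring[OF V(1)])
  interpret IV: Module.module "sect OY V" "sect I V" by (rule I.sect_module[OF V(1)])
  interpret W: tensor_square "sect OX V" "sect M V" by (rule Msq.square_sect[OF V(1)])
  interpret TV: tensor_product "sect OX V" "sect (ext2_sheaf X OX M) V" "sect (alg_dual X OX OY) V"
    by (rule T.tensor_sect[OF V(1)])
  let ?d = "mat_det (sect OX V) 2 a" and ?ax = "\<alpha> \<odot>\<^bsub>sect I V\<^esub> x"
  have ax: "?ax \<in> carrier (sect I V)" using V x by simp
  have f: "semilinear (sect OX V) (\<lambda>r. r) (sect M V) (sect M V) (\<lambda>y. c \<odot>\<^bsub>sect I V\<^esub> y)"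
    using rank_two_endo.f_semilinear[OF act_endo[OF V(1) c] V(1) order.refl] V(1) c by simp
  have d: "?d \<in> carrier (sect OX V)"
    using a by (subst O.mat_det_2) (auto simp: is_matrix_of_def)
  have "\<alpha> \<odot>\<^bsub>sect I V\<^esub> (c \<odot>\<^bsub>sect I V\<^esub> x) = c \<odot>\<^bsub>sect I V\<^esub> ?ax"
    using V c x by (simp add: IV.smult_assoc1[symmetric] S.m_comm)
  then have "wedge (sect OX V) (sect M V) (\<alpha> \<odot>\<^bsub>sect I V\<^esub> (c \<odot>\<^bsub>sect I V\<^esub> x)) (c \<odot>\<^bsub>sect I V\<^esub> x) =
      wedge (sect OX V) (sect M V) (c \<odot>\<^bsub>sect I V\<^esub> ?ax) (c \<odot>\<^bsub>sect I V\<^esub> x)" by simp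
  also have "\<dots> = ?d \<odot>\<^bsub>ext_square (sect OX V) (sect M V)\<^esub> wedge (sect OX V) (sect M V) ?ax x"
    by (rule W.wedge_det[OF M.sect_plain[OF V(1)] M.frame_onD(4)[OF e] f a]) (use ax x in simp_all)
  finally have w: "wedge_sect X OX M V (\<alpha> \<odot>\<^bsub>sect I V\<^esub> (c \<odot>\<^bsub>sect I V\<^esub> x)) (c \<odot>\<^bsub>sect I V\<^esub> x) =
      ?d \<odot>\<^bsub>sect (ext2_sheaf X OX M) V\<^esub> wedge_sect X OX M V ?ax x"
    by (rule wedge_sect_eq_smult[OF V(1) d ax x])
  show ?thesis
    unfolding expression_def w T.tensor_presheaf_sect
    by (rule TV.pure_tensor_smult_left[OF d wedge_sect_closed[OF V(1) ax x] dual_class_closed[OF g]])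
qed

text \<open>By the uniqueness in \<open>norm_map_exists\<close> it suffices that the right hand side
  has the local expressions of \<open>c x\<close>. These are compared germ by germ, since the matrix
  of \<open>c\<close> on \<open>I\<close> is available only near each point.\<close>

lemma norm_map_act:
  assumes pr: "pseudoregular X OX OY I" and U: "openin X U"
    and x: "x \<in> carrier (sect I U)" and c: "c \<in> carrier (sect OY U)"
  shows "norm_map X OX OY I U (c \<odot>\<^bsub>sect I U\<^esub> x) =
    Nm X OX OY U c \<odot>\<^bsub>sect (norm_sheaf X OX OY I) U\<^esub> norm_map X OX OY I U x"
proof -
  let ?N = "norm_sheaf X OX OY I" and ?n = "Nm X OX OY U c" and ?z = "norm_map X OX OY I U x"
  have cx: "c \<odot>\<^bsub>sect I U\<^esub> x \<in> carrier (sect I U)" using U c x by simp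
  have n: "?n \<in> carrier (sect OX U)" by (rule Nm_closed[OF U c])
  interpret N: linear_presheaf X OX ?N unfolding norm_sheaf_eq by (rule T.tensor.sheafify_linear)
  have nz: "?n \<odot>\<^bsub>sect ?N U\<^esub> ?z \<in> carrier (sect ?N U)" by (rule N.smult_closed[OF U n norm_map_closed[OF U x]])
  have "restr ?N U V (?n \<odot>\<^bsub>sect ?N U\<^esub> ?z) = to_sheafify X TP V (expression V \<alpha> (restr I U V (c \<odot>\<^bsub>sect I U\<^esub> x)))"
    if VU: "V \<subseteq> U" and g: "generator V \<alpha>" for V \<alpha>
  proof (rule extensionalityI)
    note V = generatorD[OF g]
    have xV: "restr I U V x \<in> carrier (sect I V)" and cV: "restr OY U V c \<in> carrier (sect OY V)"
      using U V VU x c by simp_all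
    have cxV: "restr I U V (c \<odot>\<^bsub>sect I U\<^esub> x) = restr OY U V c \<odot>\<^bsub>sect I V\<^esub> restr I U V x"
      by (rule restr_act[OF U V(1) VU c x])
    show "restr ?N U V (?n \<odot>\<^bsub>sect ?N U\<^esub> ?z) \<in> extensional V"
      by (simp add: norm_sheaf_eq T.tensor.sheafify_simps(2))
    show "to_sheafify X TP V (expression V \<alpha> (restr I U V (c \<odot>\<^bsub>sect I U\<^esub> x))) \<in> extensional V"
      by (simp add: to_sheafify_def)
    fix p assume p: "p \<in> V"
    then have pU: "p \<in> U" using VU by blast
    let ?e = "expression V \<alpha> (restr I U V x)"
    have ec: "?e \<in> carrier (sect TP V)" by (rule expression_closed[OF g xV])
    have "restrict ?z V p = to_sheafify X TP V ?e p"
      using norm_map_restr[OF U x VU g] by (simp add: norm_sheaf_eq T.tensor.sheafify_simps(2))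
    then have zp: "?z p = germ X TP p V ?e" using p by (simp add: to_sheafify_def)
    have nV: "restr OX U V ?n \<in> carrier (sect OX V)" using U V VU n by simp
    have lhs: "restr ?N U V (?n \<odot>\<^bsub>sect ?N U\<^esub> ?z) p = germ X TP p V (restr OX U V ?n \<odot>\<^bsub>sect TP V\<^esub> ?e)"
      using T.tensor.sheafify_smult_germ[OF U n V(1) p VU ec, of ?z] zp p
      by (simp add: norm_sheaf_eq T.tensor.sheafify_simps(2))
    interpret cM: rank_two_endo X OX M U "\<lambda>V x. restr OY U V c \<odot>\<^bsub>sect I V\<^esub> x" by (rule act_endo[OF U c])
    obtain V0 e0 a0 where V0: "p \<in> V0" "cM.framed_matrix V0 e0 a0" "restr OX U V0 ?n = mat_det (sect OX V0) 2 a0"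
      using norm_det_local[OF pr U c pU] by blast
    \<comment> \<open>The generator lives on \<open>V\<close> and the frame of \<open>I\<close> on
      \<open>V0\<close>; \<open>expression_act\<close> needs both on one open set.\<close>
    define W where "W = V \<inter> V0"
    have W: "openin X W" "W \<subseteq> V" "W \<subseteq> V0" "p \<in> W" "W \<subseteq> U"
      using V(1) cM.framed_matrixD(4)[OF V0(2)] p V0(1) VU by (auto simp: W_def)
    obtain e a where m: "cM.framed_matrix W e a" and a: "a = (\<lambda>i j. restr OX V0 W (a0 i j))"
      using cM.framed_matrix_restrict[OF V0(2) W(1,3)] by blast
    note md = cM.framed_matrixD[OF m]
    have nW: "restr OX U W ?n = mat_det (sect OX W) 2 a"
    proof -
      have "restr OX U W ?n = restr OX V0 W (restr OX U V0 ?n)"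
        using U W n cM.framed_matrixD(1,4)[OF V0(2)] by simp
      then show ?thesis unfolding V0(3) a cM.det_restr[OF V0(2) W(1,3)] .
    qed
    note gW = generator_restrict[OF g W(1,2)]
    have xW: "restr I U W x \<in> carrier (sect I W)" and cW: "restr OY U W c \<in> carrier (sect OY W)"
      using U W x c by simp_all
    have "restr TP V W (restr OX U V ?n \<odot>\<^bsub>sect TP V\<^esub> ?e) = restr OX V W (restr OX U V ?n) \<odot>\<^bsub>sect TP W\<^esub> restr TP V W ?e"
      by (rule T.tensor.restr_smult[OF V(1) W(1,2) nV ec])
    also have "\<dots> = mat_det (sect OX W) 2 a \<odot>\<^bsub>sect TP W\<^esub> expression W (restr OY V W \<alpha>) (restr I U W x)"
      unfolding expression_restr[OF g W(1,2) xV] I.restr_restr[OF U V(1) W(1,2) VU x]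
        Y.base_restr[OF U V(1) W(1,2) VU n] nW ..
    also have "\<dots> = expression W (restr OY V W \<alpha>) (restr OY U W c \<odot>\<^bsub>sect I W\<^esub> restr I U W x)"
      by (rule expression_act[OF gW cW xW md(2,3), symmetric])
    also have "restr OY U W c \<odot>\<^bsub>sect I W\<^esub> restr I U W x = restr I U W (c \<odot>\<^bsub>sect I U\<^esub> x)"
      by (rule restr_act[OF U W(1,5) c x, symmetric])
    also have "\<dots> = restr I V W (restr I U V (c \<odot>\<^bsub>sect I U\<^esub> x))"
      by (rule I.restr_restr[OF U V(1) W(1,2) VU cx, symmetric])
    also have "expression W (restr OY V W \<alpha>) \<dots> = restr TP V W (expression V \<alpha> (restr I U V (c \<odot>\<^bsub>sect I U\<^esub> x)))"
      by (rule expression_restr[OF g W(1,2), symmetric]) (use U V VU cx in simp)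
    finally have eqW: "restr TP V W (restr OX U V ?n \<odot>\<^bsub>sect TP V\<^esub> ?e) =
      restr TP V W (expression V \<alpha> (restr I U V (c \<odot>\<^bsub>sect I U\<^esub> x)))" .
    have c1: "restr OX U V ?n \<odot>\<^bsub>sect TP V\<^esub> ?e \<in> carrier (sect TP V)" by (rule T.tensor.smult_closed[OF V(1) nV ec])
    have c2: "expression V \<alpha> (restr I U V (c \<odot>\<^bsub>sect I U\<^esub> x)) \<in> carrier (sect TP V)"
      by (rule expression_closed[OF g]) (use U V VU cx in simp)
    have "germ X TP p V (restr OX U V ?n \<odot>\<^bsub>sect TP V\<^esub> ?e) =
      germ X TP p V (expression V \<alpha> (restr I U V (c \<odot>\<^bsub>sect I U\<^esub> x)))"
      unfolding T.tensor.germ_eq_iff[OF V(1) p c1 V(1) p c2] using W eqW by blast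
    then show "restr ?N U V (?n \<odot>\<^bsub>sect ?N U\<^esub> ?z) p =
        to_sheafify X TP V (expression V \<alpha> (restr I U V (c \<odot>\<^bsub>sect I U\<^esub> x))) p"
      unfolding lhs using p by (simp add: to_sheafify_def)
  qed
  then show ?thesis
    unfolding norm_map_eq[of U "c \<odot>\<^bsub>sect I U\<^esub> x"]
    using nz by (intro the1_equality[OF norm_map_exists[OF U cx]]) blast
qed

end

theorem lemma4p1p16:
  fixes X :: "'p topology"
    and OX :: "('p, 'r) ring_presheaf"
    and OY :: "('p, 'r, 'a) module_presheaf"
    and I :: "('p, 'a, 'm) module_presheaf"
  assumes "scheme X OX"
    and "quadratic_algebra X OX OY"
    and "module_sheaf X OY I"
    and "locally_free X OX (restrict_scalars OY I) 2"
    and "pseudoregular X OX OY I"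
    and "openin X U"
    and "x \<in> carrier (sect I U)"
    and "\<gamma> \<in> carrier (sect OY U)"
  shows "norm_map X OX OY I U (\<gamma> \<odot>\<^bsub>sect I U\<^esub> x) =
    Nm X OX OY U \<gamma> \<odot>\<^bsub>sect (norm_sheaf X OX OY I) U\<^esub> norm_map X OX OY I U x"
proof -
  interpret quadratic_module X OX OY I
    using assms(1-4) by (rule quadratic_module.intro)
  show ?thesis by (rule norm_map_act[OF assms(5-8)])
qed

end
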